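(* Let $n\ge2$ and let $\alpha,\delta\in\mathbb R$ with $\alpha\delta>0$. The spectrum of the Laplace–Beltrami operator on the 3-$(\alpha,\delta)$-Sasaki manifolds $S^{4n-1}\cong Sp(n)/Sp(n-1)$ and $\mathbb RP^{4n-1}\cong Sp(n)/(Sp(n-1)\times\mathbb Z_2)$ equipped with $g_{t_0,t_1}$, $t_0=(2\alpha\delta)^{-1}$, $t_1=\delta^{-2}$ (see context), is given by the collection of numbers $$\eta(z_1,z_2)=2\alpha\delta\bigl(2z_1(n-1)+2z_1z_2+2nz_2\bigr)+\delta^2(z_1-z_2)(z_1-z_2+2),$$ where $z_1\ge z_2\ge0$ are integers. For $\mathbb RP^{4n-1}$ the parameters must additionally satisfy $z_1\equiv z_2\pmod2$. In both cases the multiplicity of $\eta(z_1,z_2)$ is $$\operatorname{mult}(\eta(z_1,z_2))=\frac{(z_1-z_2+1)^2(z_1+z_2+2n-1)}{(2n-1)(2n-2)}\binom{z_1+2n-2}{2n-3}\binom{z_2+2n-3}{2n-3}.$$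
   Context: $Sp(1)\times Sp(n-1)\subset Sp(n)$ is embedded block-diagonally, $H=Sp(1)\cong SU(2)$, and $\mathbb Z_2=\{\pm1\}\subset Sp(1)$ is its center. Let $Q=-\frac{1}{4(n+1)}\,\times$ (Killing form of $\mathfrak{sp}(n)$), i.e. $Q(X,Y)=-\frac12\operatorname{tr}(XY)$ with $\mathfrak{sp}(n)$ viewed as complex $2n\times2n$ matrices, and let $\mathfrak m$ be the $Q$-orthogonal complement of $\mathfrak{sp}(1)\oplus\mathfrak{sp}(n-1)$ in $\mathfrak{sp}(n)$. The metric is the $Sp(n)$-invariant metric $g_{t_0,t_1}=t_0Q|_{\mathfrak m}\oplus t_1Q|_{\mathfrak{sp}(1)}$ with $t_0=(2\alpha\delta)^{-1}$, $t_1=\delta^{-2}$ (the positive homogeneous 3-$(\alpha,\delta)$-Sasaki manifolds of type $C_n$). Convention: each admissible pair contributes the eigenvalue with the stated multiplicity; contributions of different pairs giving the same number add up. *)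

theory Defs
  imports "HOL-Analysis.Analysis" "HOL-Library.Function_Algebras"
begin

fun Ck_on :: "nat \<Rightarrow> 'a::real_normed_vector set \<Rightarrow> ('a \<Rightarrow> 'b::real_normed_vector) \<Rightarrow> bool" where
  "Ck_on 0 U f \<longleftrightarrow> continuous_on U f"
| "Ck_on (Suc k) U f \<longleftrightarrow>
     (\<forall>x\<in>U. f differentiable (at x)) \<and> (\<forall>v. Ck_on k U (\<lambda>x. frechet_derivative f (at x) v))"

definition smooth_map_on :: "'a::real_normed_vector set \<Rightarrow> ('a \<Rightarrow> 'b::real_normed_vector) \<Rightarrow> bool" where
  "smooth_map_on U f \<longleftrightarrow> (\<forall>k. Ck_on k U f)"

definition pderiv_on :: "'d::finite \<Rightarrow> (real^'d \<Rightarrow> 'b::real_normed_vector) \<Rightarrow> real^'d \<Rightarrow> 'b" where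
  "pderiv_on i f u = frechet_derivative f (at u) (axis i 1)"

text \<open>\<open>g\<close> is the matrix of the metric in the coordinates \<open>u\<close>. The sign is the one for which the
  operator is nonnegative, that is, minus the divergence of the gradient.\<close>

definition local_laplacian ::
    "(real^'d \<Rightarrow> real^'d^'d) \<Rightarrow> (real^'d \<Rightarrow> complex) \<Rightarrow> real^'d \<Rightarrow> complex" where
  "local_laplacian g F u =
     - ((1 / sqrt (det (g u))) *\<^sub>R
         (\<Sum>i\<in>UNIV. pderiv_on i
            (\<lambda>v. sqrt (det (g v)) *\<^sub>R (\<Sum>j\<in>UNIV. (matrix_inv (g v) $ i $ j) *\<^sub>R pderiv_on j F v)) u))"

text \<open>The quaternionic coordinates are indexed by \<open>'n\<close>. The quaternionic coordinate \<open>a\<close> corresponds to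
  the two complex coordinates \<open>Inl a\<close> and \<open>Inr a\<close>, so that \<open>CARD('n) = n\<close> gives
  complex \<open>2n \<times> 2n\<close> matrices.\<close>

type_synonym 'n cmat = "complex^('n + 'n)^('n + 'n)"

definition ctranspose :: "complex^'m^'k \<Rightarrow> complex^'k^'m" where
  "ctranspose A = (\<chi> i j. cnj (A $ j $ i))"

definition symp_form :: "('n::finite) cmat" where
  "symp_form = (\<chi> i j. case (i, j) of
       (Inl a, Inr b) \<Rightarrow> (if a = b then -1 else 0)
     | (Inr a, Inl b) \<Rightarrow> (if a = b then 1 else 0)
     | _ \<Rightarrow> 0)"

definition qindex :: "'n + 'n \<Rightarrow> 'n" where
  "qindex i = (case i of Inl a \<Rightarrow> a | Inr a \<Rightarrow> a)"

text \<open>\<open>Sp_on N\<close> is the symplectic group of the quaternionic coordinates in \<open>N\<close>, embedded block-diagonally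
  (by the identity on the remaining coordinates). For \<open>CARD('n) = n\<close> and a distinguished coordinate
  \<open>e\<close>, the sets \<open>Sp_on UNIV\<close>, \<open>Sp_on {e}\<close> and \<open>Sp_on (- {e})\<close> are \<open>Sp(n)\<close>, \<open>Sp(1)\<close> and \<open>Sp(n-1)\<close>;
  \<open>sp_on\<close> gives their Lie algebras.\<close>

definition Sp_on :: "'n::finite set \<Rightarrow> 'n cmat set" where
  "Sp_on N = {A. ctranspose A ** A = mat 1 \<and> transpose A ** symp_form ** A = symp_form \<and>
     (\<forall>i j. \<not> (qindex i \<in> N \<and> qindex j \<in> N) \<longrightarrow> A $ i $ j = mat 1 $ i $ j)}"

definition sp_on :: "'n::finite set \<Rightarrow> 'n cmat set" where
  "sp_on N = {X. ctranspose X = - X \<and> transpose X ** symp_form + symp_form ** X = 0 \<and>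
     (\<forall>i j. \<not> (qindex i \<in> N \<and> qindex j \<in> N) \<longrightarrow> X $ i $ j = 0)}"

text \<open>The element \<open>-1\<close> of \<open>Sp(1)\<close>.\<close>

definition minus_one_Sp1 :: "'n::finite \<Rightarrow> 'n cmat" where
  "minus_one_Sp1 e = (\<chi> i j. if i = j then (if qindex i = e then -1 else 1) else 0)"

definition isotropy_sphere :: "'n::finite \<Rightarrow> 'n cmat set" where
  "isotropy_sphere e = Sp_on (- {e})"

definition isotropy_projective :: "'n::finite \<Rightarrow> 'n cmat set" where
  "isotropy_projective e = {k ** z | k z. k \<in> Sp_on (- {e}) \<and> z \<in> {mat 1, minus_one_Sp1 e}}"

text \<open>The trace of a product of two elements of \<open>sp(n)\<close> is real, so that taking the real part only
  adjusts the type. This is \<open>-1/(4(n+1))\<close> times the Killing form.\<close>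

definition Qform :: "('n::finite) cmat \<Rightarrow> 'n cmat \<Rightarrow> real" where
  "Qform X Y = - Re (trace (X ** Y)) / 2"

definition m_space :: "'n::finite \<Rightarrow> 'n cmat set" where
  "m_space e = {X \<in> sp_on UNIV. \<forall>Y\<in>sp_on {e}. \<forall>Z\<in>sp_on (- {e}). Qform X (Y + Z) = 0}"

text \<open>\<open>Q\<close>-orthogonal projection of \<open>sp(n)\<close> onto a subspace.\<close>

definition Qproj :: "('n::finite) cmat set \<Rightarrow> 'n cmat \<Rightarrow> 'n cmat" where
  "Qproj W X = (THE P. P \<in> W \<and> (\<forall>Y\<in>W. Qform (X - P) Y = 0))"

text \<open>The form \<open>t0 Q|m + t1 Q|sp(1)\<close>, extended to \<open>sp(n)\<close> by zero on \<open>sp(n-1)\<close>.\<close>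

definition inv_form :: "'n::finite \<Rightarrow> real \<Rightarrow> real \<Rightarrow> 'n cmat \<Rightarrow> 'n cmat \<Rightarrow> real" where
  "inv_form e t0 t1 X Y =
     t0 * Qform (Qproj (m_space e) X) (Qproj (m_space e) Y) +
     t1 * Qform (Qproj (sp_on {e}) X) (Qproj (sp_on {e}) Y)"

definition lcoset :: "('n::finite) cmat set \<Rightarrow> 'n cmat \<Rightarrow> 'n cmat set" where
  "lcoset K A = (\<lambda>k. A ** k) ` K"

definition homog_space :: "('n::finite) cmat set \<Rightarrow> 'n cmat set set" where
  "homog_space K = lcoset K ` Sp_on UNIV"

text \<open>Local parametrizations of \<open>Sp(n)/K\<close>, given by smooth lifts \<open>\<sigma>\<close> to \<open>Sp(n)\<close>: the map
  \<open>u \<mapsto> \<sigma>(u)K\<close> is an injective immersion. Here \<open>K\<close> is a group with Lie algebra \<open>sp(n-1)\<close>, so the tangent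
  space of \<open>Sp(n)/K\<close> at \<open>AK\<close> is identified with \<open>sp(n)/sp(n-1)\<close> through left translation by the
  inverse of \<open>A\<close>. The number of coordinates \<open>CARD('d)\<close> has to be \<open>dim Sp(n)/K = 4n - 1\<close>; then
  \<open>u \<mapsto> \<sigma>(u)K\<close> is a diffeomorphism onto an open subset.\<close>

definition local_param ::
    "'n::finite \<Rightarrow> 'n cmat set \<Rightarrow> (real^'d) set \<Rightarrow> (real^'d \<Rightarrow> 'n cmat) \<Rightarrow> bool" where
  "local_param e K U \<sigma> \<longleftrightarrow>
     open U \<and> smooth_map_on U \<sigma> \<and> \<sigma> ` U \<subseteq> Sp_on UNIV \<and>
     inj_on (\<lambda>u. lcoset K (\<sigma> u)) U \<and>
     (\<forall>u\<in>U. \<forall>v. matrix_inv (\<sigma> u) ** frechet_derivative \<sigma> (at u) v \<in> sp_on (- {e}) \<longrightarrow> v = 0)"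

text \<open>Coordinate matrix of the \<open>Sp(n)\<close>-invariant metric on \<open>Sp(n)/K\<close> determined by \<open>inv_form\<close>.\<close>

definition metric_matrix ::
    "'n::finite \<Rightarrow> real \<Rightarrow> real \<Rightarrow> (real^'d \<Rightarrow> 'n cmat) \<Rightarrow> real^'d \<Rightarrow> real^'d^'d" where
  "metric_matrix e t0 t1 \<sigma> u =
     (\<chi> i j. inv_form e t0 t1 (matrix_inv (\<sigma> u) ** pderiv_on i \<sigma> u)
                               (matrix_inv (\<sigma> u) ** pderiv_on j \<sigma> u))"

text \<open>Functions on \<open>Sp(n)/K\<close> are extended by zero to all sets of matrices, so that they form a
  vector space in which equality is equality on \<open>Sp(n)/K\<close>.\<close>

definition smooth_functions ::
    "'d::finite itself \<Rightarrow> 'n::finite \<Rightarrow> 'n cmat set \<Rightarrow> ('n cmat set \<Rightarrow> complex) set" where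
  "smooth_functions D e K = {f.
     (\<forall>p. p \<notin> homog_space K \<longrightarrow> f p = 0) \<and>
     (\<forall>U (\<sigma> :: real^'d \<Rightarrow> 'n cmat). local_param e K U \<sigma> \<longrightarrow> smooth_map_on U (\<lambda>u. f (lcoset K (\<sigma> u))))}"

definition laplace_beltrami ::
    "'d::finite itself \<Rightarrow> 'n::finite \<Rightarrow> 'n cmat set \<Rightarrow> real \<Rightarrow> real \<Rightarrow>
     ('n cmat set \<Rightarrow> complex) \<Rightarrow> 'n cmat set \<Rightarrow> complex" where
  "laplace_beltrami D e K t0 t1 f p =
     (THE y. \<forall>U (\<sigma> :: real^'d \<Rightarrow> 'n cmat). \<forall>u\<in>U. local_param e K U \<sigma> \<and> lcoset K (\<sigma> u) = p \<longrightarrow>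
        y = local_laplacian (metric_matrix e t0 t1 \<sigma>) (\<lambda>v. f (lcoset K (\<sigma> v))) u)"

definition lb_eigenspace ::
    "'d::finite itself \<Rightarrow> 'n::finite \<Rightarrow> 'n cmat set \<Rightarrow> real \<Rightarrow> real \<Rightarrow> complex \<Rightarrow>
     ('n cmat set \<Rightarrow> complex) set" where
  "lb_eigenspace D e K t0 t1 \<mu> =
     {f \<in> smooth_functions D e K. \<forall>p\<in>homog_space K. laplace_beltrami D e K t0 t1 f p = \<mu> * f p}"

global_interpretation cfun: vector_space "\<lambda>(c::complex) (f::'a \<Rightarrow> complex) x. c * f x"
  by unfold_locales (auto simp: fun_eq_iff algebra_simps)

definition has_complex_dim :: "('a \<Rightarrow> complex) set \<Rightarrow> nat \<Rightarrow> bool" where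
  "has_complex_dim V d \<longleftrightarrow>
     (\<exists>B. finite B \<and> card B = d \<and> cfun.independent B \<and> cfun.span B = V)"

text \<open>\<open>E \<mu>\<close> is the eigenspace for \<open>\<mu>\<close>. Each parameter \<open>z \<in> I\<close> contributes the eigenvalue \<open>\<eta> z\<close> with
  multiplicity \<open>m z\<close>; contributions with the same value of \<open>\<eta>\<close> add up.\<close>

definition spectrum_given_by ::
    "(complex \<Rightarrow> ('a \<Rightarrow> complex) set) \<Rightarrow> 'z set \<Rightarrow> ('z \<Rightarrow> real) \<Rightarrow> ('z \<Rightarrow> real) \<Rightarrow> bool" where
  "spectrum_given_by E I \<eta> m \<longleftrightarrow>
     {\<mu>. \<exists>f\<in>E \<mu>. f \<noteq> 0} = (\<lambda>z. complex_of_real (\<eta> z)) ` I \<and>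
     (\<forall>\<mu>. finite {z \<in> I. complex_of_real (\<eta> z) = \<mu>} \<and>
          (\<exists>d. has_complex_dim (E \<mu>) d \<and> real d = (\<Sum>z | z \<in> I \<and> complex_of_real (\<eta> z) = \<mu>. m z)))"

definition sasaki_eta :: "nat \<Rightarrow> real \<Rightarrow> real \<Rightarrow> nat \<Rightarrow> nat \<Rightarrow> real" where
  "sasaki_eta n \<alpha> \<delta> z1 z2 =
     2 * \<alpha> * \<delta> * (2 * real z1 * (real n - 1) + 2 * real z1 * real z2 + 2 * real n * real z2) +
     \<delta>^2 * (real z1 - real z2) * (real z1 - real z2 + 2)"

text \<open>The natural number subtractions do not truncate for \<open>n \<ge> 2\<close>.\<close>

definition sasaki_mult :: "nat \<Rightarrow> nat \<Rightarrow> nat \<Rightarrow> real" where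
  "sasaki_mult n z1 z2 =
     (real z1 - real z2 + 1)^2 * (real z1 + real z2 + 2 * real n - 1) /
       ((2 * real n - 1) * (2 * real n - 2)) *
     real ((z1 + 2 * n - 2) choose (2 * n - 3)) * real ((z2 + 2 * n - 3) choose (2 * n - 3))"

end

theory Submission
  imports Defs
begin

text \<open>The group \<open>Sp(n)\<close> acts transitively on the unit sphere of \<open>H\<^sup>n\<close>,
  seen here as \<open>complex^('n + 'n)\<close>, and the orbit map
  \<open>A \<mapsto> A *v base e\<close> identifies \<open>Sp(n)/Sp(n-1)\<close> with the sphere and
  \<open>Sp(n)/(Sp(n-1) \<times> Z\<^sub>2)\<close> with the sphere modulo sign. Under this
  identification the invariant metric is the round metric, scaled by \<open>a = 2 * t0\<close> on
  the horizontal vectors and by \<open>b = t1\<close> on the span of the three vertical vectors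
  \<open>J s x\<close> at \<open>x\<close>, where the \<open>J s\<close> are the imaginary
  quaternion units commuting with \<open>Sp(n)\<close> (\<open>inv_form_eq\<close>). Its Laplacian
  is therefore \<open>1/a\<close> times the round Laplacian plus \<open>1/b - 1/a\<close> times
  minus the sum of the squares of the vertical fields. Both summands are built from second
  derivatives along linear vector fields, so that the operator makes sense on functions of the
  ambient space: this is \<open>sphere_op\<close>, and \<open>local_laplacian_eq_sphere_op\<close>
  and \<open>laplace_beltrami_eq_sphere_op\<close> prove the claim in charts and on the quotient.

  The vertical fields complexify to a Lie algebra \<open>sl(2)\<close> acting on polynomials in the
  coordinates and their conjugates. Its raising and lowering operators \<open>Eop\<close> and
  \<open>Fop\<close> commute with the flat Laplacian \<open>Lap\<close>. On the sphere, a polynomial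
  is a sum of harmonic bihomogeneous ones (\<open>bihom_decomp\<close>), and these are sums of
  functions \<open>(Fop ^^ j) v\<close> with \<open>v\<close> harmonic of bidegree
  \<open>(z2, z1)\<close> and killed by \<open>Eop\<close>, up to complex conjugation
  (\<open>harm_decomp\<close>). With \<open>k = z1 + z2\<close> and \<open>d = z1 - z2\<close> the
  round Laplacian acts on such a function by \<open>k * (k + 4 * n - 2)\<close> and the vertical
  Casimir operator by \<open>d * (d + 2)\<close>, which gives the eigenvalue
  \<open>\<alpha>\<delta> (k (k + 4n - 2) - d (d + 2)) + \<delta>\<^sup>2 d (d + 2)\<close>, that is
  \<open>sasaki_eta\<close>. Each pair contributes \<open>d + 1\<close> copies (the values of
  \<open>j\<close>) of the space of highest weight vectors; since \<open>Lap\<close> and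
  \<open>Eop\<close> are surjective in the relevant degrees, the dimension of that space is an
  alternating sum of dimensions of spaces of bihomogeneous polynomials (\<open>real_hw_dim\<close>).

  Nothing else occurs: the operator is symmetric for the integral over the sphere and polynomials
  are dense in the continuous functions. An eigenfunction is orthogonal to all the spaces with a
  different eigenvalue, hence it equals its projection onto the finite sum of those with its own
  eigenvalue (\<open>eigen_expansion\<close>). On \<open>Sp(n)/(Sp(n-1) \<times> Z\<^sub>2)\<close>
  only even functions count, and the functions belonging to \<open>(z1, z2)\<close> have the parity
  of \<open>z1 + z2\<close>.\<close>

section \<open>Functions of class C^k\<close>

lemma frechet_derivative_cong_open:
  assumes "open U" "x \<in> U" "\<And>y. y \<in> U \<Longrightarrow> f y = g y"
  shows "frechet_derivative f (at x) = frechet_derivative g (at x)"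
proof -
  have "(f has_derivative D) (at x) \<longleftrightarrow> (g has_derivative D) (at x)" for D
    using assms by (auto intro: has_derivative_transform_within_open[OF _ assms(1,2)])
  then show ?thesis by (simp add: frechet_derivative_def)
qed

lemma differentiable_cong_open:
  assumes "open U" "x \<in> U" "\<And>y. y \<in> U \<Longrightarrow> f y = g y"
  shows "f differentiable (at x) \<longleftrightarrow> g differentiable (at x)"
proof -
  have "(f has_derivative D) (at x) \<longleftrightarrow> (g has_derivative D) (at x)" for D
    using assms by (auto intro: has_derivative_transform_within_open[OF _ assms(1,2)])
  then show ?thesis by (simp add: differentiable_def)
qed

lemma Ck_on_cong:
  assumes "open U" "\<And>x. x \<in> U \<Longrightarrow> f x = g x"
  shows "Ck_on k U f \<longleftrightarrow> Ck_on k U g"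
  using assms(2)
proof (induction k arbitrary: f g)
  case 0 then show ?case by (auto cong: continuous_on_cong)
next
  case (Suc k)
  have 1: "(\<forall>x\<in>U. f differentiable (at x)) \<longleftrightarrow> (\<forall>x\<in>U. g differentiable (at x))"
    by (intro ball_cong differentiable_cong_open[OF assms(1)] Suc.prems) auto
  have 2: "frechet_derivative f (at x) = frechet_derivative g (at x)" if "x \<in> U" for x
    by (rule frechet_derivative_cong_open[OF assms(1) that Suc.prems])
  have "Ck_on k U (\<lambda>x. frechet_derivative f (at x) v) \<longleftrightarrow> Ck_on k U (\<lambda>x. frechet_derivative g (at x) v)" for v
    by (rule Suc.IH) (simp add: 2)
  with 1 show ?case by simp
qed

lemma Ck_on_SucI:
  assumes "open U" "\<And>x. x \<in> U \<Longrightarrow> (f has_derivative f' x) (at x)"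
    and "\<And>v. Ck_on k U (\<lambda>x. f' x v)"
  shows "Ck_on (Suc k) U f"
proof -
  have "frechet_derivative f (at x) = f' x" if "x \<in> U" for x
    using assms(2)[OF that] frechet_derivative_at by metis
  then have "Ck_on k U (\<lambda>x. frechet_derivative f (at x) v)" for v
    using Ck_on_cong[OF assms(1), of "\<lambda>x. frechet_derivative f (at x) v" "\<lambda>x. f' x v"] assms(3) by simp
  then show ?thesis using assms(2) by (auto simp: differentiable_def)
qed

lemma Ck_on_SucD:
  assumes "Ck_on (Suc k) U f"
  shows "\<And>x. x \<in> U \<Longrightarrow> (f has_derivative frechet_derivative f (at x)) (at x)"
    and "\<And>v. Ck_on k U (\<lambda>x. frechet_derivative f (at x) v)"
  using assms by (auto simp: frechet_derivative_works)

lemma Ck_on_Suc_imp: "Ck_on (Suc k) U f \<Longrightarrow> Ck_on k U f"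
proof (induction k arbitrary: f)
  case 0
  then show ?case
    by (simp add: continuous_at_imp_continuous_on differentiable_imp_continuous_within)
next
  case (Suc k)
  then show ?case by (metis Ck_on.simps(2))
qed

lemma Ck_on_mono: "Ck_on l U f \<Longrightarrow> k \<le> l \<Longrightarrow> Ck_on k U f"
  by (induction l) (auto simp del: Ck_on.simps simp: le_Suc_eq dest: Ck_on_Suc_imp)

lemma Ck_on_imp_continuous_on: "Ck_on k U f \<Longrightarrow> continuous_on U f"
  using Ck_on_mono[of k U f 0] by simp

lemma Ck_on_subset: "Ck_on k U f \<Longrightarrow> V \<subseteq> U \<Longrightarrow> Ck_on k V f"
  by (induction k arbitrary: f) (auto intro: continuous_on_subset)

lemma Ck_on_const: "open U \<Longrightarrow> Ck_on k U (\<lambda>x. c)"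
  by (induction k arbitrary: c) auto

lemma Ck_on_linear:
  assumes "open U" "bounded_linear f" shows "Ck_on k U f"
proof (cases k)
  case 0 then show ?thesis using assms by (simp add: linear_continuous_on)
next
  case (Suc m)
  then show ?thesis
    using assms by (auto intro!: Ck_on_SucI[where f'="\<lambda>_. f"] Ck_on_const bounded_linear_imp_has_derivative simp del: Ck_on.simps)
qed

lemma Ck_on_add:
  assumes "open U" "Ck_on k U f" "Ck_on k U g" shows "Ck_on k U (\<lambda>x. f x + g x)"
  using assms(2,3)
proof (induction k arbitrary: f g)
  case 0 then show ?case by (simp add: continuous_on_add)
next
  case (Suc k)
  then show ?case
    by (intro Ck_on_SucI[OF assms(1), where f'="\<lambda>x v. frechet_derivative f (at x) v + frechet_derivative g (at x) v"]
        has_derivative_add Ck_on_SucD) auto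
qed

lemma Ck_on_sum:
  assumes "open U" "\<And>i. i \<in> I \<Longrightarrow> Ck_on k U (f i)" shows "Ck_on k U (\<lambda>x. \<Sum>i\<in>I. f i x)"
  using assms(2) by (induction I rule: infinite_finite_induct) (auto intro: Ck_on_const Ck_on_add assms(1))

text \<open>All product rules for \<open>Ck_on\<close> are instances of this one: the derivative of a bilinear
  expression is a sum of two bilinear expressions of one order less.\<close>

lemma Ck_on_bilinear:
  assumes "bounded_bilinear pr" "open U" "Ck_on k U f" "Ck_on k U g"
  shows "Ck_on k U (\<lambda>x. pr (f x) (g x))"
  using assms(3,4)
proof (induction k arbitrary: f g)
  case 0 then show ?case using bounded_bilinear.continuous_on[OF assms(1)] by simp
next
  case (Suc k)
  show ?case
    by (intro Ck_on_SucI[OF assms(2), where f'="\<lambda>x v. pr (f x) (frechet_derivative g (at x) v) + pr (frechet_derivative f (at x) v) (g x)"]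
        bounded_bilinear.FDERIV[OF assms(1)] Ck_on_SucD Ck_on_add[OF assms(2)] Suc.IH)
      (use Suc.prems in \<open>auto intro: Ck_on_Suc_imp Ck_on_SucD simp del: Ck_on.simps\<close>)
qed

lemma Ck_on_bounded_linear:
  assumes "bounded_linear L" "open U" "Ck_on k U f" shows "Ck_on k U (\<lambda>x. L (f x))"
  using assms(3)
proof (induction k arbitrary: f)
  case 0 then show ?case using bounded_linear.continuous_on[OF assms(1)] by simp
next
  case (Suc k)
  show ?case
    by (intro Ck_on_SucI[OF assms(2), where f'="\<lambda>x v. L (frechet_derivative f (at x) v)"]
        bounded_linear.has_derivative[OF assms(1)] Ck_on_SucD Suc.IH)
      (use Suc.prems in \<open>auto intro: Ck_on_Suc_imp Ck_on_SucD simp del: Ck_on.simps\<close>)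
qed

lemmas Ck_on_mult = Ck_on_bilinear[OF bounded_bilinear_mult]
  and Ck_on_scaleR = Ck_on_bilinear[OF bounded_bilinear_scaleR]
  and Ck_on_inner = Ck_on_bilinear[OF bounded_bilinear_inner]

lemma Ck_on_minus: "open U \<Longrightarrow> Ck_on k U f \<Longrightarrow> Ck_on k U (\<lambda>x. - f x)"
  by (rule Ck_on_bounded_linear[OF bounded_linear_minus[OF bounded_linear_ident]])

lemma Ck_on_diff: "open U \<Longrightarrow> Ck_on k U f \<Longrightarrow> Ck_on k U g \<Longrightarrow> Ck_on k U (\<lambda>x. f x - g x)"
  using Ck_on_add[OF _ _ Ck_on_minus, of U k f g] by simp

lemma Ck_on_vec:
  fixes f :: "'i::finite \<Rightarrow> 'a::real_normed_vector \<Rightarrow> 'b::real_normed_vector"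
  assumes "open U" "\<And>i. Ck_on k U (f i)"
  shows "Ck_on k U (\<lambda>x. \<chi> i. f i x)"
proof -
  have ax: "bounded_linear (axis i :: 'b \<Rightarrow> 'b^'i)" for i
  proof (rule bounded_linear_intro[where K=1])
    fix x y :: 'b and r :: real
    show "axis i (x + y) = axis i x + axis i y" by (simp add: axis_def vec_eq_iff)
    show "axis i (r *\<^sub>R x) = r *\<^sub>R axis i x" by (simp add: axis_def vec_eq_iff)
    show "norm (axis i x) \<le> norm x * 1" by (simp add: norm_vec_def L2_set_def axis_def if_distrib[of norm] if_distrib[of "\<lambda>x. x^2"] cong: if_cong)
  qed
  have "Ck_on k U (\<lambda>x. \<Sum>i\<in>UNIV. axis i (f i x))"
    by (rule Ck_on_sum[OF assms(1)], rule Ck_on_bounded_linear[OF ax assms])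
  moreover have "(\<Sum>i\<in>UNIV. axis i (f i x)) = (\<chi> i. f i x)" for x
    by (simp add: vec_eq_iff axis_def sum.delta')
  ultimately show ?thesis by simp
qed

text \<open>The derivative of \<open>f (g x)\<close> is expanded along the basis of the middle space, since
  \<open>Ck_on\<close> speaks of directional derivatives in fixed directions only.\<close>

lemma Ck_on_compose:
  fixes g :: "'a::real_normed_vector \<Rightarrow> 'b::euclidean_space"
  assumes "open U" "open V" "g ` U \<subseteq> V" "Ck_on k V f" "Ck_on k U g"
  shows "Ck_on k U (\<lambda>x. f (g x))"
  using assms(4,5)
proof (induction k arbitrary: f)
  case 0
  then show ?case using continuous_on_compose2[of V f U g] assms(3) by simp
next
  case (Suc k)
  let ?f' = "\<lambda>x v. \<Sum>b\<in>Basis. (frechet_derivative g (at x) v \<bullet> b) *\<^sub>R frechet_derivative f (at (g x)) b"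
  show ?case
  proof (rule Ck_on_SucI[OF assms(1), where f'="?f'"])
    fix x assume x: "x \<in> U"
    have d: "(f has_derivative frechet_derivative f (at (g x))) (at (g x))"
      "(g has_derivative frechet_derivative g (at x)) (at x)"
      using Ck_on_SucD(1)[OF Suc.prems(1)] Ck_on_SucD(1)[OF Suc.prems(2)] x assms(3) by auto
    have lin: "linear (frechet_derivative f (at (g x)))"
      using d(1) has_derivative_linear by blast
    have rep: "frechet_derivative f (at (g x)) y = (\<Sum>b\<in>Basis. (y \<bullet> b) *\<^sub>R frechet_derivative f (at (g x)) b)" for y
      using linear_sum[OF lin, of "\<lambda>b. (y \<bullet> b) *\<^sub>R b" Basis] by (simp add: euclidean_representation linear_scale[OF lin])
    have "?f' x = frechet_derivative f (at (g x)) \<circ> frechet_derivative g (at x)"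
      by (rule ext) (simp only: o_def rep[symmetric])
    then show "((\<lambda>x. f (g x)) has_derivative ?f' x) (at x)"
      using diff_chain_at[OF d(2,1)] by (simp add: o_def)
  next
    fix v
    have 1: "Ck_on k U (\<lambda>x. frechet_derivative g (at x) v)" by (rule Ck_on_SucD(2)[OF Suc.prems(2)])
    have 2: "Ck_on k U (\<lambda>x. frechet_derivative f (at (g x)) b)" for b
      by (rule Suc.IH[OF Ck_on_SucD(2)[OF Suc.prems(1)] Ck_on_Suc_imp[OF Suc.prems(2)]])
    show "Ck_on k U (\<lambda>x. ?f' x v)"
      by (rule Ck_on_sum[OF assms(1)] Ck_on_scaleR[OF assms(1)] Ck_on_inner[OF assms(1)] Ck_on_const[OF assms(1)] 1 2)+
  qed
qed

lemma Ck_on_inverse: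
  fixes f :: "'a::real_normed_vector \<Rightarrow> 'b::real_normed_field"
  assumes "open U" "Ck_on k U f" "\<And>x. x \<in> U \<Longrightarrow> f x \<noteq> 0"
  shows "Ck_on k U (\<lambda>x. inverse (f x))"
  using assms(2)
proof (induction k)
  case 0
  then show ?case using assms(3) by (auto intro: continuous_on_inverse)
next
  case (Suc k)
  show ?case
  proof (rule Ck_on_SucI[OF assms(1)])
    fix x assume "x \<in> U"
    then show "((\<lambda>x. inverse (f x)) has_derivative (\<lambda>v. - (inverse (f x) * frechet_derivative f (at x) v * inverse (f x)))) (at x)"
      by (intro Deriv.has_derivative_inverse Ck_on_SucD(1)[OF Suc.prems] assms(3))
  next
    fix v
    note IH = Suc.IH[OF Ck_on_Suc_imp[OF Suc.prems]]
    show "Ck_on k U (\<lambda>x. - (inverse (f x) * frechet_derivative f (at x) v * inverse (f x)))"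
      by (rule Ck_on_minus[OF assms(1) Ck_on_mult[OF assms(1) Ck_on_mult[OF assms(1) IH Ck_on_SucD(2)[OF Suc.prems]] IH]])
  qed
qed

lemma Ck_on_divide:
  fixes f :: "'a::real_normed_vector \<Rightarrow> 'b::real_normed_field"
  assumes "open U" "Ck_on k U f" "Ck_on k U g" "\<And>x. x \<in> U \<Longrightarrow> g x \<noteq> 0"
  shows "Ck_on k U (\<lambda>x. f x / g x)"
  using Ck_on_mult[OF assms(1,2) Ck_on_inverse[OF assms(1,3,4)]] by (simp add: divide_inverse)

lemma Ck_on_sqrt:
  assumes "open U" "Ck_on k U f" "\<And>x. x \<in> U \<Longrightarrow> f x > 0"
  shows "Ck_on k U (\<lambda>x. sqrt (f x))"
  using assms(2)
proof (induction k)
  case 0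
  then show ?case by (auto intro: continuous_on_real_sqrt)
next
  case (Suc k)
  show ?case
  proof (rule Ck_on_SucI[OF assms(1), where f'="\<lambda>x v. frechet_derivative f (at x) v * (inverse (sqrt (f x)) * (1/2))"])
    fix x assume x: "x \<in> U"
    have "(\<lambda>h. h * (inverse (sqrt (f x)) / 2)) = (*) (inverse (sqrt (f x)) / 2)"
      by (simp add: fun_eq_iff)
    then have "(sqrt has_derivative (\<lambda>h. h * (inverse (sqrt (f x)) / 2))) (at (f x))"
      using DERIV_real_sqrt[OF assms(3)[OF x]] by (simp only: has_field_derivative_def)
    from diff_chain_at[OF Ck_on_SucD(1)[OF Suc.prems x] this]
    show "((\<lambda>x. sqrt (f x)) has_derivative (\<lambda>v. frechet_derivative f (at x) v * (inverse (sqrt (f x)) * (1/2)))) (at x)"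
      by (simp add: o_def)
  next
    fix v
    have nz: "sqrt (f x) \<noteq> 0" if "x \<in> U" for x using assms(3)[OF that] by simp
    note IH = Suc.IH[OF Ck_on_Suc_imp[OF Suc.prems]]
    show "Ck_on k U (\<lambda>x. frechet_derivative f (at x) v * (inverse (sqrt (f x)) * (1/2)))"
      by (rule Ck_on_mult[OF assms(1) Ck_on_SucD(2)[OF Suc.prems] Ck_on_mult[OF assms(1) Ck_on_inverse[OF assms(1) IH nz] Ck_on_const[OF assms(1)]]])
  qed
qed

lemma Ck_on_norm:
  fixes f :: "'a::real_normed_vector \<Rightarrow> 'b::real_inner"
  assumes "open U" "Ck_on k U f" "\<And>x. x \<in> U \<Longrightarrow> f x \<noteq> 0"
  shows "Ck_on k U (\<lambda>x. norm (f x))"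
  unfolding norm_eq_sqrt_inner by (intro Ck_on_sqrt Ck_on_inner assms) (use assms(3) in auto)

lemma smooth_map_on_Ck: "smooth_map_on U f \<Longrightarrow> Ck_on k U f"
  by (simp add: smooth_map_on_def)

text \<open>The second difference is symmetric in \<open>v\<close> and \<open>w\<close>, while two applications
  of the mean value theorem turn it into a mixed second derivative in one of the two orders.
  Symmetry of second derivatives follows in the limit of small squares.\<close>

lemma second_difference_mvt:
  fixes f :: "'a::real_normed_vector \<Rightarrow> real"
  assumes "Ck_on 2 U f" and h: "h > 0"
    and sub: "\<And>s t. 0 \<le> s \<Longrightarrow> s \<le> h \<Longrightarrow> 0 \<le> t \<Longrightarrow> t \<le> h \<Longrightarrow> x + s *\<^sub>R v + t *\<^sub>R w \<in> U"
  shows "\<exists>s t. 0 \<le> s \<and> s \<le> h \<and> 0 \<le> t \<and> t \<le> h \<and>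
    f (x + h *\<^sub>R v + h *\<^sub>R w) - f (x + h *\<^sub>R v) - f (x + h *\<^sub>R w) + f x =
    h^2 * frechet_derivative (\<lambda>y. frechet_derivative f (at y) v) (at (x + s *\<^sub>R v + t *\<^sub>R w)) w"
proof -
  let ?D = "\<lambda>y. frechet_derivative f (at y) v"
  have C: "Ck_on (Suc (Suc 0)) U f" using assms(1) by (simp add: numeral_2_eq_2)
  have d1: "(f has_derivative frechet_derivative f (at y)) (at y)" if "y \<in> U" for y
    using Ck_on_SucD(1)[OF C that] .
  have d2: "(?D has_derivative frechet_derivative ?D (at y)) (at y)" if "y \<in> U" for y
    using Ck_on_SucD(1)[OF Ck_on_SucD(2)[OF C] that] .
  let ?p = "\<lambda>s. f (x + s *\<^sub>R v + h *\<^sub>R w) - f (x + s *\<^sub>R v)"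
  have "(?p has_derivative (\<lambda>k. k * (?D (x + s *\<^sub>R v + h *\<^sub>R w) - ?D (x + s *\<^sub>R v)))) (at s within {0..h})"
    if s: "0 \<le> s" "s \<le> h" for s
  proof -
    have u: "x + s *\<^sub>R v + h *\<^sub>R w \<in> U" "x + s *\<^sub>R v \<in> U"
      using sub[OF s, of h] sub[OF s, of 0] h by auto
    have l: "linear (frechet_derivative f (at (x + s *\<^sub>R v + h *\<^sub>R w)))" "linear (frechet_derivative f (at (x + s *\<^sub>R v)))"
      using d1[OF u(1)] d1[OF u(2)] has_derivative_linear by blast+
    have e: "((\<lambda>s. x + s *\<^sub>R v + h *\<^sub>R w) has_derivative (\<lambda>k. k *\<^sub>R v)) (at s within {0..h})"
      "((\<lambda>s. x + s *\<^sub>R v) has_derivative (\<lambda>k. k *\<^sub>R v)) (at s within {0..h})"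
      by (auto intro!: derivative_eq_intros)
    show ?thesis
      using has_derivative_diff[OF has_derivative_compose[OF e(1) d1[OF u(1)]] has_derivative_compose[OF e(2) d1[OF u(2)]]]
      by (simp add: linear_scale[OF l(1)] linear_scale[OF l(2)] right_diff_distrib)
  qed
  from mvt_simple[OF h this] obtain s where s: "s \<in> {0<..<h}"
    "?p h - ?p 0 = h * (?D (x + s *\<^sub>R v + h *\<^sub>R w) - ?D (x + s *\<^sub>R v))"
    by auto
  let ?q = "\<lambda>t. ?D (x + s *\<^sub>R v + t *\<^sub>R w)"
  have "(?q has_derivative (\<lambda>k. k * frechet_derivative ?D (at (x + s *\<^sub>R v + t *\<^sub>R w)) w)) (at t within {0..h})"
    if t: "0 \<le> t" "t \<le> h" for t
  proof -
    have u: "x + s *\<^sub>R v + t *\<^sub>R w \<in> U" using sub[of s t] s t by auto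
    have l: "linear (frechet_derivative ?D (at (x + s *\<^sub>R v + t *\<^sub>R w)))"
      using d2[OF u] has_derivative_linear by blast
    have e: "((\<lambda>t. x + s *\<^sub>R v + t *\<^sub>R w) has_derivative (\<lambda>k. k *\<^sub>R w)) (at t within {0..h})"
      by (auto intro!: derivative_eq_intros)
    show ?thesis using has_derivative_compose[OF e d2[OF u]] by (simp add: linear_scale[OF l])
  qed
  from mvt_simple[OF h this] obtain t where t: "t \<in> {0<..<h}"
    "?q h - ?q 0 = h * frechet_derivative ?D (at (x + s *\<^sub>R v + t *\<^sub>R w)) w"
    by auto
  show ?thesis
    using s t by (intro exI[of _ s] exI[of _ t]) (auto simp: power2_eq_square algebra_simps)
qed

lemma second_derivative_symmetric_real:
  fixes f :: "'a::real_normed_vector \<Rightarrow> real"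
  assumes "open U" "x \<in> U" and C: "Ck_on 2 U f"
  shows "frechet_derivative (\<lambda>y. frechet_derivative f (at y) v) (at x) w =
         frechet_derivative (\<lambda>y. frechet_derivative f (at y) w) (at x) v"
proof -
  let ?A = "\<lambda>v w y. frechet_derivative (\<lambda>y. frechet_derivative f (at y) v) (at y) w"
  have cont: "continuous_on U (?A v w)" for v w
    using C by (simp add: numeral_2_eq_2)
  have "\<bar>?A v w x - ?A w v x\<bar> \<le> 2 * e" if e: "e > 0" for e
  proof -
    have ic: "isCont (?A v w) x" "isCont (?A w v) x"
      using cont[of v w] cont[of w v] assms(1,2) by (simp_all add: continuous_on_eq_continuous_at)
    obtain r1 where r1: "r1 > 0" "\<And>y. dist y x < r1 \<Longrightarrow> dist (?A v w y) (?A v w x) < e"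
      using ic(1) e unfolding continuous_at_eps_delta by blast
    obtain r2 where r2: "r2 > 0" "\<And>y. dist y x < r2 \<Longrightarrow> dist (?A w v y) (?A w v x) < e"
      using ic(2) e unfolding continuous_at_eps_delta by blast
    obtain r3 where r3: "r3 > 0" "\<And>y. dist y x < r3 \<Longrightarrow> y \<in> U"
      using assms(1,2) unfolding open_dist by blast
    define r where "r = min r1 (min r2 r3)"
    have r: "r > 0" "\<And>y. dist y x < r \<Longrightarrow> dist (?A v w y) (?A v w x) < e \<and> dist (?A w v y) (?A w v x) < e \<and> y \<in> U"
      using r1 r2 r3 by (auto simp: r_def)
    define h where "h = r / (2 * (norm v + norm w + 1))"
    have pos: "norm v + norm w + 1 > 0" by (simp add: add_nonneg_pos)
    have h: "h > 0" using r(1) pos by (simp add: h_def)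
    have near: "dist (x + s *\<^sub>R v' + t *\<^sub>R w') x < r" if "0 \<le> s" "s \<le> h" "0 \<le> t" "t \<le> h" "v' = v \<and> w' = w \<or> v' = w \<and> w' = v" for s t v' w'
    proof -
      have "dist (x + s *\<^sub>R v' + t *\<^sub>R w') x \<le> s * norm v' + t * norm w'"
        using norm_triangle_ineq[of "s *\<^sub>R v'" "t *\<^sub>R w'"] that by (simp add: dist_norm add.assoc)
      also have "\<dots> \<le> h * norm v' + h * norm w'" using that by (intro add_mono mult_right_mono) auto
      also have "\<dots> < h * (2 * (norm v + norm w + 1))" 
        using mult_pos_pos[OF h pos] that(5) h by (auto simp: distrib_left mult.commute intro: add_nonneg_pos)
      also have "\<dots> = r" using pos by (simp add: h_def)
      finally show ?thesis .
    qed
    obtain s t where st: "0 \<le> s" "s \<le> h" "0 \<le> t" "t \<le> h"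
      "f (x + h *\<^sub>R v + h *\<^sub>R w) - f (x + h *\<^sub>R v) - f (x + h *\<^sub>R w) + f x = h^2 * ?A v w (x + s *\<^sub>R v + t *\<^sub>R w)"
      using second_difference_mvt[OF C h, of x v w] near r(2) by blast
    obtain s' t' where st': "0 \<le> s'" "s' \<le> h" "0 \<le> t'" "t' \<le> h"
      "f (x + h *\<^sub>R w + h *\<^sub>R v) - f (x + h *\<^sub>R w) - f (x + h *\<^sub>R v) + f x = h^2 * ?A w v (x + s' *\<^sub>R w + t' *\<^sub>R v)"
      using second_difference_mvt[OF C h, of x w v] near r(2) by blast
    have "h^2 * ?A v w (x + s *\<^sub>R v + t *\<^sub>R w) = h^2 * ?A w v (x + s' *\<^sub>R w + t' *\<^sub>R v)"
      unfolding st(5)[symmetric] st'(5)[symmetric] by (simp add: algebra_simps)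
    then have "?A v w (x + s *\<^sub>R v + t *\<^sub>R w) = ?A w v (x + s' *\<^sub>R w + t' *\<^sub>R v)" using h by simp
    moreover have "dist (?A v w (x + s *\<^sub>R v + t *\<^sub>R w)) (?A v w x) < e" using r(2) near st by blast
    moreover have "dist (?A w v (x + s' *\<^sub>R w + t' *\<^sub>R v)) (?A w v x) < e" using r(2) near st' by blast
    ultimately show ?thesis by (simp add: dist_real_def)
  qed
  note bound = this
  have "\<bar>?A v w x - ?A w v x\<bar> \<le> 0 + e" if "e > 0" for e
    using bound[of "e/2"] that by simp
  then have "\<bar>?A v w x - ?A w v x\<bar> \<le> 0"
    by (rule field_le_epsilon)
  then show ?thesis by simp
qed

lemma frechet_derivative_bounded_linear:
  assumes "bounded_linear L" "f differentiable (at x)"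
  shows "frechet_derivative (\<lambda>y. L (f y)) (at x) v = L (frechet_derivative f (at x) v)"
proof -
  have "((\<lambda>y. L (f y)) has_derivative (\<lambda>v. L (frechet_derivative f (at x) v))) (at x)"
    using assms by (simp add: bounded_linear.has_derivative frechet_derivative_works)
  then show ?thesis using frechet_derivative_at by metis
qed

lemma second_derivative_symmetric:
  fixes f :: "'a::real_normed_vector \<Rightarrow> 'b::euclidean_space"
  assumes "open U" "x \<in> U" and C: "Ck_on 2 U f"
  shows "frechet_derivative (\<lambda>y. frechet_derivative f (at y) v) (at x) w =
         frechet_derivative (\<lambda>y. frechet_derivative f (at y) w) (at x) v"
proof (rule euclidean_eqI)
  fix b :: 'b
  have bl: "bounded_linear (\<lambda>y::'b. y \<bullet> b)" by (rule bounded_linear_inner_left)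
  have C2: "Ck_on (Suc (Suc 0)) U f" using C by (simp add: numeral_2_eq_2)
  have *: "frechet_derivative (\<lambda>y. frechet_derivative (\<lambda>y. f y \<bullet> b) (at y) v) (at x) w =
    frechet_derivative (\<lambda>y. frechet_derivative f (at y) v) (at x) w \<bullet> b" for v w
  proof -
    have "frechet_derivative (\<lambda>y. frechet_derivative (\<lambda>y. f y \<bullet> b) (at y) v) (at x) =
      frechet_derivative (\<lambda>y. frechet_derivative f (at y) v \<bullet> b) (at x)"
      using C2 by (intro frechet_derivative_cong_open[OF assms(1,2)] frechet_derivative_bounded_linear[OF bl]) auto
    moreover have "frechet_derivative (\<lambda>y. frechet_derivative f (at y) v \<bullet> b) (at x) w =
        frechet_derivative (\<lambda>y. frechet_derivative f (at y) v) (at x) w \<bullet> b"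
      using C2 assms(2) by (intro frechet_derivative_bounded_linear[OF bl]) auto
    ultimately show ?thesis by simp
  qed
  show "frechet_derivative (\<lambda>y. frechet_derivative f (at y) v) (at x) w \<bullet> b =
        frechet_derivative (\<lambda>y. frechet_derivative f (at y) w) (at x) v \<bullet> b"
    unfolding *[symmetric]
    by (rule second_derivative_symmetric_real[OF assms(1,2)]) (rule Ck_on_bounded_linear[OF bl assms(1) C])
qed

section \<open>Derivatives of determinants and inverse matrices\<close>

text \<open>Jacobi's formula in the form obtained by differentiating the Leibniz expansion row by row.\<close>

lemma has_derivative_det:
  fixes A :: "'x::real_normed_vector \<Rightarrow> real^'n^'n"
  assumes "\<And>i j. ((\<lambda>u. A u $ i $ j) has_derivative A' i j) (at u)"
  shows "((\<lambda>u. det (A u)) has_derivative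
    (\<lambda>h. \<Sum>k\<in>UNIV. det (\<chi> i. if i = k then (\<chi> j. A' k j h) else A u $ i))) (at u)"
proof -
  let ?P = "{p. p permutes (UNIV :: 'n set)}"
  let ?D = "\<lambda>h. \<Sum>p\<in>?P. of_int (sign p) * (\<Sum>k\<in>UNIV. A' k (p k) h * (\<Prod>j\<in>UNIV - {k}. A u $ j $ p j))"
  have "((\<lambda>u. \<Prod>i\<in>UNIV. A u $ i $ p i) has_derivative
      (\<lambda>h. \<Sum>k\<in>UNIV. A' k (p k) h * (\<Prod>j\<in>UNIV - {k}. A u $ j $ p j))) (at u)" for p
    by (rule has_derivative_prod) (rule assms)
  then have "((\<lambda>u. det (A u)) has_derivative ?D) (at u)"
    unfolding det_def by (intro has_derivative_sum has_derivative_mult_right) auto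
  moreover have "?D h = (\<Sum>k\<in>UNIV. det (\<chi> i. if i = k then (\<chi> j. A' k j h) else A u $ i))" for h
  proof -
    have "A' k (p k) h * (\<Prod>j\<in>UNIV - {k}. A u $ j $ p j) =
        (\<Prod>i\<in>UNIV. (\<chi> i. if i = k then (\<chi> j. A' k j h) else A u $ i) $ i $ p i)" for p k
      by (subst prod.remove[of UNIV k]) (auto intro!: prod.cong)
    then show ?thesis
      unfolding det_def sum_distrib_left by (subst sum.swap) simp
  qed
  ultimately show ?thesis by simp
qed

text \<open>Cramer's rule: the row \<open>r\<close> is the combination of the rows of \<open>A\<close> whose
  coefficients are given by the inverse, and only the multiple of row \<open>k\<close> survives.\<close>

lemma det_replace_row:
  fixes A B :: "real^'n^'n"
  assumes "B ** A = mat 1"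
  shows "det (\<chi> i. if i = k then r else A $ i) = (\<Sum>j\<in>UNIV. r $ j * B $ j $ k) * det A"
proof -
  let ?y = "\<chi> i. \<Sum>j\<in>UNIV. r $ j * B $ j $ i"
  have "(\<Sum>i\<in>UNIV. ?y $ i *s row i A) $ l = r $ l" for l
  proof -
    have "(\<Sum>i\<in>UNIV. ?y $ i *s row i A) $ l = (\<Sum>i\<in>UNIV. \<Sum>j\<in>UNIV. r $ j * (B $ j $ i * A $ i $ l))"
      by (simp add: sum_distrib_right row_def mult.assoc)
    also have "\<dots> = (\<Sum>j\<in>UNIV. r $ j * (B ** A) $ j $ l)"
      by (subst sum.swap) (simp add: sum_distrib_left matrix_matrix_mult_def)
    also have "\<dots> = r $ l"
      unfolding assms mat_def by (simp add: if_distrib sum.delta' cong: if_cong)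
    finally show ?thesis .
  qed
  then have r: "(\<Sum>i\<in>UNIV. ?y $ i *s row i A) = r" by (simp only: vec_eq_iff) simp
  have "det (\<chi> i. if i = k then r else A $ i) = det (\<chi> i. if i = k then (\<Sum>i\<in>UNIV. ?y $ i *s row i A) else row i A)"
    unfolding r by (rule arg_cong[of _ _ det]) (simp add: row_def vec_eq_iff)
  also have "\<dots> = ?y $ k * det A" by (rule cramer_lemma_transpose)
  finally show ?thesis by simp
qed

lemma matrix_inv_mult:
  fixes A :: "real^'n^'n"
  assumes "det A \<noteq> 0"
  shows "matrix_inv A ** A = mat 1" "A ** matrix_inv A = mat 1"
  using assms by (auto simp: invertible_det_nz[symmetric] invertible_def matrix_inv_def intro: someI2)

text \<open>Writing the entries of the inverse as quotients of determinants makes the inverse of a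
  differentiable family of matrices differentiable.\<close>

lemma matrix_inv_entry:
  fixes A :: "real^'n^'n"
  assumes "det A \<noteq> 0"
  shows "matrix_inv A $ k $ j = det (\<chi> i l. if l = k then axis j 1 $ i else A $ i $ l) / det A"
proof -
  have "A *v (matrix_inv A *v axis j 1) = axis j 1"
    by (simp add: matrix_vector_mul_assoc matrix_inv_mult[OF assms])
  then have "matrix_inv A *v axis j 1 = (\<chi> k. det (\<chi> i l. if l = k then axis j 1 $ i else A $ i $ l) / det A)"
    using cramer[OF assms] by blast
  moreover have "(matrix_inv A *v axis j 1) $ k = matrix_inv A $ k $ j"
    by (simp add: matrix_vector_mult_def axis_def if_distrib sum.delta cong: if_cong)
  ultimately show ?thesis by simp
qed

lemma differentiable_det:
  fixes A :: "'x::real_normed_vector \<Rightarrow> real^'n^'n"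
  assumes "\<And>i j. (\<lambda>u. A u $ i $ j) differentiable (at u)"
  shows "(\<lambda>u. det (A u)) differentiable (at u)"
  using has_derivative_det[of A "\<lambda>i j. frechet_derivative (\<lambda>u. A u $ i $ j) (at u)" u] assms
  by (auto simp: frechet_derivative_works[symmetric] differentiable_def)

lemma differentiable_matrix_inv:
  fixes A :: "'x::real_normed_vector \<Rightarrow> real^'n^'n"
  assumes "open U" "u \<in> U" "\<And>i j. (\<lambda>u. A u $ i $ j) differentiable (at u)"
    and "\<And>u. u \<in> U \<Longrightarrow> det (A u) \<noteq> 0"
  shows "(\<lambda>u. matrix_inv (A u) $ k $ j) differentiable (at u)"
proof -
  have "(\<lambda>u. det (\<chi> i l. if l = k then axis j 1 $ i else A u $ i $ l)) differentiable (at u)"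
    proof (rule differentiable_det)
    fix i l
    show "(\<lambda>u. (\<chi> i l. if l = k then axis j 1 $ i else A u $ i $ l) $ i $ l) differentiable (at u)"
      by (cases "l = k") (simp_all add: assms(3))
  qed
  then have "(\<lambda>u. det (\<chi> i l. if l = k then axis j 1 $ i else A u $ i $ l) / det (A u)) differentiable (at u)"
    using differentiable_det[OF assms(3)] assms(2,4) by (intro differentiable_divide) auto
  then show ?thesis
    using differentiable_cong_open[OF assms(1,2)] matrix_inv_entry[OF assms(4)] by (metis (no_types, lifting))
qed

section \<open>Partial derivatives\<close>

lemma pderiv_on_eqI: "(f has_derivative f') (at u) \<Longrightarrow> pderiv_on k f u = f' (axis k 1)"
  unfolding pderiv_on_def using frechet_derivative_at by metis

lemma pderiv_on_cong:
  assumes "open U" "u \<in> U" "\<And>w. w \<in> U \<Longrightarrow> f w = g w"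
  shows "pderiv_on k f u = pderiv_on k g u"
  unfolding pderiv_on_def using frechet_derivative_cong_open[OF assms] by simp

lemma pderiv_on_const: "pderiv_on k (\<lambda>u. c) u = 0"
  by (simp add: pderiv_on_def)

lemma pderiv_on_add:
  assumes "f differentiable (at u)" "h differentiable (at u)"
  shows "pderiv_on k (\<lambda>u. f u + h u) u = pderiv_on k f u + pderiv_on k h u"
  by (rule pderiv_on_eqI[THEN trans])
    (use assms[unfolded frechet_derivative_works] in \<open>auto intro!: has_derivative_add simp: pderiv_on_def\<close>)

lemma pderiv_on_sum:
  assumes "\<And>i. i \<in> I \<Longrightarrow> f i differentiable (at u)"
  shows "pderiv_on k (\<lambda>u. \<Sum>i\<in>I. f i u) u = (\<Sum>i\<in>I. pderiv_on k (f i) u)"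
proof -
  have "((\<lambda>u. \<Sum>i\<in>I. f i u) has_derivative (\<lambda>h. \<Sum>i\<in>I. frechet_derivative (f i) (at u) h)) (at u)"
    by (intro has_derivative_sum) (use assms frechet_derivative_works in blast)
  from pderiv_on_eqI[OF this] show ?thesis by (simp add: pderiv_on_def)
qed

lemma pderiv_on_bilinear:
  assumes "bounded_bilinear pr" "f differentiable (at u)" "h differentiable (at u)"
  shows "pderiv_on k (\<lambda>u. pr (f u) (h u)) u = pr (pderiv_on k f u) (h u) + pr (f u) (pderiv_on k h u)"
proof -
  have "((\<lambda>u. pr (f u) (h u)) has_derivative
      (\<lambda>y. pr (f u) (frechet_derivative h (at u) y) + pr (frechet_derivative f (at u) y) (h u))) (at u)"
    by (rule bounded_bilinear.FDERIV[OF assms(1) assms(2,3)[unfolded frechet_derivative_works]])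
  from pderiv_on_eqI[OF this] show ?thesis by (simp add: pderiv_on_def add.commute)
qed

lemmas pderiv_on_inner = pderiv_on_bilinear[OF bounded_bilinear_inner]
  and pderiv_on_scaleR = pderiv_on_bilinear[OF bounded_bilinear_scaleR]

lemma pderiv_on_linear:
  assumes "bounded_linear L" "f differentiable (at u)"
  shows "pderiv_on k (\<lambda>u. L (f u)) u = L (pderiv_on k f u)"
  unfolding pderiv_on_def by (rule frechet_derivative_bounded_linear[OF assms])

lemma differentiable_bilinear:
  assumes "bounded_bilinear pr" "f differentiable (at u)" "h differentiable (at u)"
  shows "(\<lambda>u. pr (f u) (h u)) differentiable (at u)"
  using bounded_bilinear.FDERIV[OF assms(1)] assms(2,3) unfolding differentiable_def by blast

lemma differentiable_bounded_linear:
  assumes "bounded_linear L" "f differentiable (at u)"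
  shows "(\<lambda>u. L (f u)) differentiable (at u)"
  using bounded_linear.has_derivative[OF assms(1)] assms(2) unfolding differentiable_def by blast

lemmas differentiable_inner' = differentiable_bilinear[OF bounded_bilinear_inner]
  and differentiable_scaleR' = differentiable_bilinear[OF bounded_bilinear_scaleR]

lemma linear_basis_expand:
  fixes L :: "'a::euclidean_space \<Rightarrow> 'b::real_vector"
  assumes "linear L"
  shows "L y = (\<Sum>b\<in>Basis. (y \<bullet> b) *\<^sub>R L b)"
proof -
  have "L (\<Sum>b\<in>Basis. (y \<bullet> b) *\<^sub>R b) = (\<Sum>b\<in>Basis. (y \<bullet> b) *\<^sub>R L b)"
    by (subst linear_sum[OF assms]) (simp add: linear_scale[OF assms])
  then show ?thesis by (simp add: euclidean_representation)
qed

section \<open>Lie derivatives along linear vector fields\<close>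

definition lie :: "('a::real_normed_vector \<Rightarrow> 'a) \<Rightarrow> ('a \<Rightarrow> complex) \<Rightarrow> 'a \<Rightarrow> complex" where
  "lie A F x = frechet_derivative F (at x) (A x)"

text \<open>The rotation field of the plane spanned by \<open>b\<close> and \<open>c\<close>, the generator of a
  one-parameter group of isometries of the sphere.\<close>

definition plane_rot :: "'a::euclidean_space \<Rightarrow> 'a \<Rightarrow> 'a \<Rightarrow> 'a" where
  "plane_rot b c y = (y \<bullet> b) *\<^sub>R c - (y \<bullet> c) *\<^sub>R b"

text \<open>For \<open>p = q = 1\<close> this is the Laplacian of the round sphere; the sum over ordered pairs
  \<open>(b, c)\<close> counts each plane twice, whence \<open>p / 2\<close>. The second sum is, up
  to sign, the Casimir operator of the three fields \<open>J s\<close>. The operator is nonnegative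
  for \<open>p, q \<ge> 0\<close>.\<close>

definition sphere_op :: "real \<Rightarrow> real \<Rightarrow> (nat \<Rightarrow> 'a \<Rightarrow> 'a) \<Rightarrow> ('a::euclidean_space \<Rightarrow> complex) \<Rightarrow> 'a \<Rightarrow> complex" where
  "sphere_op p q J F x =
     - ((p / 2) *\<^sub>R (\<Sum>b\<in>Basis. \<Sum>c\<in>Basis. lie (plane_rot b c) (lie (plane_rot b c) F) x)
        + (q - p) *\<^sub>R (\<Sum>s<3. lie (J s) (lie (J s) F) x))"

text \<open>The second derivative of \<open>F\<close> at \<open>x\<close> in the directions \<open>y\<close> and
  \<open>z\<close>. It is expanded along the basis in \<open>z\<close>, since \<open>Ck_on\<close>
  gives derivatives in fixed directions.\<close>

definition hess :: "('a::euclidean_space \<Rightarrow> complex) \<Rightarrow> 'a \<Rightarrow> 'a \<Rightarrow> 'a \<Rightarrow> complex" where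
  "hess F x y z = (\<Sum>b\<in>Basis. (z \<bullet> b) *\<^sub>R frechet_derivative (\<lambda>w. frechet_derivative F (at w) b) (at x) y)"

lemma linear_plane_rot: "linear (plane_rot b c)"
  by (rule linearI) (auto simp: plane_rot_def inner_add_left algebra_simps)

lemma lie_lie:
  fixes F :: "'a::euclidean_space \<Rightarrow> complex"
  assumes "open W" "x \<in> W" "Ck_on 2 W F" "linear A"
  shows "lie A (lie A F) x = hess F x (A x) (A x) + frechet_derivative F (at x) (A (A x))"
proof -
  have C: "Ck_on (Suc (Suc 0)) W F" using assms(3) by (simp add: numeral_2_eq_2)
  let ?D = "\<lambda>b w. frechet_derivative F (at w) b"
  have 1: "lie A F w = (\<Sum>b\<in>Basis. (A w \<bullet> b) *\<^sub>R ?D b w)" if "w \<in> W" for w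
    unfolding lie_def
    by (rule linear_basis_expand) (use Ck_on_SucD(1)[OF C that] has_derivative_linear in blast)
  have d: "(?D b has_derivative frechet_derivative (?D b) (at x)) (at x)" for b
    using Ck_on_SucD(1)[OF Ck_on_SucD(2)[OF C] assms(2)] .
  have A: "bounded_linear A" using assms(4) linear_conv_bounded_linear by blast
  have dA: "(A has_derivative A) (at x)" by (rule bounded_linear_imp_has_derivative[OF A])
  have "((\<lambda>w. \<Sum>b\<in>Basis. (A w \<bullet> b) *\<^sub>R ?D b w) has_derivative
     (\<lambda>h. \<Sum>b\<in>Basis. (A x \<bullet> b) *\<^sub>R frechet_derivative (?D b) (at x) h + (A h \<bullet> b) *\<^sub>R ?D b x)) (at x)"
    by (intro has_derivative_sum has_derivative_scaleR has_derivative_inner_left dA d)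
  then have "(lie A F has_derivative
     (\<lambda>h. \<Sum>b\<in>Basis. (A x \<bullet> b) *\<^sub>R frechet_derivative (?D b) (at x) h + (A h \<bullet> b) *\<^sub>R ?D b x)) (at x)"
    by (rule has_derivative_transform_within_open[OF _ assms(1,2)]) (simp add: 1)
  then have "lie A (lie A F) x = (\<Sum>b\<in>Basis. (A x \<bullet> b) *\<^sub>R frechet_derivative (?D b) (at x) (A x) + (A (A x) \<bullet> b) *\<^sub>R ?D b x)"
    unfolding lie_def[of A "lie A F"] by (simp only: frechet_derivative_at[symmetric])
  also have "\<dots> = hess F x (A x) (A x) + (\<Sum>b\<in>Basis. (A (A x) \<bullet> b) *\<^sub>R ?D b x)"
    by (simp add: hess_def sum.distrib)
  also have "(\<Sum>b\<in>Basis. (A (A x) \<bullet> b) *\<^sub>R ?D b x) = frechet_derivative F (at x) (A (A x))"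
    by (rule linear_basis_expand[symmetric]) (use Ck_on_SucD(1)[OF C assms(2)] has_derivative_linear in blast)
  finally show ?thesis .
qed

lemma hess_linear:
  fixes F :: "'a::euclidean_space \<Rightarrow> complex"
  assumes "Ck_on 2 W F" "x \<in> W"
  shows "linear (\<lambda>y. hess F x y z)" "linear (hess F x y)"
proof -
  have C: "Ck_on (Suc (Suc 0)) W F" using assms(1) by (simp add: numeral_2_eq_2)
  have d: "linear (frechet_derivative (\<lambda>w. frechet_derivative F (at w) b) (at x))" for b
    using Ck_on_SucD(1)[OF Ck_on_SucD(2)[OF C] assms(2)] has_derivative_linear by blast
  show "linear (\<lambda>y. hess F x y z)" unfolding hess_def
    by (rule linearI) (simp_all add: linear_add[OF d] linear_scale[OF d] scaleR_add_right sum.distrib scaleR_sum_right mult.commute)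
  show "linear (hess F x y)" unfolding hess_def
    by (rule linearI) (simp_all add: inner_add_left scaleR_add_left sum.distrib scaleR_sum_right)
qed

text \<open>For a unit vector \<open>x\<close> the fields \<open>plane_rot b c\<close> at \<open>x\<close> span
  the tangent space of the sphere, and the sum over them computes twice the trace over that space.\<close>

lemma bilinear_plane_sum:
  fixes B :: "'a::euclidean_space \<Rightarrow> 'a \<Rightarrow> 'b::real_vector"
  assumes l1: "\<And>z. linear (\<lambda>y. B y z)" and l2: "\<And>y. linear (B y)"
  shows "(\<Sum>b\<in>Basis. \<Sum>c\<in>Basis. B (plane_rot b c x) (plane_rot b c x)) =
     2 *\<^sub>R ((x \<bullet> x) *\<^sub>R (\<Sum>b\<in>Basis. B b b) - B x x)"
proof -
  have e: "B (plane_rot b c x) (plane_rot b c x) =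
     (x \<bullet> b)\<^sup>2 *\<^sub>R B c c + (x \<bullet> c)\<^sup>2 *\<^sub>R B b b
     - ((x \<bullet> b) *\<^sub>R (x \<bullet> c) *\<^sub>R B c b + (x \<bullet> b) *\<^sub>R (x \<bullet> c) *\<^sub>R B b c)" for b c
    unfolding plane_rot_def linear_diff[OF l1] linear_diff[OF l2] linear_scale[OF l1] linear_scale[OF l2]
    by (simp add: algebra_simps power2_eq_square)
  have n: "x \<bullet> x = (\<Sum>b\<in>Basis. (x \<bullet> b)\<^sup>2)"
    by (subst euclidean_inner) (simp add: power2_eq_square)
  have xx: "B x x = (\<Sum>b\<in>Basis. \<Sum>c\<in>Basis. (x \<bullet> b) *\<^sub>R (x \<bullet> c) *\<^sub>R B b c)"
    by (subst linear_basis_expand[OF l1]) (subst linear_basis_expand[OF l2], simp add: scaleR_sum_right)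
  have xx': "B x x = (\<Sum>b\<in>Basis. \<Sum>c\<in>Basis. (x \<bullet> b) *\<^sub>R (x \<bullet> c) *\<^sub>R B c b)"
    unfolding xx by (subst sum.swap) (simp add: mult.commute)
  have "(\<Sum>b\<in>Basis. \<Sum>c\<in>Basis. B (plane_rot b c x) (plane_rot b c x)) =
     (\<Sum>b\<in>Basis. \<Sum>c\<in>Basis. (x \<bullet> b)\<^sup>2 *\<^sub>R B c c) + (\<Sum>b\<in>Basis. \<Sum>c\<in>Basis. (x \<bullet> c)\<^sup>2 *\<^sub>R B b b)
     - (B x x + B x x)"
    unfolding e sum_subtractf sum.distrib xx[symmetric] xx'[symmetric] ..
  also have "(\<Sum>b\<in>Basis. \<Sum>c\<in>Basis. (x \<bullet> b)\<^sup>2 *\<^sub>R B c c) = (x \<bullet> x) *\<^sub>R (\<Sum>b\<in>Basis. B b b)"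
    unfolding n by (simp only: scaleR_sum_right[symmetric] scaleR_sum_left[symmetric])
  also have "(\<Sum>b\<in>Basis. \<Sum>c\<in>Basis. (x \<bullet> c)\<^sup>2 *\<^sub>R B b b) = (x \<bullet> x) *\<^sub>R (\<Sum>b\<in>Basis. B b b)"
    unfolding n by (subst sum.swap) (simp only: scaleR_sum_right[symmetric] scaleR_sum_left[symmetric])
  finally show ?thesis by (simp only: scaleR_2 add_diff_add)
qed

lemma plane_rot_twice_sum:
  fixes x :: "'a::euclidean_space"
  shows "(\<Sum>b\<in>Basis. \<Sum>c\<in>Basis. plane_rot b c (plane_rot b c x)) = - (2 * (real DIM('a) - 1)) *\<^sub>R x"
proof -
  have e: "plane_rot b c (plane_rot b c x) = (if b = c then 2 *\<^sub>R (x \<bullet> c) *\<^sub>R c else 0) - (x \<bullet> c) *\<^sub>R c - (x \<bullet> b) *\<^sub>R b"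
    if "b \<in> Basis" "c \<in> Basis" for b c :: 'a
    using that by (auto simp: plane_rot_def inner_diff_left inner_Basis algebra_simps simp flip: scaleR_2)
  have "(\<Sum>b\<in>Basis. \<Sum>c\<in>Basis. plane_rot b c (plane_rot b c x)) =
    (\<Sum>b\<in>Basis. \<Sum>c\<in>Basis. (if b = c then 2 *\<^sub>R (x \<bullet> c) *\<^sub>R c else 0) - (x \<bullet> c) *\<^sub>R c - (x \<bullet> b) *\<^sub>R b)"
    by (intro sum.cong refl e)
  also have "\<dots> = (\<Sum>b\<in>Basis. 2 *\<^sub>R (x \<bullet> b) *\<^sub>R b) - (\<Sum>b\<in>(Basis::'a set). x) - (\<Sum>b\<in>Basis. real DIM('a) *\<^sub>R (x \<bullet> b) *\<^sub>R b)"
    by (simp add: sum_subtractf sum.delta euclidean_representation sum_constant_scaleR)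
  also have "\<dots> = 2 *\<^sub>R x - real DIM('a) *\<^sub>R x - real DIM('a) *\<^sub>R x"
    by (simp only: scaleR_sum_right[symmetric] euclidean_representation sum_constant_scaleR)
  also have "\<dots> = - (2 * (real DIM('a) - 1)) *\<^sub>R x"
    unfolding scaleR_left_diff_distrib[symmetric] by (rule arg_cong[of _ _ "\<lambda>c. c *\<^sub>R x"]) simp
  finally show ?thesis .
qed

text \<open>Three anticommuting orthogonal complex structures. The index is a natural number in order to sum
  over \<open>s < 3\<close>.\<close>

locale quaternionic =
  fixes J :: "nat \<Rightarrow> 'a::euclidean_space \<Rightarrow> 'a"
  assumes J_linear: "linear (J s)"
    and J_skew: "J s x \<bullet> y = - (x \<bullet> J s y)"
    and J_square: "J s (J s x) = - x"
    and J_anti: "s < 3 \<Longrightarrow> t < 3 \<Longrightarrow> s \<noteq> t \<Longrightarrow> J s (J t x) = - J t (J s x)"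
begin

lemma J_orth: "x \<bullet> J s x = 0"
  using J_skew[of s x x] by (simp add: inner_commute)

lemma J_isom: "J s x \<bullet> J s y = x \<bullet> y"
  using J_skew[of s x "J s y"] by (simp add: J_square)

lemma J_J_orth: "s < 3 \<Longrightarrow> t < 3 \<Longrightarrow> J s x \<bullet> J t x = (if s = t then x \<bullet> x else 0)"
proof (cases "s = t")
  case False assume s: "s < 3" "t < 3"
  have "J s x \<bullet> J t x = - (x \<bullet> J s (J t x))" by (rule J_skew)
  also have "\<dots> = x \<bullet> J t (J s x)" using J_anti[OF s False] by simp
  also have "\<dots> = - (J t x \<bullet> J s x)" using J_skew[of t x "J s x"] by simp
  finally show ?thesis using False by (simp add: inner_commute)
qed (simp add: J_isom)

text \<open>On the unit sphere the round part is the trace of the Hessian over the tangent space minus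
  \<open>dim - 1\<close> times the radial derivative. The term \<open>3 * (q - p)\<close> comes from
  \<open>J s (J s x) = - x\<close>: the integral curves of the fields \<open>J s\<close> are great
  circles, whose acceleration is \<open>- x\<close>.\<close>

lemma sphere_op_eq_hess:
  assumes "open W" "x \<in> W" "Ck_on 2 W F" "norm x = 1"
  shows "sphere_op p q J F x =
     - (p *\<^sub>R ((\<Sum>b\<in>Basis. hess F x b b) - hess F x x x) + (q - p) *\<^sub>R (\<Sum>s<3. hess F x (J s x) (J s x))
        - (p * (real DIM('a) - 1) + 3 * (q - p)) *\<^sub>R frechet_derivative F (at x) x)"
proof -
  have lD: "linear (frechet_derivative F (at x))"
    using Ck_on_SucD(1)[of "Suc 0" W F x] assms has_derivative_linear by (auto simp: numeral_2_eq_2)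
  have n: "x \<bullet> x = 1" using assms(4) by (simp add: dot_square_norm)
  have 1: "(\<Sum>b\<in>Basis. \<Sum>c\<in>Basis. lie (plane_rot b c) (lie (plane_rot b c) F) x) =
     2 *\<^sub>R ((\<Sum>b\<in>Basis. hess F x b b) - hess F x x x) - (2 * (real DIM('a) - 1)) *\<^sub>R frechet_derivative F (at x) x"
    unfolding lie_lie[OF assms(1-3) linear_plane_rot] sum.distrib
      bilinear_plane_sum[OF hess_linear[OF assms(3,2)]] linear_sum[OF lD, symmetric] plane_rot_twice_sum
    by (simp add: n linear_neg[OF lD] linear_scale[OF lD] del: scaleR_minus_left flip: scaleR_minus_left)
  have 2: "(\<Sum>s<3. lie (J s) (lie (J s) F) x) = (\<Sum>s<3. hess F x (J s x) (J s x)) - 3 *\<^sub>R frechet_derivative F (at x) x"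
    unfolding lie_lie[OF assms(1-3) J_linear] sum.distrib J_square linear_neg[OF lD]
    by (simp add: sum_constant_scaleR scaleR_conv_of_real)
  show ?thesis unfolding sphere_op_def 1 2
    by (simp add: scaleR_conv_of_real algebra_simps)
qed

end


section \<open>The Laplacian in a chart of the sphere\<close>

text \<open>A chart \<open>x\<close> of the unit sphere together with the coordinate matrix \<open>g\<close> of
  the metric that is \<open>a\<close> times the round one on the horizontal vectors and
  \<open>b\<close> times the round one on the vertical vectors \<open>J s x\<close>.\<close>

locale sphere_chart = quaternionic J for J :: "nat \<Rightarrow> 'a::euclidean_space \<Rightarrow> 'a" +
  fixes U :: "(real^'d) set" and x :: "real^'d \<Rightarrow> 'a" and a b :: real and g :: "real^'d \<Rightarrow> real^'d^'d"
  assumes U: "open U" and C2: "Ck_on 2 U x"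
    and unit: "u \<in> U \<Longrightarrow> norm (x u) = 1"
    and immersion: "u \<in> U \<Longrightarrow> frechet_derivative x (at u) w = 0 \<Longrightarrow> w = 0"
    and dim: "CARD('d) + 1 = DIM('a)"
    and a: "a > 0" and b: "b > 0"
    and metric: "u \<in> U \<Longrightarrow> g u $ i $ j =
       a * (pderiv_on i x u \<bullet> pderiv_on j x u) +
       (b - a) * (\<Sum>s<3. (J s (x u) \<bullet> pderiv_on i x u) * (J s (x u) \<bullet> pderiv_on j x u))"
begin

text \<open>The coordinate frame, as vectors of the ambient space.\<close>

abbreviation "v \<equiv> \<lambda>i. pderiv_on i x"

text \<open>The metric as a symmetric operator on the ambient space; for a unit vector \<open>y\<close> it has
  the eigenvalue \<open>b\<close> on the vectors \<open>J s y\<close> and \<open>a\<close> on their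
  complement.\<close>

definition T :: "'a \<Rightarrow> 'a \<Rightarrow> 'a" where
  "T y z = a *\<^sub>R z + (b - a) *\<^sub>R (\<Sum>s<3. (J s y \<bullet> z) *\<^sub>R J s y)"

text \<open>The inverse of \<open>T y\<close> on the tangent space at \<open>y\<close>, extended by zero to the
  normal line.\<close>

definition S :: "'a \<Rightarrow> 'a \<Rightarrow> 'a" where
  "S y z = (1/a) *\<^sub>R (z - (y \<bullet> z) *\<^sub>R y) + (1/b - 1/a) *\<^sub>R (\<Sum>s<3. (J s y \<bullet> z) *\<^sub>R J s y)"

text \<open>The dual frame of the coordinate frame, that is, the gradients of the coordinate functions.\<close>

definition "X i u = (\<Sum>j\<in>UNIV. matrix_inv (g u) $ i $ j *\<^sub>R v j u)"

lemma x_deriv: "u \<in> U \<Longrightarrow> (x has_derivative frechet_derivative x (at u)) (at u)"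
  using Ck_on_SucD(1)[of "Suc 0" U x] C2 by (simp add: numeral_2_eq_2)

lemma x_diff: "u \<in> U \<Longrightarrow> x differentiable (at u)"
  using x_deriv differentiable_def by blast

lemma v_diff: "u \<in> U \<Longrightarrow> v i differentiable (at u)"
  using C2 by (simp add: numeral_2_eq_2 pderiv_on_def[abs_def])

lemma v_sym: "u \<in> U \<Longrightarrow> pderiv_on k (v i) u = pderiv_on i (v k) u"
  using second_derivative_symmetric[OF U _ C2] by (simp add: pderiv_on_def[abs_def])

lemma xx: "u \<in> U \<Longrightarrow> x u \<bullet> x u = 1"
  using unit by (simp add: dot_square_norm)

lemma x_v: assumes "u \<in> U" shows "x u \<bullet> v i u = 0"
proof -
  have "0 = pderiv_on i (\<lambda>u. x u \<bullet> x u) u"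
    using pderiv_on_cong[OF U assms, of "\<lambda>u. x u \<bullet> x u" "\<lambda>_. 1"] xx by (simp add: pderiv_on_const)
  also have "\<dots> = 2 * (x u \<bullet> v i u)"
    by (subst pderiv_on_inner) (auto simp: x_diff[OF assms] inner_commute)
  finally show ?thesis by simp
qed

lemma linear_T: "linear (T y)"
  by (rule linearI) (simp_all add: T_def inner_add_right algebra_simps sum.distrib scaleR_sum_right)

lemma J_sum: 
  assumes "s < 3"
  shows "J s y \<bullet> (\<Sum>t<3. c t *\<^sub>R J t y) = c s * (y \<bullet> y)"
proof -
  have "J s y \<bullet> (\<Sum>t<3. c t *\<^sub>R J t y) = (\<Sum>t<3. if t = s then c t * (y \<bullet> y) else 0)"
    unfolding inner_sum_right by (intro sum.cong) (auto simp: J_J_orth assms)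
  then show ?thesis using assms by simp
qed

lemma J_T: "s < 3 \<Longrightarrow> y \<bullet> y = 1 \<Longrightarrow> J s y \<bullet> T y z = b * (J s y \<bullet> z)"
  unfolding T_def inner_add_right inner_scaleR_right J_sum by (simp add: algebra_simps)

lemma x_T: "y \<bullet> T y z = a * (y \<bullet> z)"
  by (simp add: T_def inner_add_right inner_sum_right J_orth)

lemma T_inner: "T y z \<bullet> w = a * (z \<bullet> w) + (b - a) * (\<Sum>s<3. (J s y \<bullet> z) * (J s y \<bullet> w))"
  by (simp add: T_def inner_add_left inner_sum_left)

lemma T_sym: "T y z \<bullet> w = z \<bullet> T y w"
  unfolding inner_commute[of z] T_inner by (simp add: inner_commute mult.commute)

lemma T_inj: assumes "y \<bullet> y = 1" "T y z = 0" shows "z = 0"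
proof -
  have "J s y \<bullet> z = 0" if "s < 3" for s
    using J_T[OF that assms(1), of z] assms(2) b by simp
  then show ?thesis using assms(2) a by (simp add: T_def)
qed

lemma S_T: assumes "y \<bullet> y = 1" "y \<bullet> z = 0" shows "S y (T y z) = z"
proof -
  have "(\<Sum>s<3. (J s y \<bullet> T y z) *\<^sub>R J s y) = b *\<^sub>R (\<Sum>s<3. (J s y \<bullet> z) *\<^sub>R J s y)"
    using J_T[OF _ assms(1)] by (simp add: scaleR_sum_right)
  then have "S y (T y z) = (1/a) *\<^sub>R T y z + ((1/b - 1/a) * b) *\<^sub>R (\<Sum>s<3. (J s y \<bullet> z) *\<^sub>R J s y)"
    by (simp add: S_def x_T assms)
  also have "\<dots> = z + ((b - a) / a + (1/b - 1/a) * b) *\<^sub>R (\<Sum>s<3. (J s y \<bullet> z) *\<^sub>R J s y)"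
    using a by (simp add: T_def scaleR_add_right scaleR_add_left)
  also have "(b - a) / a + (1/b - 1/a) * b = 0" using a b by (simp add: field_simps)
  finally show ?thesis by simp
qed

lemma S_orth: assumes "y \<bullet> y = 1" shows "y \<bullet> S y z = 0"
  by (simp add: S_def inner_add_right inner_sum_right inner_diff_right J_orth assms)

lemma T_S: assumes "y \<bullet> y = 1" shows "T y (S y z) = z - (y \<bullet> z) *\<^sub>R y"
proof -
  have "S y (T y (S y z)) = S y z" by (rule S_T[OF assms S_orth[OF assms]])
  have J_S: "J s y \<bullet> S y z = (1/b) * (J s y \<bullet> z)" if "s < 3" for s
    unfolding S_def inner_add_right inner_scaleR_right J_sum[OF that] inner_diff_right
    by (simp add: assms inner_commute[of "J s y" y] J_orth algebra_simps)
  have "(\<Sum>s<3. (J s y \<bullet> S y z) *\<^sub>R J s y) = (1/b) *\<^sub>R (\<Sum>s<3. (J s y \<bullet> z) *\<^sub>R J s y)"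
    using J_S by (simp add: scaleR_sum_right)
  then have "T y (S y z) = a *\<^sub>R S y z + ((b - a) * (1/b)) *\<^sub>R (\<Sum>s<3. (J s y \<bullet> z) *\<^sub>R J s y)"
    by (simp add: T_def)
  also have "\<dots> = (z - (y \<bullet> z) *\<^sub>R y) + (a * (1/b - 1/a) + (b - a) * (1/b)) *\<^sub>R (\<Sum>s<3. (J s y \<bullet> z) *\<^sub>R J s y)"
    using a by (simp add: S_def scaleR_add_right scaleR_add_left)
  also have "a * (1/b - 1/a) + (b - a) * (1/b) = 0" using a b by (simp add: field_simps)
  finally show ?thesis by simp
qed

text \<open>The coordinate vectors are tangent and linearly independent, and there are
  \<open>DIM('a) - 1\<close> of them.\<close>

lemma v_span: assumes u: "u \<in> U" and y: "x u \<bullet> y = 0"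
  shows "\<exists>c. y = (\<Sum>i\<in>UNIV. c i *\<^sub>R v i u)"
proof -
  let ?D = "frechet_derivative x (at u)"
  have lin: "linear ?D" using x_deriv[OF u] has_derivative_linear by blast
  have D: "?D w = (\<Sum>i\<in>UNIV. w $ i *\<^sub>R v i u)" for w
  proof -
    have "?D w = ?D (\<Sum>i\<in>UNIV. w $ i *\<^sub>R axis i 1)"
      using basis_expansion[of w] by (simp add: scalar_mult_eq_scaleR)
    then show ?thesis by (simp add: linear_sum[OF lin] linear_scale[OF lin] pderiv_on_def)
  qed
  have inj: "inj ?D" using immersion[OF u] linear_injective_0[OF lin] by blast
  have "dim (range ?D) = CARD('d)" using dim_image_eq[OF lin, of UNIV] inj by simp
  moreover have "x u \<noteq> 0" using unit[OF u] by auto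
  then have "dim {y. x u \<bullet> y = 0} = DIM('a) - 1" by (rule dim_hyperplane)
  moreover have "range ?D \<subseteq> {y. x u \<bullet> y = 0}" by (auto simp: D inner_sum_right x_v[OF u])
  ultimately have "range ?D = {y. x u \<bullet> y = 0}"
    using dim by (intro subspace_dim_equal) (auto intro: subspace_hyperplane linear_subspace_image[OF lin] subspace_UNIV)
  then obtain w where "y = ?D w" using y by blast
  then show ?thesis unfolding D by blast
qed

lemma g_T: "u \<in> U \<Longrightarrow> g u $ i $ j = T (x u) (v i u) \<bullet> v j u"
  by (simp add: metric T_inner)

lemma g_sym: "u \<in> U \<Longrightarrow> g u $ i $ j = g u $ j $ i"
  by (metis g_T T_sym inner_commute)

lemma det_g: assumes u: "u \<in> U" shows "det (g u) \<noteq> 0"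
proof -
  have "w = 0" if "g u *v w = 0" for w
  proof -
    let ?y = "\<Sum>j\<in>UNIV. w $ j *\<^sub>R v j u"
    have 1: "v i u \<bullet> T (x u) ?y = 0" for i
    proof -
      have "v i u \<bullet> T (x u) ?y = (g u *v w) $ i"
        by (simp add: T_sym[symmetric] inner_sum_right g_T[OF u] matrix_vector_mult_def mult.commute)
      then show ?thesis using that by simp
    qed
    have o: "x u \<bullet> ?y = 0" by (simp add: inner_sum_right x_v[OF u])
    obtain c where c: "T (x u) ?y = (\<Sum>i\<in>UNIV. c i *\<^sub>R v i u)"
      using v_span[OF u, of "T (x u) ?y"] by (auto simp: x_T o)
    have "T (x u) ?y \<bullet> T (x u) ?y = (\<Sum>i\<in>UNIV. c i * (v i u \<bullet> T (x u) ?y))"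
      by (subst c) (simp add: inner_sum_left)
    then have "T (x u) ?y = 0" using 1 by simp
    then have "?y = 0" by (rule T_inj[OF xx[OF u]])
    moreover have lin: "linear (frechet_derivative x (at u))" using x_deriv[OF u] has_derivative_linear by blast
    have "?y = frechet_derivative x (at u) (\<Sum>j\<in>UNIV. w $ j *\<^sub>R axis j 1)"
      by (simp add: linear_sum[OF lin] linear_scale[OF lin] pderiv_on_def)
    then have "?y = frechet_derivative x (at u) w"
      using basis_expansion[of w] by (simp add: scalar_mult_eq_scaleR)
    ultimately show "w = 0" using immersion[OF u] by simp
  qed
  then have "invertible (g u)"
    using matrix_left_invertible_ker invertible_left_inverse by blast
  then show ?thesis by (simp add: invertible_det_nz)
qed

abbreviation "gi \<equiv> \<lambda>u. matrix_inv (g u)"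

lemma gi_g: "u \<in> U \<Longrightarrow> (\<Sum>j\<in>UNIV. gi u $ i $ j * g u $ j $ k) = (if i = k then 1 else 0)"
  using matrix_inv_mult(1)[OF det_g, of u] by (simp add: vec_eq_iff matrix_matrix_mult_def mat_def)

lemma gi_sym: assumes u: "u \<in> U" shows "gi u $ i $ j = gi u $ j $ i"
proof -
  have "transpose (g u) = g u" using g_sym[OF u] by (simp add: transpose_def vec_eq_iff)
  then have "transpose (gi u) ** g u = mat 1"
    using matrix_inv_mult(2)[OF det_g[OF u]] by (metis matrix_transpose_mul transpose_mat)
  then have "transpose (gi u) = gi u"
    using matrix_inv_mult(2)[OF det_g[OF u]] matrix_mul_assoc[of "transpose (gi u)" "g u" "gi u"] by simp
  then show ?thesis unfolding transpose_def by (metis vec_lambda_beta)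
qed

lemma sum_gi_swap: "u \<in> U \<Longrightarrow> (\<Sum>i\<in>UNIV. \<Sum>j\<in>UNIV. gi u $ i $ j * f j i) = (\<Sum>i\<in>UNIV. \<Sum>j\<in>UNIV. gi u $ i $ j * f i j)"
  by (subst sum.swap) (simp add: gi_sym)

lemma X_T: "u \<in> U \<Longrightarrow> X i u \<bullet> T (x u) (v k u) = (if i = k then 1 else 0)"
  unfolding X_def inner_sum_left inner_scaleR_left
  by (subst gi_g[symmetric]) (auto simp: g_T T_sym)

lemma x_X: "u \<in> U \<Longrightarrow> x u \<bullet> X i u = 0"
  by (simp add: X_def inner_sum_right x_v)

text \<open>The inverse metric does not depend on the chart: as an operator on the ambient space it is
  \<open>S\<close>. All chart-dependent sums are evaluated through this formula.\<close>

lemma inverse_metric: assumes u: "u \<in> U"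
  shows "(\<Sum>i\<in>UNIV. (X i u \<bullet> y) *\<^sub>R v i u) = S (x u) y"
proof -
  obtain c where c: "S (x u) y = (\<Sum>i\<in>UNIV. c i *\<^sub>R v i u)"
    using v_span[OF u S_orth[OF xx[OF u]]] by blast
  have "y = (x u \<bullet> y) *\<^sub>R x u + T (x u) (S (x u) y)" by (simp add: T_S[OF xx[OF u]])
  also have "T (x u) (S (x u) y) = (\<Sum>k\<in>UNIV. c k *\<^sub>R T (x u) (v k u))"
    unfolding c by (simp add: linear_sum[OF linear_T] linear_scale[OF linear_T])
  finally have y: "y = (x u \<bullet> y) *\<^sub>R x u + (\<Sum>k\<in>UNIV. c k *\<^sub>R T (x u) (v k u))" .
  have "X i u \<bullet> y = c i" for i
    by (subst y) (simp add: inner_add_right inner_sum_right X_T[OF u] x_X[OF u] inner_commute[of "X i u" "x u"] if_distrib sum.delta' cong: if_cong)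
  then show ?thesis using c by simp
qed

text \<open>A trace with respect to the metric, computed in an orthonormal basis of the ambient space.\<close>

lemma contraction:
  fixes B :: "'a \<Rightarrow> 'a \<Rightarrow> 'c::real_vector"
  assumes u: "u \<in> U" and l1: "\<And>z. linear (\<lambda>y. B y z)" and l2: "\<And>y. linear (B y)"
  shows "(\<Sum>i\<in>UNIV. B (v i u) (X i u)) =
    (1/a) *\<^sub>R ((\<Sum>e\<in>Basis. B e e) - B (x u) (x u)) + (1/b - 1/a) *\<^sub>R (\<Sum>s<3. B (J s (x u)) (J s (x u)))"
proof -
  have "(\<Sum>i\<in>UNIV. B (v i u) (X i u)) = (\<Sum>i\<in>UNIV. \<Sum>e\<in>Basis. (X i u \<bullet> e) *\<^sub>R B (v i u) e)"
    by (intro sum.cong refl linear_basis_expand[OF l2])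
  also have "\<dots> = (\<Sum>e\<in>Basis. B (\<Sum>i\<in>UNIV. (X i u \<bullet> e) *\<^sub>R v i u) e)"
    by (subst sum.swap) (simp add: linear_sum[OF l1] linear_scale[OF l1])
  also have "\<dots> = (\<Sum>e\<in>Basis. B (S (x u) e) e)" by (simp add: inverse_metric[OF u])
  also have "\<dots> = (\<Sum>e\<in>Basis. (1/a) *\<^sub>R B e e - (1/a) *\<^sub>R (x u \<bullet> e) *\<^sub>R B (x u) e + (1/b - 1/a) *\<^sub>R (\<Sum>s<3. (J s (x u) \<bullet> e) *\<^sub>R B (J s (x u)) e))"
    unfolding S_def linear_add[OF l1] linear_scale[OF l1] linear_diff[OF l1] linear_sum[OF l1] scaleR_right_diff_distrib ..
  also have "\<dots> = (1/a) *\<^sub>R (\<Sum>e\<in>Basis. B e e) - (1/a) *\<^sub>R (\<Sum>e\<in>Basis. (x u \<bullet> e) *\<^sub>R B (x u) e)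
      + (1/b - 1/a) *\<^sub>R (\<Sum>s<3. \<Sum>e\<in>Basis. (J s (x u) \<bullet> e) *\<^sub>R B (J s (x u)) e)"
    unfolding sum.distrib sum_subtractf scaleR_sum_right by (simp add: sum.swap[of _ "{..<3}"])
  also have "\<dots> = (1/a) *\<^sub>R ((\<Sum>e\<in>Basis. B e e) - B (x u) (x u)) + (1/b - 1/a) *\<^sub>R (\<Sum>s<3. B (J s (x u)) (J s (x u)))"
    unfolding linear_basis_expand[OF l2, symmetric] by (simp only: scaleR_right_diff_distrib)
  finally show ?thesis .
qed

lemma trace_inverse_metric: "u \<in> U \<Longrightarrow> (\<Sum>i\<in>UNIV. v i u \<bullet> X i u) = (1/a) * (real DIM('a) - 1) + 3 * (1/b - 1/a)"
  by (subst contraction) (auto simp: xx J_isom bounded_linear.linear bounded_linear_inner_left bounded_linear_inner_right)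

lemma contraction_J: assumes "u \<in> U" shows "(\<Sum>i\<in>UNIV. J s (v i u) \<bullet> X i u) = 0"
proof -
  have l: "linear (\<lambda>y. J s y \<bullet> z)" "linear ((\<bullet>) (J s y))" for y z
    using linear_compose[OF J_linear bounded_linear.linear[OF bounded_linear_inner_left]]
    by (auto simp: o_def bounded_linear.linear bounded_linear_inner_right)
  show ?thesis
    by (subst contraction[OF assms l]) (simp add: J_orth inner_commute[of "J s _"])
qed

lemma contraction_J_J: assumes u: "u \<in> U" and s: "s < 3"
  shows "(\<Sum>i\<in>UNIV. (J s (v k u) \<bullet> v i u) * (J s (x u) \<bullet> X i u)) = 0"
proof -
  have l: "linear (\<lambda>y. (J s (v k u) \<bullet> y) * (J s (x u) \<bullet> z))" "linear (\<lambda>z. (J s (v k u) \<bullet> y) * (J s (x u) \<bullet> z))" for y z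
    by (auto intro!: linearI simp: inner_add_right algebra_simps)
  have 1: "(\<Sum>e\<in>Basis. (J s (v k u) \<bullet> e) * (J s (x u) \<bullet> e)) = 0"
    using euclidean_inner[of "J s (v k u)" "J s (x u)"] by (simp add: J_isom inner_commute[of "v k u"] x_v[OF u])
  have 2: "(\<Sum>t<3. (J s (v k u) \<bullet> J t (x u)) * (J s (x u) \<bullet> J t (x u))) = 0"
    using s by (intro sum.neutral) (auto simp: J_J_orth J_isom inner_commute[of "v k u"] x_v[OF u])
  show ?thesis by (subst contraction[OF u l]) (simp add: 1 2 J_orth inner_commute[of "J s (x u)" "x u"])
qed

lemma g_diff: assumes "u \<in> U" shows "(\<lambda>u. g u $ i $ j) differentiable (at u)"
proof -
  have bl: "bounded_linear (J s)" for s using J_linear linear_conv_bounded_linear by blast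
  have "(\<lambda>u. a * (v i u \<bullet> v j u) + (b - a) * (\<Sum>s<3. (J s (x u) \<bullet> v i u) * (J s (x u) \<bullet> v j u))) differentiable (at u)"
    by (intro differentiable_add differentiable_mult differentiable_inner' differentiable_const
        differentiable_sum differentiable_bounded_linear[OF bl] v_diff x_diff assms ballI) auto
  then show ?thesis using differentiable_cong_open[OF U assms] metric by (metis (no_types, lifting))
qed

lemma gi_diff: "u \<in> U \<Longrightarrow> (\<lambda>u. gi u $ i $ j) differentiable (at u)"
  by (rule differentiable_matrix_inv[OF U]) (auto simp: g_diff det_g)

lemma X_diff: "u \<in> U \<Longrightarrow> X i differentiable (at u)"
  unfolding X_def[abs_def] by (intro differentiable_sum differentiable_scaleR' ballI gi_diff v_diff) auto


lemma J_bounded: "bounded_linear (J s)"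
  using J_linear linear_conv_bounded_linear by blast

text \<open>The covector that the metric assigns to the coordinate vector \<open>v k u\<close>, represented by a
  vector of the ambient space.\<close>

definition "tau k u = T (x u) (v k u)"

lemma tau_diff: "u \<in> U \<Longrightarrow> tau k differentiable (at u)"
  unfolding tau_def[abs_def] T_def
  by (intro differentiable_add differentiable_scaleR' differentiable_inner' differentiable_const
        differentiable_sum differentiable_bounded_linear[OF J_bounded] v_diff x_diff ballI) auto

lemma pderiv_tau:
  assumes u: "u \<in> U"
  shows "pderiv_on i (tau k) u = a *\<^sub>R pderiv_on i (v k) u + (b - a) *\<^sub>R
    (\<Sum>s<3. (J s (v i u) \<bullet> v k u + J s (x u) \<bullet> pderiv_on i (v k) u) *\<^sub>R J s (x u) + (J s (x u) \<bullet> v k u) *\<^sub>R J s (v i u))"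
proof -
  note d = v_diff[OF u] x_diff[OF u] differentiable_bounded_linear[OF J_bounded x_diff[OF u]]
  have 1: "pderiv_on i (\<lambda>u. (J s (x u) \<bullet> v k u) *\<^sub>R J s (x u)) u =
     (J s (v i u) \<bullet> v k u + J s (x u) \<bullet> pderiv_on i (v k) u) *\<^sub>R J s (x u) + (J s (x u) \<bullet> v k u) *\<^sub>R J s (v i u)" for s
    by (subst pderiv_on_scaleR, (intro differentiable_inner' d)+,
        subst pderiv_on_inner, (intro d)+, simp add: pderiv_on_linear[OF J_bounded d(2)])
  have 2: "(\<lambda>u. (J s (x u) \<bullet> v k u) *\<^sub>R J s (x u)) differentiable (at u)" for s
    by (intro differentiable_scaleR' differentiable_inner' d)
  have 3: "(\<lambda>u. \<Sum>s<3. (J s (x u) \<bullet> v k u) *\<^sub>R J s (x u)) differentiable (at u)"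
    by (intro differentiable_sum ballI 2) auto
  have "pderiv_on i (tau k) u = pderiv_on i (\<lambda>u. a *\<^sub>R v k u) u + pderiv_on i (\<lambda>u. (b - a) *\<^sub>R (\<Sum>s<3. (J s (x u) \<bullet> v k u) *\<^sub>R J s (x u))) u"
    unfolding tau_def[abs_def] T_def
    by (intro pderiv_on_add differentiable_bounded_linear[OF bounded_linear_scaleR_right] d 3)
  also have "pderiv_on i (\<lambda>u. a *\<^sub>R v k u) u = a *\<^sub>R pderiv_on i (v k) u"
    by (rule pderiv_on_linear[OF bounded_linear_scaleR_right d(1)])
  also have "pderiv_on i (\<lambda>u. (b - a) *\<^sub>R (\<Sum>s<3. (J s (x u) \<bullet> v k u) *\<^sub>R J s (x u))) u =
      (b - a) *\<^sub>R pderiv_on i (\<lambda>u. \<Sum>s<3. (J s (x u) \<bullet> v k u) *\<^sub>R J s (x u)) u"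
    by (rule pderiv_on_linear[OF bounded_linear_scaleR_right 3])
  also have "pderiv_on i (\<lambda>u. \<Sum>s<3. (J s (x u) \<bullet> v k u) *\<^sub>R J s (x u)) u =
     (\<Sum>s<3. (J s (v i u) \<bullet> v k u + J s (x u) \<bullet> pderiv_on i (v k) u) *\<^sub>R J s (x u) + (J s (x u) \<bullet> v k u) *\<^sub>R J s (v i u))"
    by (subst pderiv_on_sum) (auto simp: 1 2)
  finally show ?thesis .
qed

text \<open>The logarithmic derivative of the square root of the determinant, by Jacobi's formula.\<close>

definition "log_deriv k u = (\<Sum>i\<in>UNIV. \<Sum>j\<in>UNIV. gi u $ i $ j * pderiv_on k (\<lambda>u. g u $ i $ j) u) / 2"

lemma pderiv_sqrt_det:
  assumes u: "u \<in> U"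
  shows "(\<lambda>u. sqrt (det (g u))) differentiable (at u)"
    and "pderiv_on k (\<lambda>u. sqrt (det (g u))) u = sqrt (det (g u)) * log_deriv k u"
proof -
  let ?g' = "\<lambda>i j. frechet_derivative (\<lambda>u. g u $ i $ j) (at u)"
  let ?D = "\<lambda>h. \<Sum>k\<in>UNIV. det (\<chi> i. if i = k then (\<chi> j. ?g' k j h) else g u $ i)"
  have d: "((\<lambda>u. det (g u)) has_derivative ?D) (at u)"
    by (rule has_derivative_det) (use g_diff[OF u] frechet_derivative_works in blast)
  have D: "?D h = (\<Sum>i\<in>UNIV. \<Sum>j\<in>UNIV. gi u $ i $ j * ?g' i j h) * det (g u)" for h
    unfolding det_replace_row[OF matrix_inv_mult(1)[OF det_g[OF u]]] sum_distrib_right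
    by (simp add: gi_sym[OF u] mult.commute)
  let ?q = "det (g u)"
  \<comment> \<open>The root of a negative number is minus the root of its absolute value, so the derivative of the root
    has a form for each sign of the determinant.\<close>
  define r where "r = (if ?q > 0 then inverse (sqrt ?q) / 2 else - inverse (sqrt ?q) / 2)"
  have nz: "?q \<noteq> 0" by (rule det_g[OF u])
  have "DERIV sqrt ?q :> r"
    by (rule DERIV_real_sqrt_generic) (use nz in \<open>auto simp: r_def\<close>)
  then have s: "(sqrt has_derivative (*) r) (at ?q)" by (simp add: has_field_derivative_def)
  have e: "((\<lambda>u. sqrt (det (g u))) has_derivative (\<lambda>h. r * ?D h)) (at u)"
    using diff_chain_at[OF d s] by (simp add: o_def)
  then show "(\<lambda>u. sqrt (det (g u))) differentiable (at u)" by (auto simp: differentiable_def)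
  have rq: "r * ?q = sqrt ?q / 2"
  proof (cases "?q > 0")
    case True
    then have "inverse (sqrt ?q) * ?q = sqrt ?q" by (simp add: field_simps real_sqrt_mult_self)
    then show ?thesis using True by (simp add: r_def)
  next
    case False
    then have "?q < 0" using nz by simp
    then have "sqrt ?q * sqrt ?q = - ?q" by (metis abs_of_neg real_sqrt_mult_self)
    then have "inverse (sqrt ?q) * ?q = - sqrt ?q" using nz by (simp add: field_simps)
    then show ?thesis using False by (simp add: r_def)
  qed
  show "pderiv_on k (\<lambda>u. sqrt (det (g u))) u = sqrt (det (g u)) * log_deriv k u"
  proof -
    have "pderiv_on k (\<lambda>u. sqrt (det (g u))) u =
        (r * ?q) * (\<Sum>i\<in>UNIV. \<Sum>j\<in>UNIV. gi u $ i $ j * ?g' i j (axis k 1))"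
      unfolding pderiv_on_eqI[OF e] D by (simp add: mult.commute mult.left_commute)
    then show ?thesis unfolding rq by (simp add: log_deriv_def pderiv_on_def)
  qed
qed

text \<open>The frames \<open>X\<close> and \<open>tau\<close> are dual to each other, so the derivatives of
  their pairings vanish.\<close>

lemma pderiv_X_T:
  assumes u: "u \<in> U"
  shows "pderiv_on l (X i) u \<bullet> tau k u = - (X i u \<bullet> pderiv_on l (tau k) u)"
proof -
  have "0 = pderiv_on l (\<lambda>u. X i u \<bullet> tau k u) u"
    using pderiv_on_cong[OF U u, of "\<lambda>u. X i u \<bullet> tau k u" "\<lambda>_. if i = k then 1 else 0"]
    by (simp add: X_T tau_def pderiv_on_const)
  also have "\<dots> = pderiv_on l (X i) u \<bullet> tau k u + X i u \<bullet> pderiv_on l (tau k) u"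
    by (rule pderiv_on_inner[OF X_diff[OF u] tau_diff[OF u]])
  finally show ?thesis by simp
qed

lemma pderiv_X_x:
  assumes u: "u \<in> U"
  shows "x u \<bullet> pderiv_on l (X i) u = - (v l u \<bullet> X i u)"
proof -
  have "0 = pderiv_on l (\<lambda>u. x u \<bullet> X i u) u"
    using pderiv_on_cong[OF U u, of "\<lambda>u. x u \<bullet> X i u" "\<lambda>_. 0"]
    by (simp add: x_X pderiv_on_const)
  also have "\<dots> = v l u \<bullet> X i u + x u \<bullet> pderiv_on l (X i) u"
    by (rule pderiv_on_inner[OF x_diff[OF u] X_diff[OF u]])
  finally show ?thesis by simp
qed

lemma g_deriv:
  assumes u: "u \<in> U"
  shows "pderiv_on k (\<lambda>u. g u $ i $ j) u = pderiv_on k (v i) u \<bullet> tau j u + v i u \<bullet> pderiv_on k (tau j) u"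
proof -
  have "pderiv_on k (\<lambda>u. g u $ i $ j) u = pderiv_on k (\<lambda>u. v i u \<bullet> tau j u) u"
    by (rule pderiv_on_cong[OF U u]) (simp add: g_T T_sym tau_def)
  then show ?thesis by (simp add: pderiv_on_inner[OF v_diff[OF u] tau_diff[OF u]])
qed

text \<open>By the product rule both sides are traces of derivatives of the chart. The terms with second
  derivatives agree because these commute, and the others are traces of bilinear forms built from
  the \<open>J s\<close>, which vanish by \<open>contraction_J\<close> and
  \<open>contraction_J_J\<close>.\<close>

lemma log_deriv_eq:
  assumes u: "u \<in> U"
  shows "log_deriv k u = (\<Sum>i\<in>UNIV. X i u \<bullet> pderiv_on i (tau k) u)"
proof -
  define c where "c = b - a"
  let ?G = "\<lambda>f. \<Sum>i\<in>UNIV. \<Sum>j\<in>UNIV. gi u $ i $ j * f i j"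
  let ?xi = "\<lambda>s. J s (x u)"
  \<comment> \<open>\<open>A\<close> and \<open>P\<close> contain the second derivatives of the chart; \<open>Q\<close>
    and \<open>R\<close> come from differentiating \<open>J s (x u)\<close> and have trace zero.\<close>
  define A where "A i j = a * (pderiv_on k (v i) u \<bullet> v j u)" for i j
  define P where "P i j = c * (\<Sum>s<3. (?xi s \<bullet> v j u) * (?xi s \<bullet> pderiv_on k (v i) u))" for i j
  define Q where "Q i j = c * (\<Sum>s<3. (J s (v k u) \<bullet> v i u) * (?xi s \<bullet> v j u))" for i j
  define R where "R i j = c * (\<Sum>s<3. (?xi s \<bullet> v k u) * (J s (v i u) \<bullet> v j u))" for i j
  have 1: "pderiv_on k (v i) u \<bullet> tau j u = A i j + P i j" for i j
    by (simp add: A_def P_def c_def tau_def T_def inner_add_right inner_sum_right inner_commute mult.commute)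
  have 2: "v i u \<bullet> pderiv_on k (tau j) u = A j i + P j i + Q j i + Q i j" for i j
    unfolding pderiv_tau[OF u] A_def P_def Q_def c_def
    by (simp add: inner_add_right inner_sum_right sum.distrib algebra_simps inner_commute[of "v i u"])
  have 3: "v j u \<bullet> pderiv_on i (tau k) u = A i j + P i j + R i j - Q i j" for i j
    unfolding pderiv_tau[OF u] v_sym[OF u, of i k] A_def P_def Q_def R_def c_def
    by (simp add: inner_add_right inner_sum_right sum.distrib algebra_simps inner_commute[of "v j u"]
        J_skew[of _ "v i u" "v k u"] inner_commute[of "v i u" "J _ (v k u)"] sum_negf sum_subtractf)
  have fG: "?G (\<lambda>i j. f i j + h i j) = ?G f + ?G h" "?G (\<lambda>i j. f i j - h i j) = ?G f - ?G h" for f h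
    by (simp_all add: algebra_simps sum.distrib sum_subtractf)
  have sw: "?G (\<lambda>i j. f j i) = ?G f" for f by (rule sum_gi_swap[OF u])
  have X: "?G (\<lambda>i j. h i (v j u)) = (\<Sum>i\<in>UNIV. h i (X i u))" if "\<And>i. linear (h i)" for h
    by (simp add: X_def linear_sum[OF that] linear_scale[OF that])
  have Q0: "?G Q = 0"
  proof -
    have "?G Q = (\<Sum>i\<in>UNIV. c * (\<Sum>s<3. (J s (v k u) \<bullet> v i u) * (?xi s \<bullet> X i u)))"
      unfolding Q_def by (rule X) (auto intro!: linearI simp: inner_add_right sum.distrib algebra_simps sum_distrib_left)
    also have "\<dots> = c * (\<Sum>s<3. \<Sum>i\<in>UNIV. (J s (v k u) \<bullet> v i u) * (?xi s \<bullet> X i u))"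
      by (subst sum.swap) (simp add: sum_distrib_left)
    finally show ?thesis by (simp add: contraction_J_J[OF u])
  qed
  have R0: "?G R = 0"
  proof -
    have "?G R = (\<Sum>i\<in>UNIV. c * (\<Sum>s<3. (?xi s \<bullet> v k u) * (J s (v i u) \<bullet> X i u)))"
      unfolding R_def by (rule X) (auto intro!: linearI simp: inner_add_right sum.distrib algebra_simps sum_distrib_left)
    also have "\<dots> = c * (\<Sum>s<3. (?xi s \<bullet> v k u) * (\<Sum>i\<in>UNIV. J s (v i u) \<bullet> X i u))"
      by (simp only: sum_distrib_left, subst sum.swap) simp
    finally show ?thesis by (simp add: contraction_J[OF u])
  qed
  have "log_deriv k u = (?G A + ?G P + (?G (\<lambda>i j. A j i) + ?G (\<lambda>i j. P j i) + ?G (\<lambda>i j. Q j i) + ?G Q)) / 2"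
    unfolding log_deriv_def g_deriv[OF u] 1 2 fG ..
  also have "\<dots> = ?G A + ?G P" unfolding sw[of A] sw[of P] sw[of Q] Q0 by simp
  also have "\<dots> = ?G (\<lambda>i j. v j u \<bullet> pderiv_on i (tau k) u)"
    unfolding 3 fG Q0 R0 by simp
  also have "\<dots> = (\<Sum>i\<in>UNIV. X i u \<bullet> pderiv_on i (tau k) u)"
    by (rule X[where h="\<lambda>i y. y \<bullet> pderiv_on i (tau k) u"]) (simp add: bounded_linear.linear bounded_linear_inner_left)
  finally show ?thesis .
qed

text \<open>The left side is minus the Laplacian of the position vector. Its tangential part vanishes by
  \<open>log_deriv_eq\<close>, and its normal part is minus the trace of the inverse metric, because
  the position vector has constant length.\<close>

lemma laplacian_position:
  assumes u: "u \<in> U"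
  shows "(\<Sum>i\<in>UNIV. pderiv_on i (X i) u + log_deriv i u *\<^sub>R X i u) =
     - ((1/a) * (real DIM('a) - 1) + 3 * (1/b - 1/a)) *\<^sub>R x u"
proof -
  let ?V = "\<Sum>i\<in>UNIV. pderiv_on i (X i) u + log_deriv i u *\<^sub>R X i u"
  let ?t = "(1/a) * (real DIM('a) - 1) + 3 * (1/b - 1/a)"
  let ?V' = "?V + ?t *\<^sub>R x u"
  have "tau k u \<bullet> ?V = 0" for k
  proof -
    have "?V \<bullet> tau k u = (\<Sum>i\<in>UNIV. - (X i u \<bullet> pderiv_on i (tau k) u)) + (\<Sum>i\<in>UNIV. if i = k then log_deriv i u else 0)"
      unfolding inner_sum_left inner_add_left sum.distrib pderiv_X_T[OF u]
      by (simp add: X_T[OF u] tau_def if_distrib cong: if_cong)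
    also have "\<dots> = 0" by (simp add: log_deriv_eq[OF u, of k] sum_negf)
    finally show ?thesis by (simp add: inner_commute)
  qed
  moreover have "tau k u \<bullet> x u = 0" for k
    using x_T[of "x u" "v k u"] by (simp add: tau_def inner_commute x_v[OF u])
  ultimately have 1: "tau k u \<bullet> ?V' = 0" for k by (simp add: inner_add_right)
  have 2: "x u \<bullet> ?V' = 0"
    unfolding inner_add_right inner_sum_right sum.distrib pderiv_X_x[OF u] sum_negf trace_inverse_metric[OF u]
    by (simp add: x_X[OF u] xx[OF u])
  obtain c where c: "T (x u) ?V' = (\<Sum>i\<in>UNIV. c i *\<^sub>R v i u)"
    using v_span[OF u, of "T (x u) ?V'"] unfolding x_T 2 by auto
  have "T (x u) ?V' \<bullet> T (x u) ?V' = (\<Sum>i\<in>UNIV. c i * (v i u \<bullet> T (x u) ?V'))"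
    by (subst c) (simp add: inner_sum_left)
  also have "\<dots> = 0" using 1 by (simp add: T_sym[symmetric] tau_def)
  finally have "?V' = 0" using T_inj[OF xx[OF u]] by simp
  then show ?thesis by (simp only: eq_neg_iff_add_eq_0 scaleR_minus_left)
qed

text \<open>By the chain rule the Laplacian of \<open>F (x u)\<close> is the trace of the Hessian of
  \<open>F\<close>, evaluated by \<open>contraction\<close>, plus the derivative of \<open>F\<close>
  along the Laplacian of the position vector.\<close>

lemma local_laplacian_eq_sphere_op:
  assumes u: "u \<in> U" and F: "Ck_on 2 (- {0}) F"
  shows "local_laplacian g (\<lambda>u. F (x u)) u = sphere_op (1/a) (1/b) J F (x u)"
proof -
  have CF: "Ck_on (Suc (Suc 0)) (- {0}) F" using F by (simp add: numeral_2_eq_2)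
  have nz: "x w \<in> - {0}" if "w \<in> U" for w using unit[OF that] by auto
  have oW: "open (- {0::'a})" by (simp add: open_Compl)
  let ?D = "\<lambda>e y. frechet_derivative F (at y) e"
  have FD: "(F has_derivative frechet_derivative F (at y)) (at y)" if "y \<in> - {0}" for y
    by (rule Ck_on_SucD(1)[OF CF that])
  have lD: "linear (frechet_derivative F (at y))" if "y \<in> - {0}" for y
    using FD[OF that] has_derivative_linear by blast
  have DD: "(?D e has_derivative frechet_derivative (?D e) (at y)) (at y)" if "y \<in> - {0}" for e y
    by (rule Ck_on_SucD(1)[OF Ck_on_SucD(2)[OF CF] that])
  have dF: "pderiv_on j (\<lambda>u. F (x u)) w = frechet_derivative F (at (x w)) (v j w)" if w: "w \<in> U" for w j
    using pderiv_on_eqI[OF diff_chain_at[OF x_deriv[OF w] FD[OF nz[OF w]]], of j] by (simp add: o_def pderiv_on_def)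
  have dD: "((\<lambda>u. ?D e (x u)) has_derivative (\<lambda>h. frechet_derivative (?D e) (at (x w)) (frechet_derivative x (at w) h))) (at w)"
    if w: "w \<in> U" for w e
    using diff_chain_at[OF x_deriv[OF w] DD[OF nz[OF w]]] by (simp add: o_def)
  define Phi where "Phi i w = (\<Sum>e\<in>Basis. (X i w \<bullet> e) *\<^sub>R ?D e (x w))" for i w
  have Phi: "(\<Sum>j\<in>UNIV. gi w $ i $ j *\<^sub>R pderiv_on j (\<lambda>u. F (x u)) w) = Phi i w" if w: "w \<in> U" for i w
  proof -
    have "(\<Sum>j\<in>UNIV. gi w $ i $ j *\<^sub>R pderiv_on j (\<lambda>u. F (x u)) w) = frechet_derivative F (at (x w)) (X i w)"
      by (simp add: dF[OF w] X_def linear_sum[OF lD[OF nz[OF w]]] linear_scale[OF lD[OF nz[OF w]]])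
    also have "\<dots> = Phi i w" unfolding Phi_def by (rule linear_basis_expand[OF lD[OF nz[OF w]]])
    finally show ?thesis .
  qed
  have de: "(\<lambda>u. ?D e (x u)) differentiable (at u)" for e using dD[OF u] by (auto simp: differentiable_def)
  have dXe: "(\<lambda>u. X i u \<bullet> e) differentiable (at u)" for i e
    by (rule differentiable_bounded_linear[OF bounded_linear_inner_left X_diff[OF u]])
  have Phi_diff: "Phi i differentiable (at u)" for i
    unfolding Phi_def[abs_def] by (intro differentiable_sum ballI differentiable_scaleR' de dXe) auto
  have dPhi: "pderiv_on i (Phi i) u = (\<Sum>e\<in>Basis. (pderiv_on i (X i) u \<bullet> e) *\<^sub>R ?D e (x u)) + hess F (x u) (v i u) (X i u)" for i
  proof -
    have "pderiv_on i (Phi i) u = (\<Sum>e\<in>Basis. pderiv_on i (\<lambda>u. (X i u \<bullet> e) *\<^sub>R ?D e (x u)) u)"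
      unfolding Phi_def[abs_def] by (rule pderiv_on_sum) (intro differentiable_scaleR' de dXe)
    also have "\<dots> = (\<Sum>e\<in>Basis. (pderiv_on i (X i) u \<bullet> e) *\<^sub>R ?D e (x u) + (X i u \<bullet> e) *\<^sub>R frechet_derivative (?D e) (at (x u)) (v i u))"
      by (intro sum.cong refl, subst pderiv_on_scaleR[OF dXe de])
        (simp add: pderiv_on_linear[OF bounded_linear_inner_left X_diff[OF u]] pderiv_on_eqI[OF dD[OF u]], simp add: pderiv_on_def)
    finally show ?thesis by (simp add: sum.distrib hess_def)
  qed
  let ?s = "\<lambda>w. sqrt (det (g w))"
  have "pderiv_on i (\<lambda>w. ?s w *\<^sub>R (\<Sum>j\<in>UNIV. gi w $ i $ j *\<^sub>R pderiv_on j (\<lambda>u. F (x u)) w)) u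
     = ?s u *\<^sub>R (log_deriv i u *\<^sub>R Phi i u + pderiv_on i (Phi i) u)" for i
  proof -
    have "pderiv_on i (\<lambda>w. ?s w *\<^sub>R (\<Sum>j\<in>UNIV. gi w $ i $ j *\<^sub>R pderiv_on j (\<lambda>u. F (x u)) w)) u = pderiv_on i (\<lambda>w. ?s w *\<^sub>R Phi i w) u"
      by (rule pderiv_on_cong[OF U u]) (simp add: Phi)
    also have "\<dots> = pderiv_on i ?s u *\<^sub>R Phi i u + ?s u *\<^sub>R pderiv_on i (Phi i) u"
      by (rule pderiv_on_scaleR[OF pderiv_sqrt_det(1)[OF u] Phi_diff])
    finally show ?thesis unfolding pderiv_sqrt_det(2)[OF u] by (simp add: scaleR_add_right)
  qed
  then have "local_laplacian g (\<lambda>u. F (x u)) u = - (\<Sum>i\<in>UNIV. log_deriv i u *\<^sub>R Phi i u + pderiv_on i (Phi i) u)"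
    using det_g[OF u] by (simp add: local_laplacian_def scaleR_sum_right[symmetric])
  also have "(\<Sum>i\<in>UNIV. log_deriv i u *\<^sub>R Phi i u + pderiv_on i (Phi i) u) =
     (\<Sum>i\<in>UNIV. log_deriv i u *\<^sub>R frechet_derivative F (at (x u)) (X i u) + frechet_derivative F (at (x u)) (pderiv_on i (X i) u))
     + (\<Sum>i\<in>UNIV. hess F (x u) (v i u) (X i u))"
    unfolding dPhi linear_basis_expand[OF lD[OF nz[OF u]], symmetric] Phi_def by (simp add: sum.distrib)
  also have "(\<Sum>i\<in>UNIV. log_deriv i u *\<^sub>R frechet_derivative F (at (x u)) (X i u) + frechet_derivative F (at (x u)) (pderiv_on i (X i) u))
     = frechet_derivative F (at (x u)) (\<Sum>i\<in>UNIV. pderiv_on i (X i) u + log_deriv i u *\<^sub>R X i u)"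
    by (simp add: linear_sum[OF lD[OF nz[OF u]]] linear_add[OF lD[OF nz[OF u]]] linear_scale[OF lD[OF nz[OF u]]] add.commute)
  also have "\<dots> = - ((1/a) * (real DIM('a) - 1) + 3 * (1/b - 1/a)) *\<^sub>R frechet_derivative F (at (x u)) (x u)"
    unfolding laplacian_position[OF u] linear_scale[OF lD[OF nz[OF u]]] ..
  also have "(\<Sum>i\<in>UNIV. hess F (x u) (v i u) (X i u)) =
     (1/a) *\<^sub>R ((\<Sum>e\<in>Basis. hess F (x u) e e) - hess F (x u) (x u) (x u)) + (1/b - 1/a) *\<^sub>R (\<Sum>s<3. hess F (x u) (J s (x u)) (J s (x u)))"
    by (rule contraction[OF u hess_linear[OF F nz[OF u]]])
  finally show ?thesis
    unfolding sphere_op_eq_hess[OF oW nz[OF u] F unit[OF u]] by (simp add: scaleR_conv_of_real algebra_simps)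
qed

end

section \<open>The quaternionic structure of the defining representation\<close>

type_synonym 'n cvec = "complex^('n + 'n)"

text \<open>A quaternionic coordinate occupies the two complex coordinates \<open>Inl a\<close> and
  \<open>Inr a\<close>. The matrix \<open>symp_form\<close> exchanges them (\<open>swp\<close>) up
  to a sign (\<open>sg\<close>).\<close>

definition swp :: "'n + 'n \<Rightarrow> 'n + 'n" where
  "swp i = (case i of Inl a \<Rightarrow> Inr a | Inr a \<Rightarrow> Inl a)"

definition sg :: "'n + 'n \<Rightarrow> complex" where
  "sg i = (case i of Inl a \<Rightarrow> -1 | Inr a \<Rightarrow> 1)"

lemma swp_simps [simp]: "swp (Inl a) = Inr a" "swp (Inr a) = Inl a" "swp (swp i) = i"
  and sg_simps [simp]: "sg (Inl a) = -1" "sg (Inr a) = 1" "sg (swp i) = - sg i" "sg i * sg i = 1" "cnj (sg i) = sg i"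
  and qindex_swp [simp]: "qindex (swp i) = qindex i" "qindex (Inl a) = a" "qindex (Inr a) = a"
  by (cases i; simp add: swp_def sg_def qindex_def)+

lemma sg_cases: "sg i = 1 \<or> sg i = -1" by (cases i) auto

lemma bij_swp: "bij swp" by (rule o_bij[of swp]) (auto simp: fun_eq_iff)

lemma sum_swp: "(\<Sum>i\<in>UNIV. f (swp i)) = (\<Sum>i\<in>UNIV. f i)"
  by (rule sum.reindex_bij_betw[OF bij_swp])

lemma sum_UNIV_Plus: "(\<Sum>i\<in>(UNIV :: ('n::finite + 'n) set). f i) = (\<Sum>a\<in>UNIV. f (Inl a)) + (\<Sum>a\<in>UNIV. f (Inr a))"
  by (subst UNIV_Plus_UNIV[symmetric], subst sum.Plus) auto

text \<open>Conjugation of the entries followed by \<open>symp_form\<close>, an antilinear map of square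
  \<open>-1\<close>. It commutes with the symplectic group and makes the complex vector space
  quaternionic.\<close>

definition quat_j :: "('n::finite) cvec \<Rightarrow> 'n cvec" where
  "quat_j x = (\<chi> i. sg i * cnj (x $ swp i))"

definition qunit :: "nat \<Rightarrow> ('n::finite) cvec \<Rightarrow> 'n cvec" where
  "qunit s x = (if s = 0 then \<i> *s x else if s = 1 then quat_j x else \<i> *s quat_j x)"

lemma inner_cvec: "x \<bullet> y = (\<Sum>i\<in>UNIV. Re (x $ i * cnj (y $ i)))" for x y :: "complex^'i::finite"
  by (simp add: inner_vec_def inner_complex_def)

lemma quat_j_nth: "quat_j x $ i = sg i * cnj (x $ swp i)"
  by (simp add: quat_j_def)

lemma quat_j_twice [simp]: "quat_j (quat_j x) = - x"
  by (simp add: vec_eq_iff quat_j_nth)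

lemma quat_j_scale: "quat_j (c *s x) = cnj c *s quat_j x"
  by (simp add: vec_eq_iff quat_j_nth)

lemma quat_j_skew: "quat_j x \<bullet> y = - (x \<bullet> quat_j y)"
proof -
  have "quat_j x \<bullet> y = (\<Sum>i\<in>UNIV. Re (sg i * cnj (x $ swp i) * cnj (y $ i)))"
    by (simp add: inner_cvec quat_j_nth)
  also have "\<dots> = (\<Sum>i\<in>UNIV. Re (sg (swp i) * cnj (x $ swp (swp i)) * cnj (y $ swp i)))"
    by (rule sum_swp[symmetric])
  also have "\<dots> = (\<Sum>i\<in>UNIV. - Re (x $ i * cnj (sg i * cnj (y $ swp i))))"
  proof (intro sum.cong refl)
    fix i show "Re (sg (swp i) * cnj (x $ swp (swp i)) * cnj (y $ swp i)) = - Re (x $ i * cnj (sg i * cnj (y $ swp i)))"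
      using sg_cases[of i] by auto
  qed
  finally show ?thesis by (simp only: sum_negf inner_cvec[of x] quat_j_nth)
qed

lemma ii_skew: "(\<i> *s x) \<bullet> y = - (x \<bullet> (\<i> *s y))" for x :: "complex^'i::finite"
  by (simp add: inner_cvec sum_negf algebra_simps flip: sum_negf)

global_interpretation quat: quaternionic "qunit :: nat \<Rightarrow> ('n::finite) cvec \<Rightarrow> 'n cvec"
proof (rule quaternionic.intro)
  fix s t :: nat and x y :: "'n cvec"
  show "linear (qunit s :: 'n cvec \<Rightarrow> 'n cvec)"
    by (rule linearI) (auto simp: qunit_def vec_eq_iff quat_j_nth algebra_simps)
  show "qunit s x \<bullet> y = - (x \<bullet> qunit s y)"
    by (auto simp: qunit_def quat_j_skew ii_skew quat_j_scale)
  show "qunit s (qunit s x) = - x"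
    by (auto simp: qunit_def quat_j_scale)
  show "qunit s (qunit t x) = - qunit t (qunit s x)" if "s < 3" "t < 3" "s \<noteq> t"
    using that by (auto simp: qunit_def quat_j_scale numeral_3_eq_3 less_Suc_eq)
qed

lemma sum_lt3: "(\<Sum>s<3. f s) = f 0 + f 1 + f (2::nat)"
  by (simp add: numeral_3_eq_3 numeral_2_eq_2)

section \<open>The symplectic group acting on vectors\<close>

lemma symp_form_nth: "symp_form $ i $ j = (if j = swp i then sg i else 0)"
  by (cases i; cases j) (auto simp: symp_form_def)

lemma sp_on_iff:
  "X \<in> sp_on N \<longleftrightarrow> (\<forall>i j. cnj (X $ j $ i) = - X $ i $ j) \<and> (\<forall>i j. sg i * X $ swp i $ j = sg j * X $ swp j $ i)
     \<and> (\<forall>i j. \<not> (qindex i \<in> N \<and> qindex j \<in> N) \<longrightarrow> X $ i $ j = 0)"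
proof -
  have 1: "(transpose X ** symp_form) $ i $ j = - sg j * X $ swp j $ i" for i j
  proof -
    have "j = swp k \<longleftrightarrow> k = swp j" for k by (metis swp_simps(3))
    then have "(transpose X ** symp_form) $ i $ j = (\<Sum>k\<in>UNIV. if k = swp j then X $ k $ i * sg k else 0)"
      unfolding matrix_matrix_mult_def transpose_def vec_lambda_beta symp_form_nth by (intro sum.cong) auto
    then show ?thesis by simp
  qed
  have 2: "(symp_form ** X) $ i $ j = sg i * X $ swp i $ j" for i j
    by (simp add: matrix_matrix_mult_def symp_form_nth if_distrib if_distribR sum.delta cong: if_cong)
  have "transpose X ** symp_form + symp_form ** X = 0 \<longleftrightarrow> (\<forall>i j. sg i * X $ swp i $ j = sg j * X $ swp j $ i)"
    unfolding vec_eq_iff by (simp add: 1 2)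
  then show ?thesis by (auto simp: sp_on_def ctranspose_def vec_eq_iff)
qed

lemma sp_quat:
  assumes "X \<in> sp_on N"
  shows "X $ swp i $ swp j = sg i * sg j * cnj (X $ i $ j)"
proof -
  have "sg i * X $ swp i $ swp j = sg (swp j) * X $ swp (swp j) $ i" using assms unfolding sp_on_iff by blast
  also have "\<dots> = sg j * cnj (X $ i $ j)"
    using assms unfolding sp_on_iff by simp
  finally have "sg i * (sg i * X $ swp i $ swp j) = sg i * (sg j * cnj (X $ i $ j))" by simp
  then show ?thesis by (simp add: mult.assoc[symmetric])
qed

lemma ctranspose_mult_vec: "(ctranspose A *v x) \<bullet> y = x \<bullet> (A *v y)" for A :: "complex^'m::finite^'k::finite"
proof -
  have "(ctranspose A *v x) \<bullet> y = (\<Sum>i\<in>UNIV. \<Sum>j\<in>UNIV. Re (cnj (A $ j $ i) * x $ j * cnj (y $ i)))"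
    by (simp add: inner_cvec ctranspose_def matrix_vector_mult_def sum_distrib_right)
  also have "\<dots> = (\<Sum>j\<in>UNIV. \<Sum>i\<in>UNIV. Re (x $ j * cnj (A $ j $ i * y $ i)))"
    by (subst sum.swap) (simp add: mult_ac)
  also have "\<dots> = x \<bullet> (A *v y)"
    by (simp add: inner_cvec matrix_vector_mult_def sum_distrib_left)
  finally show ?thesis .
qed

lemma Sp_unitary:
  assumes "A \<in> Sp_on N"
  shows "ctranspose A ** A = mat 1" "A ** ctranspose A = mat 1" "matrix_inv A = ctranspose A"
proof -
  show 1: "ctranspose A ** A = mat 1" using assms by (simp add: Sp_on_def)
  then show 2: "A ** ctranspose A = mat 1" using matrix_left_right_inverse by blast
  have "invertible A" using 1 2 by (auto simp: invertible_def)
  then have "matrix_inv A ** A = mat 1" by (auto simp: invertible_def matrix_inv_def intro: someI2)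
  then have "matrix_inv A ** A ** ctranspose A = ctranspose A" by simp
  then show "matrix_inv A = ctranspose A" using 2 by (simp add: matrix_mul_assoc[symmetric])
qed

lemma Sp_inner: "A \<in> Sp_on N \<Longrightarrow> (A *v x) \<bullet> (A *v y) = x \<bullet> y"
  by (subst ctranspose_mult_vec[symmetric]) (simp add: matrix_vector_mul_assoc Sp_unitary)

lemma Sp_norm: "A \<in> Sp_on N \<Longrightarrow> norm (A *v x) = norm x"
  by (simp add: norm_eq_sqrt_inner Sp_inner)

lemma symp_form_mult_vec: "(symp_form *v x) $ i = sg i * x $ swp i"
  by (simp add: matrix_vector_mult_def symp_form_nth if_distrib if_distribR sum.delta cong: if_cong)

text \<open>For a unitary matrix, \<open>transpose A ** symp_form ** A = symp_form\<close> says that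
  \<open>symp_form\<close> intertwines \<open>A\<close> with its complex conjugate. Hence
  \<open>Sp(n)\<close> consists of the norm-preserving quaternion-linear maps.\<close>

lemma quat_j_matrix:
  fixes A :: "('n::finite) cmat"
  assumes "ctranspose A ** A = mat 1"
  shows "transpose A ** symp_form ** A = symp_form \<longleftrightarrow> (\<forall>x. A *v quat_j x = quat_j (A *v x))"
proof -
  define C where "C = (\<chi> i j. cnj (A $ i $ j))"
  have AC: "ctranspose A = transpose C" by (simp add: C_def ctranspose_def transpose_def)
  have "ctranspose C ** C = mat 1"
  proof -
    have "(ctranspose C ** C) $ i $ j = cnj ((ctranspose A ** A) $ i $ j)" for i j
      by (simp add: C_def ctranspose_def matrix_matrix_mult_def)
    then show ?thesis unfolding assms by (simp add: vec_eq_iff mat_def)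
  qed
  moreover have CA: "ctranspose C = transpose A" by (simp add: C_def ctranspose_def transpose_def)
  ultimately have AtC: "transpose A ** C = mat 1" by simp
  then have CAt: "C ** transpose A = mat 1" by (rule matrix_left_right_inverse[THEN iffD1])
  have 1: "transpose A ** symp_form ** A = symp_form \<longleftrightarrow> symp_form ** A = C ** symp_form"
  proof
    assume "transpose A ** symp_form ** A = symp_form"
    then have "C ** (transpose A ** symp_form ** A) = C ** symp_form" by simp
    then show "symp_form ** A = C ** symp_form" by (simp add: matrix_mul_assoc CAt)
  next
    assume "symp_form ** A = C ** symp_form"
    then have "transpose A ** (symp_form ** A) = transpose A ** (C ** symp_form)" by simp
    then show "transpose A ** symp_form ** A = symp_form" by (simp add: matrix_mul_assoc AtC)
  qed
  have q: "quat_j x = symp_form *v (\<chi> i. cnj (x $ i))" for x :: "'n cvec"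
    by (simp add: vec_eq_iff quat_j_nth symp_form_mult_vec)
  have c: "(\<chi> i. cnj ((A *v x) $ i)) = C *v (\<chi> i. cnj (x $ i))" for x
    by (simp add: vec_eq_iff C_def matrix_vector_mult_def)
  have s2: "symp_form *v (symp_form *v y) = - y" for y :: "'n cvec"
    by (simp add: vec_eq_iff symp_form_mult_vec mult.assoc[symmetric])
  have "symp_form ** A = C ** symp_form \<longleftrightarrow> (\<forall>y. symp_form *v (A *v y) = C *v (symp_form *v y))"
    by (simp add: matrix_eq matrix_vector_mul_assoc)
  also have "\<dots> \<longleftrightarrow> (\<forall>x. A *v quat_j x = quat_j (A *v x))"
  proof
    assume h: "\<forall>y. symp_form *v (A *v y) = C *v (symp_form *v y)"
    show "\<forall>x. A *v quat_j x = quat_j (A *v x)"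
    proof
      fix x :: "'n cvec"
      let ?y = "\<chi> i. cnj (x $ i)"
      have "symp_form *v (A *v quat_j x) = C *v (- ?y)" unfolding q h[rule_format] s2 ..
      also have "\<dots> = symp_form *v (quat_j (A *v x))" unfolding q c s2 by (simp add: vec_eq_iff matrix_vector_mult_def sum_negf)
      finally have "symp_form *v (symp_form *v (A *v quat_j x)) = symp_form *v (symp_form *v (quat_j (A *v x)))" by simp
      then show "A *v quat_j x = quat_j (A *v x)" by (simp add: s2)
    qed
  next
    assume h: "\<forall>x. A *v quat_j x = quat_j (A *v x)"
    show "\<forall>y. symp_form *v (A *v y) = C *v (symp_form *v y)"
    proof
      fix y :: "'n cvec"
      let ?x = "\<chi> i. cnj ((symp_form *v y) $ i)"
      have cc: "(\<chi> i. cnj (?x $ i)) = symp_form *v y" by (simp add: vec_eq_iff)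
      have "A *v quat_j ?x = symp_form *v (C *v (symp_form *v y))"
        unfolding h[rule_format] unfolding q[of "A *v ?x"] c cc ..
      moreover have "quat_j ?x = - y" unfolding q cc s2 ..
      ultimately have "symp_form *v (A *v (- y)) = symp_form *v (symp_form *v (C *v (symp_form *v y)))" by simp
      then show "symp_form *v (A *v y) = C *v (symp_form *v y)"
        unfolding s2 by (simp add: vec_eq_iff matrix_vector_mult_def sum_negf)
    qed
  qed
  finally show ?thesis unfolding 1 .
qed

lemma Sp_quat_j: "A \<in> Sp_on N \<Longrightarrow> A *v quat_j x = quat_j (A *v x)"
  using quat_j_matrix[of A] by (auto simp: Sp_on_def)

lemma Sp_qunit: "A \<in> Sp_on N \<Longrightarrow> A *v qunit s x = qunit s (A *v x)"
  by (auto simp: qunit_def Sp_quat_j vector_scalar_commute)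

lemma unitary_of_norm:
  fixes A :: "complex^'m::finite^'m"
  assumes "\<And>x. norm (A *v x) = norm x"
  shows "ctranspose A ** A = mat 1"
proof -
  have sq: "(A *v x) \<bullet> (A *v x) = x \<bullet> x" for x using assms[of x] by (simp add: norm_eq_sqrt_inner)
  have "(A *v x) \<bullet> (A *v y) = x \<bullet> y" for x y
    using sq[of "x + y"] sq[of x] sq[of y]
    by (simp add: matrix_vector_right_distrib inner_add_left inner_add_right inner_commute)
  then have "((ctranspose A ** A) *v x - x) \<bullet> y = 0" for x y
    by (simp add: matrix_vector_mul_assoc[symmetric] ctranspose_mult_vec inner_diff_left)
  then have "(ctranspose A ** A) *v x = mat 1 *v x" for x
    by (metis inner_eq_zero_iff eq_iff_diff_eq_0 matrix_vector_mul_lid)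
  then show ?thesis by (simp add: matrix_eq)
qed

lemma SpI:
  assumes "\<And>x. norm (A *v x) = norm x" "\<And>x. A *v quat_j x = quat_j (A *v x)"
  shows "A \<in> Sp_on UNIV"
  using unitary_of_norm[OF assms(1)] quat_j_matrix[of A] assms(2) by (simp add: Sp_on_def)

lemma Sp_mult: "A \<in> Sp_on UNIV \<Longrightarrow> B \<in> Sp_on UNIV \<Longrightarrow> A ** B \<in> Sp_on UNIV"
  by (rule SpI) (simp_all add: matrix_vector_mul_assoc[symmetric] Sp_norm Sp_quat_j)

lemma Sp_one: "mat 1 \<in> Sp_on UNIV"
  by (rule SpI) simp_all

lemma Sp_minus: "A \<in> Sp_on UNIV \<Longrightarrow> - A \<in> Sp_on UNIV"
proof (rule SpI)
  fix x assume A: "A \<in> Sp_on UNIV"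
  have m: "- A *v y = - (A *v y)" for y by (simp add: vec_eq_iff matrix_vector_mult_def sum_negf)
  show "norm (- A *v x) = norm x" using Sp_norm[OF A] by (simp add: m)
  show "- A *v quat_j x = quat_j (- A *v x)" unfolding m Sp_quat_j[OF A] by (simp add: vec_eq_iff quat_j_nth)
qed

lemma Sp_ctranspose: assumes "A \<in> Sp_on UNIV" shows "ctranspose A \<in> Sp_on UNIV"
proof (rule SpI)
  fix x
  have x: "x = A *v (ctranspose A *v x)" by (simp add: matrix_vector_mul_assoc Sp_unitary[OF assms])
  show "norm (ctranspose A *v x) = norm x" by (subst (2) x) (rule Sp_norm[OF assms, symmetric])
  have "A *v (ctranspose A *v quat_j x) = A *v (quat_j (ctranspose A *v x))"
    by (simp add: Sp_quat_j[OF assms] matrix_vector_mul_assoc Sp_unitary[OF assms])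
  then have "ctranspose A *v (A *v (ctranspose A *v quat_j x)) = ctranspose A *v (A *v (quat_j (ctranspose A *v x)))" by simp
  then show "ctranspose A *v quat_j x = quat_j (ctranspose A *v x)"
    by (simp add: matrix_vector_mul_assoc Sp_unitary[OF assms])
qed

section \<open>Isotropy groups and cosets\<close>

definition base :: "'n::finite \<Rightarrow> 'n cvec" where "base e = axis (Inl e) 1"

lemma base_nth: "base e $ i = (if i = Inl e then 1 else 0)"
  by (simp add: base_def axis_def)

lemma norm_base [simp]: "norm (base e) = 1"
  by (simp add: base_def norm_axis_1)

lemma mult_base: "(A *v base e) $ i = A $ i $ Inl e"
  by (simp add: matrix_vector_mult_def base_nth if_distrib sum.delta cong: if_cong)

lemma mult_quat_j_base: "(A *v quat_j (base e)) $ i = A $ i $ Inr e"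
proof -
  have q: "quat_j (base e) $ j = (if j = Inr e then 1 else 0)" for j
    by (cases j) (auto simp: quat_j_nth base_nth)
  show ?thesis by (simp add: matrix_vector_mult_def q if_distrib sum.delta cong: if_cong)
qed

text \<open>The columns \<open>Inl e\<close> and \<open>Inr e\<close> of a matrix commuting with
  \<open>quat_j\<close> determine each other, and the rows follow from the columns of the inverse
  matrix.\<close>

lemma Sp_on_complement: "Sp_on (- {e}) = {A \<in> Sp_on UNIV. A *v base e = base e}"
proof (intro equalityI subsetI)
  fix A assume A: "A \<in> Sp_on (- {e})"
  then have "A \<in> Sp_on UNIV" by (simp add: Sp_on_def)
  moreover have "A $ i $ Inl e = mat 1 $ i $ Inl e" for i using A by (simp add: Sp_on_def)
  then have "A *v base e = base e" by (simp add: vec_eq_iff mult_base mat_def base_nth)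
  ultimately show "A \<in> {A \<in> Sp_on UNIV. A *v base e = base e}" by simp
next
  fix A assume "A \<in> {A \<in> Sp_on UNIV. A *v base e = base e}"
  then have A: "A \<in> Sp_on UNIV" and Ae: "A *v base e = base e" by auto
  have col: "B $ i $ j = mat 1 $ i $ j" if B: "B \<in> Sp_on UNIV" "B *v base e = base e" and j: "qindex j = e" for B i j
  proof (cases j)
    case (Inl a)
    then show ?thesis using mult_base[of B e i] B(2) j by (simp add: mat_def base_nth)
  next
    case (Inr a)
    then have "B $ i $ j = quat_j (base e) $ i" using mult_quat_j_base[of B e i] Sp_quat_j[OF B(1), of "base e"] B(2) j by simp
    then show ?thesis using Inr j by (cases i) (auto simp: mat_def quat_j_nth base_nth)
  qed
  have "ctranspose A *v base e = base e"
    using Ae Sp_unitary(1)[OF A] by (metis matrix_vector_mul_assoc matrix_vector_mul_lid)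
  from col[OF Sp_ctranspose[OF A] this] have row: "cnj (A $ j $ i) = mat 1 $ i $ j" if "qindex j = e" for i j
    using that by (simp add: ctranspose_def)
  have "A $ j $ i = mat 1 $ j $ i" if "qindex j = e" for i j
    using row[OF that, of i] by (auto simp: mat_def complex_eq_iff split: if_splits)
  then show "A \<in> Sp_on (- {e})" using A col[OF A Ae] by (auto simp: Sp_on_def)
qed

text \<open>With \<open>G = {1}\<close> and \<open>G = {1, -1}\<close> this covers both isotropy groups at once.\<close>

definition isotropy :: "complex set \<Rightarrow> 'n::finite \<Rightarrow> 'n cmat set" where
  "isotropy G e = {A \<in> Sp_on UNIV. \<exists>c\<in>G. A *v base e = c *s base e}"

lemma isotropy_sphere_eq: "isotropy_sphere e = isotropy {1} e"
  by (simp add: isotropy_sphere_def isotropy_def Sp_on_complement)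

lemma minus_one_Sp1: "minus_one_Sp1 e \<in> Sp_on UNIV" "minus_one_Sp1 e *v base e = - base e"
  "minus_one_Sp1 e ** minus_one_Sp1 e = mat 1"
proof -
  have v: "(minus_one_Sp1 e *v x) $ i = (if qindex i = e then - x $ i else x $ i)" for x i
  proof -
    have "(minus_one_Sp1 e *v x) $ i = (\<Sum>j\<in>UNIV. if j = i then (if qindex i = e then - x $ i else x $ i) else 0)"
      unfolding matrix_vector_mult_def minus_one_Sp1_def vec_lambda_beta by (intro sum.cong) auto
    then show ?thesis by simp
  qed
  show "minus_one_Sp1 e \<in> Sp_on UNIV"
  proof (rule SpI)
    fix x :: "'a cvec"
    have "norm ((minus_one_Sp1 e *v x) $ i) = norm (x $ i)" for i by (simp add: v)
    then show "norm (minus_one_Sp1 e *v x) = norm x" by (simp add: norm_vec_def)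
    show "minus_one_Sp1 e *v quat_j x = quat_j (minus_one_Sp1 e *v x)"
      by (simp add: vec_eq_iff v quat_j_nth)
  qed
  show "minus_one_Sp1 e *v base e = - base e" by (simp add: vec_eq_iff v base_nth)
  show "minus_one_Sp1 e ** minus_one_Sp1 e = mat 1"
    by (simp add: matrix_eq matrix_vector_mul_assoc[symmetric] vec_eq_iff v)
qed

lemma isotropy_projective_eq: "isotropy_projective e = isotropy {1, -1} e"
proof (intro equalityI subsetI)
  fix A assume "A \<in> isotropy_projective e"
  then obtain k z where A: "A = k ** z" and k: "k \<in> Sp_on UNIV" "k *v base e = base e" and z: "z = mat 1 \<or> z = minus_one_Sp1 e"
    by (auto simp: isotropy_projective_def Sp_on_complement)
  have "A \<in> Sp_on UNIV" unfolding A using z k(1) minus_one_Sp1(1)[of e] by (auto intro: Sp_mult Sp_one)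
  moreover have "k *v (- base e) = - base e" using k(2) by (simp add: vec_eq_iff matrix_vector_mult_def sum_negf)
  then have "A *v base e = base e \<or> A *v base e = - base e"
    unfolding A matrix_vector_mul_assoc[symmetric] using z k minus_one_Sp1(2)[of e] by auto
  ultimately show "A \<in> isotropy {1, -1} e" by (auto simp: isotropy_def)
next
  fix A assume "A \<in> isotropy {1, -1} e"
  then have A: "A \<in> Sp_on UNIV" and c: "A *v base e = base e \<or> A *v base e = - base e"
    by (auto simp: isotropy_def)
  from c show "A \<in> isotropy_projective e"
  proof
    assume "A *v base e = base e"
    then show ?thesis unfolding isotropy_projective_def Sp_on_complement using A by (force intro: exI[of _ A] exI[of _ "mat 1"])
  next
    assume h: "A *v base e = - base e"
    let ?k = "A ** minus_one_Sp1 e"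
    have "A = ?k ** minus_one_Sp1 e" by (simp add: matrix_mul_assoc[symmetric] minus_one_Sp1(3))
    moreover have "?k \<in> Sp_on UNIV" by (rule Sp_mult[OF A minus_one_Sp1(1)])
    moreover have "A *v (- base e) = base e" using h by (simp add: vec_eq_iff matrix_vector_mult_def sum_negf)
    then have "?k *v base e = base e" by (simp add: matrix_vector_mul_assoc[symmetric] minus_one_Sp1(2))
    ultimately show ?thesis unfolding isotropy_projective_def Sp_on_complement by blast
  qed
qed

text \<open>The orbit map \<open>A \<mapsto> A *v base e\<close> is well defined and injective on the
  homogeneous space, up to the signs in \<open>G\<close>.\<close>

lemma lcoset_eq_iff:
  assumes G: "G = {1} \<or> G = {1, -1}" and A: "A \<in> Sp_on UNIV" and B: "B \<in> Sp_on UNIV"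
  shows "lcoset (isotropy G e) A = lcoset (isotropy G e) B \<longleftrightarrow> (\<exists>c\<in>G. A *v base e = c *s (B *v base e))"
proof
  have one: "mat 1 \<in> isotropy G e" using G by (auto simp: isotropy_def Sp_one)
  {
    assume "lcoset (isotropy G e) A = lcoset (isotropy G e) B"
    moreover have "A \<in> lcoset (isotropy G e) A" unfolding lcoset_def using one by (metis image_eqI matrix_mul_rid)
    ultimately obtain k where k: "k \<in> isotropy G e" "A = B ** k" unfolding lcoset_def by auto
    then obtain c where "c \<in> G" "k *v base e = c *s base e" by (auto simp: isotropy_def)
    then show "\<exists>c\<in>G. A *v base e = c *s (B *v base e)"
      unfolding k by (auto simp: matrix_vector_mul_assoc[symmetric] vector_scalar_commute intro!: bexI[of _ c])
  }
  have sub: "lcoset (isotropy G e) A \<subseteq> lcoset (isotropy G e) B"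
    if A: "A \<in> Sp_on UNIV" and B: "B \<in> Sp_on UNIV" and c: "c \<in> G" "A *v base e = c *s (B *v base e)" for A B c
  proof
    fix D assume "D \<in> lcoset (isotropy G e) A"
    then obtain k d where k: "k \<in> Sp_on UNIV" "d \<in> G" "k *v base e = d *s base e" "D = A ** k"
      by (auto simp: lcoset_def isotropy_def)
    let ?m = "ctranspose B ** (A ** k)"
    have "?m \<in> Sp_on UNIV" by (intro Sp_mult Sp_ctranspose A B k)
    moreover have "?m *v base e = (d * c) *s base e"
    proof -
      have "ctranspose B *v (B *v base e) = base e" by (simp add: matrix_vector_mul_assoc Sp_unitary[OF B])
      then show ?thesis by (simp add: matrix_vector_mul_assoc[symmetric] k c vector_scalar_commute)
    qed
    moreover have "d * c \<in> G" using G c k by auto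
    moreover have "D = B ** ?m" by (simp add: matrix_mul_assoc Sp_unitary[OF B] k)
    ultimately show "D \<in> lcoset (isotropy G e) B" by (auto simp: lcoset_def isotropy_def)
  qed
  assume "\<exists>c\<in>G. A *v base e = c *s (B *v base e)"
  then obtain c where c: "c \<in> G" "A *v base e = c *s (B *v base e)" by blast
  have cc: "c * c = 1" using G c(1) by auto
  have "B *v base e = c *s (A *v base e)" by (simp add: c(2) vec_eq_iff mult.assoc[symmetric] cc)
  then show "lcoset (isotropy G e) A = lcoset (isotropy G e) B"
    using sub[OF A B c] sub[OF B A c(1)] by blast
qed

section \<open>The invariant metric in terms of the position vector\<close>

text \<open>The projections of \<open>sp(n)\<close> onto \<open>sp(1)\<close> and \<open>m\<close> keep the
  entries of the corresponding blocks and erase the others.\<close>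

definition block :: "('n + 'n \<Rightarrow> 'n + 'n \<Rightarrow> bool) \<Rightarrow> ('n::finite) cmat \<Rightarrow> 'n cmat" where
  "block P X = (\<chi> i j. if P i j then X $ i $ j else 0)"

lemma block_nth: "block P X $ i $ j = (if P i j then X $ i $ j else 0)"
  by (simp add: block_def)

lemma block_sp:
  assumes "X \<in> sp_on UNIV" and "\<And>i j. P i j \<longleftrightarrow> P j i" and "\<And>i j. P (swp i) j \<longleftrightarrow> P i j"
    and "\<And>i j. P i j \<Longrightarrow> qindex i \<in> N \<and> qindex j \<in> N"
  shows "block P X \<in> sp_on N"
proof -
  have "P (swp j) i = P (swp i) j" for i j using assms(2,3) by metis
  moreover have "\<not> P i j" if "\<not> (qindex i \<in> N \<and> qindex j \<in> N)" for i j using assms(4) that by blast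
  ultimately show ?thesis using assms(1,2) unfolding sp_on_iff block_nth by auto
qed

lemma Qform_eq: "Qform X Y = - (\<Sum>i\<in>UNIV. \<Sum>j\<in>UNIV. Re (X $ i $ j * Y $ j $ i)) / 2"
  by (simp add: Qform_def trace_def matrix_matrix_mult_def)

lemma Qform_sp: "Y \<in> sp_on N \<Longrightarrow> Qform X Y = (\<Sum>i\<in>UNIV. \<Sum>j\<in>UNIV. X $ i $ j \<bullet> Y $ i $ j) / 2"
proof -
  assume "Y \<in> sp_on N"
  then have e: "Y $ j $ i = - cnj (Y $ i $ j)" for i j unfolding sp_on_iff by (metis minus_minus)
  have "Re (X $ i $ j * Y $ j $ i) = - (X $ i $ j \<bullet> Y $ i $ j)" for i j
    unfolding e[of j i] by (simp add: inner_complex_def)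
  then have "(\<Sum>i\<in>UNIV. \<Sum>j\<in>UNIV. Re (X $ i $ j * Y $ j $ i)) = (\<Sum>i\<in>UNIV. \<Sum>j\<in>UNIV. - (X $ i $ j \<bullet> Y $ i $ j))"
    by (intro sum.cong refl)
  then show ?thesis unfolding Qform_eq by (simp only: sum_negf minus_minus)
qed

lemma Qform_commute: "Qform X Y = Qform Y X"
  unfolding Qform_eq by (subst sum.swap) (simp add: mult.commute)

lemma Qform_diff: "Qform (X - Y) Z = Qform X Z - Qform Y Z" "Qform Z (X - Y) = Qform Z X - Qform Z Y"
proof -
  have "Re ((X - Y) $ i $ j * Z $ j $ i) = Re (X $ i $ j * Z $ j $ i) - Re (Y $ i $ j * Z $ j $ i)" for i j
    by (simp add: algebra_simps)
  then show "Qform (X - Y) Z = Qform X Z - Qform Y Z"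
    by (simp only: Qform_eq sum_subtractf) argo
  then show "Qform Z (X - Y) = Qform Z X - Qform Z Y"
    by (simp only: Qform_commute[of Z])
qed

lemma Qform_definite: "X \<in> sp_on N \<Longrightarrow> Qform X X = 0 \<Longrightarrow> X = 0"
  by (simp add: Qform_sp sum_nonneg_eq_0_iff sum_nonneg vec_eq_iff)

lemma Qproj_eqI:
  assumes "W \<subseteq> sp_on UNIV" "\<And>X Y. X \<in> W \<Longrightarrow> Y \<in> W \<Longrightarrow> X - Y \<in> W"
    and "P \<in> W" "\<And>Y. Y \<in> W \<Longrightarrow> Qform (X - P) Y = 0"
  shows "Qproj W X = P"
  unfolding Qproj_def
proof (rule the_equality)
  show "P \<in> W \<and> (\<forall>Y\<in>W. Qform (X - P) Y = 0)" using assms(3,4) by blast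
  fix R assume R: "R \<in> W \<and> (\<forall>Y\<in>W. Qform (X - R) Y = 0)"
  then have d: "R - P \<in> W" using assms by blast
  have "Qform (R - P) (R - P) = Qform (X - P) (R - P) - Qform (X - R) (R - P)" by (simp add: Qform_diff)
  also have "\<dots> = 0" using R assms(4) d by simp
  finally have "R - P = 0" using Qform_definite d assms(1) by blast
  then show "R = P" by simp
qed

lemma sp_diff: "X \<in> sp_on N \<Longrightarrow> Y \<in> sp_on N \<Longrightarrow> X - Y \<in> sp_on N"
  by (simp add: sp_on_iff algebra_simps)

lemma sp_subset: "sp_on N \<subseteq> sp_on UNIV"
  by (auto simp: sp_on_iff)

lemma Qproj_vertical:
  assumes "X \<in> sp_on UNIV"
  shows "Qproj (sp_on {e}) X = block (\<lambda>i j. qindex i = e \<and> qindex j = e) X" (is "_ = ?P")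
proof (rule Qproj_eqI[OF sp_subset sp_diff])
  show "?P \<in> sp_on {e}" by (rule block_sp[OF assms]) auto
  fix Y assume Y: "Y \<in> sp_on {e}"
  have "(X - ?P) $ i $ j \<bullet> Y $ i $ j = 0" for i j
    using Y by (auto simp: block_nth sp_on_iff)
  then show "Qform (X - ?P) Y = 0" by (simp add: Qform_sp[OF Y])
qed

lemma Qproj_horizontal:
  assumes X: "X \<in> sp_on UNIV"
  shows "Qproj (m_space e) X = block (\<lambda>i j. (qindex i = e) \<noteq> (qindex j = e)) X" (is "_ = ?P")
proof (rule Qproj_eqI)
  show "m_space e \<subseteq> sp_on UNIV" by (auto simp: m_space_def)
  show "Y - Z \<in> m_space e" if "Y \<in> m_space e" "Z \<in> m_space e" for Y Z
    using that by (auto simp: m_space_def sp_diff Qform_diff)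
  have P: "?P \<in> sp_on UNIV" by (rule block_sp[OF X]) auto
  show "?P \<in> m_space e"
    unfolding m_space_def
  proof (intro CollectI conjI P ballI)
    fix Y Z assume "Y \<in> sp_on {e}" "Z \<in> sp_on (- {e})"
    then have "?P $ i $ j * (Y + Z) $ j $ i = 0" for i j by (auto simp: block_nth sp_on_iff)
    then show "Qform ?P (Y + Z) = 0" by (simp only: Qform_eq) simp
  qed
  fix Y assume Y: "Y \<in> m_space e"
  have "X - ?P = block (\<lambda>i j. qindex i = e \<and> qindex j = e) X + block (\<lambda>i j. qindex i \<noteq> e \<and> qindex j \<noteq> e) X"
    by (auto simp: vec_eq_iff block_nth)
  moreover have "block (\<lambda>i j. qindex i = e \<and> qindex j = e) X \<in> sp_on {e}" by (rule block_sp[OF X]) auto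
  moreover have "block (\<lambda>i j. qindex i \<noteq> e \<and> qindex j \<noteq> e) X \<in> sp_on (- {e})" by (rule block_sp[OF X]) auto
  ultimately show "Qform (X - ?P) Y = 0" using Y by (simp add: m_space_def Qform_commute[of _ Y])
qed

lemma inner_cnj: "cnj x \<bullet> cnj y = x \<bullet> y" by (simp add: inner_complex_def)

lemma sp_inner_swp:
  assumes "X \<in> sp_on M" "Y \<in> sp_on N"
  shows "X $ swp i $ swp j \<bullet> Y $ swp i $ swp j = X $ i $ j \<bullet> Y $ i $ j"
  unfolding sp_quat[OF assms(1)] sp_quat[OF assms(2)]
  using sg_cases[of i] sg_cases[of j] by (auto simp: inner_cnj)

lemma sp_inner_flip:
  assumes "X \<in> sp_on M" "Y \<in> sp_on N"
  shows "X $ j $ i \<bullet> Y $ j $ i = X $ i $ j \<bullet> Y $ i $ j"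
proof -
  have "X $ i $ j = - cnj (X $ j $ i)" "Y $ i $ j = - cnj (Y $ j $ i)"
    using assms unfolding sp_on_iff by (metis minus_minus)+
  then show ?thesis by (simp add: inner_cnj)
qed

text \<open>The vertical part of \<open>X *v base e\<close> consists of the entries with both indices over
  \<open>e\<close>, the horizontal part of the rest of the column \<open>Inl e\<close>. Because
  \<open>X\<close> is skew-Hermitian and commutes with \<open>quat_j\<close>, each vertical entry
  recurs twice among the entries of \<open>X\<close> and each horizontal entry four times, up to
  sign and conjugation. \<open>Qform\<close> takes half the sum over all entries, whence the factors
  in \<open>t1\<close> and \<open>2 * t0\<close>.\<close>

lemma inv_form_eq:
  assumes X: "X \<in> sp_on UNIV" and Y: "Y \<in> sp_on UNIV"
  shows "inv_form e t0 t1 X Y = 2 * t0 * ((X *v base e) \<bullet> (Y *v base e)) +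
     (t1 - 2 * t0) * (\<Sum>s<3. (qunit s (base e) \<bullet> (X *v base e)) * (qunit s (base e) \<bullet> (Y *v base e)))"
proof -
  define w where "w i j = X $ i $ j \<bullet> Y $ i $ j" for i j
  have sw: "w (swp i) (swp j) = w i j" for i j unfolding w_def by (rule sp_inner_swp[OF X Y])
  have fl: "w j i = w i j" for i j unfolding w_def by (rule sp_inner_flip[OF X Y])
  have colr: "(\<Sum>i\<in>UNIV. if P (qindex i) then w i (Inr e) else 0) = (\<Sum>i\<in>UNIV. if P (qindex i) then w i (Inl e) else 0)" for P
  proof -
    have "w (swp i) (Inr e) = w i (Inl e)" for i using sw[of i "Inl e"] by simp
    then show ?thesis by (subst sum_swp[symmetric]) (simp only: qindex_swp)
  qed
  have rowf: "(\<Sum>j\<in>UNIV. if qindex j \<noteq> e then w k j else 0) = (\<Sum>j\<in>UNIV. if qindex j \<noteq> e then w j k else 0)" for k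
    by (rule sum.cong) (auto intro: fl)
  have row: "(\<Sum>j\<in>UNIV. if qindex j = e then h j else 0) = h (Inl e) + h (Inr e)" for h :: "'a + 'a \<Rightarrow> real"
    by (simp add: sum_UNIV_Plus)
  let ?V = "\<Sum>i\<in>UNIV. if qindex i = e then w i (Inl e) else 0"
  let ?O = "\<Sum>i\<in>UNIV. if qindex i \<noteq> e then w i (Inl e) else 0"
  let ?mV = "block (\<lambda>i j. qindex i = e \<and> qindex j = e)" and ?mO = "block (\<lambda>i j. (qindex i = e) \<noteq> (qindex j = e))"
  have "Qform (?mV X) (?mV Y) = (\<Sum>i\<in>UNIV. \<Sum>j\<in>UNIV. if qindex j = e then (if qindex i = e then w i j else 0) else 0) / 2"
    by (subst Qform_sp[OF block_sp[OF Y, where N=UNIV]]) (auto simp: block_nth w_def intro!: sum.cong)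
  also have "\<dots> = ?V"
    using sw[of "Inl e" "Inl e"] sw[of "Inr e" "Inl e"] unfolding row sum.distrib by simp
  finally have 1: "Qform (?mV X) (?mV Y) = ?V" .
  have "Qform (?mO X) (?mO Y) = (\<Sum>i\<in>UNIV. \<Sum>j\<in>UNIV. (if qindex j = e then (if qindex i \<noteq> e then w i j else 0) else 0)
      + (if qindex i = e then (if qindex j \<noteq> e then w i j else 0) else 0)) / 2"
    by (subst Qform_sp[OF block_sp[OF Y, where N=UNIV]]) (auto simp: block_nth w_def intro!: sum.cong)
  also have "\<dots> = ((\<Sum>i\<in>UNIV. \<Sum>j\<in>UNIV. if qindex j = e then (if qindex i \<noteq> e then w i j else 0) else 0) +
      (\<Sum>j\<in>UNIV. \<Sum>i\<in>UNIV. if qindex i = e then (if qindex j \<noteq> e then w i j else 0) else 0)) / 2"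
    unfolding sum.distrib by (subst (3) sum.swap) simp
  also have "\<dots> = 2 * ?O"
    unfolding row sum.distrib rowf colr[of "\<lambda>q. q \<noteq> e"] by simp
  finally have 2: "Qform (?mO X) (?mO Y) = 2 * ?O" .
  have c: "(X *v base e) \<bullet> (Y *v base e) = ?V + ?O"
    by (simp add: inner_vec_def mult_base w_def flip: sum.distrib) (intro sum.cong, auto simp: w_def)
  have re0: "Re (Z $ Inl e $ Inl e) = 0" if "Z \<in> sp_on UNIV" for Z
  proof -
    have "cnj (Z $ Inl e $ Inl e) = - Z $ Inl e $ Inl e" using that unfolding sp_on_iff by blast
    then show ?thesis by (simp add: complex_eq_iff)
  qed
  have ci: "base e \<bullet> y = Re (y $ Inl e)" for y
    by (simp add: inner_cvec base_nth if_distrib if_distribR sum.delta cong: if_cong)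
  have cj: "quat_j (base e) \<bullet> y = Re (y $ Inr e)" for y
    by (simp add: quat_j_skew ci quat_j_nth)
  have q0: "qunit 0 (base e) \<bullet> y = Im (y $ Inl e)" for y :: "'a cvec"
    by (simp add: qunit_def ii_skew ci)
  have q1: "qunit 1 (base e) \<bullet> y = Re (y $ Inr e)" for y :: "'a cvec"
    by (simp add: qunit_def cj)
  have q2: "qunit 2 (base e) \<bullet> y = Im (y $ Inr e)" for y :: "'a cvec"
    by (simp add: qunit_def ii_skew cj)
  have v: "(\<Sum>s<3. (qunit s (base e) \<bullet> (X *v base e)) * (qunit s (base e) \<bullet> (Y *v base e))) = ?V"
    unfolding sum_lt3 q0 q1 q2 row mult_base by (simp add: w_def inner_complex_def re0[OF X])
  show ?thesis
    unfolding inv_form_def Qproj_vertical[OF X] Qproj_vertical[OF Y] Qproj_horizontal[OF X] Qproj_horizontal[OF Y] 1 2 c v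
    by (simp add: algebra_simps)
qed

section \<open>Local parametrizations as charts of the sphere\<close>

lemma bounded_linear_mult_vec: "bounded_linear (\<lambda>A :: complex^'m::finite^'k::finite. A *v y)"
proof -
  have "linear (\<lambda>A :: complex^'m^'k. A *v y)"
    by (rule linearI) (simp_all add: vec_eq_iff matrix_vector_mult_def algebra_simps sum.distrib scaleR_sum_right)
  then show ?thesis using linear_conv_bounded_linear by blast
qed

lemma bounded_linear_matrix: "bounded_linear (\<lambda>y. (A :: complex^'m::finite^'k::finite) *v y)"
proof -
  have "linear (\<lambda>y. A *v y)"
    by (rule linearI) (simp_all add: vec_eq_iff matrix_vector_mult_def algebra_simps sum.distrib scaleR_sum_right)
  then show ?thesis using linear_conv_bounded_linear by blast
qed

lemma bounded_linear_matrix_mult: "bounded_linear (\<lambda>X. (A :: complex^'m::finite^'k::finite) ** (X :: complex^'l::finite^'m))"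
proof -
  have "linear (\<lambda>X :: complex^'l^'m. A ** X)"
    by (rule linearI) (simp_all add: vec_eq_iff matrix_matrix_mult_def algebra_simps sum.distrib scaleR_sum_right)
  then show ?thesis using linear_conv_bounded_linear by blast
qed

lemma bounded_linear_quat_j: "bounded_linear quat_j"
  using quat.J_linear[of 1] linear_conv_bounded_linear by (auto simp: qunit_def[abs_def])

lemma sp_onI_vec:
  assumes sk: "\<And>x y. (X *v x) \<bullet> y = - (x \<bullet> (X *v y))" and q: "\<And>y. X *v quat_j y = quat_j (X *v y)"
  shows "X \<in> sp_on UNIV"
proof -
  have "((ctranspose X + X) *v x) \<bullet> y = 0" for x y
    by (simp add: matrix_vector_mult_add_rdistrib inner_add_left ctranspose_mult_vec sk)
  then have "(ctranspose X + X) *v x = 0 *v x" for x by (metis inner_eq_zero_iff matrix_vector_mult_0)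
  then have "ctranspose X + X = 0" by (simp add: matrix_eq)
  then have "ctranspose X $ i $ j + X $ i $ j = 0" for i j by (metis vector_add_component zero_index)
  then have c: "cnj (X $ j $ i) = - X $ i $ j" for i j
    by (simp add: ctranspose_def eq_neg_iff_add_eq_0)
  have ax: "(X *v axis j z) $ i = X $ i $ j * z" for i j z
    by (simp add: matrix_vector_mult_def axis_def if_distrib sum.delta cong: if_cong)
  have qa: "quat_j (axis j 1) = axis (swp j) (- sg j)" for j :: "'a + 'a"
  proof -
    have "swp i = j \<longleftrightarrow> i = swp j" for i by (metis swp_simps(3))
    then show ?thesis by (auto simp: vec_eq_iff quat_j_nth axis_def)
  qed
  have e: "- (X $ i $ swp j * sg j) = sg i * cnj (X $ swp i $ j)" for i j
    using arg_cong[OF q[of "axis j 1"], of "\<lambda>v. v $ i"] by (simp add: qa ax quat_j_nth)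
  have "sg i * X $ swp i $ j = sg j * X $ swp j $ i" for i j
  proof -
    have "X $ swp j $ i = - cnj (X $ i $ swp j)" by (simp add: c)
    moreover have "cnj (- (X $ i $ swp j * sg j)) = cnj (sg i * cnj (X $ swp i $ j))" by (simp only: e)
    ultimately show ?thesis by (simp add: mult.commute)
  qed
  then show ?thesis using c by (simp add: sp_on_iff)
qed

text \<open>The kernel of the differential of the orbit map is \<open>sp(n-1)\<close>.\<close>

lemma sp_base_zero:
  assumes X: "X \<in> sp_on UNIV" and z: "X *v base e = 0"
  shows "X \<in> sp_on (- {e})"
proof -
  have l: "X $ i $ Inl e = 0" for i using arg_cong[OF z, of "\<lambda>v. v $ i"] by (simp add: mult_base)
  have "X $ i $ Inr e = 0" for i using sp_quat[OF X, of "swp i" "Inl e"] by (simp add: l)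
  then have col: "X $ i $ j = 0" if "qindex j = e" for i j using l that by (cases j) auto
  have "cnj (X $ j $ i) = - X $ i $ j" for i j using X unfolding sp_on_iff by blast
  then have "X $ i $ j = 0" if "qindex i = e" for i j using col[OF that, of j] by (metis complex_cnj_zero neg_equal_0_iff_equal)
  then show ?thesis using X col unfolding sp_on_iff by auto
qed

lemma base_of_complement: "X \<in> sp_on (- {e}) \<Longrightarrow> X *v base e = 0"
  by (simp add: vec_eq_iff mult_base sp_on_iff)

lemma Sp_mult_matrix_inv: "A \<in> Sp_on UNIV \<Longrightarrow> A ** (matrix_inv A ** B) = B"
  by (simp add: matrix_mul_assoc Sp_unitary)

context
  fixes e :: "'n::finite" and K :: "'n cmat set" and U :: "(real^'d) set" and \<sigma> :: "real^'d \<Rightarrow> 'n cmat"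
  assumes lp: "local_param e K U \<sigma>"
begin

lemma lp_open: "open U" and lp_smooth: "Ck_on k U \<sigma>" and lp_Sp: "u \<in> U \<Longrightarrow> \<sigma> u \<in> Sp_on UNIV"
  using lp by (auto simp: local_param_def smooth_map_on_def)

lemma lp_deriv: "u \<in> U \<Longrightarrow> (\<sigma> has_derivative frechet_derivative \<sigma> (at u)) (at u)"
  using Ck_on_SucD(1)[OF lp_smooth] .

lemma lp_deriv_vec: "u \<in> U \<Longrightarrow> ((\<lambda>u. \<sigma> u *v y) has_derivative (\<lambda>w. frechet_derivative \<sigma> (at u) w *v y)) (at u)"
  by (rule bounded_linear.has_derivative[OF bounded_linear_mult_vec lp_deriv])

text \<open>The equations defining \<open>Sp(n)\<close>, differentiated.\<close>

lemma lp_tangent: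
  assumes u: "u \<in> U"
  shows "matrix_inv (\<sigma> u) ** frechet_derivative \<sigma> (at u) w \<in> sp_on UNIV"
proof (rule sp_onI_vec)
  let ?D = "frechet_derivative \<sigma> (at u) w" and ?X = "matrix_inv (\<sigma> u) ** frechet_derivative \<sigma> (at u) w"
  have S: "\<sigma> u \<in> Sp_on UNIV" by (rule lp_Sp[OF u])
  have X: "\<sigma> u *v (?X *v y) = ?D *v y" for y by (simp add: matrix_vector_mul_assoc Sp_mult_matrix_inv[OF S])
  have loc: "(h has_derivative D) (at u) \<Longrightarrow> (\<And>u. u \<in> U \<Longrightarrow> h u = c) \<Longrightarrow> D w = 0" for h :: "real^'d \<Rightarrow> 'z::real_normed_vector" and D c
    by (rule fun_cong[OF has_derivative_unique, of h D u "\<lambda>_. 0" w])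
      (auto intro: has_derivative_transform_within_open[OF has_derivative_const lp_open u])
  fix x y :: "'n cvec"
  have "((\<lambda>u. (\<sigma> u *v x) \<bullet> (\<sigma> u *v y)) has_derivative
     (\<lambda>w. (\<sigma> u *v x) \<bullet> (frechet_derivative \<sigma> (at u) w *v y) + (frechet_derivative \<sigma> (at u) w *v x) \<bullet> (\<sigma> u *v y))) (at u)"
    by (rule has_derivative_inner[OF lp_deriv_vec[OF u] lp_deriv_vec[OF u]])
  from loc[OF this, of "x \<bullet> y"] have "(\<sigma> u *v x) \<bullet> (?D *v y) + (?D *v x) \<bullet> (\<sigma> u *v y) = 0"
    using lp_Sp Sp_inner by blast
  then have "(?X *v x) \<bullet> y + x \<bullet> (?X *v y) = 0"
    unfolding X[symmetric] Sp_inner[OF S] by (simp add: add.commute)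
  then show "(?X *v x) \<bullet> y = - (x \<bullet> (?X *v y))" by simp
  have "((\<lambda>u. \<sigma> u *v quat_j y - quat_j (\<sigma> u *v y)) has_derivative
     (\<lambda>w. frechet_derivative \<sigma> (at u) w *v quat_j y - quat_j (frechet_derivative \<sigma> (at u) w *v y))) (at u)"
    by (intro has_derivative_diff bounded_linear.has_derivative[OF bounded_linear_quat_j] lp_deriv_vec[OF u])
  from loc[OF this, of 0] have "?D *v quat_j y - quat_j (?D *v y) = 0"
    using lp_Sp Sp_quat_j by fastforce
  then have "\<sigma> u *v (?X *v quat_j y) = \<sigma> u *v (quat_j (?X *v y))"
    unfolding X Sp_quat_j[OF S] by simp
  then have "ctranspose (\<sigma> u) *v (\<sigma> u *v (?X *v quat_j y)) = ctranspose (\<sigma> u) *v (\<sigma> u *v (quat_j (?X *v y)))" by simp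
  then show "?X *v quat_j y = quat_j (?X *v y)"
    by (simp add: matrix_vector_mul_assoc matrix_mul_assoc[symmetric] Sp_unitary[OF S])
      (simp add: matrix_mul_assoc Sp_unitary[OF S])
qed

text \<open>Local parametrizations of the homogeneous space become charts of the sphere, with the metric of
  \<open>inv_form_eq\<close> carried from \<open>base e\<close> to other points by the invariance of
  all ingredients under \<open>Sp(n)\<close>.\<close>

lemma lp_sphere_chart:
  assumes dim: "CARD('d) + 1 = 4 * CARD('n)" and t: "t0 > 0" "t1 > 0"
  shows "sphere_chart qunit U (\<lambda>u. \<sigma> u *v base e) (2 * t0) t1 (metric_matrix e t0 t1 \<sigma>)"
proof (intro sphere_chart.intro sphere_chart_axioms.intro)
  let ?x = "\<lambda>u. \<sigma> u *v base e"
  have D: "frechet_derivative ?x (at u) = (\<lambda>w. frechet_derivative \<sigma> (at u) w *v base e)" if "u \<in> U" for u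
    using frechet_derivative_at[OF lp_deriv_vec[OF that]] by simp
  show "quaternionic (qunit :: nat \<Rightarrow> 'n cvec \<Rightarrow> 'n cvec)" by (rule quat.quaternionic_axioms)
  show "open U" by (rule lp_open)
  show "Ck_on 2 U ?x" by (rule Ck_on_bounded_linear[OF bounded_linear_mult_vec lp_open lp_smooth])
  show "norm (?x u) = 1" if "u \<in> U" for u using Sp_norm[OF lp_Sp[OF that], of "base e"] by simp
  show "w = 0" if u: "u \<in> U" and 0: "frechet_derivative ?x (at u) w = 0" for u w
  proof -
    have "(matrix_inv (\<sigma> u) ** frechet_derivative \<sigma> (at u) w) *v base e = 0"
      using 0 unfolding D[OF u] by (simp add: matrix_vector_mul_assoc[symmetric])
    from sp_base_zero[OF lp_tangent[OF u] this] show "w = 0" using lp u by (auto simp: local_param_def)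
  qed
  show "CARD('d) + 1 = DIM('n cvec)" using dim by simp
  show "2 * t0 > 0" "t1 > 0" using t by auto
  fix u i j assume u: "u \<in> U"
  have S: "\<sigma> u \<in> Sp_on UNIV" by (rule lp_Sp[OF u])
  let ?X = "\<lambda>i. matrix_inv (\<sigma> u) ** pderiv_on i \<sigma> u"
  have X: "?X i \<in> sp_on UNIV" for i unfolding pderiv_on_def by (rule lp_tangent[OF u])
  have v: "\<sigma> u *v (?X i *v base e) = pderiv_on i ?x u" for i
    unfolding pderiv_on_def D[OF u] by (simp add: matrix_vector_mul_assoc Sp_mult_matrix_inv[OF S])
  have q: "qunit s (base e) \<bullet> (?X i *v base e) = qunit s (?x u) \<bullet> pderiv_on i ?x u" for s i
    unfolding v[symmetric] Sp_qunit[OF S, symmetric] Sp_inner[OF S] ..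
  have w: "(?X i *v base e) \<bullet> (?X j *v base e) = pderiv_on i ?x u \<bullet> pderiv_on j ?x u" for i j
    unfolding v[symmetric] Sp_inner[OF S] ..
  show "metric_matrix e t0 t1 \<sigma> u $ i $ j = 2 * t0 * (pderiv_on i ?x u \<bullet> pderiv_on j ?x u) +
      (t1 - 2 * t0) * (\<Sum>s<3. (qunit s (?x u) \<bullet> pderiv_on i ?x u) * (qunit s (?x u) \<bullet> pderiv_on j ?x u))"
    unfolding metric_matrix_def vec_lambda_beta inv_form_eq[OF X X] q w ..
qed

end

section \<open>Quaternionic reflections\<close>

definition herm :: "complex^'i::finite \<Rightarrow> complex^'i \<Rightarrow> complex" where
  "herm x y = (\<Sum>i\<in>UNIV. cnj (x $ i) * y $ i)"

lemma herm_base: "herm w (base e) = cnj (w $ Inl e)"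
  by (simp add: herm_def base_nth if_distrib sum.delta cong: if_cong)

lemma herm_quat_j: "herm (quat_j x) (quat_j y) = cnj (herm x y)"
proof -
  have "herm (quat_j x) (quat_j y) = (\<Sum>i\<in>UNIV. x $ swp i * cnj (y $ swp i))"
    unfolding herm_def
  proof (intro sum.cong refl)
    fix i show "cnj (quat_j x $ i) * quat_j y $ i = x $ swp i * cnj (y $ swp i)"
      using sg_cases[of i] by (auto simp: quat_j_nth)
  qed
  also have "\<dots> = (\<Sum>i\<in>UNIV. x $ i * cnj (y $ i))" by (rule sum_swp)
  finally show ?thesis by (simp add: herm_def)
qed

lemma herm_commute: "herm y x = cnj (herm x y)"
  by (simp add: herm_def mult.commute)

lemma herm_quat_j_self: "herm x (quat_j x) = 0"
proof -
  have "herm x (quat_j x) = cnj (herm (quat_j x) (quat_j (quat_j x)))" by (simp only: herm_quat_j complex_cnj_cnj)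
  also have "\<dots> = - herm x (quat_j x)" unfolding quat_j_twice by (simp add: herm_def sum_negf mult.commute)
  finally show ?thesis by simp
qed

lemma herm_linear: "herm x (c *s y + z) = c * herm x y + herm x z" "herm x (- y) = - herm x y" "herm x (y + z) = herm x y + herm x z"
  "herm x (c *s y) = c * herm x y"
  by (simp_all add: herm_def sum.distrib sum_distrib_left sum_negf algebra_simps)

lemma herm_linear_left: "herm (y + z) x = herm y x + herm z x" "herm (c *s y) x = cnj c * herm y x" "herm (- y) x = - herm y x"
  by (simp_all add: herm_def sum.distrib sum_distrib_left sum_negf algebra_simps)

lemma Re_herm: "Re (herm x y) = x \<bullet> y"
  by (simp add: herm_def inner_cvec)

lemma herm_self: "herm x x = of_real (x \<bullet> x)"
  by (simp add: complex_eq_iff Re_herm) (simp add: herm_def)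

text \<open>An explicit element of \<open>Sp(n)\<close> carrying \<open>base e\<close> to a given unit vector
  \<open>x\<close>, smooth in \<open>x\<close> away from \<open>- base e\<close>. In quaternionic
  notation it is \<open>v \<mapsto> w c\<^sup>-\<^sup>1 \<langle>w, v\<rangle> - v\<close> with
  \<open>w = base e + x\<close> and \<open>c = \<langle>w, base e\<rangle>\<close>: then
  \<open>base e\<close> goes to \<open>w - base e = x\<close>, and the map preserves norms because
  the real part of \<open>c\<close> is half the square of the norm of \<open>w\<close>. The four
  terms are the quaternionic product in complex coordinates.\<close>

definition refl_matrix :: "'n::finite \<Rightarrow> 'n cvec \<Rightarrow> 'n cmat" where
  "refl_matrix e x = (let w = base e + x; jw = quat_j w; \<alpha> = w $ Inl e; \<beta> = w $ Inr e in
     (\<chi> i j. (w $ i * (\<alpha> * cnj (w $ j) - cnj \<beta> * cnj (jw $ j)) + jw $ i * (\<beta> * cnj (w $ j) + cnj \<alpha> * cnj (jw $ j)))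
        / (\<alpha> * cnj \<alpha> + \<beta> * cnj \<beta>) - (if i = j then 1 else 0)))"

lemma refl_matrix_mult:
  fixes e x v
  defines "w \<equiv> base e + x" and "N \<equiv> (base e + x) $ Inl e * cnj ((base e + x) $ Inl e) + (base e + x) $ Inr e * cnj ((base e + x) $ Inr e)"
  shows "refl_matrix e x *v v = ((w $ Inl e * herm w v - cnj (w $ Inr e) * herm (quat_j w) v) / N) *s w
     + ((w $ Inr e * herm w v + cnj (w $ Inl e) * herm (quat_j w) v) / N) *s quat_j w - v"
proof -
  let ?a = "w $ Inl e" and ?b = "w $ Inr e" and ?j = "quat_j w"
  have "(refl_matrix e x *v v) $ i = ((?a * herm w v - cnj ?b * herm ?j v) / N) * w $ i
     + ((?b * herm w v + cnj ?a * herm ?j v) / N) * ?j $ i - v $ i" for i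
  proof -
    have "(refl_matrix e x *v v) $ i = (\<Sum>j\<in>UNIV. (w $ i / N * ?a) * (cnj (w $ j) * v $ j) - (w $ i / N * cnj ?b) * (cnj (?j $ j) * v $ j)
       + ((?j $ i / N * ?b) * (cnj (w $ j) * v $ j) + (?j $ i / N * cnj ?a) * (cnj (?j $ j) * v $ j)) - (if j = i then v $ j else 0))"
      unfolding matrix_vector_mult_def refl_matrix_def Let_def vec_lambda_beta w_def[symmetric]
      by (intro sum.cong refl) (auto simp: N_def w_def algebra_simps add_divide_distrib diff_divide_distrib)
    also have "\<dots> = (w $ i / N * ?a) * herm w v - (w $ i / N * cnj ?b) * herm ?j v + ((?j $ i / N * ?b) * herm w v + (?j $ i / N * cnj ?a) * herm ?j v) - v $ i"
      unfolding sum_subtractf sum.distrib sum_distrib_left[symmetric] herm_def by simp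
    finally show ?thesis by (simp add: algebra_simps add_divide_distrib diff_divide_distrib)
  qed
  then show ?thesis by (simp add: vec_eq_iff)
qed

lemma
  assumes x: "norm x = 1" and nz: "x \<noteq> - base e"
  shows refl_matrix_Sp: "refl_matrix e x \<in> Sp_on UNIV"
    and refl_matrix_base: "refl_matrix e x *v base e = x"
proof -
  define w where "w = base e + x"
  define a where "a = w $ Inl e"
  define b where "b = w $ Inr e"
  define N where "N = a * cnj a + b * cnj b"
  have mult: "refl_matrix e x *v v = ((a * herm w v - cnj b * herm (quat_j w) v) / N) *s w
     + ((b * herm w v + cnj a * herm (quat_j w) v) / N) *s quat_j w - v" for v
    using refl_matrix_mult[of e x v] by (simp add: w_def a_def b_def N_def)
  have xx: "x \<bullet> x = 1" using x by (simp add: dot_square_norm)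
  have bb: "base e \<bullet> base e = 1" by (simp add: dot_square_norm)
  have bx: "base e \<bullet> x = Re a - 1"
    using Re_herm[of "base e" x] unfolding herm_commute[of "base e" x] herm_base by (simp add: a_def w_def base_nth)
  have ww: "w \<bullet> w = 2 * Re a"
    unfolding w_def inner_add_left inner_add_right bb xx inner_commute[of x "base e"] bx by simp
  have "w \<noteq> 0" using nz by (auto simp: w_def eq_neg_iff_add_eq_0 add.commute)
  then have "Re a > 0" using ww by (metis inner_gt_zero_iff zero_less_mult_iff zero_less_numeral not_numeral_less_zero)
  then have a0: "a \<noteq> 0" by auto
  define n where "n = (cmod a)\<^sup>2 + (cmod b)\<^sup>2"
  have Nn: "N = of_real n" by (simp only: N_def n_def of_real_add complex_norm_square)
  have n: "n > 0" using a0 by (simp add: n_def add_pos_nonneg)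
  have N0: "N \<noteq> 0" using n by (simp add: Nn)
  have h1: "herm w (base e) = cnj a" by (simp add: herm_base a_def)
  have h2: "herm (quat_j w) (base e) = - b" by (simp add: herm_base quat_j_nth b_def)
  show "refl_matrix e x *v base e = x"
  proof -
    have "(a * cnj a - cnj b * - b) / N = 1" using N0 by (simp add: N_def mult.commute)
    moreover have "b * cnj a + cnj a * - b = 0" by simp
    ultimately show ?thesis unfolding mult h1 h2 by (simp add: w_def)
  qed
  show "refl_matrix e x \<in> Sp_on UNIV"
  proof (rule SpI)
    fix v
    define h where "h = herm w v"
    define k where "k = herm (quat_j w) v"
    define p where "p = (a * h - cnj b * k) / N"
    define q where "q = (b * h + cnj a * k) / N"
    define y where "y = p *s w + q *s quat_j w"
    have A: "refl_matrix e x *v v = y - v" by (simp add: mult y_def p_def q_def h_def k_def)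
    have hyy: "herm y y = (p * cnj p + q * cnj q) * of_real (2 * Re a)"
    proof -
      have "herm w w = of_real (2 * Re a)" "herm (quat_j w) (quat_j w) = of_real (2 * Re a)" 
        by (simp_all only: herm_quat_j herm_self[of w] ww) simp_all
      moreover have "herm w (quat_j w) = 0" "herm (quat_j w) w = 0"
        using herm_quat_j_self[of w] herm_commute[of "quat_j w" w] by simp_all
      ultimately show ?thesis unfolding y_def herm_linear herm_linear_left by (simp add: algebra_simps)
    qed
    have "p * cnj p + q * cnj q = (h * cnj h + k * cnj k) / N"
    proof -
      have cN: "cnj N = N" by (simp add: Nn)
      have "(a * h - cnj b * k) * cnj (a * h - cnj b * k) + (b * h + cnj a * k) * cnj (b * h + cnj a * k) = N * (h * cnj h + k * cnj k)"
        by (simp add: N_def algebra_simps)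
      then have "p * cnj p + q * cnj q = N * (h * cnj h + k * cnj k) / (N * N)"
        unfolding p_def q_def complex_cnj_divide cN times_divide_times_eq add_divide_distrib[symmetric] by simp
      then show ?thesis using N0 by simp
    qed
    then have "herm y y = of_real (((cmod h)\<^sup>2 + (cmod k)\<^sup>2) / n * (2 * Re a))"
      by (simp only: hyy Nn of_real_add of_real_divide of_real_mult complex_norm_square)
    then have yy: "y \<bullet> y = ((cmod h)\<^sup>2 + (cmod k)\<^sup>2) / n * (2 * Re a)"
      unfolding herm_self of_real_eq_iff .
    have "herm v y = p * cnj h + q * cnj k"
      unfolding y_def herm_linear herm_commute[of v] h_def k_def herm_linear_left by (simp add: herm_commute[of v w] herm_commute[of v "quat_j w"])
    also have "\<dots> = (a * (h * cnj h) + cnj a * (k * cnj k) + (b * h * cnj k - cnj (b * h * cnj k))) / N"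
      unfolding p_def q_def by (simp add: add_divide_distrib[symmetric] algebra_simps)
    also have "Re \<dots> = Re a * ((cmod h)\<^sup>2 + (cmod k)\<^sup>2) / n"
      unfolding Nn by (simp add: complex_norm_square[symmetric] Re_divide_of_real distrib_left) (simp add: algebra_simps)
    finally have vy: "v \<bullet> y = Re a * ((cmod h)\<^sup>2 + (cmod k)\<^sup>2) / n" unfolding Re_herm .
    have "(y - v) \<bullet> (y - v) = v \<bullet> v"
      unfolding inner_diff_left inner_diff_right inner_commute[of y v] yy vy by simp
    then show "norm (refl_matrix e x *v v) = norm v" unfolding A norm_eq_sqrt_inner by simp
    have h': "herm w (quat_j v) = - cnj k"
      using herm_quat_j[of "quat_j w" v] by (simp add: herm_linear_left k_def) (metis minus_minus)
    have k': "herm (quat_j w) (quat_j v) = cnj h" by (simp add: herm_quat_j h_def)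
    have p': "(a * - cnj k - cnj b * cnj h) / N = - cnj q"
      using Nn by (simp add: q_def minus_divide_left algebra_simps)
    have q': "(b * - cnj k + cnj a * cnj h) / N = cnj p"
      using Nn by (simp add: p_def algebra_simps)
    have "refl_matrix e x *v quat_j v = (- cnj q) *s w + cnj p *s quat_j w - quat_j v"
      unfolding mult h' k' p' q' ..
    also have "\<dots> = quat_j (y - v)"
      using sg_cases by (auto simp: y_def vec_eq_iff quat_j_nth algebra_simps)
    finally show "refl_matrix e x *v quat_j v = quat_j (refl_matrix e x *v v)" unfolding A .
  qed
qed

lemma Sp_transitive:
  assumes "norm x = 1" shows "\<exists>A \<in> Sp_on UNIV. A *v base e = x"
proof (cases "x = - base e")
  case True
  have "- mat 1 *v base e = - base e" by (simp add: vec_eq_iff mult_base mat_def base_nth)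
  then show ?thesis using True Sp_minus[OF Sp_one] by blast
next
  case False then show ?thesis using refl_matrix_Sp refl_matrix_base assms by blast
qed

section \<open>Stereographic local parametrizations\<close>

text \<open>\<open>L\<close> embeds the coordinate space isometrically as the orthogonal complement of
  \<open>base e\<close>, and \<open>G\<close> is the orthogonal projection followed by the inverse
  of \<open>L\<close>.\<close>

locale stereo =
  fixes e :: "'n::finite" and L :: "real^'d \<Rightarrow> 'n cvec" and G :: "'n cvec \<Rightarrow> real^'d"
  assumes L: "linear L" and G: "linear G" and GL: "G (L u) = u" and norm_L: "norm (L u) = norm u"
    and base_L: "base e \<bullet> L u = 0" and LG: "L (G y) = y - (base e \<bullet> y) *\<^sub>R base e"

text \<open>The orthogonal complement of \<open>base e\<close> has real dimension
  \<open>4 * CARD('n) - 1\<close>.\<close>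

lemma stereo_exists:
  assumes "CARD('d) + 1 = 4 * CARD('n)"
  shows "\<exists>(L :: real^'d \<Rightarrow> ('n::finite) cvec) G. stereo e L G"
proof -
  let ?T = "{y :: 'n cvec. base e \<bullet> y = 0}"
  have bb: "base e \<bullet> base e = 1" by (simp add: dot_square_norm)
  have "base e \<noteq> 0" using bb by auto
  then have "dim ?T = DIM('n cvec) - 1" by (rule dim_hyperplane)
  then have d: "dim (UNIV :: (real^'d) set) = dim ?T" using assms by simp
  obtain f g where fg: "linear f" "linear g" "f ` (UNIV :: (real^'d) set) = ?T" "g ` ?T = (UNIV :: (real^'d) set)"
    "\<And>x. norm (f x) = norm x" "\<And>x. g (f x) = x" "\<And>y. y \<in> ?T \<Longrightarrow> f (g y) = y"
    by (rule isometries_subspaces[OF subspace_UNIV subspace_hyperplane d]) blast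
  let ?G = "\<lambda>y. g (y - (base e \<bullet> y) *\<^sub>R base e)"
  have bf: "base e \<bullet> f x = 0" for x using fg(3) by blast
  have "stereo e f ?G"
  proof (rule stereo.intro)
    show "linear f" by (rule fg)
    have "linear (\<lambda>y. y - (base e \<bullet> y) *\<^sub>R base e)"
      by (rule linearI) (simp_all add: inner_add_right algebra_simps)
    from linear_compose[OF this fg(2)] show "linear ?G" by (simp add: o_def)
    show "?G (f u) = u" for u by (simp add: bf fg(6))
    show "norm (f u) = norm u" "base e \<bullet> f u = 0" for u by (simp_all add: bf fg(5))
    show "f (?G y) = y - (base e \<bullet> y) *\<^sub>R base e" for y
      by (rule fg(7)) (simp add: inner_diff_right bb)
  qed
  then show ?thesis by blast
qed

lemma Ck_on_cong_local:
  assumes "\<And>x. x \<in> U \<Longrightarrow> \<exists>V. open V \<and> x \<in> V \<and> Ck_on k V f"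
  shows "Ck_on k U f"
  using assms
proof (induction k arbitrary: f)
  case 0
  have "isCont f x" if "x \<in> U" for x
    using 0[OF that] by (auto simp: continuous_on_eq_continuous_at)
  then show ?case by (simp add: continuous_at_imp_continuous_on)
next
  case (Suc k)
  have "f differentiable (at x)" if "x \<in> U" for x using Suc.prems[OF that] by auto
  moreover have "Ck_on k U (\<lambda>x. frechet_derivative f (at x) v)" for v
    by (rule Suc.IH) (use Suc.prems in fastforce)
  ultimately show ?case by simp
qed

lemma Ck_on_nth: "open U \<Longrightarrow> Ck_on k U f \<Longrightarrow> Ck_on k U (\<lambda>u. f u $ i)"
  by (rule Ck_on_bounded_linear[OF bounded_linear_vec_nth])

lemma Ck_on_cnj: "open U \<Longrightarrow> Ck_on k U f \<Longrightarrow> Ck_on k U (\<lambda>u. cnj (f u))"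
  by (rule Ck_on_bounded_linear[OF bounded_linear_cnj])

lemma Ck_on_refl_matrix:
  fixes e :: "'n::finite"
  assumes U: "open U" and x: "Ck_on k U x" and pos: "\<And>u. u \<in> U \<Longrightarrow> base e \<bullet> x u > -1"
  shows "Ck_on k U (\<lambda>u. refl_matrix e (x u))"
proof -
  define w where "w u = base e + x u" for u
  have Ckw: "Ck_on k U w" unfolding w_def[abs_def] by (intro Ck_on_add Ck_on_const U x)
  have Ckj: "Ck_on k U (\<lambda>u. quat_j (w u))" by (rule Ck_on_bounded_linear[OF bounded_linear_quat_j U Ckw])
  note c = Ck_on_nth[OF U Ckw] Ck_on_nth[OF U Ckj] Ck_on_cnj[OF U Ck_on_nth[OF U Ckw]] Ck_on_cnj[OF U Ck_on_nth[OF U Ckj]]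
  have nz: "w u $ Inl e * cnj (w u $ Inl e) + w u $ Inr e * cnj (w u $ Inr e) \<noteq> 0" if "u \<in> U" for u
  proof -
    have "Re (w u $ Inl e) = 1 + base e \<bullet> x u"
      using Re_herm[of "base e" "x u"] unfolding herm_commute[of "base e" "x u"] herm_base by (simp add: w_def base_nth)
    then have "w u $ Inl e \<noteq> 0" using pos[OF that] by auto
    then have "(cmod (w u $ Inl e))\<^sup>2 + (cmod (w u $ Inr e))\<^sup>2 \<noteq> 0" by (simp add: add_nonneg_eq_0_iff)
    then have "complex_of_real ((cmod (w u $ Inl e))\<^sup>2 + (cmod (w u $ Inr e))\<^sup>2) \<noteq> 0" by (simp only: of_real_eq_0_iff) simp
    then show ?thesis by (simp only: of_real_add complex_norm_square) simp
  qed
  have k1: "Ck_on k U (\<lambda>u. if i = j then 1 else 0 :: complex)" for i j :: "'n + 'n"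
    by (rule Ck_on_const[OF U])
  show ?thesis
    unfolding refl_matrix_def Let_def w_def[symmetric]
    by (rule Ck_on_vec[OF U] Ck_on_diff[OF U] Ck_on_divide[OF U _ _ nz] Ck_on_add[OF U] Ck_on_mult[OF U] c k1 | assumption)+
qed

context stereo
begin

text \<open>\<open>stereo_coord\<close> is stereographic projection from the point opposite to
  \<open>base e\<close>, and \<open>stereo_point\<close> is its inverse.\<close>

definition "stereo_point u = (1 / (1 + (norm u)\<^sup>2)) *\<^sub>R ((1 - (norm u)\<^sup>2) *\<^sub>R base e + 2 *\<^sub>R L u)"

definition "stereo_coord y = (1 / (1 + base e \<bullet> y)) *\<^sub>R G y"

lemma bb: "base e \<bullet> base e = 1" by (simp add: dot_square_norm)

lemma pos: "1 + (norm u)\<^sup>2 > 0" for u :: "real^'d" by (simp add: add_pos_nonneg)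

lemma base_stereo_point: "base e \<bullet> stereo_point u = (1 - (norm u)\<^sup>2) / (1 + (norm u)\<^sup>2)"
  by (simp add: stereo_point_def inner_add_right bb base_L)

lemma norm_stereo_point: "norm (stereo_point u) = 1"
proof -
  let ?r = "(norm u)\<^sup>2"
  have LL: "L u \<bullet> L u = ?r" by (simp add: dot_square_norm norm_L)
  define k where "k = 1 / (1 + ?r)"
  have "stereo_point u \<bullet> stereo_point u = k\<^sup>2 * ((1 - ?r)\<^sup>2 + 4 * ?r)"
    unfolding stereo_point_def k_def[symmetric] inner_scaleR_left inner_scaleR_right inner_add_left inner_add_right bb base_L LL inner_commute[of "L u" "base e"]
    by (simp add: power2_eq_square algebra_simps)
  also have "(1 - ?r)\<^sup>2 + 4 * ?r = (1 + ?r)\<^sup>2" by (simp add: power2_eq_square algebra_simps)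
  finally have "stereo_point u \<bullet> stereo_point u = 1" using pos[of u] by (simp add: k_def power_divide)
  then show ?thesis by (simp add: norm_eq_sqrt_inner)
qed

lemma G_base: "G (base e) = 0"
proof -
  have "L (G (base e)) = 0" by (simp add: LG bb)
  then have "norm (G (base e)) = 0" by (metis norm_L norm_zero)
  then show ?thesis by simp
qed

lemma stereo_coord_point: "stereo_coord (stereo_point u) = u"
proof -
  let ?r = "(norm u)\<^sup>2"
  have "G (stereo_point u) = (1 / (1 + ?r)) *\<^sub>R 2 *\<^sub>R u"
    unfolding stereo_point_def by (simp add: linear_add[OF G] linear_scale[OF G] G_base GL)
  moreover have "1 + base e \<bullet> stereo_point u = 2 / (1 + ?r)" unfolding base_stereo_point using pos[of u] by (simp add: field_simps)
  ultimately show ?thesis unfolding stereo_coord_def using pos[of u] by (simp add: field_simps)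
qed

lemma stereo_point_coord: assumes y: "norm y = 1" and c: "base e \<bullet> y > -1"
  shows "stereo_point (stereo_coord y) = y" "(norm (stereo_coord y))\<^sup>2 = (1 - base e \<bullet> y) / (1 + base e \<bullet> y)"
proof -
  define c where "c = base e \<bullet> y"
  have c1: "1 + c > 0" using assms by (simp add: c_def)
  have yy: "y \<bullet> y = 1" using y by (simp add: dot_square_norm)
  have "(norm (G y))\<^sup>2 = L (G y) \<bullet> L (G y)" by (simp add: dot_square_norm norm_L)
  also have "\<dots> = 1 - c\<^sup>2"
    unfolding LG c_def[symmetric] inner_diff_left inner_diff_right inner_scaleR_left inner_scaleR_right bb yy inner_commute[of y "base e"]
    by (simp add: power2_eq_square c_def)
  finally have n: "(norm (G y))\<^sup>2 = (1 - c) * (1 + c)" by (simp add: power2_eq_square algebra_simps)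
  have r: "(norm (stereo_coord y))\<^sup>2 = (1 - c) / (1 + c)"
  proof -
    have "(1 / d)\<^sup>2 * (z * d) = z / d" if "d \<noteq> 0" for d z :: real using that by (simp add: power2_eq_square)
    then show ?thesis using c1 unfolding stereo_coord_def c_def[symmetric] norm_scaleR power_mult_distrib n by simp
  qed
  then show "(norm (stereo_coord y))\<^sup>2 = (1 - base e \<bullet> y) / (1 + base e \<bullet> y)" by (simp add: c_def)
  have d1: "1 + (1 - c) / (1 + c) = 2 / (1 + c)" and d2: "1 - (1 - c) / (1 + c) = 2 * c / (1 + c)"
    using c1 by (simp_all add: field_simps)
  have "stereo_point (stereo_coord y) = ((1 + c) / 2) *\<^sub>R ((2 * c / (1 + c)) *\<^sub>R base e + 2 *\<^sub>R (1 / (1 + c)) *\<^sub>R (y - c *\<^sub>R base e))"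
    unfolding stereo_point_def r d1 d2 by (simp add: stereo_coord_def linear_scale[OF L] LG c_def)
  also have "\<dots> = y"
  proof -
    have "(d / 2) *\<^sub>R ((2 * c / d) *\<^sub>R z + 2 *\<^sub>R (1 / d) *\<^sub>R w) = c *\<^sub>R z + w" if "d \<noteq> 0" for d and z w :: "'n cvec"
      using that by (simp add: scaleR_add_right)
    then show ?thesis using c1 by simp
  qed
  finally show "stereo_point (stereo_coord y) = y" .
qed

lemma Ck_stereo_point: "Ck_on k UNIV stereo_point"
proof -
  have o: "open (UNIV :: (real^'d) set)" by simp
  have n: "Ck_on k UNIV (\<lambda>u :: real^'d. (norm u)\<^sup>2)"
    unfolding power2_norm_eq_inner by (intro Ck_on_inner o Ck_on_linear bounded_linear_ident)
  have bl: "bounded_linear L" using L linear_conv_bounded_linear by blast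
  have p: "1 + (norm u)\<^sup>2 \<noteq> 0" for u :: "real^'d" using pos[of u] by linarith
  show ?thesis unfolding stereo_point_def[abs_def]
    by (intro Ck_on_scaleR Ck_on_divide Ck_on_add Ck_on_diff Ck_on_const o n Ck_on_linear bl p)
qed

lemma Ck_stereo_coord: assumes "open V" "\<And>y. y \<in> V \<Longrightarrow> base e \<bullet> y > -1" shows "Ck_on k V stereo_coord"
proof -
  have bl: "bounded_linear G" using G linear_conv_bounded_linear by blast
  have p: "1 + base e \<bullet> y \<noteq> 0" if "y \<in> V" for y using assms(2)[OF that] by linarith
  show ?thesis unfolding stereo_coord_def[abs_def]
    by (intro Ck_on_scaleR Ck_on_divide Ck_on_add Ck_on_const assms(1) Ck_on_linear bl bounded_linear_inner_right p)
qed

text \<open>The lift to \<open>Sp(n)\<close> of the stereographic parametrization around the point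
  \<open>B *v base e\<close>.\<close>

definition "lift B u = B ** refl_matrix e (stereo_point u)"

lemma base_stereo_point_pos: "base e \<bullet> stereo_point u > -1"
  unfolding base_stereo_point using pos[of u] by (simp add: field_simps)

lemma stereo_point_not_minus: "stereo_point u \<noteq> - base e"
  using base_stereo_point_pos[of u] bb by auto

lemma lift_Sp: "B \<in> Sp_on UNIV \<Longrightarrow> lift B u \<in> Sp_on UNIV"
  unfolding lift_def by (intro Sp_mult refl_matrix_Sp norm_stereo_point stereo_point_not_minus)

lemma lift_base: "lift B u *v base e = B *v stereo_point u"
  unfolding lift_def matrix_vector_mul_assoc[symmetric] refl_matrix_base[OF norm_stereo_point stereo_point_not_minus] ..

text \<open>Restricting to the unit ball keeps the points in an open hemisphere, which contains no two opposite
  points. This makes the same lift injective for both isotropy groups.\<close>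

lemma local_param_lift:
  assumes Gs: "Gs = {1} \<or> Gs = {1, -1}" and B: "B \<in> Sp_on UNIV"
  shows "local_param e (isotropy Gs e) (ball 0 1) (lift B)"
  unfolding local_param_def
proof (intro conjI)
  have o: "open (UNIV :: (real^'d) set)" by simp
  have Ck: "Ck_on k UNIV (lift B)" for k
    unfolding lift_def[abs_def]
    by (rule Ck_on_bounded_linear[OF bounded_linear_matrix_mult o Ck_on_refl_matrix[OF o Ck_stereo_point base_stereo_point_pos]])
  show "open (ball 0 1 :: (real^'d) set)" by simp
  show "smooth_map_on (ball 0 1) (lift B)" unfolding smooth_map_on_def using Ck_on_subset[OF Ck] by blast
  show "lift B ` ball 0 1 \<subseteq> Sp_on UNIV" using lift_Sp[OF B] by auto
  have Binj: "y = z" if "B *v y = B *v z" for y z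
  proof -
    have "ctranspose B *v (B *v y) = ctranspose B *v (B *v z)" using that by simp
    then show ?thesis by (simp add: matrix_vector_mul_assoc Sp_unitary[OF B])
  qed
  show "inj_on (\<lambda>u. lcoset (isotropy Gs e) (lift B u)) (ball 0 1)"
  proof (rule inj_onI)
    fix u u' :: "real^'d"
    assume u: "u \<in> ball 0 1" "u' \<in> ball 0 1" and "lcoset (isotropy Gs e) (lift B u) = lcoset (isotropy Gs e) (lift B u')"
    then obtain c where c: "c \<in> Gs" "lift B u *v base e = c *s (lift B u' *v base e)"
      using lcoset_eq_iff[OF Gs lift_Sp[OF B] lift_Sp[OF B]] by blast
    have p: "base e \<bullet> stereo_point v > 0" if "v \<in> ball 0 1" for v
    proof -
      have "(norm v)\<^sup>2 < 1" using that by (simp add: power_less_one_iff abs_square_less_1)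
      then show ?thesis unfolding base_stereo_point using pos[of v] by simp
    qed
    have "B *v stereo_point u = B *v (c *s stereo_point u')" using c(2) by (simp add: lift_base vector_scalar_commute)
    then have "stereo_point u = c *s stereo_point u'" by (rule Binj)
    moreover have "c = 1"
    proof (rule ccontr)
      assume "c \<noteq> 1"
      then have "c = -1" using Gs c(1) by auto
      then have "stereo_point u = - stereo_point u'" using \<open>stereo_point u = c *s stereo_point u'\<close> by (simp add: vec_eq_iff)
      then show False using p[OF u(1)] p[OF u(2)] by simp
    qed
    ultimately have "stereo_point u = stereo_point u'" by simp
    then show "u = u'" by (metis stereo_coord_point)
  qed
  show "\<forall>u\<in>ball 0 1. \<forall>v. matrix_inv (lift B u) ** frechet_derivative (lift B) (at u) v \<in> sp_on (- {e}) \<longrightarrow> v = 0"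
  proof (intro ballI allI impI)
    fix u v :: "real^'d"
    assume h: "matrix_inv (lift B u) ** frechet_derivative (lift B) (at u) v \<in> sp_on (- {e})"
    have "lift B u *v ((matrix_inv (lift B u) ** frechet_derivative (lift B) (at u) v) *v base e) = 0"
      unfolding base_of_complement[OF h] by simp
    then have D0: "frechet_derivative (lift B) (at u) v *v base e = 0"
      by (simp add: matrix_vector_mul_assoc Sp_mult_matrix_inv[OF lift_Sp[OF B]])
    have "((\<lambda>u. lift B u *v base e) has_derivative (\<lambda>w. frechet_derivative (lift B) (at u) w *v base e)) (at u)"
      by (rule bounded_linear.has_derivative[OF bounded_linear_mult_vec Ck_on_SucD(1)[OF Ck]]) simp
    moreover have dsx: "(stereo_point has_derivative frechet_derivative stereo_point (at u)) (at u)"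
      by (rule Ck_on_SucD(1)[OF Ck_stereo_point]) simp
    then have "((\<lambda>u. B *v stereo_point u) has_derivative (\<lambda>w. B *v frechet_derivative stereo_point (at u) w)) (at u)"
      by (rule bounded_linear.has_derivative[OF bounded_linear_matrix])
    ultimately have "(\<lambda>w. frechet_derivative (lift B) (at u) w *v base e) = (\<lambda>w. B *v frechet_derivative stereo_point (at u) w)"
      unfolding lift_base by (rule has_derivative_unique)
    then have "B *v frechet_derivative stereo_point (at u) v = B *v 0" using D0 by (metis matrix_vector_mult_0_right)
    then have s0: "frechet_derivative stereo_point (at u) v = 0" by (rule Binj)
    let ?V = "{y. base e \<bullet> y > -1}"
    have "(stereo_coord has_derivative frechet_derivative stereo_coord (at (stereo_point u))) (at (stereo_point u))"
      by (rule Ck_on_SucD(1)[OF Ck_stereo_coord[of ?V]]) (auto intro: open_halfspace_gt base_stereo_point_pos)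
    from diff_chain_at[OF dsx this] have "(id has_derivative frechet_derivative stereo_coord (at (stereo_point u)) \<circ> frechet_derivative stereo_point (at u)) (at u)"
      by (simp add: o_def stereo_coord_point id_def)
    then have "frechet_derivative stereo_coord (at (stereo_point u)) \<circ> frechet_derivative stereo_point (at u) = id"
      using has_derivative_unique has_derivative_id by blast
    then have "frechet_derivative stereo_coord (at (stereo_point u)) (frechet_derivative stereo_point (at u) v) = v" by (metis comp_apply id_apply)
    then show "v = 0" unfolding s0
      using linear_0[OF has_derivative_linear[OF \<open>(stereo_coord has_derivative _) _\<close>]] by simp
  qed
qed

end

section \<open>Functions on the homogeneous space as functions on the sphere\<close>

text \<open>The function on the sphere corresponding to a function on the homogeneous space, extended to be
  constant along rays. Functions on the ambient space can be differentiated without charts.\<close>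

definition sphere_ext :: "complex set \<Rightarrow> 'n::finite \<Rightarrow> ('n cmat set \<Rightarrow> complex) \<Rightarrow> 'n cvec \<Rightarrow> complex" where
  "sphere_ext Gs e f y = f (lcoset (isotropy Gs e) (SOME A. A \<in> Sp_on UNIV \<and> A *v base e = (1 / norm y) *\<^sub>R y))"

lemma sphere_ext_eq:
  assumes Gs: "Gs = {1} \<or> Gs = {1, -1}" and A: "A \<in> Sp_on UNIV" and y: "A *v base e = (1 / norm y) *\<^sub>R y"
  shows "sphere_ext Gs e f y = f (lcoset (isotropy Gs e) A)"
proof -
  let ?A = "SOME A. A \<in> Sp_on UNIV \<and> A *v base e = (1 / norm y) *\<^sub>R y"
  have "?A \<in> Sp_on UNIV \<and> ?A *v base e = (1 / norm y) *\<^sub>R y" by (rule someI[of _ A]) (use A y in blast)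
  then have "lcoset (isotropy Gs e) ?A = lcoset (isotropy Gs e) A"
    using lcoset_eq_iff[OF Gs _ A, of ?A e] y Gs by auto
  then show ?thesis by (simp add: sphere_ext_def)
qed

lemma sphere_ext_base: "Gs = {1} \<or> Gs = {1, -1} \<Longrightarrow> A \<in> Sp_on UNIV \<Longrightarrow> sphere_ext Gs e f (A *v base e) = f (lcoset (isotropy Gs e) A)"
  by (rule sphere_ext_eq) (auto simp: Sp_norm)

lemma sphere_ext_uminus:
  assumes "Gs = {1, -1}" shows "sphere_ext Gs e f (- y) = sphere_ext Gs e f y"
proof (cases "y = 0")
  case False
  then have n: "norm ((1 / norm y) *\<^sub>R y) = 1" by simp
  obtain A where A: "A \<in> Sp_on UNIV" "A *v base e = (1 / norm y) *\<^sub>R y" using Sp_transitive[OF n] by blast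
  have m: "- A *v base e = (1 / norm (- y)) *\<^sub>R (- y)" using A(2) by (simp add: vec_eq_iff mult_base)
  have "lcoset (isotropy Gs e) (- A) = lcoset (isotropy Gs e) A"
    unfolding lcoset_eq_iff[OF disjI2[OF assms] Sp_minus[OF A(1)] A(1)]
    using assms by (auto simp: vec_eq_iff mult_base intro!: bexI[of _ "-1"])
  then show ?thesis
    using sphere_ext_eq[OF disjI2[OF assms] Sp_minus[OF A(1)] m, of f] sphere_ext_eq[OF disjI2[OF assms] A, of f] by simp
qed simp

text \<open>Near a point the extension is the function in a stereographic parametrization, composed with the
  smooth inverse of that parametrization and the radial projection.\<close>

lemma Ck_sphere_ext:
  fixes e :: "'n::finite"
  assumes Gs: "Gs = {1} \<or> Gs = {1, -1}" and dim: "CARD('d::finite) + 1 = 4 * CARD('n)"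
    and f: "f \<in> smooth_functions TYPE('d) e (isotropy Gs e)"
  shows "Ck_on k (- {0}) (sphere_ext Gs e f)"
proof (rule Ck_on_cong_local)
  fix y0 :: "'n cvec" assume "y0 \<in> - {0}"
  then have y0: "y0 \<noteq> 0" by simp
  then have n: "norm ((1 / norm y0) *\<^sub>R y0) = 1" by simp
  obtain B where B: "B \<in> Sp_on UNIV" "B *v base e = (1 / norm y0) *\<^sub>R y0" using Sp_transitive[OF n] by blast
  obtain L :: "real^'d \<Rightarrow> 'n cvec" and G where "stereo e L G" using stereo_exists[OF dim] by blast
  then interpret stereo e L G .
  let ?C = "ctranspose B"
  have CB: "?C *v (B *v y) = y" and BC: "B *v (?C *v y) = y" for y
    by (simp_all add: matrix_vector_mul_assoc Sp_unitary[OF B(1)])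
  \<comment> \<open>The half space of points whose radial projections lie in the open hemisphere around
    \<open>B *v base e\<close>.\<close>
  define V where "V = {y. (B *v base e) \<bullet> y > 0}"
  have V: "open V" unfolding V_def by (rule open_halfspace_gt)
  have yV: "y0 \<in> V" using y0 by (simp add: V_def B(2) dot_square_norm power2_eq_square)
  have V0: "y \<noteq> 0" if "y \<in> V" for y using that by (auto simp: V_def)
  define z where "z y = ?C *v ((1 / norm y) *\<^sub>R y)" for y
  have nz: "norm (z y) = 1" if "y \<in> V" for y
    unfolding z_def using V0[OF that] by (simp add: Sp_norm[OF Sp_ctranspose[OF B(1)]])
  have bz: "base e \<bullet> z y > 0" if "y \<in> V" for y
  proof -
    have "base e \<bullet> z y = (B *v base e) \<bullet> (B *v z y)" by (simp add: Sp_inner[OF B(1)])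
    also have "\<dots> = (1 / norm y) * ((B *v base e) \<bullet> y)" by (simp add: z_def BC)
    finally show ?thesis using that V0[OF that] by (simp add: V_def)
  qed
  let ?h = "\<lambda>u. f (lcoset (isotropy Gs e) (lift B u))"
  have eq: "sphere_ext Gs e f y = ?h (stereo_coord (z y))" and inb: "stereo_coord (z y) \<in> ball 0 1" if "y \<in> V" for y
  proof -
    have b1: "base e \<bullet> z y > -1" using bz[OF that] by linarith
    have "lift B (stereo_coord (z y)) *v base e = (1 / norm y) *\<^sub>R y"
      unfolding lift_base stereo_point_coord(1)[OF nz[OF that] b1] by (simp add: z_def BC)
    then show "sphere_ext Gs e f y = ?h (stereo_coord (z y))" by (rule sphere_ext_eq[OF Gs lift_Sp[OF B(1)]])
    have "(norm (stereo_coord (z y)))\<^sup>2 < 1"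
      unfolding stereo_point_coord(2)[OF nz[OF that] b1] using bz[OF that] by simp
    then show "stereo_coord (z y) \<in> ball 0 1" by (simp add: power_less_one_iff abs_square_less_1)
  qed
  have Ckz: "Ck_on k V z"
    unfolding z_def[abs_def]
    by (intro Ck_on_bounded_linear[OF bounded_linear_matrix V] Ck_on_scaleR[OF V] Ck_on_divide[OF V] Ck_on_const[OF V]
        Ck_on_norm[OF V] Ck_on_linear[OF V] bounded_linear_ident) (auto dest: V0)
  let ?H = "{y. base e \<bullet> y > 0}"
  have H: "open ?H" by (rule open_halfspace_gt)
  have Cksp: "Ck_on k V (\<lambda>y. stereo_coord (z y))"
    by (rule Ck_on_compose[OF V H _ Ck_stereo_coord[OF H] Ckz]) (use bz in \<open>auto\<close>)
  have Ckh: "Ck_on k (ball 0 1) ?h"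
    using f local_param_lift[OF Gs B(1)] by (auto simp: smooth_functions_def smooth_map_on_def)
  have "Ck_on k V (\<lambda>y. ?h (stereo_coord (z y)))"
    by (rule Ck_on_compose[OF V _ _ Ckh Cksp]) (use inb in auto)
  then have "Ck_on k V (sphere_ext Gs e f)" using Ck_on_cong[OF V, of "sphere_ext Gs e f" "\<lambda>y. ?h (stereo_coord (z y))" k] eq by simp
  then show "\<exists>V. open V \<and> y0 \<in> V \<and> Ck_on k V (sphere_ext Gs e f)" using V yV by blast
qed

lemma lie_uminus:
  fixes F :: "'a::euclidean_space \<Rightarrow> complex"
  assumes "Ck_on (Suc 0) (- {0}) F" "\<And>y. y \<noteq> 0 \<Longrightarrow> F (- y) = F y" "linear A" "y \<noteq> 0"
  shows "lie A F (- y) = lie A F y"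
proof -
  have d: "(F has_derivative frechet_derivative F (at y)) (at y)" if "y \<noteq> 0" for y
    using Ck_on_SucD(1)[OF assms(1)] that by simp
  have u: "(uminus has_derivative uminus) (at y)" by (simp add: bounded_linear_imp_has_derivative bounded_linear_minus[OF bounded_linear_ident])
  have "((\<lambda>y. F (- y)) has_derivative (\<lambda>v. frechet_derivative F (at (- y)) (- v))) (at y)"
    using diff_chain_at[OF u, of F] d[of "- y"] assms(4) by (simp add: o_def)
  then have "(F has_derivative (\<lambda>v. frechet_derivative F (at (- y)) (- v))) (at y)"
    by (rule has_derivative_transform_within_open[of _ _ _ _ "- {0}"]) (use assms(2,4) in \<open>auto simp: open_Compl\<close>)
  then have "frechet_derivative F (at y) = (\<lambda>v. frechet_derivative F (at (- y)) (- v))"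
    using frechet_derivative_at by metis
  then show ?thesis by (simp add: lie_def linear_neg[OF assms(3)])
qed

lemma Ck_on_lie:
  fixes F :: "'a::euclidean_space \<Rightarrow> complex"
  assumes "open W" "Ck_on (Suc k) W F" "linear A"
  shows "Ck_on k W (lie A F)"
proof -
  have A: "bounded_linear A" using assms(3) linear_conv_bounded_linear by blast
  have "Ck_on k W (\<lambda>w. \<Sum>b\<in>Basis. (A w \<bullet> b) *\<^sub>R frechet_derivative F (at w) b)"
    by (intro Ck_on_sum Ck_on_scaleR Ck_on_inner Ck_on_const Ck_on_linear A assms(1) Ck_on_SucD(2)[OF assms(2)])
  moreover have "lie A F w = (\<Sum>b\<in>Basis. (A w \<bullet> b) *\<^sub>R frechet_derivative F (at w) b)" if "w \<in> W" for w
    unfolding lie_def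
    by (rule linear_basis_expand) (use Ck_on_SucD(1)[OF assms(2) that] has_derivative_linear in blast)
  ultimately show ?thesis using Ck_on_cong[OF assms(1)] by (metis (no_types, lifting))
qed

lemma sphere_op_uminus:
  fixes F :: "'a::euclidean_space \<Rightarrow> complex"
  assumes "Ck_on 2 (- {0}) F" "\<And>y. y \<noteq> 0 \<Longrightarrow> F (- y) = F y" "y \<noteq> 0" "\<And>s. linear (J s)"
  shows "sphere_op p q J F (- y) = sphere_op p q J F y"
proof -
  have C: "Ck_on (Suc (Suc 0)) (- {0}) F" using assms(1) by (simp add: numeral_2_eq_2)
  have o: "open (- {0::'a})" by (simp add: open_Compl)
  have *: "lie A (lie A F) (- y) = lie A (lie A F) y" if "linear A" for A
    by (rule lie_uminus[OF Ck_on_lie[OF o C that] lie_uminus[OF Ck_on_Suc_imp[OF C] assms(2) that] that assms(3)])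
  have "(\<Sum>b\<in>Basis. \<Sum>c\<in>Basis. lie (plane_rot b c) (lie (plane_rot b c) F) (- y)) =
      (\<Sum>b\<in>Basis. \<Sum>c\<in>Basis. lie (plane_rot b c) (lie (plane_rot b c) F) y)"
    by (intro sum.cong refl * linear_plane_rot)
  moreover have "(\<Sum>s<3. lie (J s) (lie (J s) F) (- y)) = (\<Sum>s<3. lie (J s) (lie (J s) F) y)"
    by (intro sum.cong refl * assms(4))
  ultimately show ?thesis unfolding sphere_op_def by simp
qed

text \<open>The value of \<open>sphere_op\<close> does not depend on the parametrization, so that all local
  parametrizations give the same Laplacian; two of them may differ by a sign on the sphere when
  \<open>Gs = {1, -1}\<close>, whence the assumption that \<open>F\<close> is even. At least one
  parametrization is needed for the value to be determined, and the lifted stereographic one around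
  the point serves for that.\<close>

lemma laplace_beltrami_eq_sphere_op:
  fixes e :: "'n::finite"
  assumes Gs: "Gs = {1} \<or> Gs = {1, -1}" and dim: "CARD('d::finite) + 1 = 4 * CARD('n)" and t: "t0 > 0" "t1 > 0"
    and F: "Ck_on 2 (- {0}) F" and even: "\<And>y. Gs = {1, -1} \<Longrightarrow> y \<noteq> 0 \<Longrightarrow> F (- y) = F y"
    and f: "\<And>A. A \<in> Sp_on UNIV \<Longrightarrow> f (lcoset (isotropy Gs e) A) = F (A *v base e)"
    and A: "A \<in> Sp_on UNIV"
  shows "laplace_beltrami TYPE('d) e (isotropy Gs e) t0 t1 f (lcoset (isotropy Gs e) A)
    = sphere_op (1 / (2 * t0)) (1 / t1) qunit F (A *v base e)"
    (is "_ = ?r")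
  unfolding laplace_beltrami_def
proof (rule the_equality)
  have nz: "B *v base e \<noteq> 0" if "B \<in> Sp_on UNIV" for B using Sp_norm[OF that, of "base e"] by auto
  have val: "local_laplacian (metric_matrix e t0 t1 \<sigma>) (\<lambda>v. f (lcoset (isotropy Gs e) (\<sigma> v))) u = ?r"
    if lp: "local_param e (isotropy Gs e) U \<sigma>" and u: "u \<in> U" and p: "lcoset (isotropy Gs e) (\<sigma> u) = lcoset (isotropy Gs e) A"
    for U and \<sigma> :: "real^'d \<Rightarrow> 'n cmat" and u
  proof -
    interpret sphere_chart qunit U "\<lambda>u. \<sigma> u *v base e" "2 * t0" t1 "metric_matrix e t0 t1 \<sigma>"
      by (rule lp_sphere_chart[OF lp dim t])
    have S: "\<sigma> u \<in> Sp_on UNIV" if "u \<in> U" for u by (rule lp_Sp[OF lp that])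
    let ?g = "metric_matrix e t0 t1 \<sigma>"
    have pd: "pderiv_on j (\<lambda>v. f (lcoset (isotropy Gs e) (\<sigma> v))) w = pderiv_on j (\<lambda>v. F (\<sigma> v *v base e)) w" if "w \<in> U" for j w
      by (rule pderiv_on_cong[OF U that]) (simp add: f S)
    have "local_laplacian ?g (\<lambda>v. f (lcoset (isotropy Gs e) (\<sigma> v))) u = local_laplacian ?g (\<lambda>v. F (\<sigma> v *v base e)) u"
      unfolding local_laplacian_def
      by (intro arg_cong[of _ _ uminus] arg_cong[of _ _ "scaleR _"] sum.cong refl pderiv_on_cong[OF U u]) (simp add: pd)
    also have "\<dots> = sphere_op (1 / (2 * t0)) (1 / t1) qunit F (\<sigma> u *v base e)"
      by (rule local_laplacian_eq_sphere_op[OF u F])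
    also obtain c where c: "c \<in> Gs" "\<sigma> u *v base e = c *s (A *v base e)"
      using p lcoset_eq_iff[OF Gs S[OF u] A] by blast
    have "sphere_op (1 / (2 * t0)) (1 / t1) qunit F (\<sigma> u *v base e) = ?r"
    proof (cases "c = 1")
      case True then show ?thesis using c by simp
    next
      case False
      then have G2: "Gs = {1, -1}" and "c = -1" using Gs c(1) by auto
      then have "\<sigma> u *v base e = - (A *v base e)" using c(2) by (simp add: vec_eq_iff)
      then show ?thesis using sphere_op_uminus[OF F even[OF G2] nz[OF A] quat.J_linear] by simp
    qed
    finally show ?thesis .
  qed
  show "\<forall>U (\<sigma> :: real^'d \<Rightarrow> 'n cmat). \<forall>u\<in>U. local_param e (isotropy Gs e) U \<sigma> \<and> lcoset (isotropy Gs e) (\<sigma> u) = lcoset (isotropy Gs e) A \<longrightarrow>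
    ?r = local_laplacian (metric_matrix e t0 t1 \<sigma>) (\<lambda>v. f (lcoset (isotropy Gs e) (\<sigma> v))) u"
    using val by metis
  fix y assume y: "\<forall>U (\<sigma> :: real^'d \<Rightarrow> 'n cmat). \<forall>u\<in>U. local_param e (isotropy Gs e) U \<sigma> \<and> lcoset (isotropy Gs e) (\<sigma> u) = lcoset (isotropy Gs e) A \<longrightarrow>
    y = local_laplacian (metric_matrix e t0 t1 \<sigma>) (\<lambda>v. f (lcoset (isotropy Gs e) (\<sigma> v))) u"
  obtain L :: "real^'d \<Rightarrow> 'n cvec" and G where "stereo e L G" using stereo_exists[OF dim] by blast
  then interpret stereo e L G .
  have lp: "local_param e (isotropy Gs e) (ball 0 1) (lift A)" by (rule local_param_lift[OF Gs A])
  have "lift A 0 *v base e = A *v base e" unfolding lift_base by (simp add: stereo_point_def linear_0[OF L])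
  then have p: "lcoset (isotropy Gs e) (lift A 0) = lcoset (isotropy Gs e) A"
    using lcoset_eq_iff[OF Gs lift_Sp[OF A] A] Gs by auto
  show "y = ?r"
    using y[THEN spec[of _ "ball 0 1"], THEN spec[of _ "lift A"], THEN bspec[of _ _ 0]] lp p val[OF lp _ p] by simp
qed

section \<open>Polynomial functions and their derivations\<close>

lemma fun_sum_apply: "(\<Sum>i\<in>A. f i) x = (\<Sum>i\<in>A. f i x)" for f :: "'a \<Rightarrow> 'b \<Rightarrow> 'c::comm_monoid_add"
  by (induction A rule: infinite_finite_induct) auto

text \<open>Polynomials in the coordinates and their conjugates are treated as functions. \<open>dz\<close> and
  \<open>dw\<close> are the Wirtinger derivatives, for which the coordinates \<open>zc\<close> and
  their conjugates \<open>wc\<close> are independent variables.\<close>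

definition zc :: "'i::finite \<Rightarrow> complex^'i \<Rightarrow> complex" where "zc i = (\<lambda>x. x $ i)"
definition wc :: "'i::finite \<Rightarrow> complex^'i \<Rightarrow> complex" where "wc i = (\<lambda>x. cnj (x $ i))"
definition dz :: "'i::finite \<Rightarrow> (complex^'i \<Rightarrow> complex) \<Rightarrow> complex^'i \<Rightarrow> complex" where
  "dz i f = (\<lambda>x. (frechet_derivative f (at x) (axis i 1) - \<i> * frechet_derivative f (at x) (axis i \<i>)) / 2)"
definition dw :: "'i::finite \<Rightarrow> (complex^'i \<Rightarrow> complex) \<Rightarrow> complex^'i \<Rightarrow> complex" where
  "dw i f = (\<lambda>x. (frechet_derivative f (at x) (axis i 1) + \<i> * frechet_derivative f (at x) (axis i \<i>)) / 2)"

inductive_set polys :: "(complex^'i::finite \<Rightarrow> complex) set" where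
  const: "(\<lambda>_. c) \<in> polys"
| zc: "zc i \<in> polys"
| wc: "wc i \<in> polys"
| add: "f \<in> polys \<Longrightarrow> g \<in> polys \<Longrightarrow> f + g \<in> polys"
| mult: "f \<in> polys \<Longrightarrow> g \<in> polys \<Longrightarrow> f * g \<in> polys"

lemma polys_add: "f \<in> polys \<Longrightarrow> g \<in> polys \<Longrightarrow> f + g \<in> polys"
  and polys_mult: "f \<in> polys \<Longrightarrow> g \<in> polys \<Longrightarrow> f * g \<in> polys"
  by (fact polys.add, fact polys.mult)

lemmas polys_intros = polys.const polys.zc polys.wc polys_add polys_mult

lemma polys_induct [consumes 1, case_names const zc wc add mult]:
  assumes "f \<in> polys" "\<And>c. P (\<lambda>_. c)" "\<And>i. P (zc i)" "\<And>i. P (wc i)"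
    and "\<And>f g. f \<in> polys \<Longrightarrow> P f \<Longrightarrow> g \<in> polys \<Longrightarrow> P g \<Longrightarrow> P (f + g)"
    and "\<And>f g. f \<in> polys \<Longrightarrow> P f \<Longrightarrow> g \<in> polys \<Longrightarrow> P g \<Longrightarrow> P (f * g)"
  shows "P f"
  using assms(1) by (induction rule: polys.induct) (use assms(2-) in \<open>simp_all add: plus_fun_def times_fun_def\<close>)

lemma polys_zero: "0 \<in> polys"
  using polys.const[of 0] by (simp add: zero_fun_def)

lemma polys_scale: "f \<in> polys \<Longrightarrow> (\<lambda>x. c * f x) \<in> polys"
  using polys_mult[OF polys.const[of c]] by (simp add: times_fun_def)

lemma polys_minus: "f \<in> polys \<Longrightarrow> - f \<in> polys"
  using polys_scale[of f "-1"] by (simp add: fun_Compl_def)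

lemma polys_diff: "f \<in> polys \<Longrightarrow> g \<in> polys \<Longrightarrow> f - g \<in> polys"
  using polys_add[OF _ polys_minus, of f g] by simp

lemma polys_sum: "(\<And>i. i \<in> I \<Longrightarrow> f i \<in> polys) \<Longrightarrow> (\<Sum>i\<in>I. f i) \<in> polys"
  by (induction I rule: infinite_finite_induct) (auto intro: polys_zero polys_add)

lemma Ck_polys: "f \<in> polys \<Longrightarrow> Ck_on k UNIV f"
proof (induction rule: polys_induct)
  case (zc i) then show ?case unfolding zc_def by (intro Ck_on_linear bounded_linear_vec_nth) simp
next
  case (wc i) then show ?case unfolding wc_def by (intro Ck_on_cnj Ck_on_linear bounded_linear_vec_nth) simp_all
next
  case (add f g) then show ?case unfolding plus_fun_def by (intro Ck_on_add) simp_all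
next
  case (mult f g) then show ?case unfolding times_fun_def by (intro Ck_on_mult) simp_all
qed (simp add: Ck_on_const)

lemma polys_has_derivative: "f \<in> polys \<Longrightarrow> (f has_derivative frechet_derivative f (at x)) (at x)"
  using Ck_on_SucD(1)[OF Ck_polys] by blast

lemma frechet_eqI: "(f has_derivative f') (at x) \<Longrightarrow> frechet_derivative f (at x) = f'"
  using frechet_derivative_at by metis

lemma frechet_add: "f \<in> polys \<Longrightarrow> g \<in> polys \<Longrightarrow> frechet_derivative (f + g) (at x) v = frechet_derivative f (at x) v + frechet_derivative g (at x) v"
  unfolding plus_fun_def by (subst frechet_eqI[OF has_derivative_add[OF polys_has_derivative polys_has_derivative]]) auto

lemma frechet_mult: "f \<in> polys \<Longrightarrow> g \<in> polys \<Longrightarrow> frechet_derivative (f * g) (at x) v = frechet_derivative f (at x) v * g x + f x * frechet_derivative g (at x) v"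
  unfolding times_fun_def by (subst frechet_eqI[OF has_derivative_mult[OF polys_has_derivative polys_has_derivative]]) auto

lemma frechet_zc: "frechet_derivative (zc i) (at x) v = v $ i"
  unfolding zc_def by (subst frechet_eqI[OF bounded_linear_imp_has_derivative[OF bounded_linear_vec_nth]]) auto

lemma frechet_wc: "frechet_derivative (wc i) (at x) v = cnj (v $ i)"
  unfolding wc_def
  by (subst frechet_eqI[OF bounded_linear_imp_has_derivative[OF bounded_linear_compose[OF bounded_linear_cnj bounded_linear_vec_nth]]]) auto

text \<open>A derivation of the algebra of polynomials is determined by its values on the coordinates
  (\<open>poly_deriv_eqI\<close>), and commutators of derivations are derivations. Identities
  between first order operators, such as the commutation relations of \<open>sl(2)\<close>, are
  checked on the generators in this way.\<close>

definition poly_deriv :: "((complex^'i::finite \<Rightarrow> complex) \<Rightarrow> complex^'i \<Rightarrow> complex) \<Rightarrow> bool" where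
  "poly_deriv D \<longleftrightarrow> (\<forall>f\<in>polys. D f \<in> polys) \<and>
     (\<forall>f\<in>polys. \<forall>g\<in>polys. D (f + g) = D f + D g \<and> D (f * g) = D f * g + f * D g) \<and> (\<forall>c. D (\<lambda>_. c) = 0)"

lemma poly_derivD:
  assumes "poly_deriv D"
  shows "f \<in> polys \<Longrightarrow> D f \<in> polys" "f \<in> polys \<Longrightarrow> g \<in> polys \<Longrightarrow> D (f + g) = D f + D g"
    "f \<in> polys \<Longrightarrow> g \<in> polys \<Longrightarrow> D (f * g) = D f * g + f * D g" "D (\<lambda>_. c) = 0"
  using assms by (auto simp: poly_deriv_def)

lemma poly_deriv_scale:
  assumes "poly_deriv D" "f \<in> polys" shows "D (\<lambda>x. c * f x) = (\<lambda>x. c * D f x)"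
  using poly_derivD(3)[OF assms(1) polys.const assms(2), of c] poly_derivD(4)[OF assms(1)]
  by (simp add: times_fun_def plus_fun_def)

lemma poly_deriv_zero: "poly_deriv D \<Longrightarrow> D 0 = 0"
  using poly_derivD(4)[of D 0] by (simp add: zero_fun_def)

lemma poly_deriv_diff: "poly_deriv D \<Longrightarrow> f \<in> polys \<Longrightarrow> g \<in> polys \<Longrightarrow> D (f - g) = D f - D g"
proof -
  assume D: "poly_deriv D" and f: "f \<in> polys" and g: "g \<in> polys"
  have "D (- g) = - D g" using poly_deriv_scale[OF D g, of "-1"] by (simp add: fun_Compl_def)
  then show ?thesis using poly_derivD(2)[OF D f polys_minus[OF g]] by simp
qed

lemma poly_deriv_sum: "poly_deriv D \<Longrightarrow> (\<And>i. i \<in> I \<Longrightarrow> f i \<in> polys) \<Longrightarrow> D (\<Sum>i\<in>I. f i) = (\<Sum>i\<in>I. D (f i))"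
  by (induction I rule: infinite_finite_induct) (auto simp: poly_deriv_zero poly_derivD(2) polys_sum)

lemma poly_deriv_eqI:
  assumes "poly_deriv D" "poly_deriv D'" "\<And>i. D (zc i) = D' (zc i)" "\<And>i. D (wc i) = D' (wc i)" "f \<in> polys"
  shows "D f = D' f"
  using assms(5)
  by (induction rule: polys_induct) (simp_all only: assms(3,4) poly_derivD[OF assms(1)] poly_derivD[OF assms(2)])

lemma poly_deriv_commutator:
  assumes A: "poly_deriv A" and B: "poly_deriv B"
  shows "poly_deriv (\<lambda>f. A (B f) - B (A f))"
  unfolding poly_deriv_def
proof (intro conjI ballI allI)
  fix f g :: "complex^'a \<Rightarrow> complex" assume f: "f \<in> polys" and g: "g \<in> polys"
  note p = poly_derivD(1)[OF A] poly_derivD(1)[OF B] f g polys_add polys_mult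
  show "A (B f) - B (A f) \<in> polys" by (intro polys_diff p)
  show "A (B (f + g)) - B (A (f + g)) = A (B f) - B (A f) + (A (B g) - B (A g))"
    by (simp add: poly_derivD(2)[OF A] poly_derivD(2)[OF B] p)
  show "A (B (f * g)) - B (A (f * g)) = (A (B f) - B (A f)) * g + f * (A (B g) - B (A g))"
    by (simp add: poly_derivD(2,3)[OF A] poly_derivD(2,3)[OF B] p algebra_simps)
next
  fix c show "A (B (\<lambda>_. c)) - B (A (\<lambda>_. c)) = 0"
    by (simp add: poly_derivD(4)[OF A] poly_derivD(4)[OF B] poly_deriv_zero[OF A] poly_deriv_zero[OF B])
qed

lemma poly_deriv_mult: "poly_deriv D \<Longrightarrow> g \<in> polys \<Longrightarrow> poly_deriv (\<lambda>f. g * D f)"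
  unfolding poly_deriv_def by (auto intro: polys_mult simp: algebra_simps)

lemma poly_deriv_add: "poly_deriv D \<Longrightarrow> poly_deriv D' \<Longrightarrow> poly_deriv (\<lambda>f. D f + D' f)"
  unfolding poly_deriv_def by (auto intro: polys_add simp: algebra_simps)

lemma poly_deriv_null: "poly_deriv (\<lambda>f. 0)"
  unfolding poly_deriv_def by (auto intro: polys_zero)

lemma poly_deriv_Sum: "(\<And>i. i \<in> I \<Longrightarrow> poly_deriv (D i)) \<Longrightarrow> poly_deriv (\<lambda>f. \<Sum>i\<in>I. D i f)"
proof (induction I rule: infinite_finite_induct)
  case (insert i I)
  have "poly_deriv (\<lambda>f. D i f + (\<Sum>i\<in>I. D i f))" by (rule poly_deriv_add) (use insert in auto)
  then show ?case by (simp only: sum.insert[OF insert.hyps])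
qed (simp_all add: poly_deriv_null)

lemma
  shows dz_zc: "dz i (zc j) = (\<lambda>_. if i = j then 1 else 0)" and dz_wc: "dz i (wc j) = 0"
    and dw_zc: "dw i (zc j) = 0" and dw_wc: "dw i (wc j) = (\<lambda>_. if i = j then 1 else 0)"
  by (auto simp: dz_def dw_def frechet_zc frechet_wc axis_def fun_eq_iff)

lemma poly_deriv_dz_dw:
  fixes i :: "'i::finite"
  shows "poly_deriv (dz i)" "poly_deriv (dw i)"
proof -
  have c: "dz i (\<lambda>_. c) = 0" "dw i (\<lambda>_. c) = 0" for c by (auto simp: dz_def dw_def fun_eq_iff)
  have a: "dz i (f + g) = dz i f + dz i g" "dw i (f + g) = dw i f + dw i g"
    "dz i (f * g) = dz i f * g + f * dz i g" "dw i (f * g) = dw i f * g + f * dw i g"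
    if "f \<in> polys" "g \<in> polys" for f g
    using that by (auto simp: dz_def dw_def fun_eq_iff frechet_add frechet_mult field_simps)
  have "dz i f \<in> polys \<and> dw i f \<in> polys" if "f \<in> polys" for f
    using that
  proof (induction rule: polys_induct)
    case (add f g) then show ?case by (simp only: a polys_add simp_thms)
  next
    case (mult f g) then show ?case by (simp only: a polys_add polys_mult simp_thms)
  qed (auto simp: c dz_zc dz_wc dw_zc dw_wc polys_zero polys.const)
  then show "poly_deriv (dz i)" "poly_deriv (dw i)" unfolding poly_deriv_def by (auto simp: a c)
qed

lemmas poly_deriv_dz = poly_deriv_dz_dw(1) and poly_deriv_dw = poly_deriv_dz_dw(2)

lemma polys_dz: "f \<in> polys \<Longrightarrow> dz i f \<in> polys" and polys_dw: "f \<in> polys \<Longrightarrow> dw i f \<in> polys"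
  using poly_derivD(1)[OF poly_deriv_dz] poly_derivD(1)[OF poly_deriv_dw] by blast+

lemma d_const: "dz i (\<lambda>_. c) = 0" "dw i (\<lambda>_. c) = 0"
  using poly_derivD(4)[OF poly_deriv_dz] poly_derivD(4)[OF poly_deriv_dw] by blast+

lemma d_0: "dz i 0 = 0" "dw i 0 = 0"
  using poly_deriv_zero[OF poly_deriv_dz] poly_deriv_zero[OF poly_deriv_dw] by blast+

lemma dz_dz: "f \<in> polys \<Longrightarrow> dz i (dz j f) = dz j (dz i f)"
  and dw_dw: "f \<in> polys \<Longrightarrow> dw i (dw j f) = dw j (dw i f)"
  and dz_dw: "f \<in> polys \<Longrightarrow> dz i (dw j f) = dw j (dz i f)"
  using poly_deriv_eqI[OF poly_deriv_commutator[OF poly_deriv_dz poly_deriv_dz] poly_deriv_null, of i j f]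
    poly_deriv_eqI[OF poly_deriv_commutator[OF poly_deriv_dw poly_deriv_dw] poly_deriv_null, of i j f]
    poly_deriv_eqI[OF poly_deriv_commutator[OF poly_deriv_dz poly_deriv_dw] poly_deriv_null, of i j f]
  by (simp_all add: dz_zc dz_wc dw_zc dw_wc d_const d_0)

lemma frechet_polys:
  assumes "f \<in> polys"
  shows "frechet_derivative f (at x) v = (\<Sum>i\<in>UNIV. v $ i * dz i f x + cnj (v $ i) * dw i f x)"
  using assms
proof (induction rule: polys_induct)
  case (zc j) show ?case by (simp add: frechet_zc dz_zc dw_zc if_distrib[of "\<lambda>c. _ * c"] cong: if_cong)
next
  case (wc j) show ?case by (simp add: frechet_wc dz_wc dw_wc if_distrib[of "\<lambda>c. _ * c"] cong: if_cong)
next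
  case (add f g)
  have "dz i (f + g) x = dz i f x + dz i g x" "dw i (f + g) x = dw i f x + dw i g x" for i
    by (simp_all only: poly_derivD(2)[OF poly_deriv_dz] poly_derivD(2)[OF poly_deriv_dw] plus_fun_apply add.hyps)
  then show ?case
    by (simp only: frechet_add add.hyps add.IH sum.distrib[symmetric]) (simp only: algebra_simps)
next
  case (mult f g)
  have d: "dz i (f * g) x = dz i f x * g x + f x * dz i g x" "dw i (f * g) x = dw i f x * g x + f x * dw i g x" for i
    by (simp_all only: poly_derivD(3)[OF poly_deriv_dz] poly_derivD(3)[OF poly_deriv_dw] plus_fun_apply times_fun_apply mult.hyps)
  show ?case
    unfolding frechet_mult[OF mult.hyps] mult.IH sum_distrib_left sum_distrib_right sum.distrib[symmetric] d
    by (intro sum.cong refl) (simp add: distrib_left distrib_right mult_ac)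
qed (simp add: d_const)

section \<open>The two commuting sl(2)-actions on polynomials\<close>

text \<open>\<open>Nz\<close> and \<open>Nw\<close> count the degrees in the coordinates and in their
  conjugates. \<open>Eop\<close> replaces a coordinate by a conjugate coordinate and
  \<open>Fop\<close> does the reverse; together with \<open>Nw - Nz\<close> they span the
  \<open>sl(2)\<close> of the fields \<open>qunit s\<close>, see \<open>lie_qunit1\<close> and
  \<open>lie_qunit2\<close>. \<open>Lap\<close>, multiplication by \<open>rad\<close> and the total
  degree, up to an additive constant, span a second \<open>sl(2)\<close>.\<close>

definition Nz :: "(complex^'i::finite \<Rightarrow> complex) \<Rightarrow> complex^'i \<Rightarrow> complex" where "Nz f = (\<Sum>i\<in>UNIV. zc i * dz i f)"
definition Nw :: "(complex^'i::finite \<Rightarrow> complex) \<Rightarrow> complex^'i \<Rightarrow> complex" where "Nw f = (\<Sum>i\<in>UNIV. wc i * dw i f)"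
definition Eop :: "('n::finite cvec \<Rightarrow> complex) \<Rightarrow> 'n cvec \<Rightarrow> complex" where
  "Eop f = (\<Sum>i\<in>UNIV. ((\<lambda>_. sg i) * wc (swp i)) * dz i f)"
definition Fop :: "('n::finite cvec \<Rightarrow> complex) \<Rightarrow> 'n cvec \<Rightarrow> complex" where
  "Fop f = (\<Sum>i\<in>UNIV. ((\<lambda>_. - sg i) * zc (swp i)) * dw i f)"
definition Lap :: "(complex^'i::finite \<Rightarrow> complex) \<Rightarrow> complex^'i \<Rightarrow> complex" where
  "Lap f = (\<Sum>i\<in>UNIV. dz i (dw i f))"
definition rad :: "complex^'i::finite \<Rightarrow> complex" where "rad = (\<Sum>i\<in>UNIV. zc i * wc i)"

lemma poly_deriv_ops: "poly_deriv Nz" "poly_deriv Nw" "poly_deriv Eop" "poly_deriv Fop"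
  unfolding Nz_def[abs_def] Nw_def[abs_def] Eop_def[abs_def] Fop_def[abs_def]
  by (intro poly_deriv_Sum poly_deriv_mult poly_deriv_dz poly_deriv_dw polys_intros)+

lemma rad_polys: "rad \<in> polys"
  unfolding rad_def by (intro polys_sum polys_intros)

lemma polys_ops: "f \<in> polys \<Longrightarrow> Nz f \<in> polys" "f \<in> polys \<Longrightarrow> Nw f \<in> polys" "f \<in> polys \<Longrightarrow> Eop f \<in> polys"
  "f \<in> polys \<Longrightarrow> Fop f \<in> polys" "f \<in> polys \<Longrightarrow> Lap f \<in> polys"
  using poly_deriv_ops poly_derivD(1) by (blast, blast, blast, blast) (auto simp: Lap_def intro: polys_sum polys_dz polys_dw)

lemma mult_delta: "f * (\<lambda>_. if P then 1 else 0) = (if P then f else 0)" for f :: "'a \<Rightarrow> complex"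
  by (auto simp: fun_eq_iff)

lemma ops_gen: "Nz (zc j) = zc j" "Nz (wc j) = 0" "Nw (zc j) = 0" "Nw (wc j) = wc j"
  by (simp_all add: Nz_def Nw_def dz_zc dz_wc dw_zc dw_wc mult_delta sum.delta)

lemma EF_gen: "Eop (zc j) = (\<lambda>_. sg j) * wc (swp j)" "Eop (wc j) = 0" "Fop (zc j) = 0" "Fop (wc j) = (\<lambda>_. - sg j) * zc (swp j)"
  by (simp_all add: Eop_def Fop_def dz_zc dz_wc dw_zc dw_wc mult_delta sum.delta)

lemma E_F: "f \<in> polys \<Longrightarrow> Eop (Fop f) - Fop (Eop f) = Nw f - Nz f"
proof -
  have n: "poly_deriv (\<lambda>f. Nw f - Nz f)"
    using poly_deriv_add[OF poly_deriv_ops(2) poly_deriv_mult[OF poly_deriv_ops(1) polys.const[of "-1"]]]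
    by (simp add: fun_eq_iff times_fun_def) (simp add: plus_fun_def fun_diff_def cong: if_cong)
  assume "f \<in> polys"
  then show ?thesis
    by (rule poly_deriv_eqI[OF poly_deriv_commutator[OF poly_deriv_ops(3,4)] n, rotated -1])
      (auto simp: EF_gen ops_gen poly_derivD(3,4)[OF poly_deriv_ops(3)] poly_derivD(3,4)[OF poly_deriv_ops(4)] polys_intros
        poly_deriv_zero[OF poly_deriv_ops(3)] poly_deriv_zero[OF poly_deriv_ops(4)] fun_eq_iff)
qed

lemma E_d: "f \<in> polys \<Longrightarrow> dz i (Eop f) = Eop (dz i f)"
    "f \<in> polys \<Longrightarrow> dw i (Eop f) = Eop (dw i f) + (\<lambda>_. - sg i) * dz (swp i) f"
  and F_d: "f \<in> polys \<Longrightarrow> dw i (Fop f) = Fop (dw i f)"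
    "f \<in> polys \<Longrightarrow> dz i (Fop f) = Fop (dz i f) + (\<lambda>_. sg i) * dw (swp i) f"
proof -
  note s = EF_gen dz_zc dz_wc dw_zc dw_wc d_const d_0 poly_derivD(3,4)[OF poly_deriv_dz] poly_derivD(3,4)[OF poly_deriv_dw] polys_intros
    poly_deriv_zero[OF poly_deriv_ops(3)] poly_deriv_zero[OF poly_deriv_ops(4)] poly_derivD(4)[OF poly_deriv_ops(3)] poly_derivD(4)[OF poly_deriv_ops(4)]
  have sw: "swp i = j \<longleftrightarrow> i = swp j" for i j :: "'a + 'a" by (metis swp_simps(3))
  assume f: "f \<in> polys"
  have "dz i (Eop f) - Eop (dz i f) = 0"
    by (rule poly_deriv_eqI[OF poly_deriv_commutator[OF poly_deriv_dz poly_deriv_ops(3)] poly_deriv_null _ _ f]) (auto simp: s)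
  then show "dz i (Eop f) = Eop (dz i f)" by simp
  have "dw i (Fop f) - Fop (dw i f) = 0"
    by (rule poly_deriv_eqI[OF poly_deriv_commutator[OF poly_deriv_dw poly_deriv_ops(4)] poly_deriv_null _ _ f]) (auto simp: s)
  then show "dw i (Fop f) = Fop (dw i f)" by simp
  have "dw i (Eop f) - Eop (dw i f) = (\<lambda>_. - sg i) * dz (swp i) f"
    by (rule poly_deriv_eqI[OF poly_deriv_commutator[OF poly_deriv_dw poly_deriv_ops(3)] poly_deriv_mult[OF poly_deriv_dz polys.const] _ _ f])
      (auto simp: s fun_eq_iff sw)
  then show "dw i (Eop f) = Eop (dw i f) + (\<lambda>_. - sg i) * dz (swp i) f" by (simp add: algebra_simps)
  have "dz i (Fop f) - Fop (dz i f) = (\<lambda>_. sg i) * dw (swp i) f"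
    by (rule poly_deriv_eqI[OF poly_deriv_commutator[OF poly_deriv_dz poly_deriv_ops(4)] poly_deriv_mult[OF poly_deriv_dw polys.const] _ _ f])
      (auto simp: s fun_eq_iff sw)
  then show "dz i (Fop f) = Fop (dz i f) + (\<lambda>_. sg i) * dw (swp i) f" by (simp add: algebra_simps)
qed

text \<open>The symplectic form contracted with a symmetric tensor.\<close>

lemma skew_sum_zero:
  fixes g :: "'n::finite + 'n \<Rightarrow> 'n + 'n \<Rightarrow> 'a \<Rightarrow> complex"
  assumes "\<And>i j. g i j = g j i"
  shows "(\<Sum>i\<in>UNIV. (\<lambda>_. sg i) * g i (swp i)) = 0"
proof -
  let ?S = "\<Sum>i\<in>UNIV. (\<lambda>_. sg i) * g i (swp i)"
  have "?S = (\<Sum>i\<in>UNIV. (\<lambda>_. sg (swp i)) * g (swp i) (swp (swp i)))" by (rule sum_swp[symmetric])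
  also have "\<dots> = (\<Sum>i\<in>UNIV. - ((\<lambda>_. sg i) * g i (swp i)))"
    using assms[of "swp _" _] by (intro sum.cong refl) (auto simp: fun_eq_iff assms[of "swp _"])
  also have "\<dots> = - ?S" by (simp add: sum_negf)
  finally have e: "?S = - ?S" .
  have "?S x = 0" for x using fun_cong[OF e, of x] by simp
  then show ?thesis by (simp only: fun_eq_iff zero_fun_apply) simp
qed

text \<open>The correction terms in \<open>E_d\<close> and \<open>F_d\<close> contract the symplectic form with
  second derivatives, so they cancel in the sum by \<open>skew_sum_zero\<close>.\<close>

lemma Lap_E: "f \<in> polys \<Longrightarrow> Lap (Eop f) = Eop (Lap f)"
  and Lap_F: "f \<in> polys \<Longrightarrow> Lap (Fop f) = Fop (Lap f)"
proof -
  assume f: "f \<in> polys"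
  have "Lap (Eop f) = (\<Sum>i\<in>UNIV. Eop (dz i (dw i f)) - (\<lambda>_. sg i) * dz i (dz (swp i) f))"
    unfolding Lap_def
    by (intro sum.cong refl) (simp add: E_d f poly_derivD(2,3)[OF poly_deriv_dz] d_const polys_ops polys_dz polys_dw polys_intros, simp add: fun_eq_iff)
  also have "\<dots> = Eop (Lap f)"
    unfolding sum_subtractf skew_sum_zero[of "\<lambda>i j. dz i (dz j f)", OF dz_dz[OF f]]
    by (simp add: Lap_def poly_deriv_sum[OF poly_deriv_ops(3)] polys_dz polys_dw f)
  finally show "Lap (Eop f) = Eop (Lap f)" .
  have "Lap (Fop f) = (\<Sum>i\<in>UNIV. Fop (dz i (dw i f)) + (\<lambda>_. sg i) * dw i (dw (swp i) f))"
    unfolding Lap_def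
    by (intro sum.cong refl) (simp add: F_d f dw_dw polys_ops polys_dz polys_dw polys_intros)
  also have "\<dots> = Fop (Lap f)"
    unfolding sum.distrib skew_sum_zero[of "\<lambda>i j. dw i (dw j f)", OF dw_dw[OF f]]
    by (simp add: Lap_def poly_deriv_sum[OF poly_deriv_ops(4)] polys_dz polys_dw f)
  finally show "Lap (Fop f) = Fop (Lap f)" .
qed

text \<open>The relation of the second \<open>sl(2)\<close>.\<close>

lemma Lap_rad:
  fixes f :: "complex^'i::finite \<Rightarrow> complex"
  assumes f: "f \<in> polys"
  shows "Lap (rad * f) = rad * Lap f + (\<lambda>_. of_nat CARD('i)) * f + Nz f + Nw f"
proof -
  have r: "dz i rad = wc i" "dw i rad = zc i" for i :: 'i
    unfolding rad_def
    by (simp_all add: poly_deriv_sum[OF poly_deriv_dz] poly_deriv_sum[OF poly_deriv_dw] polys_intros poly_derivD(3)[OF poly_deriv_dz] poly_derivD(3)[OF poly_deriv_dw]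
        dz_zc dz_wc dw_zc dw_wc mult_delta mult.commute[of "\<lambda>_. _"] sum.delta)
  have "dz i (dw i (rad * f)) = rad * dz i (dw i f) + f + zc i * dz i f + wc i * dw i f" for i
    by (simp add: poly_derivD(2,3)[OF poly_deriv_dz] poly_derivD(3)[OF poly_deriv_dw] r rad_polys f polys_intros polys_dw dz_zc)
      (simp add: fun_eq_iff)
  then have "Lap (rad * f) = (\<Sum>i\<in>UNIV. rad * dz i (dw i f) + f + zc i * dz i f + wc i * dw i f)"
    unfolding Lap_def by simp
  also have "\<dots> = rad * Lap f + (\<Sum>i\<in>(UNIV::'i set). f) + Nz f + Nw f"
    by (simp add: sum.distrib Lap_def Nz_def Nw_def sum_distrib_left)
  also have "(\<Sum>i\<in>(UNIV::'i set). f) = (\<lambda>_. of_nat CARD('i)) * f" by (simp add: fun_eq_iff fun_sum_apply)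
  finally show ?thesis .
qed

text \<open>From here on equations between functions are mostly rewritten as equations in the algebra of functions;
  the pointwise rules are applied on demand.\<close>

declare plus_fun_apply [simp del] times_fun_apply [simp del] zero_fun_apply [simp del] uminus_apply [simp del] minus_apply [simp del]
lemmas pointwise = fun_eq_iff plus_fun_apply times_fun_apply zero_fun_apply uminus_apply minus_apply fun_sum_apply

section \<open>Bihomogeneous polynomials\<close>

text \<open>Bihomogeneous polynomials of degree \<open>p\<close> in the coordinates and \<open>q\<close> in
  their conjugates. The rules build them from monomials, which gives an induction principle; zero
  has all bidegrees.\<close>

inductive bihom :: "nat \<Rightarrow> nat \<Rightarrow> (complex^'i::finite \<Rightarrow> complex) \<Rightarrow> bool" where
  zero: "bihom p q 0"
| const: "bihom 0 0 (\<lambda>_. c)"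
| zc: "bihom p q f \<Longrightarrow> bihom (Suc p) q (zc i * f)"
| wc: "bihom p q f \<Longrightarrow> bihom p (Suc q) (wc i * f)"
| add: "bihom p q f \<Longrightarrow> bihom p q g \<Longrightarrow> bihom p q (f + g)"

lemma bihom_polys: "bihom p q f \<Longrightarrow> f \<in> polys"
  by (induction rule: bihom.induct) (auto intro: polys_intros polys_zero)

lemma bihom_scale: "bihom p q f \<Longrightarrow> bihom p q (\<lambda>x. c * f x)"
proof (induction rule: bihom.induct)
  case (zero p q)
  have "(\<lambda>x::complex^'a. c * 0 x) = 0" by (simp add: pointwise)
  then show ?case by (simp only: bihom.zero)
next
  case (const d) show ?case by (rule bihom.const)
next
  case (zc p q f i)
  have "(\<lambda>x. c * (zc i * f) x) = zc i * (\<lambda>x. c * f x)" by (simp add: pointwise)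
  then show ?case using bihom.zc[OF zc.IH] by simp
next
  case (wc p q f i)
  have "(\<lambda>x. c * (wc i * f) x) = wc i * (\<lambda>x. c * f x)" by (simp add: pointwise)
  then show ?case using bihom.wc[OF wc.IH] by simp
next
  case (add p q f g)
  have "(\<lambda>x. c * (f + g) x) = (\<lambda>x. c * f x) + (\<lambda>x. c * g x)" by (simp add: pointwise algebra_simps)
  then show ?case using bihom.add[OF add.IH] by simp
qed

lemma bihom_minus: "bihom p q f \<Longrightarrow> bihom p q (- f)"
  using bihom_scale[of p q f "-1"] by (simp add: fun_Compl_def)

lemma bihom_diff: "bihom p q f \<Longrightarrow> bihom p q g \<Longrightarrow> bihom p q (f - g)"
  using bihom.add[OF _ bihom_minus, of p q f g] by simp

lemma bihom_sum: "(\<And>i. i \<in> I \<Longrightarrow> bihom p q (f i)) \<Longrightarrow> bihom p q (\<Sum>i\<in>I. f i)"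
  by (induction I rule: infinite_finite_induct) (auto intro: bihom.zero bihom.add)

lemma bihom_mult: "bihom p q f \<Longrightarrow> bihom p' q' g \<Longrightarrow> bihom (p + p') (q + q') (f * g)"
proof (induction rule: bihom.induct)
  case (const c)
  have "(\<lambda>_. c) * g = (\<lambda>x. c * g x)" by (simp add: pointwise)
  then show ?case using bihom_scale[OF const] by simp
next
  case (zc p q f i) then show ?case using bihom.zc[of "p + p'" "q + q'" "f * g" i] by (simp add: mult.assoc)
next
  case (wc p q f i) then show ?case using bihom.wc[of "p + p'" "q + q'" "f * g" i] by (simp add: mult.assoc)
next
  case (add p q f g') then show ?case using bihom.add by (simp add: distrib_right)
qed (simp add: bihom.zero)

lemma bihom_cnj: "bihom p q f \<Longrightarrow> bihom q p (\<lambda>x. cnj (f x))"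
proof (induction rule: bihom.induct)
  case (zero p q)
  have "(\<lambda>x::complex^'a. cnj (0 x)) = 0" by (simp add: pointwise)
  then show ?case by (simp only: bihom.zero)
next
  case (const c) show ?case by (rule bihom.const)
next
  case (zc p q f i)
  have "(\<lambda>x. cnj ((zc i * f) x)) = wc i * (\<lambda>x. cnj (f x))" by (simp add: pointwise zc_def wc_def)
  then show ?case using bihom.wc[OF zc.IH] by simp
next
  case (wc p q f i)
  have "(\<lambda>x. cnj ((wc i * f) x)) = zc i * (\<lambda>x. cnj (f x))" by (simp add: pointwise zc_def wc_def)
  then show ?case using bihom.zc[OF wc.IH] by simp
next
  case (add p q f g)
  have "(\<lambda>x. cnj ((f + g) x)) = (\<lambda>x. cnj (f x)) + (\<lambda>x. cnj (g x))" by (simp add: pointwise)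
  then show ?case using bihom.add[OF add.IH] by simp
qed

lemma bihom_uminus: "bihom p q f \<Longrightarrow> f (- x) = (-1) ^ (p + q) * f x"
  by (induction rule: bihom.induct) (simp_all add: pointwise zc_def wc_def algebra_simps)

lemma delta_mult: "(\<lambda>_. if P then 1 else 0) * f = (if P then f else 0)" for f :: "'a \<Rightarrow> complex"
  by (auto simp: pointwise)

lemma
  assumes f: "f \<in> polys"
  shows dz_mult: "dz i (zc j * f) = (if i = j then f else 0) + zc j * dz i f" "dz i (wc j * f) = wc j * dz i f"
    and dw_mult: "dw i (wc j * f) = (if i = j then f else 0) + wc j * dw i f" "dw i (zc j * f) = zc j * dw i f"
  unfolding poly_derivD(3)[OF poly_deriv_dz polys.zc f] poly_derivD(3)[OF poly_deriv_dz polys.wc f]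
    poly_derivD(3)[OF poly_deriv_dw polys.zc f] poly_derivD(3)[OF poly_deriv_dw polys.wc f] dz_zc dz_wc dw_zc dw_wc delta_mult
  by simp_all

lemma bihom_dz: "bihom p q f \<Longrightarrow> (p = 0 \<longrightarrow> dz i f = 0) \<and> (\<forall>p'. p = Suc p' \<longrightarrow> bihom p' q (dz i f))"
proof (induction rule: bihom.induct)
  case (zc p q f j)
  have "bihom p q (zc j * dz i f)"
  proof (cases p)
    case 0 then have "zc j * dz i f = 0" using zc.IH by simp
    then show ?thesis by (simp only: bihom.zero)
  next
    case (Suc p') then show ?thesis using zc.IH bihom.zc by blast
  qed
  moreover have "bihom p q (if i = j then f else 0)" using zc.hyps bihom.zero by auto
  ultimately show ?case unfolding dz_mult(1)[OF bihom_polys[OF zc.hyps]] using bihom.add by blast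
next
  case (wc p q f j)
  then show ?case unfolding dz_mult(2)[OF bihom_polys[OF wc.hyps]] by (auto intro: bihom.wc)
next
  case (add p q f g)
  then show ?case unfolding poly_derivD(2)[OF poly_deriv_dz bihom_polys[OF add.hyps(1)] bihom_polys[OF add.hyps(2)]]
    by (auto intro: bihom.add)
qed (simp_all only: d_0 d_const bihom.zero simp_thms)

lemma bihom_dw: "bihom p q f \<Longrightarrow> (q = 0 \<longrightarrow> dw i f = 0) \<and> (\<forall>q'. q = Suc q' \<longrightarrow> bihom p q' (dw i f))"
proof (induction rule: bihom.induct)
  case (wc p q f j)
  have "bihom p q (wc j * dw i f)"
  proof (cases q)
    case 0 then have "wc j * dw i f = 0" using wc.IH by simp
    then show ?thesis by (simp only: bihom.zero)
  next
    case (Suc p') then show ?thesis using wc.IH bihom.wc by blast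
  qed
  moreover have "bihom p q (if i = j then f else 0)" using wc.hyps bihom.zero by auto
  ultimately show ?case unfolding dw_mult(1)[OF bihom_polys[OF wc.hyps]] using bihom.add by blast
next
  case (zc p q f j)
  then show ?case unfolding dw_mult(2)[OF bihom_polys[OF zc.hyps]] by (auto intro: bihom.zc)
next
  case (add p q f g)
  then show ?case unfolding poly_derivD(2)[OF poly_deriv_dw bihom_polys[OF add.hyps(1)] bihom_polys[OF add.hyps(2)]]
    by (auto intro: bihom.add)
qed (simp_all only: d_0 d_const bihom.zero simp_thms)

lemma bihom_const_mult: "bihom p q f \<Longrightarrow> bihom p q ((\<lambda>_. c) * f)"
  using bihom_scale[of p q f c] by (simp add: times_fun_def)

lemma bihom_E: "bihom (Suc p) q f \<Longrightarrow> bihom p (Suc q) (Eop f)" "bihom 0 q f \<Longrightarrow> Eop f = 0"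
  and bihom_F: "bihom p (Suc q) f \<Longrightarrow> bihom (Suc p) q (Fop f)"
proof -
  show "bihom (Suc p) q f \<Longrightarrow> bihom p (Suc q) (Eop f)"
    unfolding Eop_def using bihom_dz[of "Suc p" q f] by (auto intro!: bihom_sum bihom_const_mult bihom.wc simp: mult.assoc)
  show "bihom 0 q f \<Longrightarrow> Eop f = 0"
    unfolding Eop_def using bihom_dz[of 0 q f] by simp
  show "bihom p (Suc q) f \<Longrightarrow> bihom (Suc p) q (Fop f)"
    unfolding Fop_def using bihom_dw[of p "Suc q" f] by (auto intro!: bihom_sum bihom_const_mult bihom.zc simp: mult.assoc)
qed

lemma bihom_Lap: "bihom (Suc p) (Suc q) f \<Longrightarrow> bihom p q (Lap f)"
  unfolding Lap_def using bihom_dw[of "Suc p" "Suc q" f] bihom_dz[of "Suc p" q] by (auto intro!: bihom_sum)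

lemma bihom_Lap_0: "bihom 0 q f \<Longrightarrow> Lap f = 0"
proof -
  assume h: "bihom 0 q f"
  have "dz i (dw i f) = 0" for i
    unfolding dz_dw[OF bihom_polys[OF h]] using bihom_dz[OF h, of i] by (simp add: d_0)
  then show "Lap f = 0" unfolding Lap_def by simp
qed

lemma bihom_Lap_0': "bihom p 0 f \<Longrightarrow> Lap f = 0"
  unfolding Lap_def using bihom_dw[of p 0 f] by (simp add: d_0)

lemma bihom_rad: "bihom p q f \<Longrightarrow> bihom (Suc p) (Suc q) (rad * f)"
  unfolding rad_def sum_distrib_right by (auto intro!: bihom_sum bihom.zc bihom.wc simp: mult.assoc)

lemma Nz_Nw_mult: "f \<in> polys \<Longrightarrow> Nz (zc i * f) = zc i * f + zc i * Nz f" "f \<in> polys \<Longrightarrow> Nz (wc i * f) = wc i * Nz f"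
  "f \<in> polys \<Longrightarrow> Nw (wc i * f) = wc i * f + wc i * Nw f" "f \<in> polys \<Longrightarrow> Nw (zc i * f) = zc i * Nw f"
  by (simp_all add: poly_derivD(3)[OF poly_deriv_ops(1)] poly_derivD(3)[OF poly_deriv_ops(2)] polys_intros ops_gen)

lemma bihom_Nz: "bihom p q f \<Longrightarrow> Nz f = (\<lambda>x. of_nat p * f x) \<and> Nw f = (\<lambda>x. of_nat q * f x)"
proof (induction rule: bihom.induct)
  case (zero p q) show ?case unfolding poly_deriv_zero[OF poly_deriv_ops(1)] poly_deriv_zero[OF poly_deriv_ops(2)] by (simp add: pointwise)
next
  case (const c) show ?case by (simp add: poly_derivD(4)[OF poly_deriv_ops(1)] poly_derivD(4)[OF poly_deriv_ops(2)] pointwise)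
next
  case (zc p q f i)
  then show ?case unfolding Nz_Nw_mult[OF bihom_polys[OF zc.hyps]] by (simp add: pointwise algebra_simps)
next
  case (wc p q f i)
  then show ?case unfolding Nz_Nw_mult[OF bihom_polys[OF wc.hyps]] by (simp add: pointwise algebra_simps)
next
  case (add p q f g)
  then show ?case
    unfolding poly_derivD(2)[OF poly_deriv_ops(1) bihom_polys[OF add.hyps(1)] bihom_polys[OF add.hyps(2)]]
      poly_derivD(2)[OF poly_deriv_ops(2) bihom_polys[OF add.hyps(1)] bihom_polys[OF add.hyps(2)]]
    by (simp add: pointwise algebra_simps)
qed

section \<open>Decomposition into highest weight vectors\<close>

definition harm :: "nat \<Rightarrow> nat \<Rightarrow> (complex^'i::finite \<Rightarrow> complex) \<Rightarrow> bool" where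
  "harm p q f \<longleftrightarrow> bihom p q f \<and> Lap f = 0"

text \<open>Harmonic highest weight vectors for \<open>sl(2)\<close>: the weight of a function of bidegree
  \<open>(p, q)\<close> is \<open>q - p\<close>, and \<open>Eop\<close> raises it by
  \<open>2\<close>.\<close>

definition hw :: "nat \<Rightarrow> nat \<Rightarrow> ('n::finite cvec \<Rightarrow> complex) \<Rightarrow> bool" where
  "hw p q f \<longleftrightarrow> harm p q f \<and> Eop f = 0"

lemma harm_polys: "harm p q f \<Longrightarrow> f \<in> polys" and hw_polys: "hw p q g \<Longrightarrow> g \<in> polys"
  by (auto simp: harm_def hw_def bihom_polys)

lemma Lap_add: "f \<in> polys \<Longrightarrow> g \<in> polys \<Longrightarrow> Lap (f + g) = Lap f + Lap g"
  by (simp only: Lap_def poly_derivD(2)[OF poly_deriv_dw] poly_derivD(2)[OF poly_deriv_dz] polys_dw sum.distrib)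

lemma Lap_scale: "f \<in> polys \<Longrightarrow> Lap (\<lambda>x. c * f x) = (\<lambda>x. c * Lap f x)"
  by (simp only: Lap_def poly_deriv_scale[OF poly_deriv_dw] poly_deriv_scale[OF poly_deriv_dz] polys_dw)
    (simp add: pointwise sum_distrib_left)

lemma Lap_zero: "Lap 0 = 0"
  by (simp add: Lap_def d_0)

lemma Lap_diff: "f \<in> polys \<Longrightarrow> g \<in> polys \<Longrightarrow> Lap (f - g) = Lap f - Lap g"
  by (simp only: Lap_def poly_deriv_diff[OF poly_deriv_dw] poly_deriv_diff[OF poly_deriv_dz] polys_dw sum_subtractf)

lemmas Lap_linear = Lap_add Lap_scale Lap_zero Lap_diff

lemma Lap_sum: "(\<And>i. i \<in> I \<Longrightarrow> f i \<in> polys) \<Longrightarrow> Lap (\<Sum>i\<in>I. f i) = (\<Sum>i\<in>I. Lap (f i))"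
  by (induction I rule: infinite_finite_induct) (auto simp: Lap_linear polys_sum)

lemma F_pow:
  assumes "bihom l m v"
  shows "j \<le> m \<Longrightarrow> bihom (l + j) (m - j) ((Fop ^^ j) v)"
proof (induction j)
  case (Suc j)
  then have "bihom (l + j) (Suc (m - Suc j)) ((Fop ^^ j) v)" by (simp add: Suc_diff_Suc)
  from bihom_F[OF this] show ?case by simp
qed (simp add: assms)

lemma F_pow_polys: "v \<in> polys \<Longrightarrow> (Fop ^^ j) v \<in> polys"
  by (induction j) (auto intro: polys_ops)

lemma F_pow_scale: "v \<in> polys \<Longrightarrow> (Fop ^^ j) (\<lambda>x. c * v x) = (\<lambda>x. c * (Fop ^^ j) v x)"
  by (induction j) (simp_all add: poly_deriv_scale[OF poly_deriv_ops(4)] F_pow_polys)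

lemma F_pow_add: "v \<in> polys \<Longrightarrow> u \<in> polys \<Longrightarrow> (Fop ^^ j) (v + u) = (Fop ^^ j) v + (Fop ^^ j) u"
proof (induction j)
  case (Suc j) then show ?case by (simp only: funpow.simps o_apply poly_derivD(2)[OF poly_deriv_ops(4)] F_pow_polys)
qed simp

lemma F_pow_harm: "harm l m v \<Longrightarrow> j \<le> m \<Longrightarrow> harm (l + j) (m - j) ((Fop ^^ j) v)"
proof -
  assume h: "harm l m v" and j: "j \<le> m"
  have "Lap ((Fop ^^ j) v) = 0"
    by (induction j) (use h in \<open>auto simp: harm_def Lap_F F_pow_polys bihom_polys poly_deriv_zero[OF poly_deriv_ops(4)]\<close>)
  then show ?thesis using F_pow[OF _ j] h by (auto simp: harm_def)
qed

text \<open>The usual computation in a highest weight module: \<open>v\<close> has weight \<open>m - l\<close>.\<close>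

lemma E_F_pow:
  assumes v: "hw l m v"
  shows "Suc j \<le> m \<Longrightarrow> Eop ((Fop ^^ Suc j) v) = (\<lambda>x. (of_nat (Suc j) * (of_nat m - of_nat l - of_nat j)) * (Fop ^^ j) v x)"
proof (induction j)
  case 0
  have "Eop (Fop v) = Fop (Eop v) + (Nw v - Nz v)" using E_F[OF hw_polys[OF v]] by (simp add: algebra_simps)
  also have "Fop (Eop v) = 0" using v by (simp add: hw_def poly_deriv_zero[OF poly_deriv_ops(4)])
  finally show ?case using bihom_Nz[of l m v] v by (simp add: hw_def harm_def pointwise algebra_simps)
next
  case (Suc j)
  let ?g = "(Fop ^^ Suc j) v"
  have g: "?g \<in> polys" by (rule F_pow_polys[OF hw_polys[OF v]])
  have b: "bihom (l + Suc j) (m - Suc j) ?g" using v Suc.prems by (intro F_pow) (auto simp: hw_def harm_def)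
  have "Eop (Fop ?g) = Fop (Eop ?g) + (Nw ?g - Nz ?g)" using E_F[OF g] by (simp add: algebra_simps)
  also have "Fop (Eop ?g) = (\<lambda>x. (of_nat (Suc j) * (of_nat m - of_nat l - of_nat j)) * ?g x)"
    unfolding Suc.IH[OF Suc_leD[OF Suc.prems]] poly_deriv_scale[OF poly_deriv_ops(4) F_pow_polys[OF hw_polys[OF v]]] by simp
  also have "Nw ?g - Nz ?g = (\<lambda>x. (of_nat m - of_nat (Suc j) - of_nat (l + Suc j)) * ?g x)"
    using bihom_Nz[OF b] Suc.prems by (simp add: pointwise algebra_simps of_nat_diff)
  finally show ?case by (simp add: pointwise algebra_simps)
qed

text \<open>The coefficients in \<open>E_F_pow\<close> do not vanish before the lowest weight is reached.\<close>

lemma F_pow_inj: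
  assumes v: "hw l m v" and j: "l + j \<le> m" and z: "(Fop ^^ j) v = 0"
  shows "v = 0"
  using j z
proof (induction j)
  case (Suc j)
  have "(\<lambda>x. (of_nat (Suc j) * (of_nat m - of_nat l - of_nat j)) * (Fop ^^ j) v x) = Eop 0"
    using E_F_pow[OF v, of j] Suc.prems by simp
  also have "\<dots> = 0" by (rule poly_deriv_zero[OF poly_deriv_ops(3)])
  finally have "of_nat (Suc j) * (of_nat m - of_nat l - of_nat j) * (Fop ^^ j) v x = 0" for x
    by (simp only: fun_eq_iff zero_fun_apply)
  moreover have "(of_nat (Suc j) * (of_nat m - of_nat l - of_nat j) :: complex) \<noteq> 0"
  proof -
    have "(of_nat m - of_nat l - of_nat j :: complex) = of_nat (m - l - j)" using Suc.prems by (simp add: of_nat_diff)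
    then show ?thesis using Suc.prems by (simp only: mult_eq_0_iff of_nat_eq_0_iff) simp
  qed
  ultimately have "(Fop ^^ j) v = 0" by (simp add: pointwise del: of_nat_Suc)
  then show ?case using Suc by simp
qed simp

lemma harm_linear: "harm p q 0" "harm p q f \<Longrightarrow> harm p q g \<Longrightarrow> harm p q (f + g)" "harm p q f \<Longrightarrow> harm p q (\<lambda>x. c * f x)"
  "harm p q f \<Longrightarrow> harm p q g \<Longrightarrow> harm p q (f - g)"
  by (auto simp: harm_def Lap_linear bihom_polys bihom.zero bihom_diff intro: bihom.add bihom_scale) (simp add: zero_fun_def)?

lemma harm_sum: "(\<And>i. i \<in> I \<Longrightarrow> harm p q (f i)) \<Longrightarrow> harm p q (\<Sum>i\<in>I. f i)"
  by (induction I rule: infinite_finite_induct) (auto intro: harm_linear)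

lemma hw_scale: "hw p q f \<Longrightarrow> hw p q (\<lambda>x. c * f x)"
  using poly_deriv_scale[OF poly_deriv_ops(3), of f c] hw_polys[of p q f]
  by (auto simp: hw_def harm_linear zero_fun_def)

text \<open>Since \<open>Eop\<close> maps \<open>(Fop ^^ Suc j) v\<close> to a nonzero multiple of
  \<open>(Fop ^^ j) v\<close>, dividing by these multiples inverts \<open>Eop\<close> on a sum of
  such terms.\<close>

lemma E_preimage:
  assumes pq: "p < q" and v: "\<And>j. j \<le> p \<Longrightarrow> hw (p - j) (Suc q + j) (v j)"
  shows "\<exists>u. (\<forall>j\<le>p. hw (p - j) (Suc q + j) (u j)) \<and> harm (Suc p) q (\<Sum>j\<le>p. (Fop ^^ Suc j) (u j)) \<and>
    Eop (\<Sum>j\<le>p. (Fop ^^ Suc j) (u j)) = (\<Sum>j\<le>p. (Fop ^^ j) (v j))"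
proof -
  define c :: "nat \<Rightarrow> complex" where "c j = of_nat (Suc j) * (of_nat (Suc q + j) - of_nat (p - j) - of_nat j)" for j
  have c0: "c j \<noteq> 0" if "j \<le> p" for j
  proof -
    have "Suc q + j = (Suc q - (p - j)) + (p - j) + j" using pq by simp
    then have "(of_nat (Suc q + j) :: complex) = of_nat (Suc q - (p - j)) + of_nat (p - j) + of_nat j" by (metis of_nat_add)
    moreover have "x - b - c = a" if "x = a + b + c" for x a b c :: complex using that by simp
    ultimately have "c j = of_nat (Suc j) * of_nat (Suc q - (p - j))" unfolding c_def by metis
    then show ?thesis using pq by (simp only: mult_eq_0_iff of_nat_eq_0_iff) simp
  qed
  define u where "u j = (\<lambda>x. inverse (c j) * v j x)" for j
  have u: "hw (p - j) (Suc q + j) (u j)" if "j \<le> p" for j unfolding u_def by (rule hw_scale[OF v[OF that]])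
  have Ev: "Eop ((Fop ^^ Suc j) (u j)) = (Fop ^^ j) (v j)" if "j \<le> p" for j
  proof -
    have "Eop ((Fop ^^ Suc j) (u j)) = (\<lambda>x. c j * (Fop ^^ j) (u j) x)"
      unfolding c_def by (rule E_F_pow[OF u[OF that]]) simp
    also have "\<dots> = (Fop ^^ j) (v j)"
      unfolding u_def F_pow_scale[OF hw_polys[OF v[OF that]]] using c0[OF that] by (simp add: pointwise)
    finally show ?thesis .
  qed
  have hF: "harm (Suc p) q ((Fop ^^ Suc j) (u j))" if "j \<le> p" for j
    using F_pow_harm[of "p - j" "Suc q + j" "u j" "Suc j"] u[OF that] that by (simp add: hw_def)
  have "harm (Suc p) q (\<Sum>j\<le>p. (Fop ^^ Suc j) (u j))" by (rule harm_sum) (use hF in auto)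
  moreover have "Eop (\<Sum>j\<le>p. (Fop ^^ Suc j) (u j)) = (\<Sum>j\<le>p. (Fop ^^ j) (v j))"
    by (subst poly_deriv_sum[OF poly_deriv_ops(3)]) (use hF harm_polys Ev in \<open>auto intro!: sum.cong simp del: funpow.simps\<close>)
  ultimately show ?thesis using u by blast
qed

text \<open>By induction on \<open>p\<close>: \<open>Eop f\<close> has lower degree in the coordinates, hence is
  decomposed already, and subtracting a preimage of \<open>Eop f\<close> from \<open>f\<close>
  leaves a highest weight vector.\<close>

lemma harm_decomp:
  "p \<le> q \<Longrightarrow> harm p q f \<Longrightarrow> \<exists>v. (\<forall>j\<le>p. hw (p - j) (q + j) (v j)) \<and> f = (\<Sum>j\<le>p. (Fop ^^ j) (v j))"
proof (induction p arbitrary: q f)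
  case 0
  then have "hw 0 q f" using bihom_E(2)[of q f] by (simp add: hw_def harm_def)
  then show ?case by (intro exI[of _ "\<lambda>_. f"]) simp
next
  case (Suc p)
  have fp: "f \<in> polys" by (rule harm_polys[OF Suc.prems(2)])
  have "harm p (Suc q) (Eop f)"
    using Suc.prems(2) bihom_E(1)[of p q f] Lap_E[OF fp] by (simp add: harm_def poly_deriv_zero[OF poly_deriv_ops(3)])
  then obtain v where v: "\<And>j. j \<le> p \<Longrightarrow> hw (p - j) (Suc q + j) (v j)" and Ef: "Eop f = (\<Sum>j\<le>p. (Fop ^^ j) (v j))"
    using Suc.IH[of "Suc q" "Eop f"] Suc.prems(1) by auto
  have "p < q" using Suc.prems(1) by simp
  from E_preimage[OF this v] obtain u where u: "\<And>j. j \<le> p \<Longrightarrow> hw (p - j) (Suc q + j) (u j)"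
    and hs: "harm (Suc p) q (\<Sum>j\<le>p. (Fop ^^ Suc j) (u j))"
    and Es: "Eop (\<Sum>j\<le>p. (Fop ^^ Suc j) (u j)) = (\<Sum>j\<le>p. (Fop ^^ j) (v j))" by blast
  let ?s = "\<Sum>j\<le>p. (Fop ^^ Suc j) (u j)"
  have "Eop (f - ?s) = 0"
    unfolding poly_deriv_diff[OF poly_deriv_ops(3) fp harm_polys[OF hs]] Es Ef by simp
  then have h0: "hw (Suc p) q (f - ?s)" using harm_linear(4)[OF Suc.prems(2) hs] by (simp add: hw_def)
  let ?u = "\<lambda>j. case j of 0 \<Rightarrow> f - ?s | Suc i \<Rightarrow> u i"
  have "hw (Suc p - j) (q + j) (?u j)" if "j \<le> Suc p" for j
    using that h0 u by (cases j) auto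
  moreover have "f = (\<Sum>j\<le>Suc p. (Fop ^^ j) (?u j))"
    unfolding sum.atMost_Suc_shift by simp
  ultimately show ?case by blast
qed

text \<open>For \<open>p < q\<close> the weight \<open>q - p - 1\<close> of the source is nonnegative, and
  raising operators are onto there.\<close>

lemma E_surj:
  assumes "p < q" "harm p (Suc q) g"
  shows "\<exists>f. harm (Suc p) q f \<and> Eop f = g"
proof -
  obtain v where v: "\<And>j. j \<le> p \<Longrightarrow> hw (p - j) (Suc q + j) (v j)" and g: "g = (\<Sum>j\<le>p. (Fop ^^ j) (v j))"
    using harm_decomp[of p "Suc q" g] assms by auto
  show ?thesis using E_preimage[OF assms(1) v] unfolding g by blast
qed

text \<open>The powers of \<open>rad\<close> are written as iterated multiplication, which matches the inductive proofs.\<close>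

abbreviation rpow :: "nat \<Rightarrow> (complex^'i::finite \<Rightarrow> complex) \<Rightarrow> complex^'i \<Rightarrow> complex" where
  "rpow j f \<equiv> ((*) rad ^^ j) f"

lemma rpow_bihom: "bihom p q f \<Longrightarrow> bihom (p + j) (q + j) (rpow j f)"
  by (induction j) (auto intro: bihom_rad)

lemma Lap_rpow:
  fixes h :: "complex^'i::finite \<Rightarrow> complex"
  assumes h: "harm p q h"
  shows "Lap (rpow (Suc j) h) = (\<lambda>x. of_nat (Suc j * (CARD('i) + p + q + j)) * rpow j h x)"
proof (induction j)
  case 0
  have r: "rpow (Suc 0) h = rad * h" "rpow 0 h = h" by simp_all
  have b: "bihom p q h" and L: "Lap h = 0" using h by (auto simp: harm_def)
  show ?case
    unfolding r Lap_rad[OF harm_polys[OF h]] L bihom_Nz[OF b, THEN conjunct1] bihom_Nz[OF b, THEN conjunct2]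
    by (simp add: pointwise algebra_simps)
next
  case (Suc j)
  have b: "bihom (p + Suc j) (q + Suc j) (rpow (Suc j) h)" using h rpow_bihom[of p q h "Suc j"] by (simp only: harm_def)
  have "Lap (rpow (Suc (Suc j)) h) = Lap (rad * rpow (Suc j) h)" by simp
  also have "\<dots> = rad * Lap (rpow (Suc j) h) + (\<lambda>_. of_nat CARD('i)) * rpow (Suc j) h + Nz (rpow (Suc j) h) + Nw (rpow (Suc j) h)"
    by (rule Lap_rad[OF bihom_polys[OF b]])
  also have "\<dots> = (\<lambda>x. of_nat (Suc (Suc j) * (CARD('i) + p + q + Suc j)) * rpow (Suc j) h x)"
    unfolding Suc.IH bihom_Nz[OF b, THEN conjunct1] bihom_Nz[OF b, THEN conjunct2] by (simp add: pointwise algebra_simps)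
  finally show ?case .
qed

lemma rpow_scale: "rpow j (\<lambda>x. c * f x) = (\<lambda>x. c * rpow j f x)"
  by (induction j) (simp_all add: pointwise)

text \<open>The counterpart of \<open>E_preimage\<close> for the second \<open>sl(2)\<close>: \<open>Lap\<close>
  maps \<open>rpow (Suc j) h\<close> to a nonzero multiple of \<open>rpow j h\<close>.\<close>

lemma Lap_preimage:
  fixes h :: "nat \<Rightarrow> complex^'i::finite \<Rightarrow> complex"
  assumes h: "\<And>j. j \<le> min p q \<Longrightarrow> harm (p - j) (q - j) (h j)"
  shows "\<exists>u. (\<forall>j\<le>min p q. harm (p - j) (q - j) (u j)) \<and> bihom (Suc p) (Suc q) (\<Sum>j\<le>min p q. rpow (Suc j) (u j)) \<and>
    Lap (\<Sum>j\<le>min p q. rpow (Suc j) (u j)) = (\<Sum>j\<le>min p q. rpow j (h j))"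
proof -
  define c :: "nat \<Rightarrow> complex" where "c j = of_nat (Suc j * (CARD('i) + (p - j) + (q - j) + j))" for j
  have c0: "c j \<noteq> 0" for j unfolding c_def of_nat_eq_0_iff by simp
  define u where "u j = (\<lambda>x. inverse (c j) * h j x)" for j
  have u: "harm (p - j) (q - j) (u j)" if "j \<le> min p q" for j unfolding u_def by (rule harm_linear(3)[OF h[OF that]])
  have L: "Lap (rpow (Suc j) (u j)) = rpow j (h j)" if "j \<le> min p q" for j
    unfolding Lap_rpow[OF u[OF that]] c_def[symmetric] unfolding u_def rpow_scale using c0[of j] by (simp add: pointwise)
  have b: "bihom (Suc p) (Suc q) (rpow (Suc j) (u j))" if "j \<le> min p q" for j
    using rpow_bihom[of "p - j" "q - j" "u j" "Suc j"] u[OF that] that by (simp add: harm_def del: funpow.simps)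
  have "bihom (Suc p) (Suc q) (\<Sum>j\<le>min p q. rpow (Suc j) (u j))" by (rule bihom_sum) (use b in auto)
  moreover have "Lap (\<Sum>j\<le>min p q. rpow (Suc j) (u j)) = (\<Sum>j\<le>min p q. rpow j (h j))"
    by (subst Lap_sum) (use b bihom_polys L in \<open>auto intro!: sum.cong simp del: funpow.simps\<close>)
  ultimately show ?thesis using u by blast
qed

text \<open>The classical decomposition into harmonic polynomials times powers of \<open>rad\<close>, by the
  same induction as in \<open>harm_decomp\<close>.\<close>

lemma bihom_decomp:
  "bihom p q f \<Longrightarrow> \<exists>g. (\<forall>j\<le>min p q. harm (p - j) (q - j) (g j)) \<and> f = (\<Sum>j\<le>min p q. rpow j (g j))"
proof (induction p arbitrary: q f)
  case 0
  then have "harm 0 q f" using bihom_Lap_0 by (auto simp: harm_def)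
  then show ?case by (intro exI[of _ "\<lambda>_. f"]) simp
next
  case (Suc p)
  show ?case
  proof (cases q)
    case 0
    then have "harm (Suc p) 0 f" using Suc.prems bihom_Lap_0' by (auto simp: harm_def)
    then show ?thesis using 0 by (intro exI[of _ "\<lambda>_. f"]) simp
  next
    case (Suc q')
    note q = this
    have fp: "f \<in> polys" by (rule bihom_polys[OF Suc.prems])
    obtain g where g: "\<And>j. j \<le> min p q' \<Longrightarrow> harm (p - j) (q' - j) (g j)" and Lf: "Lap f = (\<Sum>j\<le>min p q'. rpow j (g j))"
      using Suc.IH[OF bihom_Lap[OF Suc.prems[unfolded q]]] by blast
    from Lap_preimage[OF g] obtain u where u: "\<And>j. j \<le> min p q' \<Longrightarrow> harm (p - j) (q' - j) (u j)"
      and bs: "bihom (Suc p) (Suc q') (\<Sum>j\<le>min p q'. rpow (Suc j) (u j))"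
      and Ls: "Lap (\<Sum>j\<le>min p q'. rpow (Suc j) (u j)) = (\<Sum>j\<le>min p q'. rpow j (g j))" by blast
    let ?s = "\<Sum>j\<le>min p q'. rpow (Suc j) (u j)"
    have "Lap (f - ?s) = 0" unfolding Lap_linear(4)[OF fp bihom_polys[OF bs]] Ls Lf by simp
    then have h0: "harm (Suc p) q (f - ?s)" using bihom_diff[OF Suc.prems bs[folded q]] by (simp add: harm_def)
    let ?u = "\<lambda>j. case j of 0 \<Rightarrow> f - ?s | Suc i \<Rightarrow> u i"
    have m: "min (Suc p) q = Suc (min p q')" by (simp add: q)
    have "harm (Suc p - j) (q - j) (?u j)" if "j \<le> Suc (min p q')" for j
      using that h0 u q by (cases j) auto
    moreover have "f = (\<Sum>j\<le>Suc (min p q'). rpow j (?u j))"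
      unfolding sum.atMost_Suc_shift by simp
    ultimately show ?thesis unfolding m by blast
  qed
qed

text \<open>With this, the harmonic polynomials have the dimension expected from rank and nullity.\<close>

lemma Lap_surj:
  assumes "bihom p q g"
  shows "\<exists>f. bihom (Suc p) (Suc q) f \<and> Lap f = g"
proof -
  obtain h where h: "\<And>j. j \<le> min p q \<Longrightarrow> harm (p - j) (q - j) (h j)" and g: "g = (\<Sum>j\<le>min p q. rpow j (h j))"
    using bihom_decomp[OF assms] by blast
  show ?thesis using Lap_preimage[OF h] unfolding g by blast
qed

declare one_fun_apply [simp del]

section \<open>Dimensions\<close>

lemma has_complex_dim_unique:
  assumes "has_complex_dim V a" "has_complex_dim V b" shows "a = b"
proof -
  obtain A B where A: "finite A" "card A = a" "cfun.independent A" "cfun.span A = V"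
    and B: "finite B" "card B = b" "cfun.independent B" "cfun.span B = V"
    using assms by (auto simp: has_complex_dim_def)
  have "card A \<le> card B" using cfun.independent_span_bound[OF B(1) A(3)] A(4) B(4) cfun.span_superset[of A] by auto
  moreover have "card B \<le> card A" using cfun.independent_span_bound[OF A(1) B(3)] A(4) B(4) cfun.span_superset[of B] by auto
  ultimately show ?thesis using A B by simp
qed

lemma subspace_has_complex_dim:
  assumes "has_complex_dim W a" "cfun.subspace K" "K \<subseteq> W"
  shows "\<exists>k. has_complex_dim K k"
proof -
  obtain A where A: "finite A" "cfun.span A = W" using assms by (auto simp: has_complex_dim_def)
  obtain B where B: "B \<subseteq> K" "cfun.independent B" "K \<subseteq> cfun.span B"
    using cfun.maximal_independent_subset[of K] by blast
  have "finite B" using cfun.independent_span_bound[OF A(1) B(2)] B(1) assms(3) A(2) by auto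
  moreover have "cfun.span B = K" using B cfun.span_minimal[OF B(1) assms(2)] by blast
  ultimately show ?thesis using B(2) unfolding has_complex_dim_def by blast
qed

lemma cfun_subspace_iff:
  "cfun.subspace S \<longleftrightarrow> 0 \<in> S \<and> (\<forall>f\<in>S. \<forall>g\<in>S. f + g \<in> S) \<and> (\<forall>c. \<forall>f\<in>S. (\<lambda>x. c * f x) \<in> S)"
  by (auto simp: cfun.subspace_def)

lemma semilinear_sum:
  assumes W: "cfun.subspace W" and add: "\<And>f g. f \<in> W \<Longrightarrow> g \<in> W \<Longrightarrow> T (f + g) = T f + T g"
    and scale: "\<And>c f. f \<in> W \<Longrightarrow> T (\<lambda>x. c * f x) = (\<lambda>x. \<phi> c * T f x)" and T0: "T 0 = 0"
    and A: "\<And>v. v \<in> A \<Longrightarrow> h v \<in> W"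
  shows "T (\<Sum>v\<in>A. (\<lambda>x. c v * h v x)) = (\<Sum>v\<in>A. (\<lambda>x. \<phi> (c v) * T (h v) x))"
  using A
proof (induction A rule: infinite_finite_induct)
  case (insert v A)
  have "(\<Sum>v\<in>A. (\<lambda>x. c v * h v x)) \<in> W"
    using insert.prems by (intro cfun.subspace_sum[OF W] cfun.subspace_scale[OF W]) auto
  moreover have "(\<lambda>x. c v * h v x) \<in> W" using insert.prems by (intro cfun.subspace_scale[OF W]) auto
  ultimately show ?case using insert by (simp add: add scale)
qed (simp_all add: T0)

text \<open>Rank and nullity for a surjective map. The map is only assumed to be linear on \<open>W\<close>,
  because operators such as \<open>Lap\<close> are additive on polynomials but not on arbitrary
  functions.\<close>

lemma has_complex_dim_kernel:
  fixes T :: "('a \<Rightarrow> complex) \<Rightarrow> 'b \<Rightarrow> complex"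
  assumes W: "has_complex_dim W a" and Y: "has_complex_dim Y b"
    and add: "\<And>f g. f \<in> W \<Longrightarrow> g \<in> W \<Longrightarrow> T (f + g) = T f + T g"
    and scale: "\<And>c f. f \<in> W \<Longrightarrow> T (\<lambda>x. c * f x) = (\<lambda>x. c * T f x)"
    and TY: "\<And>f. f \<in> W \<Longrightarrow> T f \<in> Y" and surj: "\<And>y. y \<in> Y \<Longrightarrow> \<exists>f\<in>W. T f = y"
  shows "\<exists>k. has_complex_dim {f \<in> W. T f = 0} k \<and> k + b = a"
proof -
  let ?K = "{f \<in> W. T f = 0}"
  have sW: "cfun.subspace W" using W cfun.subspace_span by (auto simp: has_complex_dim_def)
  have T0: "T 0 = 0"
    using add[of 0 0] sW by (simp add: cfun_subspace_iff)
  have sK: "cfun.subspace ?K"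
  proof -
    have "(\<lambda>x. c * (0 :: 'b \<Rightarrow> complex) x) = 0" for c by (simp add: pointwise)
    then show ?thesis using sW by (auto simp: cfun_subspace_iff add scale T0)
  qed
  obtain k where k: "has_complex_dim ?K k" using subspace_has_complex_dim[OF W sK] by blast
  obtain A where A: "finite A" "card A = k" "cfun.independent A" "cfun.span A = ?K" using k by (auto simp: has_complex_dim_def)
  obtain B where B: "finite B" "card B = b" "cfun.independent B" "cfun.span B = Y" using Y by (auto simp: has_complex_dim_def)
  have AK: "v \<in> W" "T v = 0" if "v \<in> A" for v using A(4) cfun.span_base[OF that] by auto
  have "\<forall>y\<in>B. \<exists>f\<in>W. T f = y" using surj B(4) cfun.span_base by blast
  then obtain g where g: "\<And>y. y \<in> B \<Longrightarrow> g y \<in> W" "\<And>y. y \<in> B \<Longrightarrow> T (g y) = y" by metis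
  have inj: "inj_on g B" using g(2) by (metis inj_onI)
  have B0: "y \<noteq> 0" if "y \<in> B" for y using B(3) that cfun.dependent_zero by blast
  have disj: "A \<inter> g ` B = {}" using AK(2) g(2) B0 by fastforce
  have indep: "cfun.independent (A \<union> g ` B)"
  proof (rule cfun.independent_if_scalars_zero)
    show "finite (A \<union> g ` B)" using A(1) B(1) by simp
    fix c v assume z: "(\<Sum>v\<in>A \<union> g ` B. (\<lambda>x. c v * v x)) = 0" and v: "v \<in> A \<union> g ` B"
    have split: "(\<Sum>v\<in>A \<union> g ` B. (\<lambda>x. c v * v x)) = (\<Sum>v\<in>A. (\<lambda>x. c v * v x)) + (\<Sum>y\<in>B. (\<lambda>x. c (g y) * g y x))"
      using A(1) B(1) disj inj by (simp add: sum.union_disjoint sum.reindex)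
    have WA: "(\<Sum>v\<in>A. (\<lambda>x. c v * v x)) \<in> W" "(\<Sum>y\<in>B. (\<lambda>x. c (g y) * g y x)) \<in> W"
      using AK g by (auto intro!: cfun.subspace_sum[OF sW] cfun.subspace_scale[OF sW])
    have TA: "T (\<Sum>v\<in>A. (\<lambda>x. c v * v x)) = 0"
      by (subst semilinear_sum[OF sW add scale T0, of A "\<lambda>v. v"]) (auto simp: AK pointwise)
    have TB: "T (\<Sum>y\<in>B. (\<lambda>x. c (g y) * g y x)) = (\<Sum>y\<in>B. (\<lambda>x. c (g y) * y x))"
      by (subst semilinear_sum[OF sW add scale T0, of B g]) (auto simp: g)
    have "T 0 = 0 + (\<Sum>y\<in>B. (\<lambda>x. c (g y) * y x))"
      unfolding z[symmetric] split add[OF WA] TA TB ..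
    then have "(\<Sum>y\<in>B. (\<lambda>x. c (g y) * y x)) = 0" by (simp add: T0)
    then have cB: "c (g y) = 0" if "y \<in> B" for y
      using cfun.independentD[OF B(3,1) subset_refl, of "\<lambda>y. c (g y)" y] that by simp
    have "(\<Sum>y\<in>B. (\<lambda>x. c (g y) * g y x)) = 0"
      by (intro sum.neutral ballI) (simp add: cB pointwise)
    then have "(\<Sum>v\<in>A. (\<lambda>x. c v * v x)) = 0" using z split by simp
    then have "c v = 0" if "v \<in> A" for v
      using cfun.independentD[OF A(3,1) subset_refl, of c v] that by simp
    then show "c v = 0" using v cB by auto
  qed
  have "cfun.span (A \<union> g ` B) = W"
  proof
    show "cfun.span (A \<union> g ` B) \<subseteq> W" by (rule cfun.span_minimal[OF _ sW]) (use AK g in auto)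
    show "W \<subseteq> cfun.span (A \<union> g ` B)"
    proof
      fix f assume f: "f \<in> W"
      then have "T f \<in> cfun.span B" using TY B(4) by simp
      then obtain u where u: "T f = (\<Sum>y\<in>B. (\<lambda>x. u y * y x))" unfolding cfun.span_finite[OF B(1)] by auto
      let ?h = "\<Sum>y\<in>B. (\<lambda>x. u y * g y x)"
      have hW: "?h \<in> W" using g by (auto intro!: cfun.subspace_sum[OF sW] cfun.subspace_scale[OF sW])
      have Th: "T ?h = T f"
        unfolding u by (subst semilinear_sum[OF sW add scale T0, of B g]) (auto simp: g)
      have mW: "(\<lambda>x. (-1) * ?h x) \<in> W" using cfun.subspace_scale[OF sW hW] .
      have "T (f + (\<lambda>x. (-1) * ?h x)) = 0" unfolding add[OF f mW] scale[OF hW] Th by (simp add: pointwise)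
      then have "f + (\<lambda>x. (-1) * ?h x) \<in> cfun.span A" using A(4) cfun.subspace_add[OF sW f mW] by simp
      then have "f + (\<lambda>x. (-1) * ?h x) \<in> cfun.span (A \<union> g ` B)" using cfun.span_mono[of A "A \<union> g ` B"] by blast
      moreover have "?h \<in> cfun.span (A \<union> g ` B)"
        by (intro cfun.span_sum cfun.span_scale cfun.span_base) auto
      ultimately have "f + (\<lambda>x. (-1) * ?h x) + ?h \<in> cfun.span (A \<union> g ` B)" by (rule cfun.span_add)
      moreover have "f + (\<lambda>x. (-1) * h x) + h = f" for h :: "'a \<Rightarrow> complex"
        by (rule ext) (simp add: plus_fun_apply uminus_apply)
      ultimately show "f \<in> cfun.span (A \<union> g ` B)" by (simp only:)
    qed
  qed
  then have "has_complex_dim W (card (A \<union> g ` B))"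
    unfolding has_complex_dim_def by (intro exI[of _ "A \<union> g ` B"] conjI indep refl) (simp_all add: A(1) B(1))
  moreover have "card (A \<union> g ` B) = k + b"
    using card_Un_disjoint[OF A(1) _ disj] B(1,2) A(2) card_image[OF inj] by simp
  ultimately have "k + b = a" using has_complex_dim_unique[OF W] by simp
  then show ?thesis using k by blast
qed

text \<open>The map may be semilinear with respect to an involution \<open>\<phi>\<close> of the scalars, in
  order to cover complex conjugation.\<close>

lemma has_complex_dim_image:
  fixes T :: "('a \<Rightarrow> complex) \<Rightarrow> 'b \<Rightarrow> complex"
  assumes W: "has_complex_dim W d"
    and add: "\<And>f g. f \<in> W \<Longrightarrow> g \<in> W \<Longrightarrow> T (f + g) = T f + T g"
    and scale: "\<And>c f. f \<in> W \<Longrightarrow> T (\<lambda>x. c * f x) = (\<lambda>x. \<phi> c * T f x)"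
    and \<phi>: "\<And>c. \<phi> (\<phi> c) = c" "\<phi> 0 = 0"
    and inj: "\<And>f. f \<in> W \<Longrightarrow> T f = 0 \<Longrightarrow> f = 0"
  shows "has_complex_dim (T ` W) d"
proof -
  have sW: "cfun.subspace W" using W cfun.subspace_span by (auto simp: has_complex_dim_def)
  have T0: "T 0 = 0" using add[of 0 0] sW by (simp add: cfun_subspace_iff)
  obtain B where B: "finite B" "card B = d" "cfun.independent B" "cfun.span B = W" using W by (auto simp: has_complex_dim_def)
  have BW: "v \<in> W" if "v \<in> B" for v using B(4) cfun.span_base[OF that] by auto
  have Tinj: "inj_on T W"
  proof (rule inj_onI)
    fix f g assume f: "f \<in> W" and g: "g \<in> W" and e: "T f = T g"
    have m: "(\<lambda>x. (-1) * g x) \<in> W" by (rule cfun.subspace_scale[OF sW g])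
    have "T (g + (\<lambda>x. (-1) * g x)) = T 0" by (rule arg_cong[of _ _ T]) (simp add: pointwise)
    then have "T (f + (\<lambda>x. (-1) * g x)) = 0" unfolding add[OF f m] add[OF g m] e T0 .
    then have "f + (\<lambda>x. (-1) * g x) = 0" using inj cfun.subspace_add[OF sW f m] by blast
    then show "f = g" by (simp add: pointwise)
  qed
  then have injB: "inj_on T B" using BW by (meson inj_on_subset subsetI)
  have sumT: "(\<Sum>v\<in>T ` B. (\<lambda>x. u v * v x)) = T (\<Sum>v\<in>B. (\<lambda>x. \<phi> (u (T v)) * v x))" for u
    by (subst semilinear_sum[OF sW add scale T0, of B "\<lambda>v. v"]) (auto simp: BW \<phi> sum.reindex[OF injB])
  have "cfun.independent (T ` B)"
  proof (rule cfun.independent_if_scalars_zero)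
    show "finite (T ` B)" using B(1) by simp
    fix u w assume z: "(\<Sum>v\<in>T ` B. (\<lambda>x. u v * v x)) = 0" and "w \<in> T ` B"
    then obtain v where v: "v \<in> B" "w = T v" by blast
    have "(\<Sum>v\<in>B. (\<lambda>x. \<phi> (u (T v)) * v x)) \<in> W"
      using BW by (intro cfun.subspace_sum[OF sW] cfun.subspace_scale[OF sW])
    then have "(\<Sum>v\<in>B. (\<lambda>x. \<phi> (u (T v)) * v x)) = 0" using z unfolding sumT by (rule inj)
    then have "\<phi> (u (T v)) = 0" using cfun.independentD[OF B(3,1) subset_refl, of "\<lambda>v. \<phi> (u (T v))" v] v by simp
    then show "u w = 0" using \<phi> v(2) by metis
  qed
  moreover have "cfun.span (T ` B) = T ` W"
  proof
    have "T ` W = (\<lambda>u. \<Sum>v\<in>T ` B. (\<lambda>x. u v * v x)) ` UNIV"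
    proof (intro equalityI subsetI)
      fix y assume "y \<in> T ` W"
      then obtain c where c: "y = T (\<Sum>v\<in>B. (\<lambda>x. c v * v x))"
        unfolding B(4)[symmetric] cfun.span_finite[OF B(1)] by auto
      have "y = (\<Sum>v\<in>T ` B. (\<lambda>x. \<phi> (c (inv_into B T v)) * v x))"
        unfolding sumT c by (intro arg_cong[of _ _ T] sum.cong refl) (simp add: \<phi> inv_into_f_f[OF injB])
      then show "y \<in> (\<lambda>u. \<Sum>v\<in>T ` B. (\<lambda>x. u v * v x)) ` UNIV"
        by (intro image_eqI[of _ _ "\<lambda>v. \<phi> (c (inv_into B T v))"]) auto
    next
      fix y assume "y \<in> (\<lambda>u. \<Sum>v\<in>T ` B. (\<lambda>x. u v * v x)) ` UNIV"
      then obtain u where "y = T (\<Sum>v\<in>B. (\<lambda>x. \<phi> (u (T v)) * v x))" unfolding sumT by blast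
      moreover have "(\<Sum>v\<in>B. (\<lambda>x. \<phi> (u (T v)) * v x)) \<in> W"
        using BW by (intro cfun.subspace_sum[OF sW] cfun.subspace_scale[OF sW])
      ultimately show "y \<in> T ` W" by blast
    qed
    then show "cfun.span (T ` B) \<subseteq> T ` W" "T ` W \<subseteq> cfun.span (T ` B)"
      unfolding cfun.span_finite[OF finite_imageI[OF B(1)]] by auto
  qed
  ultimately show ?thesis using B(1,2) card_image[OF injB] unfolding has_complex_dim_def by blast
qed

section \<open>Monomials\<close>

definition monomial :: "('i::finite \<Rightarrow> nat) \<Rightarrow> ('i \<Rightarrow> nat) \<Rightarrow> complex^'i \<Rightarrow> complex" where
  "monomial a b = (\<Prod>j\<in>UNIV. zc j ^ a j) * (\<Prod>j\<in>UNIV. wc j ^ b j)"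

lemma polys_power: "f \<in> polys \<Longrightarrow> f ^ k \<in> polys"
  using polys.const[of 1] by (induction k) (auto intro: polys_mult simp: one_fun_def)

lemma polys_prod: "(\<And>j. j \<in> A \<Longrightarrow> f j \<in> polys) \<Longrightarrow> (\<Prod>j\<in>A. f j) \<in> polys"
  using polys.const[of 1] by (induction A rule: infinite_finite_induct) (auto intro: polys_mult simp: one_fun_def)

lemma poly_deriv_one: "poly_deriv D \<Longrightarrow> D 1 = 0"
  using poly_derivD(4)[of D 1] by (simp add: one_fun_def)

lemma poly_deriv_power_zero: "poly_deriv D \<Longrightarrow> f \<in> polys \<Longrightarrow> D f = 0 \<Longrightarrow> D (f ^ k) = 0"
  by (induction k) (simp_all add: poly_deriv_one poly_derivD(3) polys_power)

lemma poly_deriv_power: "poly_deriv D \<Longrightarrow> f \<in> polys \<Longrightarrow> D f = 1 \<Longrightarrow> D (f ^ k) = (\<lambda>_. of_nat k) * f ^ (k - 1)"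
proof (induction k)
  case 0 then show ?case by (simp only: power_0 poly_deriv_one of_nat_0) (simp add: pointwise)
next
  case (Suc k)
  have "D (f ^ Suc k) = D f * f ^ k + f * D (f ^ k)" using Suc.prems by (simp add: poly_derivD(3) polys_power)
  also have "\<dots> = f ^ k + f * ((\<lambda>_. of_nat k) * f ^ (k - 1))" using Suc by simp
  also have "\<dots> = (\<lambda>_. of_nat (Suc k)) * f ^ k" by (cases k) (simp_all add: pointwise one_fun_apply algebra_simps)
  finally show ?case by simp
qed

lemma poly_deriv_prod_zero: "poly_deriv D \<Longrightarrow> (\<And>j. j \<in> A \<Longrightarrow> f j \<in> polys \<and> D (f j) = 0) \<Longrightarrow> D (\<Prod>j\<in>A. f j) = 0"
  by (induction A rule: infinite_finite_induct) (simp_all add: poly_deriv_one poly_derivD(3) polys_prod)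

lemma dz_monomial: "dz i (monomial a b) = (\<lambda>_. of_nat (a i)) * monomial (a(i := a i - 1)) b"
proof -
  let ?r = "(\<Prod>j\<in>UNIV - {i}. zc j ^ a j) * (\<Prod>j\<in>UNIV. wc j ^ b j)"
  have m: "monomial c b = zc i ^ c i * ((\<Prod>j\<in>UNIV - {i}. zc j ^ c j) * (\<Prod>j\<in>UNIV. wc j ^ b j))" for c
    unfolding monomial_def by (subst prod.remove[of UNIV i]) (simp_all add: mult.assoc)
  have p1: "(\<Prod>j\<in>UNIV - {i}. zc j ^ a j) \<in> polys" and p2: "(\<Prod>j\<in>UNIV. wc j ^ b j) \<in> polys"
    by (intro polys_prod polys_power polys_intros)+
  have "dz i (\<Prod>j\<in>UNIV - {i}. zc j ^ a j) = 0"
  proof (rule poly_deriv_prod_zero[OF poly_deriv_dz])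
    fix j assume "j \<in> UNIV - {i}"
    then have "dz i (zc j) = 0" by (simp only: dz_zc) (simp add: pointwise)
    then show "zc j ^ a j \<in> polys \<and> dz i (zc j ^ a j) = 0"
      using poly_deriv_power_zero[OF poly_deriv_dz polys.zc] by (auto intro: polys_power polys_intros)
  qed
  moreover have "dz i (\<Prod>j\<in>UNIV. wc j ^ b j) = 0"
    by (rule poly_deriv_prod_zero[OF poly_deriv_dz])
      (auto intro: polys_power polys_intros poly_deriv_power_zero[OF poly_deriv_dz polys.wc] dz_wc)
  ultimately have r0: "dz i ?r = 0" unfolding poly_derivD(3)[OF poly_deriv_dz p1 p2] by simp
  have one: "dz i (zc i) = 1" by (simp add: dz_zc one_fun_def)
  have "dz i (monomial a b) = dz i (zc i ^ a i) * ?r"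
    unfolding m poly_derivD(3)[OF poly_deriv_dz polys_power[OF polys.zc] polys_mult[OF p1 p2]] r0 by simp
  also have "\<dots> = (\<lambda>_. of_nat (a i)) * (zc i ^ (a i - 1) * ?r)"
    unfolding poly_deriv_power[OF poly_deriv_dz polys.zc one] by (simp add: mult.assoc)
  also have "zc i ^ (a i - 1) * ?r = monomial (a(i := a i - 1)) b" unfolding m by simp
  finally show ?thesis .
qed

lemma dw_monomial: "dw i (monomial a b) = (\<lambda>_. of_nat (b i)) * monomial a (b(i := b i - 1))"
proof -
  let ?r = "(\<Prod>j\<in>UNIV. zc j ^ a j) * (\<Prod>j\<in>UNIV - {i}. wc j ^ b j)"
  have m: "monomial a c = wc i ^ c i * ((\<Prod>j\<in>UNIV. zc j ^ a j) * (\<Prod>j\<in>UNIV - {i}. wc j ^ c j))" for c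
    unfolding monomial_def by (subst (2) prod.remove[of UNIV i]) (simp_all add: mult_ac)
  have p1: "(\<Prod>j\<in>UNIV. zc j ^ a j) \<in> polys" and p2: "(\<Prod>j\<in>UNIV - {i}. wc j ^ b j) \<in> polys"
    by (intro polys_prod polys_power polys_intros)+
  have "dw i (\<Prod>j\<in>UNIV - {i}. wc j ^ b j) = 0"
  proof (rule poly_deriv_prod_zero[OF poly_deriv_dw])
    fix j assume "j \<in> UNIV - {i}"
    then have "dw i (wc j) = 0" by (simp only: dw_wc) (simp add: pointwise)
    then show "wc j ^ b j \<in> polys \<and> dw i (wc j ^ b j) = 0"
      using poly_deriv_power_zero[OF poly_deriv_dw polys.wc] by (auto intro: polys_power polys_intros)
  qed
  moreover have "dw i (\<Prod>j\<in>UNIV. zc j ^ a j) = 0"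
    by (rule poly_deriv_prod_zero[OF poly_deriv_dw])
      (auto intro: polys_power polys_intros poly_deriv_power_zero[OF poly_deriv_dw polys.zc] dw_zc)
  ultimately have r0: "dw i ?r = 0" unfolding poly_derivD(3)[OF poly_deriv_dw p1 p2] by simp
  have one: "dw i (wc i) = 1" by (simp add: dw_wc one_fun_def)
  have "dw i (monomial a b) = dw i (wc i ^ b i) * ?r"
    unfolding m poly_derivD(3)[OF poly_deriv_dw polys_power[OF polys.wc] polys_mult[OF p1 p2]] r0 by simp
  also have "\<dots> = (\<lambda>_. of_nat (b i)) * (wc i ^ (b i - 1) * ?r)"
    unfolding poly_deriv_power[OF poly_deriv_dw polys.wc one] by (simp add: mult.assoc)
  also have "wc i ^ (b i - 1) * ?r = monomial a (b(i := b i - 1))" unfolding m by simp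
  finally show ?thesis .
qed

lemma monomial_polys: "monomial a b \<in> polys"
  unfolding monomial_def by (intro polys_mult polys_prod polys_power polys_intros)

lemma monomial_0: "monomial (\<lambda>_. 0) (\<lambda>_. 0) = 1"
  by (simp add: monomial_def)

lemma zc_monomial: "zc i * monomial a b = monomial (a(i := Suc (a i))) b" and wc_monomial: "wc i * monomial a b = monomial a (b(i := Suc (b i)))"
proof -
  have "(\<Prod>j\<in>UNIV. zc j ^ (a(i := Suc (a i))) j) = zc i * (\<Prod>j\<in>UNIV. zc j ^ a j)"
    by (subst (1 2) prod.remove[of UNIV i]) (simp_all add: mult_ac)
  then show "zc i * monomial a b = monomial (a(i := Suc (a i))) b" by (simp add: monomial_def mult.assoc)
  have "(\<Prod>j\<in>UNIV. wc j ^ (b(i := Suc (b i))) j) = wc i * (\<Prod>j\<in>UNIV. wc j ^ b j)"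
    by (subst (1 2) prod.remove[of UNIV i]) (simp_all add: mult_ac)
  then show "wc i * monomial a b = monomial a (b(i := Suc (b i)))" by (simp add: monomial_def mult_ac)
qed

lemma poly_deriv_lincomb:
  assumes "poly_deriv D" "\<And>s. s \<in> S \<Longrightarrow> f s \<in> polys"
  shows "D (\<Sum>s\<in>S. (\<lambda>_. c s) * f s) = (\<Sum>s\<in>S. (\<lambda>_. c s) * D (f s))"
  using assms by (subst poly_deriv_sum) (auto intro!: polys_intros sum.cong simp: poly_derivD(3,4) polys.const)

lemma sum_fun_upd_pred: "a i > 0 \<Longrightarrow> sum a UNIV = Suc k \<Longrightarrow> sum (a(i := a i - 1)) UNIV = k" for a :: "'i::finite \<Rightarrow> nat"
  by (subst (asm) sum.remove[of UNIV i], simp, simp, subst sum.remove[of UNIV i]) auto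

text \<open>By induction on the degree: differentiating a relation with respect to a coordinate that occurs in
  the monomial \<open>s\<close> gives a relation in lower degree, in which the coefficient of
  \<open>s\<close> survives up to a nonzero factor.\<close>

lemma monomial_independent:
  fixes S :: "(('i::finite \<Rightarrow> nat) \<times> ('i \<Rightarrow> nat)) set"
  assumes "finite S" "\<And>s. s \<in> S \<Longrightarrow> sum (fst s) UNIV + sum (snd s) UNIV = k"
    and "(\<Sum>s\<in>S. (\<lambda>_. c s) * monomial (fst s) (snd s)) = 0" "s \<in> S"
  shows "c s = 0"
  using assms
proof (induction k arbitrary: S c s)
  case 0
  have z: "t = (\<lambda>_. 0, \<lambda>_. 0)" if "t \<in> S" for t
    using 0(2)[OF that] by (cases t) (auto simp: fun_eq_iff)
  then have S: "S = {(\<lambda>_. 0, \<lambda>_. 0)}" using 0(4) by blast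
  have "(\<Sum>s\<in>S. (\<lambda>_. c s) * monomial (fst s) (snd s)) x = c s" for x
    using z[OF 0(4)] by (simp add: S monomial_0 times_fun_apply one_fun_apply)
  then show ?case using 0(3) by (simp add: zero_fun_apply)
next
  case (Suc k)
  obtain a b where s: "s = (a, b)" by (cases s)
  have "sum a UNIV + sum b UNIV = Suc k" using Suc.prems(2,4) s by force
  then have "(\<exists>i. a i > 0) \<or> (\<exists>i. b i > 0)" by (metis add_is_0 neq0_conv sum.neutral nat.distinct(1))
  then show ?case
  proof
    assume "\<exists>i. a i > 0"
    then obtain i where i: "a i > 0" by blast
    let ?S = "{t \<in> S. fst t i > 0}"
    let ?f = "\<lambda>t :: ('i \<Rightarrow> nat) \<times> ('i \<Rightarrow> nat). ((fst t)(i := fst t i - 1), snd t)"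
    have inj: "inj_on ?f ?S"
    proof (rule inj_onI)
      fix t u assume t: "t \<in> ?S" and u: "u \<in> ?S" and e: "?f t = ?f u"
      have e1: "(fst t)(i := fst t i - 1) = (fst u)(i := fst u i - 1)" using e by simp
      have "fst t j = fst u j" for j
        using t u fun_cong[OF e1, of j] by (cases "j = i") auto
      then show "t = u" using e by (simp add: prod_eq_iff fun_eq_iff)
    qed
    have "0 = dz i (\<Sum>s\<in>S. (\<lambda>_. c s) * monomial (fst s) (snd s))" unfolding Suc.prems(3) by (simp add: d_0)
    also have "\<dots> = (\<Sum>t\<in>S. (\<lambda>_. c t) * ((\<lambda>_. of_nat (fst t i)) * monomial ((fst t)(i := fst t i - 1)) (snd t)))"
      by (subst poly_deriv_lincomb[OF poly_deriv_dz monomial_polys]) (simp only: dz_monomial)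
    also have "\<dots> = (\<Sum>t\<in>?S. (\<lambda>_. c t) * ((\<lambda>_. of_nat (fst t i)) * monomial ((fst t)(i := fst t i - 1)) (snd t)))"
      by (rule sum.mono_neutral_right) (use Suc.prems(1) in \<open>auto simp: pointwise\<close>)
    also have "\<dots> = (\<Sum>t\<in>?f ` ?S. (\<lambda>_. c (inv_into ?S ?f t) * of_nat (fst (inv_into ?S ?f t) i)) * monomial (fst t) (snd t))"
      by (subst sum.reindex[OF inj], rule sum.cong) (simp_all only: o_def inv_into_f_f[OF inj] fst_conv snd_conv, simp add: pointwise)
    finally have z: "(\<Sum>t\<in>?f ` ?S. (\<lambda>_. c (inv_into ?S ?f t) * of_nat (fst (inv_into ?S ?f t) i)) * monomial (fst t) (snd t)) = 0" by simp
    have sS: "s \<in> ?S" using i s Suc.prems(4) by simp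
    have "c (inv_into ?S ?f (?f s)) * of_nat (fst (inv_into ?S ?f (?f s)) i) = 0"
    proof (rule Suc.IH[OF _ _ z])
      show "finite (?f ` ?S)" using Suc.prems(1) by simp
      show "?f s \<in> ?f ` ?S" using sS by blast
      fix t assume "t \<in> ?f ` ?S"
      then obtain u where u: "u \<in> S" "fst u i > 0" "t = ?f u" by blast
      have "sum (fst u) UNIV = Suc (sum (fst u) UNIV - 1)" using u(2) by (metis Suc_pred' finite sum_eq_0_iff neq0_conv UNIV_I)
      then have "sum ((fst u)(i := fst u i - 1)) UNIV = sum (fst u) UNIV - 1" by (rule sum_fun_upd_pred[where i=i and a="fst u", OF u(2)])
      moreover have "sum (fst u) UNIV > 0" using u(2) by (metis finite sum_eq_0_iff neq0_conv UNIV_I)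
      ultimately show "sum (fst t) UNIV + sum (snd t) UNIV = k" using Suc.prems(2)[OF u(1)] by (simp add: u(3))
    qed
    then show "c s = 0" unfolding inv_into_f_f[OF inj sS] using i s by simp
  next
    assume "\<exists>i. b i > 0"
    then obtain i where i: "b i > 0" by blast
    let ?S = "{t \<in> S. snd t i > 0}"
    let ?f = "\<lambda>t :: ('i \<Rightarrow> nat) \<times> ('i \<Rightarrow> nat). (fst t, (snd t)(i := snd t i - 1))"
    have inj: "inj_on ?f ?S"
    proof (rule inj_onI)
      fix t u assume t: "t \<in> ?S" and u: "u \<in> ?S" and e: "?f t = ?f u"
      have e1: "(snd t)(i := snd t i - 1) = (snd u)(i := snd u i - 1)" using e by simp
      have "snd t j = snd u j" for j
        using t u fun_cong[OF e1, of j] by (cases "j = i") auto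
      then show "t = u" using e by (simp add: prod_eq_iff fun_eq_iff)
    qed
    have "0 = dw i (\<Sum>s\<in>S. (\<lambda>_. c s) * monomial (fst s) (snd s))" unfolding Suc.prems(3) by (simp add: d_0)
    also have "\<dots> = (\<Sum>t\<in>S. (\<lambda>_. c t) * ((\<lambda>_. of_nat (snd t i)) * monomial (fst t) ((snd t)(i := snd t i - 1))))"
      by (subst poly_deriv_lincomb[OF poly_deriv_dw monomial_polys]) (simp only: dw_monomial)
    also have "\<dots> = (\<Sum>t\<in>?S. (\<lambda>_. c t) * ((\<lambda>_. of_nat (snd t i)) * monomial (fst t) ((snd t)(i := snd t i - 1))))"
      by (rule sum.mono_neutral_right) (use Suc.prems(1) in \<open>auto simp: pointwise\<close>)
    also have "\<dots> = (\<Sum>t\<in>?f ` ?S. (\<lambda>_. c (inv_into ?S ?f t) * of_nat (snd (inv_into ?S ?f t) i)) * monomial (fst t) (snd t))"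
      by (subst sum.reindex[OF inj], rule sum.cong) (simp_all only: o_def inv_into_f_f[OF inj] fst_conv snd_conv, simp add: pointwise)
    finally have z: "(\<Sum>t\<in>?f ` ?S. (\<lambda>_. c (inv_into ?S ?f t) * of_nat (snd (inv_into ?S ?f t) i)) * monomial (fst t) (snd t)) = 0" by simp
    have sS: "s \<in> ?S" using i s Suc.prems(4) by simp
    have "c (inv_into ?S ?f (?f s)) * of_nat (snd (inv_into ?S ?f (?f s)) i) = 0"
    proof (rule Suc.IH[OF _ _ z])
      show "finite (?f ` ?S)" using Suc.prems(1) by simp
      show "?f s \<in> ?f ` ?S" using sS by blast
      fix t assume "t \<in> ?f ` ?S"
      then obtain u where u: "u \<in> S" "snd u i > 0" "t = ?f u" by blast
      have "sum (snd u) UNIV = Suc (sum (snd u) UNIV - 1)" using u(2) by (metis Suc_pred' finite sum_eq_0_iff neq0_conv UNIV_I)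
      then have "sum ((snd u)(i := snd u i - 1)) UNIV = sum (snd u) UNIV - 1" by (rule sum_fun_upd_pred[where i=i and a="snd u", OF u(2)])
      moreover have "sum (snd u) UNIV > 0" using u(2) by (metis finite sum_eq_0_iff neq0_conv UNIV_I)
      ultimately show "sum (fst t) UNIV + sum (snd t) UNIV = k" using Suc.prems(2)[OF u(1)] by (simp add: u(3))
    qed
    then show "c s = 0" unfolding inv_into_f_f[OF inj sS] using i s by simp
  qed
qed

definition expts :: "nat \<Rightarrow> ('i::finite \<Rightarrow> nat) set" where "expts p = {a. sum a UNIV = p}"

text \<open>Stars and bars, through a listing of the index type.\<close>

lemma card_expts: "finite (expts p :: ('i::finite \<Rightarrow> nat) set)" "card (expts p :: ('i \<Rightarrow> nat) set) = (p + CARD('i) - 1) choose p"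
proof -
  obtain xs :: "'i list" where xs: "set xs = UNIV" "distinct xs" using finite_distinct_list[of "UNIV :: 'i set"] by auto
  have len: "length xs = CARD('i)" using xs distinct_card[of xs] by simp
  have sl: "sum_list (map a xs) = sum a UNIV" for a :: "'i \<Rightarrow> nat"
    using sum_list_distinct_conv_sum_set[OF xs(2), of a] xs(1) by simp
  let ?L = "{l::nat list. length l = CARD('i) \<and> sum_list l = p}"
  have b: "bij_betw (\<lambda>a. map a xs) (expts p) ?L"
  proof (rule bij_betwI')
    fix a c :: "'i \<Rightarrow> nat"
    show "(map a xs = map c xs) = (a = c)" using xs(1) by (auto simp: fun_eq_iff)
    show "map a xs \<in> ?L" if "a \<in> expts p" using that sl by (simp add: expts_def len)
  next
    fix l assume l: "l \<in> ?L"
    have "map (the \<circ> map_of (zip xs l)) xs = l"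
      by (rule nth_equalityI) (use l len xs(2) in \<open>auto simp: map_of_zip_nth\<close>)
    then have "l = map (the \<circ> map_of (zip xs l)) xs" by simp
    moreover from this have "(the \<circ> map_of (zip xs l)) \<in> expts p" using l sl[of "the \<circ> map_of (zip xs l)"] by (simp add: expts_def)
    ultimately show "\<exists>a\<in>expts p. l = map a xs" by blast
  qed
  have c: "card ?L = (p + CARD('i) - 1) choose p" using card_length_sum_list[of "CARD('i)" p] by simp
  then show "card (expts p :: ('i \<Rightarrow> nat) set) = (p + CARD('i) - 1) choose p" using bij_betw_same_card[OF b] by simp
  have "0 < CARD('i)" by (simp add: card_gt_0_iff)
  then have "p \<le> p + CARD('i) - 1" by linarith
  then have "((p + CARD('i) - 1) choose p) > 0" by (rule zero_less_binomial)
  then have "card (expts p :: ('i \<Rightarrow> nat) set) > 0" using bij_betw_same_card[OF b] c by simp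
  then show "finite (expts p :: ('i \<Rightarrow> nat) set)" by (rule card_ge_0_finite)
qed

lemma bihom_monomial:
  assumes "a \<in> expts p" "b \<in> expts q" shows "bihom p q (monomial a b)"
proof -
  have one: "bihom 0 0 1" using bihom.const[of 1] by (simp add: one_fun_def)
  have z: "bihom k 0 (zc j ^ k)" and w: "bihom 0 k (wc j ^ k)" for j :: 'a and k
    by (induction k) (simp_all add: one bihom.zc bihom.wc)
  have "bihom (sum a A) 0 (\<Prod>j\<in>A. zc j ^ a j)" if "finite A" for A
    using that
  proof (induction A)
    case (insert i A) then show ?case using bihom_mult[OF z[of "a i" i] insert.IH] by simp
  qed (simp add: one)
  then have A: "bihom (sum a UNIV) 0 (\<Prod>j\<in>UNIV. zc j ^ a j)" by simp
  have "bihom 0 (sum b A) (\<Prod>j\<in>A. wc j ^ b j)" if "finite A" for A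
    using that
  proof (induction A)
    case (insert i A) then show ?case using bihom_mult[OF w[of "b i" i] insert.IH] by simp
  qed (simp add: one)
  then have B: "bihom 0 (sum b UNIV) (\<Prod>j\<in>UNIV. wc j ^ b j)" by simp
  show ?thesis using bihom_mult[OF A B] assms by (simp add: expts_def monomial_def)
qed

lemma bihom_subspace: "cfun.subspace {f. bihom p q f}"
  by (auto simp: cfun_subspace_iff bihom.zero bihom.add bihom_scale)

lemma span_mono_mult:
  assumes f: "f \<in> cfun.span A" and g: "\<And>h. h \<in> A \<Longrightarrow> g * h \<in> cfun.span B"
  shows "g * f \<in> cfun.span B"
  using f
proof (induction rule: cfun.span_induct_alt)
  case base show ?case by (simp add: cfun.span_zero)
next
  case (step c x y)
  have "g * ((\<lambda>z. c * x z) + y) = (\<lambda>z. c * (g * x) z) + g * y" by (simp add: pointwise algebra_simps)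
  then show ?case using step g[OF step(1)] by (simp add: cfun.span_add cfun.span_scale)
qed

definition monomials :: "nat \<Rightarrow> nat \<Rightarrow> (complex^'i::finite \<Rightarrow> complex) set" where
  "monomials p q = (\<lambda>(a, b). monomial a b) ` (expts p \<times> expts q)"

lemma expts_Suc: "a \<in> expts p \<Longrightarrow> a(i := Suc (a i)) \<in> expts (Suc p)"
  unfolding expts_def by (simp add: sum.remove[of UNIV i])

lemma bihom_span: "bihom p q f \<Longrightarrow> f \<in> cfun.span (monomials p q)"
proof (induction rule: bihom.induct)
  case (zero p q) show ?case by (rule cfun.span_zero)
next
  case (const c)
  have "(\<lambda>_. 0) \<in> expts 0" by (simp add: expts_def)
  then have "1 \<in> monomials 0 0"
    unfolding monomials_def monomial_0[symmetric] by (intro image_eqI[of _ _ "(\<lambda>_. 0, \<lambda>_. 0)"]) simp_all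
  then have "(\<lambda>x. c * 1 x) \<in> cfun.span (monomials 0 0)" by (intro cfun.span_scale cfun.span_base)
  then show ?case by (simp add: one_fun_def)
next
  case (zc p q f i)
  show ?case by (rule span_mono_mult[OF zc.IH]) (auto simp: monomials_def zc_monomial intro!: cfun.span_base image_eqI expts_Suc)
next
  case (wc p q f i)
  show ?case by (rule span_mono_mult[OF wc.IH]) (auto simp: monomials_def wc_monomial intro!: cfun.span_base image_eqI expts_Suc)
next
  case (add p q f g) then show ?case by (intro cfun.span_add)
qed

text \<open>The number of monomials of degree \<open>p\<close> in \<open>m\<close> variables.\<close>

definition hdim :: "nat \<Rightarrow> nat \<Rightarrow> nat" where "hdim m p = (p + m - 1) choose p"

lemma dim_bihom: "has_complex_dim {f :: complex^'i::finite \<Rightarrow> complex. bihom p q f} (hdim CARD('i) p * hdim CARD('i) q)"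
proof -
  let ?M = "expts p \<times> expts q :: (('i \<Rightarrow> nat) \<times> ('i \<Rightarrow> nat)) set"
  let ?f = "\<lambda>(a, b). monomial a b :: complex^'i \<Rightarrow> complex"
  have fin: "finite ?M" using card_expts(1) by blast
  have deg: "sum (fst s) UNIV + sum (snd s) UNIV = p + q" if "s \<in> ?M" for s using that by (auto simp: expts_def)
  have inj: "inj_on ?f ?M"
  proof (rule inj_onI, rule ccontr)
    fix s t assume s: "s \<in> ?M" and t: "t \<in> ?M" and e: "?f s = ?f t" and n: "s \<noteq> t"
    have e': "monomial (fst s) (snd s) = monomial (fst t) (snd t)" using e by (simp add: case_prod_beta)
    have "(\<lambda>u. if u = s then 1 else -1 :: complex) s = 0"
    proof (rule monomial_independent[where S="{s, t}" and k="p + q" and c="\<lambda>u. if u = s then 1 else -1"])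
      show "(\<Sum>u\<in>{s, t}. (\<lambda>_. if u = s then 1 else - 1) * monomial (fst u) (snd u)) = (0 :: complex^'i \<Rightarrow> complex)"
        using n by (simp add: e') (simp add: pointwise)
    qed (use s t deg in auto)
    then show False by simp
  qed
  have "cfun.independent (?f ` ?M)"
  proof (rule cfun.independent_if_scalars_zero)
    show "finite (?f ` ?M)" using fin by simp
    fix u w assume z: "(\<Sum>v\<in>?f ` ?M. (\<lambda>x. u v * v x)) = 0" and "w \<in> ?f ` ?M"
    then obtain s where s: "s \<in> ?M" "w = ?f s" by blast
    have "(\<Sum>s\<in>?M. (\<lambda>_. u (?f s)) * monomial (fst s) (snd s)) = 0"
      using z unfolding sum.reindex[OF inj] by (simp add: case_prod_beta times_fun_def o_def)
    from monomial_independent[OF fin deg this s(1)] show "u w = 0" using s(2) by simp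
  qed
  moreover have "cfun.span (?f ` ?M) = {f. bihom p q f}"
  proof
    show "cfun.span (?f ` ?M) \<subseteq> {f. bihom p q f}"
      by (rule cfun.span_minimal[OF _ bihom_subspace]) (auto intro: bihom_monomial)
    show "{f. bihom p q f} \<subseteq> cfun.span (?f ` ?M)" using bihom_span unfolding monomials_def by blast
  qed
  moreover have "card (?f ` ?M) = hdim CARD('i) p * hdim CARD('i) q"
    unfolding card_image[OF inj] card_cartesian_product card_expts(2) hdim_def ..
  ultimately show ?thesis unfolding has_complex_dim_def using fin by blast
qed


section \<open>Dimensions of the highest weight spaces\<close>

text \<open>Rank and nullity for \<open>Lap\<close>, which maps bidegree \<open>(p, q)\<close> onto bidegree
  \<open>(p - 1, q - 1)\<close> and is zero if \<open>p = 0\<close> or \<open>q = 0\<close>.\<close>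

definition harm_dim :: "nat \<Rightarrow> nat \<Rightarrow> nat \<Rightarrow> nat" where
  "harm_dim m p q = hdim m p * hdim m q - (if p = 0 \<or> q = 0 then 0 else hdim m (p - 1) * hdim m (q - 1))"

text \<open>Rank and nullity for \<open>Eop\<close>, which maps harmonic polynomials of bidegree
  \<open>(p, q)\<close> onto those of bidegree \<open>(p - 1, q + 1)\<close> if
  \<open>p \<le> q\<close> and \<open>p \<noteq> 0\<close>, and is zero if \<open>p = 0\<close>.\<close>

definition hw_dim :: "nat \<Rightarrow> nat \<Rightarrow> nat \<Rightarrow> nat" where
  "hw_dim m p q = harm_dim m p q - (if p = 0 then 0 else harm_dim m (p - 1) (q + 1))"

lemma dim_harm:
  "has_complex_dim {f :: complex^'i::finite \<Rightarrow> complex. harm p q f} (harm_dim CARD('i) p q)"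
  "p \<noteq> 0 \<Longrightarrow> q \<noteq> 0 \<Longrightarrow> hdim CARD('i) (p - 1) * hdim CARD('i) (q - 1) \<le> hdim CARD('i) p * hdim CARD('i) q"
proof -
  have *: "has_complex_dim {f :: complex^'i \<Rightarrow> complex. harm p q f} (harm_dim CARD('i) p q) \<and>
    hdim CARD('i) (p - 1) * hdim CARD('i) (q - 1) \<le> hdim CARD('i) p * hdim CARD('i) q" if "p \<noteq> 0" "q \<noteq> 0"
  proof -
    from that obtain p' q' where pq: "p = Suc p'" "q = Suc q'" by (metis nat.exhaust)
    let ?W = "{f :: complex^'i \<Rightarrow> complex. bihom p q f}" and ?Y = "{f :: complex^'i \<Rightarrow> complex. bihom p' q' f}"
    have "\<exists>k. has_complex_dim {f \<in> ?W. Lap f = 0} k \<and> k + hdim CARD('i) p' * hdim CARD('i) q' = hdim CARD('i) p * hdim CARD('i) q"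
      by (rule has_complex_dim_kernel[OF dim_bihom dim_bihom])
        (use Lap_surj in \<open>auto simp: pq Lap_add Lap_scale bihom_polys bihom_Lap\<close>)
    then obtain k where k: "has_complex_dim {f \<in> ?W. Lap f = 0} k"
      "k + hdim CARD('i) (p - 1) * hdim CARD('i) (q - 1) = hdim CARD('i) p * hdim CARD('i) q" by (auto simp: pq)
    then have "k = harm_dim CARD('i) p q" by (simp add: harm_dim_def pq)
    then have "has_complex_dim {f :: complex^'i \<Rightarrow> complex. harm p q f} (harm_dim CARD('i) p q)"
      using k(1) by (simp add: harm_def)
    then show ?thesis using k(2) by linarith
  qed
  show "has_complex_dim {f :: complex^'i \<Rightarrow> complex. harm p q f} (harm_dim CARD('i) p q)"
  proof (cases "p = 0 \<or> q = 0")
    case True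
    then have "{f :: complex^'i \<Rightarrow> complex. harm p q f} = {f. bihom p q f}"
      using bihom_Lap_0 bihom_Lap_0' by (auto simp: harm_def)
    then show ?thesis using dim_bihom[where 'i='i, of p q] True by (simp add: harm_dim_def)
  next
    case False then show ?thesis using * by blast
  qed
  show "p \<noteq> 0 \<Longrightarrow> q \<noteq> 0 \<Longrightarrow> hdim CARD('i) (p - 1) * hdim CARD('i) (q - 1) \<le> hdim CARD('i) p * hdim CARD('i) q"
    using * by blast
qed

lemma dim_hw:
  assumes "p \<le> q"
  shows "has_complex_dim {f :: ('n::finite) cvec \<Rightarrow> complex. hw p q f} (hw_dim CARD('n + 'n) p q)"
    and "p \<noteq> 0 \<Longrightarrow> harm_dim CARD('n + 'n) (p - 1) (q + 1) \<le> harm_dim CARD('n + 'n) p q"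
proof -
  have *: "has_complex_dim {f :: 'n cvec \<Rightarrow> complex. hw p q f} (hw_dim CARD('n + 'n) p q) \<and>
    harm_dim CARD('n + 'n) (p - 1) (q + 1) \<le> harm_dim CARD('n + 'n) p q" if "p \<noteq> 0"
  proof -
    from that obtain p' where p: "p = Suc p'" by (metis nat.exhaust)
    let ?W = "{f :: 'n cvec \<Rightarrow> complex. harm p q f}" and ?Y = "{f :: 'n cvec \<Rightarrow> complex. harm p' (q + 1) f}"
    have EY: "harm p' (Suc q) (Eop f)" if "harm (Suc p') q f" for f :: "'n cvec \<Rightarrow> complex"
      using that bihom_E(1)[of p' q f] Lap_E[OF harm_polys[OF that]]
      by (simp add: harm_def poly_deriv_zero[OF poly_deriv_ops(3)])
    have "\<exists>k. has_complex_dim {f \<in> ?W. Eop f = 0} k \<and> k + harm_dim CARD('n + 'n) p' (q + 1) = harm_dim CARD('n + 'n) p q"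
    proof (rule has_complex_dim_kernel[OF dim_harm(1) dim_harm(1)])
      show "\<exists>f\<in>?W. Eop f = y" if "y \<in> ?Y" for y using E_surj[of p' q y] that assms by (auto simp: p)
    qed (auto simp: p EY poly_derivD(2)[OF poly_deriv_ops(3)] poly_deriv_scale[OF poly_deriv_ops(3)] harm_polys)
    then obtain k where k: "has_complex_dim {f \<in> ?W. Eop f = 0} k"
      "k + harm_dim CARD('n + 'n) (p - 1) (q + 1) = harm_dim CARD('n + 'n) p q" by (auto simp: p)
    then have "k = hw_dim CARD('n + 'n) p q" by (simp add: hw_dim_def p)
    then have "has_complex_dim {f :: 'n cvec \<Rightarrow> complex. hw p q f} (hw_dim CARD('n + 'n) p q)"
      using k(1) by (simp add: hw_def)
    then show ?thesis using k(2) by linarith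
  qed
  show "has_complex_dim {f :: 'n cvec \<Rightarrow> complex. hw p q f} (hw_dim CARD('n + 'n) p q)"
  proof (cases "p = 0")
    case True
    then have "{f :: 'n cvec \<Rightarrow> complex. hw p q f} = {f. harm p q f}"
      using bihom_E(2) by (auto simp: hw_def harm_def)
    then show ?thesis using dim_harm(1)[where 'i="'n + 'n", of p q] True by (simp add: hw_dim_def)
  next
    case False then show ?thesis using * by blast
  qed
  show "p \<noteq> 0 \<Longrightarrow> harm_dim CARD('n + 'n) (p - 1) (q + 1) \<le> harm_dim CARD('n + 'n) p q"
    using * by blast
qed

lemma choose_pred:
  assumes "p \<ge> 1"
  shows "real ((p - 1 + N) choose (p - 1)) = real p * real ((p + N) choose p) / (real p + real N)"
proof -
  obtain r where p: "p = Suc r" using assms by (metis not0_implies_Suc not_one_le_zero)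
  have "Suc r * (Suc (r + N) choose Suc r) = Suc (r + N) * (r + N choose r)" using binomial_absorption[of r "Suc (r + N)"] by simp
  then have "real p * real ((p + N) choose p) = (real p + real N) * real ((p - 1 + N) choose (p - 1))"
    by (simp add: p flip: of_nat_mult of_nat_add of_nat_Suc)
  then show ?thesis using assms by (simp add: field_simps)
qed

lemma choose_lower:
  "real M * (real M + 1) * real ((p + M + 1) choose p) = (real p + real M + 1) * (real p + real M) * real ((p + M - 1) choose p)"
proof -
  have a: "M * ((p + M) choose p) = (p + M) * ((p + M - 1) choose p)"
    using binomial_absorb_comp[of "p + M" p] by simp
  have b: "Suc M * ((p + M + 1) choose p) = (p + M + 1) * ((p + M) choose p)"
    using binomial_absorb_comp[of "p + M + 1" p] by simp
  have "real M * (real (Suc M) * real ((p + M + 1) choose p)) = real M * (real (p + M + 1) * real ((p + M) choose p))"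
    using b by (simp only: flip: of_nat_mult)
  also have "\<dots> = real (p + M + 1) * (real (p + M) * real ((p + M - 1) choose p))"
    using arg_cong[OF a, of real] unfolding of_nat_mult by (simp only: mult.left_commute[of "real M"])
  finally show ?thesis by (simp add: algebra_simps)
qed

lemma choose_lower_div:
  assumes "M \<ge> 1"
  shows "real ((p + M - 1) choose p) = real M * (real M + 1) * real ((p + M + 1) choose p) / ((real p + real M + 1) * (real p + real M))"
proof -
  have "(real p + real M + 1) * (real p + real M) \<noteq> 0" using assms by auto
  then show ?thesis unfolding choose_lower by simp
qed

text \<open>With \<open>N = 2 * n - 1\<close> all binomial coefficients are rational multiples of
  \<open>H p * H q\<close>, where \<open>H p\<close> is the number of monomials of degree
  \<open>p\<close> in \<open>N + 1\<close> variables, so that the alternating sum becomes an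
  identity of rational functions in \<open>p\<close>, \<open>q\<close> and \<open>N\<close>.\<close>

lemma real_hw_dim:
  assumes pq: "p \<le> q" and n: "CARD('n::finite) = n" "n \<ge> 2"
  shows "real (hw_dim CARD('n + 'n) p q) * (real q - real p + 1) = sasaki_mult n q p"
proof -
  define N where "N = 2 * n - 1"
  have m: "CARD('n + 'n) = N + 1" using n by (simp add: N_def)
  have N3: "N \<ge> 3" using n by (simp add: N_def)
  define H where "H p = real ((p + N) choose p)" for p
  define Hp where "Hp k = (if k = 0 then 0 else H (k - 1))" for k
  have hd: "real (hdim CARD('n + 'n) p) = H p" for p unfolding hdim_def H_def m by simp
  then have hd': "real (hdim (CARD('n) + CARD('n)) p) = H p" for p by simp
  have Hpp: "Hp k = real k * H k / (real k + real N)" for k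
    using choose_pred[of k N] by (auto simp: Hp_def H_def)
  have harm: "real (harm_dim CARD('n + 'n) p q) = H p * H q - Hp p * Hp q" for p q
    using dim_harm(2)[where 'i="'n + 'n", of p q] unfolding harm_dim_def
    by (auto simp: Hp_def hd hd' of_nat_diff)
  then have harm': "real (harm_dim (CARD('n) + CARD('n)) p q) = H p * H q - Hp p * Hp q" for p q by simp
  have Hs: "H (q + 1) = (real q + 1 + real N) * H q / (real q + 1)"
    using choose_pred[of "q + 1" N] by (simp add: H_def field_simps)
  have "real (hw_dim CARD('n + 'n) p q) = (H p * H q - Hp p * Hp q) - (if p = 0 then 0 else H (p - 1) * H (q + 1) - Hp (p - 1) * H q)"
  proof (cases "p = 0")
    case True
    then show ?thesis by (simp add: hw_dim_def harm')
  next
    case False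
    then have "real (hw_dim CARD('n + 'n) p q) = real (harm_dim CARD('n + 'n) p q) - real (harm_dim CARD('n + 'n) (p - 1) (q + 1))"
      using dim_hw(2)[where 'n='n, OF pq] by (simp add: hw_dim_def of_nat_diff)
    then show ?thesis using False unfolding harm by (simp add: Hp_def[of "Suc q"])
  qed
  also have "\<dots> = H p * H q - Hp p * Hp q - (Hp p * H (q + 1) - (real p * (real p - 1) / ((real p + real N) * (real p + real N - 1)) * H p) * H q)"
  proof (cases "p = 0")
    case True then show ?thesis by (simp add: Hp_def)
  next
    case False
    then have "Hp (p - 1) = (real p - 1) * H (p - 1) / (real p - 1 + real N)" using Hpp[of "p - 1"] by (simp add: of_nat_diff)
    also have "H (p - 1) = real p * H p / (real p + real N)" using Hpp[of p] False by (simp add: Hp_def)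
    finally show ?thesis using False N3 by (simp add: Hp_def) (simp add: algebra_simps)
  qed
  also have "\<dots> = H p * H q * (1 - real p * real q / ((real p + real N) * (real q + real N))
     - real p * (real q + 1 + real N) / ((real p + real N) * (real q + 1)) + real p * (real p - 1) / ((real p + real N) * (real p + real N - 1)))"
  proof -
    have "h * g - (P * h * a) * (Q * g * b) - ((P * h * a) * (R * g * c) - (P * L * (a * d) * h) * g)
      = h * g * (1 - P * Q * (a * b) - P * R * (a * c) + P * L * (a * d))" for h g P Q R L a b c d :: real
      by algebra
    then show ?thesis unfolding Hpp Hs divide_inverse inverse_mult_distrib .
  qed
  also have "1 - real p * real q / ((real p + real N) * (real q + real N))
     - real p * (real q + 1 + real N) / ((real p + real N) * (real q + 1)) + real p * (real p - 1) / ((real p + real N) * (real p + real N - 1))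
     = (real q - real p + 1) * (real q + real p + real N) * (real N * (real N - 1)) / ((real p + real N) * (real p + real N - 1) * ((real q + 1) * (real q + real N)))"
  proof -
    have "1 - P * Q / ((P + K) * (Q + K)) - P * (Q + 1 + K) / ((P + K) * (Q + 1)) + P * (P - 1) / ((P + K) * (P + K - 1))
      = (Q - P + 1) * (Q + P + K) * (K * (K - 1)) / ((P + K) * (P + K - 1) * ((Q + 1) * (Q + K)))"
      if "P \<ge> 0" "Q \<ge> 0" "K \<ge> 3" for P Q K :: real
    proof -
      have nz: "P + K \<noteq> 0" "P + K - 1 \<noteq> 0" "Q + 1 \<noteq> 0" "Q + K \<noteq> 0" using that by linarith+
      show ?thesis using nz by (simp add: divide_simps) (simp add: algebra_simps power2_eq_square)
    qed
    then show ?thesis using N3 by simp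
  qed
  finally have dim: "real (hw_dim CARD('n + 'n) p q) = H p * H q * ((real q - real p + 1) * (real q + real p + real N) * (real N * (real N - 1)) / ((real p + real N) * (real p + real N - 1) * ((real q + 1) * (real q + real N))))" .
  obtain M where M: "N = M + 1" "M \<ge> 2" using N3 by (metis add.commute le_Suc_ex numeral_2_eq_2 numeral_3_eq_3 add_Suc_right Suc_eq_plus1 le_add1 add_2_eq_Suc' Suc_le_mono)
  have c1: "real ((p + 2 * n - 3) choose (2 * n - 3)) = real N * (real N - 1) * H p / ((real p + real N) * (real p + real N - 1))"
  proof -
    have "(p + 2 * n - 3) choose (2 * n - 3) = (p + M - 1) choose p"
    proof -
      have e: "p + 2 * n - 3 = p + M - 1" "2 * n - 3 = (p + M - 1) - p" using M n by (auto simp: N_def)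
      show ?thesis unfolding e by (rule binomial_symmetric[symmetric]) (use M in simp)
    qed
    moreover have "p + N = p + M + 1" using M by simp
    ultimately show ?thesis using choose_lower_div[of M p] M(2) unfolding H_def by (simp add: M(1) mult_ac add_ac)
  qed
  have c2: "real ((q + 2 * n - 2) choose (2 * n - 3)) = real N * (real N - 1) * H q / ((real q + 1) * (real q + real N))"
  proof -
    have "(q + 2 * n - 2) choose (2 * n - 3) = (q + 1 + M - 1) choose (q + 1)"
    proof -
      have e: "q + 2 * n - 2 = q + 1 + M - 1" "2 * n - 3 = (q + 1 + M - 1) - (q + 1)" using M n by (auto simp: N_def)
      show ?thesis unfolding e by (rule binomial_symmetric[symmetric]) (use M in simp)
    qed
    then have "real ((q + 2 * n - 2) choose (2 * n - 3)) = real M * (real M + 1) * H (q + 1) / ((real q + 1 + real M + 1) * (real q + 1 + real M))"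
      using choose_lower_div[of M "q + 1"] M(2) unfolding H_def by (simp add: M(1) mult_ac add_ac)
    also have "\<dots> = real N * (real N - 1) * H q / ((real q + 1) * (real q + real N))"
    proof -
      have "A * (A + 1) * ((Q + 1 + (A + 1)) * h / (Q + 1)) / ((Q + 1 + A + 1) * (Q + 1 + A)) = (A + 1) * A * h / ((Q + 1) * (Q + (A + 1)))"
        if "Q \<ge> 0" "A \<ge> 0" for A Q h :: real
      proof -
        have "Q + 1 + A + 1 \<noteq> 0" "Q + 1 + A \<noteq> 0" "Q + 1 \<noteq> 0" using that by linarith+
        then show ?thesis by (simp add: divide_simps)
      qed
      from this[of "real q" "real M" "H q"] show ?thesis unfolding Hs by (simp add: M(1) add_ac)
    qed
    finally show ?thesis .
  qed
  have n2: "2 * real n - 1 = real N" "2 * real n - 2 = real N - 1" using n by (simp_all add: N_def of_nat_diff)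
  have n3: "real q + real p + 2 * real n - 1 = real q + real p + real N" using n2 by linarith
  have nz: "real N \<noteq> 0" "real N - 1 \<noteq> 0" using N3 by auto
  have "h * g * (D * W * (A * B) / (x * y)) * D = D\<^sup>2 * W / (A * B) * (A * B * g / y) * (A * B * h / x)"
    if "A \<noteq> 0" "B \<noteq> 0" for h g D W A B x y :: real
    using that by (simp add: power2_eq_square mult_ac)
  then show ?thesis unfolding sasaki_mult_def n2 n3 c1 c2 dim using nz by blast
qed

section \<open>Eigenfunctions of the Laplacian\<close>

lemma sum_Basis_cvec:
  fixes g :: "complex^'i::finite \<Rightarrow> 'b::comm_monoid_add"
  shows "(\<Sum>b\<in>Basis. g b) = (\<Sum>i\<in>UNIV. g (axis i 1) + g (axis i \<i>))"
proof -
  have B: "(Basis :: (complex^'i) set) = (\<lambda>(i, u). axis i u) ` (UNIV \<times> {1, \<i>})"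
    by (auto simp: Basis_vec_def Basis_complex_def image_iff)
  have inj: "inj_on (\<lambda>(i, u). axis i u :: complex^'i) (UNIV \<times> {1, \<i>})"
    by (auto simp: inj_on_def axis_eq_axis)
  have "(\<Sum>b\<in>Basis. g b) = (\<Sum>(i, u)\<in>UNIV \<times> {1, \<i>}. g (axis i u))"
    unfolding B sum.reindex[OF inj] by (simp add: o_def case_prod_beta)
  also have "\<dots> = (\<Sum>i\<in>UNIV. \<Sum>u\<in>{1, \<i>}. g (axis i u))" by (rule sum.cartesian_product[symmetric])
  finally show ?thesis by simp
qed

lemma lie_polys: "f \<in> polys \<Longrightarrow> lie A f x = (\<Sum>i\<in>UNIV. A x $ i * dz i f x + cnj (A x $ i) * dw i f x)"
  by (simp add: lie_def frechet_polys)

lemma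
  assumes f: "f \<in> polys"
  shows lie_qunit0: "lie (qunit 0) f = (\<lambda>x. \<i> * (Nz f x - Nw f x))"
    and lie_qunit1: "lie (qunit 1) f = Eop f - Fop f"
    and lie_qunit2: "lie (qunit 2) f = (\<lambda>x. \<i> * (Eop f x + Fop f x))"
  by (simp_all add: fun_eq_iff lie_polys[OF f] qunit_def quat_j_nth Nz_def Nw_def Eop_def Fop_def pointwise zc_def wc_def
      sum.distrib sum_negf sum_distrib_left sum_subtractf pointwise algebra_simps)

lemma lie_ident: "f \<in> polys \<Longrightarrow> lie (\<lambda>x. x) f = Nz f + Nw f"
  by (simp add: fun_eq_iff lie_polys Nz_def Nw_def pointwise zc_def wc_def sum.distrib)

lemma sum_hess_polys: "f \<in> polys \<Longrightarrow> (\<Sum>b\<in>Basis. hess f x b b) = 4 * Lap f x"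
proof -
  assume f: "f \<in> polys"
  have h: "hess f x b b = frechet_derivative (\<lambda>w. frechet_derivative f (at w) b) (at x) b" if "b \<in> Basis" for b
    using that by (simp add: hess_def inner_Basis if_distrib[of "\<lambda>c. c *\<^sub>R _"] if_distribR sum.delta' cong: if_cong)
  have 1: "(\<lambda>w. frechet_derivative f (at w) (axis i 1)) = dz i f + dw i f"
    and 2: "(\<lambda>w. frechet_derivative f (at w) (axis i \<i>)) = (\<lambda>w. \<i> * (dz i f - dw i f) w)" for i
    by (auto simp: fun_eq_iff pointwise dz_def dw_def field_simps)
  have d1: "frechet_derivative g (at x) (axis i 1) = dz i g x + dw i g x"
    and d2: "frechet_derivative g (at x) (axis i \<i>) = \<i> * (dz i g x - dw i g x)" for i and g :: "complex^'a \<Rightarrow> complex"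
    by (auto simp: dz_def dw_def field_simps plus_fun_apply minus_apply)
  have p: "dz i f \<in> polys" "dw i f \<in> polys" for i using polys_dz polys_dw f by blast+
  have "hess f x (axis i 1) (axis i 1) + hess f x (axis i \<i>) (axis i \<i>) = 4 * dz i (dw i f) x" for i
  proof -
    have b: "axis i 1 \<in> (Basis :: (complex^'a) set)" "axis i \<i> \<in> (Basis :: (complex^'a) set)" by (auto simp: Basis_vec_def Basis_complex_def)
    have e1: "hess f x (axis i 1) (axis i 1) = dz i (dz i f) x + dz i (dw i f) x + (dw i (dz i f) x + dw i (dw i f) x)"
      unfolding h[OF b(1)] 1 d1 poly_derivD(2)[OF poly_deriv_dz p] poly_derivD(2)[OF poly_deriv_dw p] by (simp add: plus_fun_apply)
    have e2: "hess f x (axis i \<i>) (axis i \<i>) = \<i> * (\<i> * (dz i (dz i f) x - dz i (dw i f) x) - \<i> * (dw i (dz i f) x - dw i (dw i f) x))"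
      unfolding h[OF b(2)] 2 d2 poly_deriv_scale[OF poly_deriv_dz polys_diff[OF p]] poly_deriv_scale[OF poly_deriv_dw polys_diff[OF p]]
        poly_deriv_diff[OF poly_deriv_dz p] poly_deriv_diff[OF poly_deriv_dw p] by (simp add: minus_apply)
    show ?thesis unfolding e1 e2 dz_dw[OF f, of i i, symmetric] by (simp add: pointwise algebra_simps)
  qed
  then show ?thesis unfolding sum_Basis_cvec Lap_def by (simp add: pointwise sum_distrib_left)
qed

lemma E_diff: "f \<in> polys \<Longrightarrow> g \<in> polys \<Longrightarrow> Eop (f - g) = Eop f - Eop g" "f \<in> polys \<Longrightarrow> g \<in> polys \<Longrightarrow> Fop (f - g) = Fop f - Fop g"
  using poly_deriv_diff poly_deriv_ops by blast+

text \<open>The sum of the squares of the three fields in terms of the basis \<open>Eop\<close>,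
  \<open>Fop\<close>, \<open>Nw - Nz\<close> of \<open>sl(2)\<close>.\<close>

lemma casimir:
  assumes b: "bihom p q f"
  shows "(\<Sum>s<3. lie (qunit s) (lie (qunit s) f) x) =
     - ((of_nat q - of_nat p)\<^sup>2 * f x + 2 * (Eop (Fop f) x + Fop (Eop f) x))"
proof -
  have f: "f \<in> polys" by (rule bihom_polys[OF b])
  have EF: "Eop f \<in> polys" "Fop f \<in> polys" using f by (auto intro: polys_ops)
  note N = bihom_Nz[OF b, THEN conjunct1] bihom_Nz[OF b, THEN conjunct2]
  have 0: "lie (qunit 0) f = (\<lambda>x. (\<i> * (of_nat p - of_nat q)) * f x)"
    unfolding lie_qunit0[OF f] N by (simp add: pointwise algebra_simps)
  have 00: "lie (qunit 0) (lie (qunit 0) f) x = - (of_nat q - of_nat p)\<^sup>2 * f x"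
    unfolding 0 lie_qunit0[OF polys_scale[OF f]] poly_deriv_scale[OF poly_deriv_ops(1) f] poly_deriv_scale[OF poly_deriv_ops(2) f] N
    by (simp add: power2_eq_square pointwise algebra_simps)
  have 11: "lie (qunit 1) (lie (qunit 1) f) x = Eop (Eop f) x - Eop (Fop f) x - (Fop (Eop f) x - Fop (Fop f) x)"
    unfolding lie_qunit1[OF f] lie_qunit1[OF polys_diff[OF EF]] E_diff[OF EF] by (simp add: minus_apply)
  have 2: "lie (qunit 2) f = (\<lambda>x. \<i> * (Eop f + Fop f) x)"
    unfolding lie_qunit2[OF f] by (simp add: plus_fun_apply)
  have 22: "lie (qunit 2) (lie (qunit 2) f) x = - (Eop (Eop f) x + Eop (Fop f) x + (Fop (Eop f) x + Fop (Fop f) x))"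
    unfolding 2 lie_qunit2[OF polys_scale[OF polys_add[OF EF]]] poly_deriv_scale[OF poly_deriv_ops(3) polys_add[OF EF]]
      poly_deriv_scale[OF poly_deriv_ops(4) polys_add[OF EF]] poly_derivD(2)[OF poly_deriv_ops(3) EF] poly_derivD(2)[OF poly_deriv_ops(4) EF]
    by (simp add: plus_fun_apply pointwise algebra_simps)
  show ?thesis unfolding sum_lt3 00 11 22 by (simp add: pointwise algebra_simps)
qed

text \<open>On the sphere the round Laplacian of a harmonic polynomial of degree \<open>k\<close> is determined
  by its radial derivatives: the radial Hessian is \<open>k * (k - 1)\<close> and the radial
  derivative is \<open>k\<close> times the function.\<close>

lemma sphere_op_harm:
  fixes f :: "('n::finite) cvec \<Rightarrow> complex"
  assumes h: "harm p q f" and C: "Eop (Fop f) x + Fop (Eop f) x = c * f x"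
    and x: "norm x = 1"
  shows "sphere_op P Q qunit f x =
    of_real P * ((of_nat (p + q) * (of_nat (p + q) + 4 * of_nat CARD('n) - 2)) * f x)
     + of_real (Q - P) * (((of_nat q - of_nat p)\<^sup>2 + 2 * c) * f x)"
proof -
  have b: "bihom p q f" and L: "Lap f = 0" using h by (auto simp: harm_def)
  have f: "f \<in> polys" by (rule bihom_polys[OF b])
  note N = bihom_Nz[OF b, THEN conjunct1] bihom_Nz[OF b, THEN conjunct2]
  define k where "k = (of_nat (p + q) :: complex)"
  have x1: "lie (\<lambda>x. x) f = (\<lambda>x. k * f x)" unfolding lie_ident[OF f] N by (simp add: pointwise k_def algebra_simps)
  have x2: "lie (\<lambda>x. x) (lie (\<lambda>x. x) f) = (\<lambda>x. k * (k * f x))"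
    unfolding x1 lie_ident[OF polys_scale[OF f]] poly_deriv_scale[OF poly_deriv_ops(1) f] poly_deriv_scale[OF poly_deriv_ops(2) f] N
    by (simp add: pointwise k_def algebra_simps)
  have D: "frechet_derivative f (at x) x = k * f x" using fun_cong[OF x1, of x] by (simp add: lie_def)
  have li: "linear (\<lambda>x::'n cvec. x)" by (rule linear_ident)
  have hx: "hess f x x x = k * (k * f x) - k * f x"
    using lie_lie[OF open_UNIV UNIV_I Ck_polys[OF f] li, of x] fun_cong[OF x2, of x] D by simp
  have M: "real DIM('n cvec) - 1 = 4 * real CARD('n) - 1" by simp
  have "sphere_op 1 1 qunit f x = - (4 * Lap f x - hess f x x x - (4 * real CARD('n) - 1) *\<^sub>R (k * f x))"
    unfolding quat.sphere_op_eq_hess[OF open_UNIV UNIV_I Ck_polys[OF f] x] sum_hess_polys[OF f] M D by simp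
  also have "\<dots> = k * (k + 4 * of_nat CARD('n) - 2) * f x"
    unfolding L hx by (simp add: pointwise scaleR_conv_of_real pointwise algebra_simps)
  finally have R: "(1 / 2) *\<^sub>R (\<Sum>b\<in>Basis. \<Sum>c\<in>Basis. lie (plane_rot b c) (lie (plane_rot b c) f) x) = - (k * (k + 4 * of_nat CARD('n) - 2) * f x)"
    by (simp add: sphere_op_def minus_equation_iff[of "(1 / 2) *\<^sub>R _"] eq_commute)
  have P: "(P / 2) *\<^sub>R z = P *\<^sub>R ((1 / 2) *\<^sub>R z)" for z :: complex by simp
  have S: "(\<Sum>s<3. lie (qunit s) (lie (qunit s) f) x) = - (((of_nat q - of_nat p)\<^sup>2 + 2 * c) * f x)"
    unfolding casimir[OF b] C by (simp add: pointwise algebra_simps)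
  show ?thesis unfolding sphere_op_def P R S k_def by (simp add: scaleR_conv_of_real pointwise algebra_simps)
qed

text \<open>Here \<open>z1 + z2\<close> is the degree and \<open>z1 - z2\<close> the highest weight. For
  \<open>P = \<alpha> * \<delta>\<close> and \<open>Q = \<delta>\<^sup>2\<close> this is
  \<open>sasaki_eta\<close>, see \<open>eigval_eq_sasaki_eta\<close>.\<close>

definition eigval :: "real \<Rightarrow> real \<Rightarrow> nat \<Rightarrow> nat \<Rightarrow> nat \<Rightarrow> real" where
  "eigval P Q n z1 z2 = P * (real (z1 + z2) * (real (z1 + z2) + 4 * real n - 2)) + (Q - P) * (real (z1 - z2) * (real (z1 - z2) + 2))"

text \<open>The operator \<open>Fop\<close> composed with \<open>Eop\<close> acts by a scalar on each weight
  vector of an irreducible module.\<close>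

lemma F_E_F_pow:
  assumes v: "hw l m v" and j: "l + j \<le> m"
  shows "Fop (Eop ((Fop ^^ j) v)) = (\<lambda>x. (of_nat j * (of_nat (m - l) - of_nat j + 1)) * (Fop ^^ j) v x)"
proof (cases j)
  case 0
  have "Fop (Eop v) = 0" using v by (simp add: hw_def poly_deriv_zero[OF poly_deriv_ops(4)])
  then show ?thesis by (simp add: 0) (simp add: pointwise)
next
  case (Suc i)
  have i: "Suc i \<le> m" using j Suc by simp
  have p: "(Fop ^^ i) v \<in> polys" by (rule F_pow_polys[OF hw_polys[OF v]])
  have "of_nat (m - l) = (of_nat m - of_nat l :: complex)" using j by (simp add: of_nat_diff)
  then have "(of_nat (Suc i) * (of_nat m - of_nat l - of_nat i) :: complex) = of_nat j * (of_nat (m - l) - of_nat j + 1)"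
    by (simp add: Suc)
  then show ?thesis
    unfolding Suc E_F_pow[OF v i] poly_deriv_scale[OF poly_deriv_ops(4) p] by (simp add: Suc)
qed

text \<open>The Casimir operator acts by \<open>d * (d + 2)\<close> on the whole module generated by a highest
  weight vector of weight \<open>d\<close>.\<close>

lemma sphere_op_F_pow:
  fixes v :: "('n::finite) cvec \<Rightarrow> complex"
  assumes v: "hw z2 z1 v" and j: "z2 + j \<le> z1" and x: "norm x = 1"
  shows "sphere_op P Q qunit ((Fop ^^ j) v) x = of_real (eigval P Q CARD('n) z1 z2) * (Fop ^^ j) v x"
proof -
  let ?f = "(Fop ^^ j) v"
  have h: "harm (z2 + j) (z1 - j) ?f" using F_pow_harm[of z2 z1 v j] v j by (simp add: hw_def)
  have f: "?f \<in> polys" by (rule harm_polys[OF h])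
  define d where "d = (of_nat (z1 - z2) :: complex)"
  define J where "J = (of_nat j :: complex)"
  have w: "of_nat (z1 - j) - of_nat (z2 + j) = d - 2 * J" using j by (simp add: d_def J_def of_nat_diff uminus_apply)
  have N: "Nw ?f x - Nz ?f x = (d - 2 * J) * ?f x"
    using bihom_Nz[of "z2 + j" "z1 - j" ?f] h unfolding w[symmetric] by (simp add: harm_def pointwise algebra_simps)
  have FE: "Fop (Eop ?f) x = (J * (d - J + 1)) * ?f x"
    using fun_cong[OF F_E_F_pow[OF v j], of x] by (simp add: d_def J_def)
  have "Eop (Fop ?f) x = Fop (Eop ?f) x + (Nw ?f x - Nz ?f x)"
    using fun_cong[OF E_F[OF f], of x] by (simp add: minus_apply pointwise algebra_simps)
  then have C: "Eop (Fop ?f) x + Fop (Eop ?f) x = (2 * (J * (d - J + 1)) + (d - 2 * J)) * ?f x"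
    unfolding N FE by (simp add: pointwise algebra_simps)
  have k: "z2 + j + (z1 - j) = z1 + z2" using j by simp
  have dd: "(d - 2 * J)\<^sup>2 + 2 * (2 * (J * (d - J + 1)) + (d - 2 * J)) = d * (d + 2)"
    by (simp add: power2_eq_square pointwise algebra_simps)
  show ?thesis
    unfolding sphere_op_harm[OF h C x] w dd k eigval_def by (simp add: d_def pointwise algebra_simps)
qed

lemma lie_cnj:
  assumes "\<And>x. f differentiable (at x)"
  shows "lie A (\<lambda>x. cnj (f x)) = (\<lambda>x. cnj (lie A f x))"
proof
  fix x
  show "lie A (\<lambda>x. cnj (f x)) x = cnj (lie A f x)"
    unfolding lie_def by (rule frechet_derivative_bounded_linear[OF bounded_linear_cnj assms])
qed

lemma sphere_op_cnj:
  fixes f :: "'a::euclidean_space \<Rightarrow> complex"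
  assumes "Ck_on 2 UNIV f" "\<And>s. linear (J s)"
  shows "sphere_op P Q J (\<lambda>x. cnj (f x)) x = cnj (sphere_op P Q J f x)"
proof -
  have C: "Ck_on (Suc (Suc 0)) UNIV f" using assms(1) by (simp add: numeral_2_eq_2)
  have "lie A (lie A (\<lambda>x. cnj (f x))) x = cnj (lie A (lie A f) x)" if A: "linear A" for A
  proof -
    have d: "f differentiable (at x)" for x using C by auto
    have "lie A f differentiable (at x)" for x using Ck_on_lie[OF open_UNIV C A] by auto
    then show ?thesis unfolding lie_cnj[OF d] by (subst lie_cnj) auto
  qed
  then have "(\<Sum>b\<in>Basis. \<Sum>c\<in>Basis. lie (plane_rot b c) (lie (plane_rot b c) (\<lambda>x. cnj (f x))) x) =
       cnj (\<Sum>b\<in>Basis. \<Sum>c\<in>Basis. lie (plane_rot b c) (lie (plane_rot b c) f) x)"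
    "(\<Sum>s<3. lie (J s) (lie (J s) (\<lambda>x. cnj (f x))) x) = cnj (\<Sum>s<3. lie (J s) (lie (J s) f) x)"
    by (simp_all add: linear_plane_rot assms(2))
  then show ?thesis unfolding sphere_op_def by (simp add: scaleR_conv_of_real)
qed

text \<open>The weight vectors of bidegree \<open>(z2 + j, z1 - j)\<close> in the isotypic component of
  \<open>(z1, z2)\<close>. For nonnegative weight they are images of highest weight vectors under
  powers of \<open>Fop\<close>; those of negative weight are obtained as complex conjugates of
  vectors of the opposite weight, in the same way as bidegrees \<open>(p, q)\<close> with
  \<open>p > q\<close> are reduced to \<open>p < q\<close>.\<close>

definition weight_space :: "nat \<Rightarrow> nat \<Rightarrow> nat \<Rightarrow> ('n::finite cvec \<Rightarrow> complex) set" where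
  "weight_space z1 z2 j = (if 2 * j \<le> z1 - z2 then (\<lambda>v. (Fop ^^ j) v) ` {v. hw z2 z1 v}
     else (\<lambda>f x. cnj (f x)) ` ((\<lambda>v. (Fop ^^ (z1 - z2 - j)) v) ` {v. hw z2 z1 v}))"

lemma weight_space_cases:
  assumes "f \<in> weight_space z1 z2 j"
  obtains v where "hw z2 z1 v" "f = (Fop ^^ j) v" "2 * j \<le> z1 - z2"
    | v where "hw z2 z1 v" "f = (\<lambda>x. cnj ((Fop ^^ (z1 - z2 - j)) v x))" "\<not> 2 * j \<le> z1 - z2"
  using assms unfolding weight_space_def by (auto split: if_splits)

context
  fixes z1 z2 j :: nat
  assumes z: "z2 \<le> z1" and j: "j \<le> z1 - z2"
begin

lemma weight_space_bihom:
  assumes "f \<in> weight_space z1 z2 j" shows "bihom (z2 + j) (z1 - j) f"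
  using assms
proof (cases rule: weight_space_cases)
  case (1 v)
  then show ?thesis using F_pow[of z2 z1 v j] z j by (simp add: hw_def harm_def)
next
  case (2 v)
  have "bihom (z2 + (z1 - z2 - j)) (z1 - (z1 - z2 - j)) ((Fop ^^ (z1 - z2 - j)) v)"
    using 2(1) z j by (intro F_pow) (auto simp: hw_def harm_def)
  moreover have "z2 + (z1 - z2 - j) = z1 - j" "z1 - (z1 - z2 - j) = z2 + j" using z j by auto
  ultimately show ?thesis using bihom_cnj 2(2) by simp
qed

lemma weight_space_eigen:
  fixes x :: "'n::finite cvec"
  assumes f: "f \<in> weight_space z1 z2 j" and x: "norm x = 1"
  shows "sphere_op P Q qunit f x = of_real (eigval P Q CARD('n) z1 z2) * f x"
  using f
proof (cases rule: weight_space_cases)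
  case (1 v)
  then show ?thesis using sphere_op_F_pow[OF 1(1) _ x, of j] z j by simp
next
  case (2 v)
  let ?g = "(Fop ^^ (z1 - z2 - j)) v"
  have "sphere_op P Q qunit f x = cnj (sphere_op P Q qunit ?g x)"
    unfolding 2(2) by (rule sphere_op_cnj[OF Ck_polys[OF F_pow_polys[OF hw_polys[OF 2(1)]]] quat.J_linear])
  also have "sphere_op P Q qunit ?g x = of_real (eigval P Q CARD('n) z1 z2) * ?g x"
    using sphere_op_F_pow[OF 2(1) _ x, of "z1 - z2 - j"] z j by simp
  finally show ?thesis by (simp add: 2(2))
qed

lemma dim_weight_space: "has_complex_dim (weight_space z1 z2 j :: ('n::finite cvec \<Rightarrow> complex) set) (hw_dim CARD('n + 'n) z2 z1)"
proof -
  have F: "has_complex_dim ((\<lambda>v. (Fop ^^ i) v) ` {v :: 'n cvec \<Rightarrow> complex. hw z2 z1 v}) (hw_dim CARD('n + 'n) z2 z1)"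
    if "z2 + i \<le> z1" for i
    by (rule has_complex_dim_image[where \<phi>="\<lambda>c. c", OF dim_hw(1)[OF z]])
      (use that in \<open>auto simp: F_pow_add F_pow_scale hw_polys intro: F_pow_inj\<close>)
  show ?thesis
  proof (cases "2 * j \<le> z1 - z2")
    case True
    then show ?thesis unfolding weight_space_def using F[of j] z j by simp
  next
    case False
    have "has_complex_dim ((\<lambda>f x. cnj (f x)) ` ((\<lambda>v. (Fop ^^ (z1 - z2 - j)) v) ` {v :: 'n cvec \<Rightarrow> complex. hw z2 z1 v})) (hw_dim CARD('n + 'n) z2 z1)"
      by (rule has_complex_dim_image[where \<phi>=cnj, OF F]) (use z j in \<open>auto simp: pointwise\<close>)
    then show ?thesis unfolding weight_space_def using False by simp
  qed
qed

end

lemma rad_sphere: "norm x = 1 \<Longrightarrow> rad x = 1" for x :: "complex^'i::finite"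
proof -
  assume "norm x = 1"
  then have "x \<bullet> x = 1" by (simp add: dot_square_norm)
  then have "herm x x = 1" by (simp add: herm_self)
  then show ?thesis by (simp add: rad_def pointwise zc_def wc_def herm_def mult.commute)
qed

lemma rpow_sphere: "norm x = 1 \<Longrightarrow> rpow j f x = f x"
  by (induction j) (simp_all add: times_fun_apply rad_sphere)

text \<open>On the sphere \<open>rad\<close> equals \<open>1\<close>, so the two decompositions turn a
  bihomogeneous polynomial into a sum of elements of weight spaces, directly if
  \<open>p \<le> q\<close> and after conjugation otherwise.\<close>

lemma poly_sphere_induct:
  fixes P :: "('n::finite cvec \<Rightarrow> complex) \<Rightarrow> bool"
  assumes base: "\<And>z1 z2 j f. z2 \<le> z1 \<Longrightarrow> j \<le> z1 - z2 \<Longrightarrow> f \<in> weight_space z1 z2 j \<Longrightarrow> P f"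
    and zero: "P 0" and add: "\<And>f g. f \<in> polys \<Longrightarrow> g \<in> polys \<Longrightarrow> P f \<Longrightarrow> P g \<Longrightarrow> P (f + g)"
    and cong: "\<And>f g. f \<in> polys \<Longrightarrow> (\<And>x. norm x = 1 \<Longrightarrow> f x = g x) \<Longrightarrow> P f \<Longrightarrow> P g"
    and f: "f \<in> polys"
  shows "P f"
proof -
  have sum: "P (\<Sum>i\<in>I. f i)" if "finite I" "\<And>i. i \<in> I \<Longrightarrow> f i \<in> polys \<and> P (f i)" for f and I :: "nat set"
    using that by (induction I) (auto intro: zero add polys_sum)
  have main: "P f \<and> (p \<noteq> q \<longrightarrow> P (\<lambda>x. cnj (f x)))" if b: "bihom p q f" and pq: "p \<le> q" for p q f
  proof -
    obtain g where g: "\<And>i. i \<le> p \<Longrightarrow> harm (p - i) (q - i) (g i)" and fg: "f = (\<Sum>i\<le>p. rpow i (g i))"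
      using bihom_decomp[OF b] pq by (auto simp: min_def)
    have "\<exists>v. (\<forall>j\<le>p - i. hw (p - i - j) (q - i + j) (v j)) \<and> g i = (\<Sum>j\<le>p - i. (Fop ^^ j) (v j))" if "i \<le> p" for i
      using harm_decomp[OF _ g[OF that]] pq that by simp
    then have "\<forall>i. \<exists>v. i \<le> p \<longrightarrow> (\<forall>j\<le>p - i. hw (p - i - j) (q - i + j) (v j)) \<and> g i = (\<Sum>j\<le>p - i. (Fop ^^ j) (v j))"
      by blast
    note that_choice = choice[OF this]
    obtain v where v: "\<And>i j. i \<le> p \<Longrightarrow> j \<le> p - i \<Longrightarrow> hw (p - i - j) (q - i + j) (v i j)"
      and gv: "\<And>i. i \<le> p \<Longrightarrow> g i = (\<Sum>j\<le>p - i. (Fop ^^ j) (v i j))"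
      using that_choice by blast
    let ?h = "\<lambda>i j. (Fop ^^ j) (v i j)"
    have hp: "?h i j \<in> polys" if "i \<le> p" "j \<le> p - i" for i j by (rule F_pow_polys[OF hw_polys[OF v[OF that]]])
    have hb: "bihom p' q' (?h i j) \<Longrightarrow> (\<lambda>x. cnj (?h i j x)) \<in> polys" for i j p' q' using bihom_cnj bihom_polys by blast
    have hc: "(\<lambda>x. cnj (?h i j x)) \<in> polys" if "i \<le> p" "j \<le> p - i" for i j
    proof -
      have "bihom (p - i - j + j) (q - i + j - j) (?h i j)"
        by (rule F_pow) (use v[OF that] that pq in \<open>auto simp: hw_def harm_def\<close>)
      then show ?thesis by (rule hb)
    qed
    have fx: "f x = (\<Sum>i\<le>p. \<Sum>j\<le>p - i. ?h i j) x" if "norm x = 1" for x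
      unfolding fg by (simp add: fun_sum_apply rpow_sphere[OF that] gv)
    have Ph: "P (?h i j)" if "i \<le> p" "j \<le> p - i" for i j
    proof (rule base)
      let ?z1 = "q - i + j" and ?z2 = "p - i - j"
      show "?z2 \<le> ?z1" using pq that by simp
      show "j \<le> ?z1 - ?z2" using pq that by simp
      have "2 * j \<le> ?z1 - ?z2" using pq that by simp
      then show "?h i j \<in> weight_space ?z1 ?z2 j" using v[OF that] unfolding weight_space_def by auto
    qed
    have Pc: "P (\<lambda>x. cnj (?h i j x))" if "i \<le> p" "j \<le> p - i" "p \<noteq> q" for i j
    proof (rule base)
      let ?z1 = "q - i + j" and ?z2 = "p - i - j"
      let ?k = "?z1 - ?z2 - j"
      show "?z2 \<le> ?z1" using pq that by simp
      show "?k \<le> ?z1 - ?z2" by simp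
      have "\<not> 2 * ?k \<le> ?z1 - ?z2" "?z1 - ?z2 - ?k = j" using pq that by auto
      then show "(\<lambda>x. cnj (?h i j x)) \<in> weight_space ?z1 ?z2 ?k" using v[OF that(1,2)] unfolding weight_space_def by auto
    qed
    have "P f"
    proof (rule cong)
      show "P (\<Sum>i\<le>p. \<Sum>j\<le>p - i. ?h i j)" by (intro sum conjI polys_sum hp Ph) auto
      show "(\<Sum>i\<le>p. \<Sum>j\<le>p - i. ?h i j) \<in> polys" by (intro polys_sum hp) auto
    qed (simp add: fx)
    moreover have "P (\<lambda>x. cnj (f x))" if "p \<noteq> q"
    proof (rule cong)
      show "P (\<Sum>i\<le>p. \<Sum>j\<le>p - i. (\<lambda>x. cnj (?h i j x)))" by (intro sum conjI polys_sum hc Pc that) auto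
      show "(\<Sum>i\<le>p. \<Sum>j\<le>p - i. (\<lambda>x. cnj (?h i j x))) \<in> polys" by (intro polys_sum hc) auto
    qed (simp add: fx fun_sum_apply cnj_sum)
    ultimately show ?thesis by blast
  qed
  have bi: "P f" if "bihom p q f" for p q f
  proof (cases "p \<le> q")
    case True then show ?thesis using main[OF that] by blast
  next
    case False
    then have "P (\<lambda>x. cnj (cnj (f x)))" using main[OF bihom_cnj[OF that]] by auto
    then show ?thesis by simp
  qed
  have stereo_coord: "f \<in> cfun.span (\<Union>p. \<Union>q. {f :: 'n cvec \<Rightarrow> complex. bihom p q f})" (is "_ \<in> cfun.span ?B")
    using f
  proof (induction rule: polys_induct)
    case (const c) show ?case using bihom.const by (intro cfun.span_base) blast
  next
    case (zc i)
    have "bihom 1 0 (zc i * (\<lambda>_. 1))" using bihom.zc[OF bihom.const] by simp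
    moreover have "zc i * (\<lambda>_. 1) = (zc i :: 'n cvec \<Rightarrow> complex)" by (simp add: pointwise)
    ultimately have "bihom 1 0 (zc i :: 'n cvec \<Rightarrow> complex)" by simp
    then show ?case by (intro cfun.span_base) blast
  next
    case (wc i)
    have "bihom 0 1 (wc i * (\<lambda>_. 1))" using bihom.wc[OF bihom.const] by simp
    moreover have "wc i * (\<lambda>_. 1) = (wc i :: 'n cvec \<Rightarrow> complex)" by (simp add: pointwise)
    ultimately have "bihom 0 1 (wc i :: 'n cvec \<Rightarrow> complex)" by simp
    then show ?case by (intro cfun.span_base) blast
  next
    case (add f g) then show ?case by (intro cfun.span_add)
  next
    case (mult f g)
    show ?case
    proof (rule span_mono_mult[OF mult.IH(2)])
      fix h assume h: "h \<in> ?B"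
      have "h * f \<in> cfun.span ?B"
        by (rule span_mono_mult[OF mult.IH(1)]) (use h in \<open>auto intro!: cfun.span_base bihom_mult exI\<close>)
      then show "f * h \<in> cfun.span ?B" by (simp add: mult.commute)
    qed
  qed
  then have "P f \<and> f \<in> polys"
  proof (induction rule: cfun.span_induct_alt)
    case base show ?case using zero polys_zero by blast
  next
    case (step c x y)
    then obtain p q where "bihom p q x" by blast
    then have "bihom p q (\<lambda>z. c * x z)" by (rule bihom_scale)
    then show ?case using step bi add bihom_polys polys_add by blast
  qed
  then show ?thesis by blast
qed

section \<open>Integration over the sphere\<close>

lemma integral_lborel_translate:
  fixes f :: "'a::euclidean_space \<Rightarrow> complex"
  assumes "f \<in> borel_measurable borel"
  shows "integral\<^sup>L lborel (\<lambda>x. f (c + x)) = integral\<^sup>L lborel f"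
  using integral_distr[of "\<lambda>x. c + x" lborel borel f] assms by (simp add: lborel_distr_plus)

lemma integrable_bounded_support:
  fixes f :: "'a::euclidean_space \<Rightarrow> complex"
  assumes "continuous_on UNIV f" "\<And>x. norm x > r \<Longrightarrow> f x = 0"
  shows "integrable lborel f"
proof -
  have "integrable lborel (\<lambda>x. indicator (cball 0 r) x *\<^sub>R f x)"
    by (rule borel_integrable_compact[OF compact_cball]) (use assms(1) continuous_on_subset in blast)
  also have "(\<lambda>x. indicator (cball 0 r) x *\<^sub>R f x) = f"
    using assms(2) by (auto simp: fun_eq_iff indicator_def not_le)
  finally show ?thesis .
qed

text \<open>The integral of a difference quotient vanishes by translation invariance, and difference quotients
  converge to the derivative while staying bounded on a fixed ball.\<close>

lemma integral_derivative_zero: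
  fixes H :: "'a::euclidean_space \<Rightarrow> complex"
  assumes C: "Ck_on 1 UNIV H" and supp: "\<And>x. norm x > r \<Longrightarrow> H x = 0"
  shows "integrable lborel (\<lambda>x. frechet_derivative H (at x) v)"
    and "(\<integral>x. frechet_derivative H (at x) v \<partial>lborel) = 0"
proof -
  let ?D = "\<lambda>x. frechet_derivative H (at x) v"
  have C': "Ck_on (Suc 0) UNIV H" using C by simp
  note d = Ck_on_SucD(1)[OF C' UNIV_I]
  have cD: "continuous_on UNIV ?D" using Ck_on_SucD(2)[OF C', of v] by simp
  have cH: "continuous_on UNIV H" by (rule Ck_on_imp_continuous_on[OF C])
  have D0: "?D x = 0" if "norm x > r" for x
  proof -
    have "frechet_derivative H (at x) = frechet_derivative (\<lambda>_. 0) (at x)"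
      by (rule frechet_derivative_cong_open[of "{x. norm x > r}"])
        (use that supp in \<open>auto intro!: open_Collect_less continuous_intros\<close>)
    then show ?thesis by simp
  qed
  show int: "integrable lborel ?D" by (rule integrable_bounded_support[OF cD D0])
  have "bounded (?D ` cball 0 r)"
    by (rule compact_imp_bounded[OF compact_continuous_image[OF continuous_on_subset[OF cD] compact_cball]]) simp
  then obtain B where B: "\<And>x. x \<in> cball 0 r \<Longrightarrow> norm (?D x) \<le> B" and B0: "B > 0" unfolding bounded_pos by blast
  have DB: "norm (?D x) \<le> B" for x using B[of x] D0[of x] B0 by (cases "norm x \<le> r") auto
  define q where "q k x = (H (inverse (real (Suc k)) *\<^sub>R v + x) - H x) /\<^sub>R inverse (real (Suc k))" for k x
  have mH: "H \<in> borel_measurable borel" by (rule borel_measurable_continuous_onI[OF cH])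
  have iH: "integrable lborel H" by (rule integrable_bounded_support[OF cH supp])
  have iHt: "integrable lborel (\<lambda>x. H (c + x))" for c
  proof (rule integrable_bounded_support[where r="r + norm c"])
    show "continuous_on UNIV (\<lambda>x. H (c + x))" by (intro continuous_on_compose2[OF cH] continuous_intros) auto
    show "H (c + x) = 0" if "norm x > r + norm c" for x
      using that norm_diff_ineq[of x c] by (intro supp) (simp add: add.commute)
  qed
  have q0: "integral\<^sup>L lborel (q k) = 0" for k
    unfolding q_def using iH iHt integral_lborel_translate[OF mH] by simp
  have lim: "(\<lambda>k. integral\<^sup>L lborel (q k)) \<longlonglongrightarrow> integral\<^sup>L lborel ?D"
  proof (rule integral_dominated_convergence[where w="\<lambda>x. indicator (cball 0 (r + norm v)) x *\<^sub>R B"])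
    show "?D \<in> borel_measurable lborel" using borel_measurable_continuous_onI[OF cD] by simp
    show "q k \<in> borel_measurable lborel" for k
      unfolding q_def using borel_measurable_integrable[OF iHt] borel_measurable_integrable[OF iH] by simp
    show "integrable lborel (\<lambda>x::'a. indicator (cball 0 (r + norm v)) x *\<^sub>R B)"
      by (rule borel_integrable_compact[OF compact_cball]) simp
    show "AE x in lborel. (\<lambda>k. q k x) \<longlonglongrightarrow> ?D x"
    proof (rule AE_I2)
      fix x :: 'a
      let ?g = "\<lambda>t. H (t *\<^sub>R v + x)"
      have "((\<lambda>t. H (t *\<^sub>R v + x)) has_derivative (\<lambda>h. frechet_derivative H (at x) (h *\<^sub>R v))) (at (0::real))"
        by (rule has_derivative_compose[where g=H and f="\<lambda>t. t *\<^sub>R v + x", simplified]) (use d[of x] in \<open>auto intro!: derivative_eq_intros\<close>)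
      then have "(?g has_vector_derivative ?D x) (at 0)"
        using linear_scale[OF has_derivative_linear[OF d[of x]]] by (simp add: has_vector_derivative_def)
      then have "((\<lambda>t. (?g t - ?g 0 - t *\<^sub>R ?D x) /\<^sub>R norm t) \<longlongrightarrow> 0) (at 0)"
        by (simp add: has_vector_derivative_def has_derivative_def)
      then have "(\<lambda>k. (?g (inverse (real (Suc k))) - ?g 0 - inverse (real (Suc k)) *\<^sub>R ?D x) /\<^sub>R norm (inverse (real (Suc k)))) \<longlonglongrightarrow> 0"
        using LIMSEQ_inverse_real_of_nat unfolding tendsto_at_iff_sequentially
        by (auto simp: o_def dest!: spec[of _ "\<lambda>k. inverse (real (Suc k))"])
      moreover have "(?g t - ?g 0 - t *\<^sub>R d) /\<^sub>R norm t = (?g t - ?g 0) /\<^sub>R t - d" if "t > 0" for t d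
        using that by (simp add: scaleR_diff_right)
      moreover have "inverse (real (Suc k)) > 0" for k by simp
      ultimately have "(\<lambda>k. q k x - ?D x) \<longlonglongrightarrow> 0" unfolding q_def by (simp only: scaleR_zero_left add_0_left)
      then show "(\<lambda>k. q k x) \<longlonglongrightarrow> ?D x" by (rule LIM_zero_cancel)
    qed
    show "AE x in lborel. norm (q k x) \<le> indicator (cball 0 (r + norm v)) x *\<^sub>R B" for k
    proof (rule AE_I2)
      fix x :: 'a
      define t where "t = inverse (real (Suc k))"
      have t: "0 < t" "t \<le> 1" by (auto simp: t_def field_simps)
      show "norm (q k x) \<le> indicator (cball 0 (r + norm v)) x *\<^sub>R B"
      proof (cases "norm x \<le> r + norm v")
        case True
        have "norm (H (t *\<^sub>R v + x) - H (0 *\<^sub>R v + x)) \<le> B * norm (t - 0)"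
        proof (rule differentiable_bound[where S=UNIV and f'="\<lambda>s h. h *\<^sub>R ?D (s *\<^sub>R v + x)"])
          fix s :: real
          have "((\<lambda>s. H (s *\<^sub>R v + x)) has_derivative (\<lambda>h. frechet_derivative H (at (s *\<^sub>R v + x)) (h *\<^sub>R v))) (at s)"
            by (rule has_derivative_compose[OF _ d]) (auto intro!: derivative_eq_intros)
          then show "((\<lambda>s. H (s *\<^sub>R v + x)) has_derivative (\<lambda>h. h *\<^sub>R ?D (s *\<^sub>R v + x))) (at s within UNIV)"
            using linear_scale[OF has_derivative_linear[OF d]] by simp
          show "onorm (\<lambda>h. h *\<^sub>R ?D (s *\<^sub>R v + x)) \<le> B"
            by (rule onorm_bound) (use DB B0 in \<open>auto simp: mult.commute[of B] intro!: mult_left_mono\<close>)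
        qed auto
        then have "norm (q k x) \<le> B"
          unfolding q_def t_def[symmetric] norm_scaleR using t by (simp add: divide_le_eq flip: divide_inverse_commute)
        then show ?thesis using True by simp
      next
        case False
        have "norm (t *\<^sub>R v) \<le> norm v" using t by (simp add: mult_left_le_one_le)
        then have "norm (t *\<^sub>R v + x) > r" using False norm_diff_ineq[of x "t *\<^sub>R v"] by (simp add: add.commute)
        moreover have "norm x > r" using False norm_ge_zero[of v] by linarith
        ultimately have "q k x = 0" unfolding q_def t_def[symmetric] by (simp add: supp)
        then show ?thesis using B0 by simp
      qed
    qed
  qed
  then show "(\<integral>x. ?D x \<partial>lborel) = 0" unfolding q0 using LIMSEQ_const_iff by metis
qed

text \<open>Integrals over the sphere are replaced by integrals over the ambient space of functions that are
  constant along rays, times a radial weight of class \<open>C\<^sup>1\<close>. The weight is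
  supported in the annulus between the radii \<open>1/2\<close> and \<open>2\<close>, so that
  neither the origin nor infinity causes trouble.\<close>

definition weight :: "'a::euclidean_space \<Rightarrow> real" where
  "weight x = (max 0 (x \<bullet> x - 1 / 4))\<^sup>2 * (max 0 (4 - x \<bullet> x))\<^sup>2"

definition sphere_integral :: "('a::euclidean_space \<Rightarrow> complex) \<Rightarrow> complex" where
  "sphere_integral h = (\<integral>x. weight x *\<^sub>R h (x /\<^sub>R norm x) \<partial>lborel)"

lemma Ck_on_square_max: "Ck_on 1 UNIV (\<lambda>t::real. (max 0 t)\<^sup>2)"
proof -
  have "((\<lambda>t. (max 0 t)\<^sup>2) has_real_derivative 2 * max 0 t) (at t)" for t :: real
  proof (cases t "0 :: real" rule: linorder_cases)
    case less
    have "((\<lambda>t. 0) has_real_derivative 2 * max 0 t) (at t)" using less by simp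
    then show ?thesis
      by (rule has_field_derivative_transform_within_open[where S="{..<0}"]) (use less in auto)
  next
    case equal
    have "((\<lambda>h. max 0 h) \<longlongrightarrow> max 0 (0::real)) (at 0)" by (intro tendsto_intros)
    moreover have "(\<lambda>h. ((max 0 h)\<^sup>2) / h) = (\<lambda>h. max 0 (h::real))"
      by (auto simp: fun_eq_iff max_def power2_eq_square)
    ultimately show ?thesis using equal by (simp add: DERIV_def)
  next
    case greater
    have "((\<lambda>t. t\<^sup>2) has_real_derivative 2 * max 0 t) (at t)" using greater by (auto intro!: derivative_eq_intros)
    then show ?thesis
      by (rule has_field_derivative_transform_within_open[where S="{0<..}"]) (use greater in auto)
  qed
  then have d: "((\<lambda>t. (max 0 t)\<^sup>2) has_derivative (\<lambda>h. 2 * max 0 t * h)) (at t)" for t :: real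
    by (simp add: has_field_derivative_def mult.commute[of _ "2 * _"])
  show ?thesis unfolding One_nat_def
    by (rule Ck_on_SucI[OF open_UNIV d]) (auto intro!: continuous_intros)
qed

lemma Ck_weight: "Ck_on 1 UNIV (weight :: 'a::euclidean_space \<Rightarrow> real)"
proof -
  have i: "Ck_on 1 UNIV (\<lambda>x::'a. x \<bullet> x)"
    by (intro Ck_on_inner Ck_on_linear open_UNIV bounded_linear_ident)
  note c = Ck_on_compose[OF open_UNIV open_UNIV subset_UNIV Ck_on_square_max]
  have "Ck_on 1 UNIV (\<lambda>x::'a. (max 0 (x \<bullet> x - 1 / 4))\<^sup>2)"
    by (rule c[OF Ck_on_diff[OF open_UNIV i Ck_on_const[OF open_UNIV]]])
  moreover have "Ck_on 1 UNIV (\<lambda>x::'a. (max 0 (4 - x \<bullet> x))\<^sup>2)"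
    by (rule c[OF Ck_on_diff[OF open_UNIV Ck_on_const[OF open_UNIV] i]])
  ultimately show ?thesis unfolding weight_def[abs_def] by (intro Ck_on_mult open_UNIV)
qed

lemma weight_inner: "norm x \<le> 1 / 2 \<Longrightarrow> weight x = 0"
  using power_mono[of "norm x" "1/2" 2] by (simp add: weight_def dot_square_norm power2_eq_square max_def)

lemma weight_outer: "norm x \<ge> 2 \<Longrightarrow> weight x = 0"
  using power_mono[of 2 "norm x" 2] by (simp add: weight_def dot_square_norm max_def)

lemma weight_nonneg: "weight x \<ge> 0" by (simp add: weight_def)

lemma weight_sphere: "norm x = 1 \<Longrightarrow> weight x > 0"
  by (simp add: weight_def dot_square_norm)

lemma Ck_normalize: "Ck_on k (- {0}) (\<lambda>x::'a::euclidean_space. x /\<^sub>R norm x)"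
  by (intro Ck_on_scaleR Ck_on_inverse Ck_on_norm Ck_on_linear) auto

text \<open>The function may be singular at the origin, but the weight vanishes nearby.\<close>

lemma Ck_weighted:
  fixes F :: "'a::euclidean_space \<Rightarrow> complex"
  assumes F: "Ck_on k (- {0}) F" and k: "k \<le> 1"
  shows "Ck_on k UNIV (\<lambda>x. weight x *\<^sub>R F (x /\<^sub>R norm x))"
proof (rule Ck_on_cong_local)
  fix x :: 'a
  have "Ck_on k (ball 0 (1 / 2)) (\<lambda>x. weight x *\<^sub>R F (x /\<^sub>R norm x))"
    using Ck_on_const[of "ball 0 (1 / 2)" k 0] Ck_on_cong[of "ball 0 (1/2)" "\<lambda>x. weight x *\<^sub>R F (x /\<^sub>R norm x)" "\<lambda>_. 0" k]
    by (auto simp: weight_inner)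
  moreover have "Ck_on k (- {0}) (\<lambda>x. weight x *\<^sub>R F (x /\<^sub>R norm x))"
    by (intro Ck_on_scaleR Ck_on_compose[OF _ _ _ F Ck_normalize] Ck_on_mono[OF Ck_on_subset[OF Ck_weight] k]) auto
  moreover have "x \<in> ball 0 (1 / 2) \<or> x \<in> - {0}" by auto
  ultimately show "\<exists>V. open V \<and> x \<in> V \<and> Ck_on k V (\<lambda>x. weight x *\<^sub>R F (x /\<^sub>R norm x))"
    by (meson open_ball open_Compl closed_singleton)
qed

lemma sphere_integrand_cont:
  fixes h :: "'a::euclidean_space \<Rightarrow> complex"
  assumes h: "continuous_on (sphere 0 1) h"
  shows "continuous_on UNIV (\<lambda>x. weight x *\<^sub>R h (x /\<^sub>R norm x))"
proof -
  have cw: "continuous_on A weight" for A :: "'a set"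
    using continuous_on_subset[OF Ck_on_imp_continuous_on[OF Ck_weight]] by blast
  have "continuous_on {x. 1 / 2 \<le> norm x} (\<lambda>x. weight x *\<^sub>R h (x /\<^sub>R norm x))"
    by (intro continuous_on_scaleR cw continuous_on_compose2[OF h] continuous_intros) (auto intro!: left_inverse)
  moreover have "continuous_on {x. norm x \<le> 1 / 2} (\<lambda>x. weight x *\<^sub>R h (x /\<^sub>R norm x))"
    by (rule continuous_on_cong[THEN iffD2, OF refl _ continuous_on_const[of _ 0]]) (simp add: weight_inner)
  ultimately have "continuous_on ({x. 1 / 2 \<le> norm x} \<union> {x. norm x \<le> 1 / 2}) (\<lambda>x. weight x *\<^sub>R h (x /\<^sub>R norm x))"
    by (rule continuous_on_closed_Un[rotated 2]) (auto intro!: closed_Collect_le continuous_intros)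
  moreover have "{x. 1 / 2 \<le> norm x} \<union> {x. norm x \<le> 1 / 2} = (UNIV :: 'a set)" by auto
  ultimately show ?thesis by simp
qed

lemma sphere_integrable:
  fixes h :: "'a::euclidean_space \<Rightarrow> complex"
  assumes h: "continuous_on (sphere 0 1) h"
  shows "integrable lborel (\<lambda>x. weight x *\<^sub>R h (x /\<^sub>R norm x))"
  by (rule integrable_bounded_support[OF sphere_integrand_cont[OF h], of 2]) (simp add: weight_outer)

lemma sphere_integral_cong: "(\<And>x. norm x = 1 \<Longrightarrow> f x = g x) \<Longrightarrow> sphere_integral f = sphere_integral g"
  unfolding sphere_integral_def
proof (rule Bochner_Integration.integral_cong[OF refl])
  fix x :: 'a assume "\<And>x :: 'a. norm x = 1 \<Longrightarrow> f x = g x"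
  then have "f (x /\<^sub>R norm x) = g (x /\<^sub>R norm x)" if "x \<noteq> 0" using that by simp
  then show "weight x *\<^sub>R f (x /\<^sub>R norm x) = weight x *\<^sub>R g (x /\<^sub>R norm x)"
    by (cases "x = 0") (simp_all add: weight_inner)
qed

lemma sphere_integral_add:
  "continuous_on (sphere 0 1) f \<Longrightarrow> continuous_on (sphere 0 1) g \<Longrightarrow>
    sphere_integral (\<lambda>x. f x + g x) = sphere_integral f + sphere_integral g"
  unfolding sphere_integral_def using sphere_integrable[of f] sphere_integrable[of g]
  by (simp add: scaleR_add_right)

lemma sphere_integral_scale: "sphere_integral (\<lambda>x. c * f x) = c * sphere_integral f"
  by (simp add: sphere_integral_def flip: integral_mult_right_zero)

lemma sphere_integral_diff:
  assumes "continuous_on (sphere 0 1) f" "continuous_on (sphere 0 1) g"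
  shows "sphere_integral (\<lambda>x. f x - g x) = sphere_integral f - sphere_integral g"
  unfolding sphere_integral_def using assms[THEN sphere_integrable] by (simp add: scaleR_diff_right)

lemma sphere_integral_sum:
  "(\<And>i. i \<in> I \<Longrightarrow> continuous_on (sphere 0 1) (f i)) \<Longrightarrow>
    sphere_integral (\<lambda>x. \<Sum>i\<in>I. f i x) = (\<Sum>i\<in>I. sphere_integral (f i))"
  unfolding sphere_integral_def scaleR_sum_right by (intro Bochner_Integration.integral_sum sphere_integrable)

lemma norm_sphere_integral:
  fixes h :: "'a::euclidean_space \<Rightarrow> complex"
  assumes h: "continuous_on (sphere 0 1) h" and M: "\<And>x. norm x = 1 \<Longrightarrow> norm (h x) \<le> M"
  shows "norm (sphere_integral h) \<le> M * norm (sphere_integral (\<lambda>x::'a::euclidean_space. 1))"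
proof -
  let ?w = "weight :: 'a \<Rightarrow> real"
  have iw: "integrable lborel (\<lambda>x. complex_of_real (?w x))"
    using sphere_integrable[of "\<lambda>x::'a. 1"] by (simp add: scaleR_conv_of_real)
  then have iw': "integrable lborel ?w" by (simp only: complex_of_real_integrable_eq)
  have "norm (sphere_integral h) \<le> (\<integral>x. M * ?w x \<partial>lborel)"
    unfolding sphere_integral_def
  proof (rule Bochner_Integration.integral_norm_bound_integral)
    show "integrable lborel (\<lambda>x. ?w x *\<^sub>R h (x /\<^sub>R norm x))" by (rule sphere_integrable[OF h])
    show "integrable lborel (\<lambda>x. M * ?w x)" using iw' by simp
    fix x :: 'a
    have "norm (h (x /\<^sub>R norm x)) \<le> M" if "x \<noteq> 0" using that by (intro M) simp
    then show "norm (?w x *\<^sub>R h (x /\<^sub>R norm x)) \<le> M * ?w x"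
      by (cases "x = 0") (auto simp: weight_inner weight_nonneg mult.commute[of M] intro!: mult_left_mono)
  qed
  also have "\<dots> = M * (\<integral>x. ?w x \<partial>lborel)" by simp
  also have "(\<integral>x. ?w x \<partial>lborel) = norm (sphere_integral (\<lambda>x::'a. 1))"
    by (simp add: sphere_integral_def scaleR_conv_of_real weight_nonneg)
  finally show ?thesis .
qed

text \<open>The integrand is continuous and nonnegative, so it vanishes everywhere if its integral does.\<close>

lemma sphere_integral_pos:
  fixes h :: "'a::euclidean_space \<Rightarrow> complex"
  assumes h: "continuous_on (sphere 0 1) h" and z: "sphere_integral (\<lambda>x. h x * cnj (h x)) = 0" and x: "norm x = 1"
  shows "h x = 0"
proof -
  let ?f = "\<lambda>x::'a. weight x * (cmod (h (x /\<^sub>R norm x)))\<^sup>2"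
  have c: "continuous_on (sphere 0 1) (\<lambda>x. h x * cnj (h x))" by (intro continuous_intros h)
  have e: "weight x *\<^sub>R (h (x /\<^sub>R norm x) * cnj (h (x /\<^sub>R norm x))) = complex_of_real (?f x)" for x
    unfolding complex_norm_square[symmetric] by (simp add: scaleR_conv_of_real)
  have "integrable lborel (\<lambda>x. complex_of_real (?f x))" using sphere_integrable[OF c] unfolding e .
  then have i: "integrable lborel ?f" by (simp only: complex_of_real_integrable_eq)
  have "complex_of_real (integral\<^sup>L lborel ?f) = 0"
    using z unfolding sphere_integral_def e by (simp only: integral_complex_of_real)
  then have "integral\<^sup>L lborel ?f = 0" by simp
  then have "AE x in lborel. ?f x = 0"
    using integral_nonneg_eq_0_iff_AE[OF i] by (simp add: weight_nonneg)
  then have "AE x in lebesgue. x \<in> {x. ?f x = 0}" by (simp add: AE_completion)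
  moreover have "closed {x. ?f x = 0}"
  proof -
    have "continuous_on UNIV (\<lambda>x. complex_of_real (?f x))" using sphere_integrand_cont[OF c] unfolding e .
    then have "closed {x. complex_of_real (?f x) = 0}" by (intro closed_Collect_eq continuous_on_const)
    then show ?thesis by simp
  qed
  ultimately have "?f x = 0" using mem_closed_if_AE_lebesgue by blast
  then show ?thesis using x weight_sphere[OF x] by simp
qed

text \<open>A skew linear field is tangent to the spheres and has divergence zero. Hence the derivative along it
  is the sum of the partial derivatives of the components times the function, and each of them has
  integral zero. The field annihilates the weight and commutes with the radial projection.\<close>

lemma sphere_integral_lie:
  fixes F :: "'a::euclidean_space \<Rightarrow> complex"
  assumes F: "Ck_on 1 (- {0}) F" and A: "linear A" and skew: "\<And>x. A x \<bullet> x = 0"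
  shows "sphere_integral (lie A F) = 0"
proof -
  define G where "G x = weight x *\<^sub>R F (x /\<^sub>R norm x)" for x
  have G: "Ck_on 1 UNIV G" unfolding G_def by (rule Ck_weighted[OF F]) simp
  note dG = Ck_on_SucD(1)[OF G[unfolded One_nat_def] UNIV_I]
  have bA: "bounded_linear A" using A by (rule linear_conv_bounded_linear[THEN iffD1])
  have lieG: "frechet_derivative G (at x) (A x) = weight x *\<^sub>R lie A F (x /\<^sub>R norm x)" for x
  proof (cases "x = 0")
    case True
    then show ?thesis using linear_0[OF A] linear_0[OF has_derivative_linear[OF dG[of 0]]] by (simp add: weight_inner)
  next
    case False
    let ?N = "\<lambda>x::'a. x /\<^sub>R norm x"
    have N: "(?N has_derivative (\<lambda>h. inverse (norm x) *\<^sub>R h + (- (inverse (norm x) * (h \<bullet> sgn x) * inverse (norm x))) *\<^sub>R x)) (at x)"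
      using has_derivative_scaleR[OF Deriv.has_derivative_inverse[OF _ has_derivative_norm] has_derivative_ident] False by simp
    have F': "(F has_derivative frechet_derivative F (at (?N x))) (at (?N x))"
      using Ck_on_SucD(1)[OF F[unfolded One_nat_def], of "?N x"] False by simp
    have w: "(weight has_derivative frechet_derivative weight (at x)) (at x)"
      using Ck_on_SucD(1)[OF Ck_weight[unfolded One_nat_def] UNIV_I] .
    have w0: "frechet_derivative weight (at x) (A x) = 0"
    proof -
      let ?r = "\<lambda>t::real. (max 0 (t - 1 / 4))\<^sup>2 * (max 0 (4 - t))\<^sup>2"
      have "Ck_on 1 UNIV (\<lambda>t::real. (max 0 (t - 1 / 4))\<^sup>2)" "Ck_on 1 UNIV (\<lambda>t::real. (max 0 (4 - t))\<^sup>2)"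
        by (rule Ck_on_compose[OF open_UNIV open_UNIV _ Ck_on_square_max];
            (intro Ck_on_diff Ck_on_const Ck_on_linear open_UNIV bounded_linear_ident)?; simp)+
      then have "Ck_on 1 UNIV ?r" by (intro Ck_on_mult open_UNIV)
      then have r: "(?r has_derivative frechet_derivative ?r (at (x \<bullet> x))) (at (x \<bullet> x))"
        unfolding One_nat_def by (rule Ck_on_SucD(1)[OF _ UNIV_I])
      have "((\<lambda>x. ?r (x \<bullet> x)) has_derivative (\<lambda>h. frechet_derivative ?r (at (x \<bullet> x)) (x \<bullet> h + h \<bullet> x))) (at x)"
        by (rule has_derivative_compose[where f="\<lambda>x. x \<bullet> x" and g="?r" and g'="frechet_derivative ?r (at (x \<bullet> x))", OF _ r])
          (auto intro!: derivative_eq_intros)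
      then have "frechet_derivative weight (at x) = (\<lambda>h. frechet_derivative ?r (at (x \<bullet> x)) (x \<bullet> h + h \<bullet> x))"
        unfolding weight_def[abs_def] by (rule frechet_derivative_at[symmetric])
      then show ?thesis using skew[of x] linear_0[OF has_derivative_linear[OF r]] by (simp add: inner_commute)
    qed
    have "(G has_derivative (\<lambda>h. weight x *\<^sub>R frechet_derivative F (at (?N x)) (inverse (norm x) *\<^sub>R h + (- (inverse (norm x) * (h \<bullet> sgn x) * inverse (norm x))) *\<^sub>R x)
        + frechet_derivative weight (at x) h *\<^sub>R F (?N x))) (at x)"
      unfolding G_def by (rule has_derivative_scaleR[OF w has_derivative_compose[OF N F']])
    then have "frechet_derivative G (at x) = (\<lambda>h. weight x *\<^sub>R frechet_derivative F (at (?N x)) (inverse (norm x) *\<^sub>R h + (- (inverse (norm x) * (h \<bullet> sgn x) * inverse (norm x))) *\<^sub>R x)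
        + frechet_derivative weight (at x) h *\<^sub>R F (?N x))" by (rule frechet_derivative_at[symmetric])
    then show ?thesis using skew[of x] by (simp add: w0 lie_def linear_scale[OF A] sgn_div_norm)
  qed
  have "frechet_derivative G (at x) (A x) = (\<Sum>b\<in>Basis. frechet_derivative (\<lambda>x. (A x \<bullet> b) *\<^sub>R G x) (at x) b)" for x
  proof -
    have "frechet_derivative (\<lambda>x. (A x \<bullet> b) *\<^sub>R G x) (at x) b = (A x \<bullet> b) *\<^sub>R frechet_derivative G (at x) b" for b
    proof -
      have "((\<lambda>x. (A x \<bullet> b) *\<^sub>R G x) has_derivative (\<lambda>h. (A x \<bullet> b) *\<^sub>R frechet_derivative G (at x) h + (A h \<bullet> b) *\<^sub>R G x)) (at x)"
        by (intro has_derivative_scaleR dG has_derivative_inner_left bounded_linear_imp_has_derivative bA)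
      from frechet_derivative_at[OF this, symmetric] show ?thesis by (simp add: skew)
    qed
    then show ?thesis using linear_basis_expand[OF has_derivative_linear[OF dG], of x "A x"] by simp
  qed
  note expand = this
  have "Ck_on 1 UNIV (\<lambda>x. (A x \<bullet> b) *\<^sub>R G x)" for b
    by (intro Ck_on_scaleR open_UNIV G Ck_on_inner Ck_on_const Ck_on_linear bA)
  note Z = integral_derivative_zero[OF this, of 2]
  have "G x = 0" if "norm x > 2" for x using that by (simp add: G_def weight_outer)
  then have "(\<integral>x. frechet_derivative G (at x) (A x) \<partial>lborel) = 0"
    unfolding expand using Z by (subst Bochner_Integration.integral_sum) auto
  then show ?thesis unfolding lieG sphere_integral_def .
qed

lemma sphere_subset_punctured: "sphere 0 1 \<subseteq> - {0::'a::euclidean_space}" by auto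

lemma Ck_on_sphere_cont: "Ck_on k (- {0::'a::euclidean_space}) F \<Longrightarrow> continuous_on (sphere 0 1) F"
  by (rule continuous_on_subset[OF Ck_on_imp_continuous_on sphere_subset_punctured])

lemma open_punctured: "open (- {0::'a::euclidean_space})" by auto

lemma sphere_integral_by_parts:
  fixes F :: "'a::euclidean_space \<Rightarrow> complex"
  assumes F: "Ck_on 1 (- {0}) F" and G: "Ck_on 1 (- {0}) G" and A: "linear A" and skew: "\<And>x. A x \<bullet> x = 0"
  shows "sphere_integral (\<lambda>x. lie A F x * G x) = - sphere_integral (\<lambda>x. F x * lie A G x)"
proof -
  have l: "Ck_on 0 (- {0}) (lie A F)" "Ck_on 0 (- {0}) (lie A G)"
    using Ck_on_lie[OF open_punctured _ A, of 0] F G by (auto simp del: Ck_on.simps simp: One_nat_def)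
  have "sphere_integral (lie A (\<lambda>x. F x * G x)) = 0"
    by (rule sphere_integral_lie[OF Ck_on_mult[OF open_punctured F G] A skew])
  also have "sphere_integral (lie A (\<lambda>x. F x * G x)) = sphere_integral (\<lambda>x. lie A F x * G x + F x * lie A G x)"
  proof (rule sphere_integral_cong)
    fix x :: 'a assume "norm x = 1"
    then have x: "x \<in> - {0}" by auto
    note d = Ck_on_SucD(1)[OF F[unfolded One_nat_def] x] Ck_on_SucD(1)[OF G[unfolded One_nat_def] x]
    show "lie A (\<lambda>x. F x * G x) x = lie A F x * G x + F x * lie A G x"
      unfolding lie_def frechet_derivative_at[OF has_derivative_mult[OF d], symmetric] by (simp add: add.commute)
  qed
  also have "\<dots> = sphere_integral (\<lambda>x. lie A F x * G x) + sphere_integral (\<lambda>x. F x * lie A G x)"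
    by (intro sphere_integral_add continuous_on_mult Ck_on_sphere_cont[OF l(1)] Ck_on_sphere_cont[OF l(2)] Ck_on_sphere_cont[OF F] Ck_on_sphere_cont[OF G])
  finally show ?thesis by (simp add: eq_neg_iff_add_eq_0)
qed

lemma continuous_lie_lie:
  fixes F :: "'a::euclidean_space \<Rightarrow> complex"
  assumes F: "Ck_on 2 (- {0}) F" and A: "linear A"
  shows "continuous_on (sphere 0 1) (lie A (lie A F))"
proof -
  have "Ck_on (Suc 0) (- {0}) (lie A F)"
    using Ck_on_lie[OF open_punctured _ A, of 1] F by (auto simp del: Ck_on.simps simp: numeral_2_eq_2)
  then show ?thesis by (rule Ck_on_sphere_cont[OF Ck_on_lie[OF open_punctured _ A]])
qed

context
  fixes F G :: "'a::euclidean_space \<Rightarrow> complex"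
  assumes F: "Ck_on 2 (- {0}) F" and G: "Ck_on 2 (- {0}) G"
begin

lemma sphere_integral_lie_lie:
  assumes A: "linear A" and skew: "\<And>x. A x \<bullet> x = 0"
  shows "sphere_integral (\<lambda>x. lie A (lie A F) x * G x) = sphere_integral (\<lambda>x. F x * lie A (lie A G) x)"
proof -
  have F1: "Ck_on 1 (- {0}) F" and G1: "Ck_on 1 (- {0}) G" using F G Ck_on_mono one_le_numeral by blast+
  have l: "Ck_on 1 (- {0}) (lie A F)" "Ck_on 1 (- {0}) (lie A G)"
    using Ck_on_lie[OF open_punctured _ A, of 1] F G by (auto simp del: Ck_on.simps simp: numeral_2_eq_2)
  show ?thesis
    unfolding sphere_integral_by_parts[OF l(1) G1 A skew] sphere_integral_by_parts[OF F1 l(2) A skew] by simp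
qed

end

lemma plane_rot_skew: "plane_rot b c x \<bullet> x = 0"
  by (simp add: plane_rot_def inner_diff_left inner_diff_right inner_commute)

text \<open>All the fields in \<open>sphere_op\<close> are skew, so two integrations by parts move each square
  to the other factor.\<close>

lemma (in quaternionic) sphere_op_sym:
  fixes F G :: "'a \<Rightarrow> complex"
  assumes F: "Ck_on 2 (- {0}) F" and G: "Ck_on 2 (- {0}) G"
  shows "sphere_integral (\<lambda>x. sphere_op p q J F x * G x) = sphere_integral (\<lambda>x. F x * sphere_op p q J G x)"
proof -
  note c = continuous_lie_lie[OF _ linear_plane_rot] continuous_lie_lie[OF _ J_linear]
  note cF = Ck_on_sphere_cont[OF F] and cG = Ck_on_sphere_cont[OF G]
  have J_orth: "J s x \<bullet> x = 0" if "s < 3" for s x using J_skew[of s x x] that by (simp add: inner_commute)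
  have 1: "(\<lambda>x. sphere_op p q J F x * G x) = (\<lambda>x. (- of_real (p / 2)) * (\<Sum>b\<in>Basis. \<Sum>c\<in>Basis. lie (plane_rot b c) (lie (plane_rot b c) F) x * G x)
    + (- of_real (q - p)) * (\<Sum>s<3. lie (J s) (lie (J s) F) x * G x))"
    by (simp add: fun_eq_iff sphere_op_def scaleR_conv_of_real sum_distrib_right sum_distrib_left algebra_simps minus_apply plus_fun_apply uminus_apply sum_negf)
  have 2: "(\<lambda>x. F x * sphere_op p q J G x) = (\<lambda>x. (- of_real (p / 2)) * (\<Sum>b\<in>Basis. \<Sum>c\<in>Basis. F x * lie (plane_rot b c) (lie (plane_rot b c) G) x)
    + (- of_real (q - p)) * (\<Sum>s<3. F x * lie (J s) (lie (J s) G) x))"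
    by (simp add: fun_eq_iff sphere_op_def scaleR_conv_of_real sum_distrib_right sum_distrib_left algebra_simps minus_apply plus_fun_apply uminus_apply sum_negf)
  show "sphere_integral (\<lambda>x. sphere_op p q J F x * G x) = sphere_integral (\<lambda>x. F x * sphere_op p q J G x)"
  proof -
    have 3: "sphere_integral (\<lambda>x. \<Sum>b\<in>Basis. \<Sum>c\<in>Basis. lie (plane_rot b c) (lie (plane_rot b c) F) x * G x) =
        sphere_integral (\<lambda>x. \<Sum>b\<in>Basis. \<Sum>c\<in>Basis. F x * lie (plane_rot b c) (lie (plane_rot b c) G) x)"
    proof -
      have "sphere_integral (\<lambda>x. \<Sum>b\<in>Basis. \<Sum>c\<in>Basis. lie (plane_rot b c) (lie (plane_rot b c) F) x * G x) =
          (\<Sum>b\<in>Basis. \<Sum>c\<in>Basis. sphere_integral (\<lambda>x. lie (plane_rot b c) (lie (plane_rot b c) F) x * G x))"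
        by (subst sphere_integral_sum; (rule sum.cong[OF refl])?; (subst sphere_integral_sum)?; (intro continuous_intros c F cG)?; rule refl)
      also have "\<dots> = (\<Sum>b\<in>Basis. \<Sum>c\<in>Basis. sphere_integral (\<lambda>x. F x * lie (plane_rot b c) (lie (plane_rot b c) G) x))"
        by (simp only: sphere_integral_lie_lie[OF F G linear_plane_rot plane_rot_skew])
      also have "\<dots> = sphere_integral (\<lambda>x. \<Sum>b\<in>Basis. \<Sum>c\<in>Basis. F x * lie (plane_rot b c) (lie (plane_rot b c) G) x)"
        by (subst sphere_integral_sum; (rule sum.cong[OF refl])?; (subst sphere_integral_sum)?; (intro continuous_intros c G cF)?; rule refl)
      finally show ?thesis .
    qed
    have 4: "sphere_integral (\<lambda>x. \<Sum>s<3. lie (J s) (lie (J s) F) x * G x) = sphere_integral (\<lambda>x. \<Sum>s<3. F x * lie (J s) (lie (J s) G) x)"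
    proof -
      have "sphere_integral (\<lambda>x. \<Sum>s<3. lie (J s) (lie (J s) F) x * G x) = (\<Sum>s<3. sphere_integral (\<lambda>x. lie (J s) (lie (J s) F) x * G x))"
        by (rule sphere_integral_sum) (intro continuous_intros c F cG)
      also have "\<dots> = (\<Sum>s<3. sphere_integral (\<lambda>x. F x * lie (J s) (lie (J s) G) x))"
        by (intro sum.cong refl sphere_integral_lie_lie[OF F G J_linear J_orth]) simp
      also have "\<dots> = sphere_integral (\<lambda>x. \<Sum>s<3. F x * lie (J s) (lie (J s) G) x)"
        by (rule sphere_integral_sum[symmetric]) (intro continuous_intros c G cF)
      finally show ?thesis .
    qed
    have add: "sphere_integral (\<lambda>x. a * f x + b * g x) = a * sphere_integral f + b * sphere_integral g"
      if "continuous_on (sphere 0 1) f" "continuous_on (sphere 0 1) g" for a b and f g :: "'a \<Rightarrow> complex"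
      by (subst sphere_integral_add) (intro continuous_intros that, intro continuous_intros that, simp only: sphere_integral_scale)
    have "sphere_integral (\<lambda>x. sphere_op p q J F x * G x) =
        (- of_real (p / 2)) * sphere_integral (\<lambda>x. \<Sum>b\<in>Basis. \<Sum>c\<in>Basis. lie (plane_rot b c) (lie (plane_rot b c) F) x * G x)
        + (- of_real (q - p)) * sphere_integral (\<lambda>x. \<Sum>s<3. lie (J s) (lie (J s) F) x * G x)"
      unfolding 1 by (rule add) (intro continuous_intros c F cG)+
    also have "\<dots> = sphere_integral (\<lambda>x. F x * sphere_op p q J G x)"
      unfolding 2 3 4 by (rule add[symmetric]) (intro continuous_intros c G cF)+
    finally show ?thesis .
  qed
qed

lemma real_polynomial_polys:
  fixes f :: "complex^'i::finite \<Rightarrow> real"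
  assumes "real_polynomial_function f"
  shows "(\<lambda>x. complex_of_real (f x)) \<in> polys"
  using assms
proof (induction rule: real_polynomial_function.induct)
  case (linear f)
  have "(\<lambda>x. complex_of_real (f x)) = (\<Sum>i\<in>UNIV. (\<lambda>x. ((of_real (f (axis i 1)) - \<i> * of_real (f (axis i \<i>))) / 2) * zc i x)
     + (\<lambda>x. ((of_real (f (axis i 1)) + \<i> * of_real (f (axis i \<i>))) / 2) * wc i x))"
  proof
    fix x :: "complex^'i"
    have lf: "linear f" by (rule bounded_linear.linear[OF linear])
    have e: "(x \<bullet> axis i 1) = Re (x $ i)" "(x \<bullet> axis i \<i>) = Im (x $ i)" for i by (simp_all add: inner_axis inner_complex_def)
    have "f x = (\<Sum>i\<in>UNIV. Re (x $ i) * f (axis i 1) + Im (x $ i) * f (axis i \<i>))"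
      using linear_basis_expand[OF lf, of x] unfolding sum_Basis_cvec e by simp
    moreover have "complex_of_real (Re z * a + Im z * b) = (of_real a - \<i> * of_real b) / 2 * z + (of_real a + \<i> * of_real b) / 2 * cnj z" for z a b
      by (simp add: complex_eq_iff field_simps)
    ultimately show "complex_of_real (f x) = (\<Sum>i\<in>UNIV. (\<lambda>x. ((of_real (f (axis i 1)) - \<i> * of_real (f (axis i \<i>))) / 2) * zc i x)
     + (\<lambda>x. ((of_real (f (axis i 1)) + \<i> * of_real (f (axis i \<i>))) / 2) * wc i x)) x"
      by (simp add: fun_sum_apply plus_fun_apply zc_def wc_def)
  qed
  also have "\<dots> \<in> polys" by (intro polys_sum polys_add polys_scale polys_intros)
  finally show ?case .
next
  case (const c) show ?case by (rule polys_intros)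
next
  case (add f g)
  have "(\<lambda>x. complex_of_real (f x + g x)) = (\<lambda>x. complex_of_real (f x)) + (\<lambda>x. complex_of_real (g x))" by (simp add: pointwise)
  then show ?case using polys_add add.IH by metis
next
  case (mult f g)
  have "(\<lambda>x. complex_of_real (f x * g x)) = (\<lambda>x. complex_of_real (f x)) * (\<lambda>x. complex_of_real (g x))" by (simp add: pointwise)
  then show ?case using polys_mult mult.IH by metis
qed

lemma polynomial_function_polys:
  fixes g :: "complex^'i::finite \<Rightarrow> complex"
  assumes "polynomial_function g"
  shows "g \<in> polys"
proof -
  have "real_polynomial_function (\<lambda>x. Re (g x))" "real_polynomial_function (\<lambda>x. Im (g x))"
    using assms bounded_linear_Re bounded_linear_Im unfolding polynomial_function_def by (auto simp: o_def)
  then have "(\<lambda>x. complex_of_real (Re (g x))) + (\<lambda>x. \<i> * complex_of_real (Im (g x))) \<in> polys"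
    by (intro polys_add polys_scale real_polynomial_polys)
  also have "(\<lambda>x. complex_of_real (Re (g x))) + (\<lambda>x. \<i> * complex_of_real (Im (g x))) = g"
    by (simp add: pointwise flip: complex_eq)
  finally show ?thesis .
qed

text \<open>By the theorem of Stone and Weierstrass the function is a uniform limit of polynomials on the
  sphere, so it is orthogonal to itself.\<close>

lemma orthogonal_polys_zero:
  fixes h :: "complex^'i::finite \<Rightarrow> complex"
  assumes h: "continuous_on (sphere 0 1) h" and orth: "\<And>g. g \<in> polys \<Longrightarrow> sphere_integral (\<lambda>x. h x * cnj (g x)) = 0"
    and x: "norm x = 1"
  shows "h x = 0"
proof (rule sphere_integral_pos[OF h _ x])
  have "bounded (h ` sphere 0 1)" by (rule compact_imp_bounded[OF compact_continuous_image[OF h compact_sphere]])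
  then obtain B where B: "\<And>x. norm x = 1 \<Longrightarrow> norm (h x) \<le> B" and B0: "B > 0" unfolding bounded_pos by fastforce
  let ?W = "norm (sphere_integral (\<lambda>x::complex^'i. 1))"
  have "norm (sphere_integral (\<lambda>x. h x * cnj (h x))) \<le> e" if e: "e > 0" for e
  proof -
    define d where "d = e / (B * (?W + 1))"
    have W: "?W \<ge> 0" by simp
    have d: "d > 0" using e B0 W by (simp add: d_def add_nonneg_pos)
    obtain g where g: "polynomial_function g" "\<And>x. x \<in> sphere 0 1 \<Longrightarrow> norm (h x - g x) < d"
      using Stone_Weierstrass_polynomial_function[OF compact_sphere h d] by blast
    have gp: "g \<in> polys" by (rule polynomial_function_polys[OF g(1)])
    have gc: "continuous_on (sphere 0 1) g"
      using continuous_on_subset[OF Ck_on_imp_continuous_on[OF Ck_polys[OF gp]]] by blast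
    have c: "continuous_on (sphere 0 1) (\<lambda>x. h x * cnj (h x - g x))" "continuous_on (sphere 0 1) (\<lambda>x. h x * cnj (g x))"
      by (intro continuous_intros h gc)+
    have "sphere_integral (\<lambda>x. h x * cnj (h x)) = sphere_integral (\<lambda>x. h x * cnj (h x - g x) + h x * cnj (g x))"
      by (simp add: algebra_simps minus_apply plus_fun_apply)
    also have "\<dots> = sphere_integral (\<lambda>x. h x * cnj (h x - g x))"
      using sphere_integral_add[OF c] orth[OF gp] by simp
    also have "norm \<dots> \<le> (B * d) * ?W"
    proof (rule norm_sphere_integral[OF c(1)])
      fix x :: "complex^'i" assume "norm x = 1"
      then show "norm (h x * cnj (h x - g x)) \<le> B * d"
        unfolding norm_mult complex_mod_cnj using B[of x] g(2)[of x] B0 by (intro mult_mono) auto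
    qed
    also have "\<dots> \<le> (B * d) * (?W + 1)" using B0 d by (intro mult_left_mono) auto
    also have "\<dots> = e" using B0 W by (simp add: d_def field_simps add_nonneg_eq_0_iff)
    finally show ?thesis .
  qed
  then have "norm (sphere_integral (\<lambda>x. h x * cnj (h x))) \<le> 0" by (rule field_le_epsilon) simp
  then show "sphere_integral (\<lambda>x. h x * cnj (h x)) = 0" by simp
qed

section \<open>Direct sums\<close>

lemma has_complex_dim_subspace: "has_complex_dim V d \<Longrightarrow> cfun.subspace V"
  using cfun.subspace_span by (auto simp: has_complex_dim_def)

text \<open>The union of bases is a basis. Adding the elements of the second basis one at a time keeps the union
  independent, since a dependency would lie in the intersection.\<close>

lemma has_complex_dim_add:
  assumes V: "has_complex_dim V a" and W: "has_complex_dim W b" and VW: "V \<inter> W \<subseteq> {0}"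
  shows "has_complex_dim {v + w |v w. v \<in> V \<and> w \<in> W} (a + b)"
proof -
  obtain A where A: "finite A" "card A = a" "cfun.independent A" "cfun.span A = V" using V by (auto simp: has_complex_dim_def)
  obtain B where B: "finite B" "card B = b" "cfun.independent B" "cfun.span B = W" using W by (auto simp: has_complex_dim_def)
  have "cfun.independent (A \<union> C) \<and> A \<inter> C = {}" if "C \<subseteq> B" for C
    using finite_subset[OF that B(1)] that
  proof (induction C rule: finite_induct)
    case empty then show ?case using A(3) by auto
  next
    case (insert c C)
    have c: "c \<notin> cfun.span (A \<union> C)"
    proof
      assume "c \<in> cfun.span (A \<union> C)"
      then obtain u w where u: "c = u + w" "u \<in> V" "w \<in> cfun.span C" unfolding cfun.span_Un A(4) by blast
      have cC: "cfun.span (insert c C) \<subseteq> W" using insert.prems B(4) cfun.span_mono by blast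
      have "u = c - w" using u(1) by simp
      moreover have "c - w \<in> W"
        using cC cfun.span_diff[OF cfun.span_base[of c "insert c C"] subsetD[OF cfun.span_mono[of C "insert c C"] u(3)]] by blast
      ultimately have "u = 0" using u(2) VW by blast
      then have "c \<in> cfun.span C" using u by simp
      moreover have "cfun.independent (insert c C)" using cfun.independent_mono[OF B(3) insert.prems] .
      ultimately show False using insert.hyps(2) by (simp add: cfun.independent_insert)
    qed
    moreover have "c \<notin> A" using c cfun.span_base[of c "A \<union> C"] by blast
    ultimately show ?case using insert cfun.independent_insertI[OF c] by auto
  qed
  from this[of B] have AB: "cfun.independent (A \<union> B)" "A \<inter> B = {}" by simp_all
  have "cfun.span (A \<union> B) = {v + w |v w. v \<in> V \<and> w \<in> W}" unfolding cfun.span_Un A(4) B(4) ..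
  moreover have "card (A \<union> B) = a + b" using card_Un_disjoint[OF A(1) B(1) AB(2)] A(2) B(2) by simp
  ultimately show ?thesis using AB(1) A(1) B(1) unfolding has_complex_dim_def by (intro exI[of _ "A \<union> B"]) auto
qed

lemma has_complex_dim_zero: "has_complex_dim {0} 0"
  unfolding has_complex_dim_def by (intro exI[of _ "{}"]) (simp add: cfun.independent_empty)

lemma has_complex_dim_sum:
  assumes "finite I" and V: "\<And>i. i \<in> I \<Longrightarrow> has_complex_dim (V i) (d i)"
    and ind: "\<And>f i. (\<And>i. i \<in> I \<Longrightarrow> f i \<in> V i) \<Longrightarrow> sum f I = 0 \<Longrightarrow> i \<in> I \<Longrightarrow> f i = 0"
  shows "has_complex_dim {sum f I |f. \<forall>i\<in>I. f i \<in> V i} (sum d I)"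
  using assms
proof (induction I rule: finite_induct)
  case empty
  then show ?case using has_complex_dim_zero by simp
next
  case (insert x I)
  let ?S = "{sum f I |f. \<forall>i\<in>I. f i \<in> V i}"
  have sub: "cfun.subspace (V i)" if "i \<in> insert x I" for i using has_complex_dim_subspace insert.prems(1)[OF that] by blast
  have upd: "sum (f(x := v)) (insert x I) = v + sum f I" for f v
  proof -
    have "sum (f(x := v)) I = sum f I" using insert.hyps(2) by (intro sum.cong) auto
    then show ?thesis using insert.hyps by simp
  qed
  have "has_complex_dim ?S (sum d I)"
  proof (rule insert.IH)
    show "has_complex_dim (V i) (d i)" if "i \<in> I" for i using insert.prems(1) that by blast
    fix f i assume f: "\<And>i. i \<in> I \<Longrightarrow> f i \<in> V i" "sum f I = 0" "i \<in> I"
    have "(f(x := 0)) i = 0"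
    proof (rule insert.prems(2))
      show "(f(x := 0)) i \<in> V i" if "i \<in> insert x I" for i
        using that f(1) sub[of x] by (auto simp: cfun_subspace_iff)
      show "sum (f(x := 0)) (insert x I) = 0" unfolding upd using f(2) by simp
    qed (use f(3) in simp)
    moreover have "i \<noteq> x" using f(3) insert.hyps by blast
    ultimately show "f i = 0" by simp
  qed
  moreover have "V x \<inter> ?S \<subseteq> {0}"
  proof
    fix v assume "v \<in> V x \<inter> ?S"
    then obtain f where v: "v \<in> V x" "v = sum f I" and f: "\<forall>i\<in>I. f i \<in> V i" by blast
    have mv: "- v \<in> V x" using cfun.subspace_neg[OF sub v(1)] by simp
    have "(f(x := - v)) x = 0"
    proof (rule insert.prems(2)[of "f(x := - v)"])
      show "(f(x := - v)) i \<in> V i" if "i \<in> insert x I" for i using that f mv by auto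
      show "sum (f(x := - v)) (insert x I) = 0" unfolding upd using v(2) by simp
    qed simp
    then show "v \<in> {0}" by simp
  qed
  ultimately have "has_complex_dim {v + w |v w. v \<in> V x \<and> w \<in> ?S} (d x + sum d I)"
    using has_complex_dim_add insert.prems(1)[of x] by blast
  moreover have "{v + w |v w. v \<in> V x \<and> w \<in> ?S} = {sum f (insert x I) |f. \<forall>i\<in>insert x I. f i \<in> V i}"
  proof (intro equalityI subsetI)
    fix g assume "g \<in> {v + w |v w. v \<in> V x \<and> w \<in> ?S}"
    then obtain v f where g: "g = v + sum f I" "v \<in> V x" "\<forall>i\<in>I. f i \<in> V i" by blast
    have "\<forall>i\<in>insert x I. (f(x := v)) i \<in> V i" using g by auto
    moreover have "g = sum (f(x := v)) (insert x I)" unfolding upd by (rule g(1))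
    ultimately show "g \<in> {sum f (insert x I) |f. \<forall>i\<in>insert x I. f i \<in> V i}" by blast
  next
    fix g assume "g \<in> {sum f (insert x I) |f. \<forall>i\<in>insert x I. f i \<in> V i}"
    then show "g \<in> {v + w |v w. v \<in> V x \<and> w \<in> ?S}" using insert.hyps by auto
  qed
  ultimately show ?case using insert.hyps by simp
qed

section \<open>Orthogonal expansion of eigenfunctions\<close>

text \<open>A Hermitian form on the continuous functions on the sphere, positive definite by
  \<open>sphere_integral_pos\<close>.\<close>

definition sphere_inner :: "('a::euclidean_space \<Rightarrow> complex) \<Rightarrow> ('a \<Rightarrow> complex) \<Rightarrow> complex" where
  "sphere_inner f g = sphere_integral (\<lambda>x. f x * cnj (g x))"

abbreviation sphere_cont :: "('a::euclidean_space \<Rightarrow> complex) \<Rightarrow> bool" where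
  "sphere_cont \<equiv> continuous_on (sphere 0 1)"

lemma polys_sphere_cont: "f \<in> polys \<Longrightarrow> sphere_cont f"
  using continuous_on_subset[OF Ck_on_imp_continuous_on[OF Ck_polys]] by blast

lemma sphere_inner_add_right: "sphere_cont f \<Longrightarrow> sphere_cont g \<Longrightarrow> sphere_cont h \<Longrightarrow> sphere_inner f (g + h) = sphere_inner f g + sphere_inner f h"
  unfolding sphere_inner_def by (subst sphere_integral_add[symmetric]) (auto simp: plus_fun_apply algebra_simps intro!: continuous_intros)

lemma sphere_inner_diff_left: "sphere_cont f \<Longrightarrow> sphere_cont g \<Longrightarrow> sphere_cont h \<Longrightarrow> sphere_inner (\<lambda>x. f x - g x) h = sphere_inner f h - sphere_inner g h"
  unfolding sphere_inner_def by (subst sphere_integral_diff[symmetric]) (auto simp: left_diff_distrib intro!: continuous_intros)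

lemma sphere_inner_scale_left: "sphere_inner (\<lambda>x. c * f x) h = c * sphere_inner f h"
  unfolding sphere_inner_def by (simp add: mult.assoc sphere_integral_scale)

lemma sphere_inner_scale_right: "sphere_inner f (\<lambda>x. c * h x) = cnj c * sphere_inner f h"
  unfolding sphere_inner_def by (simp add: mult.left_commute[of _ "cnj c"] sphere_integral_scale)

lemma sphere_inner_zero: "sphere_inner f 0 = 0"
  unfolding sphere_inner_def using sphere_integral_scale[of 0 "\<lambda>_. 0"] by (simp add: zero_fun_apply)

lemma sphere_inner_sum_left: "(\<And>i. i \<in> I \<Longrightarrow> sphere_cont (f i)) \<Longrightarrow> sphere_cont h \<Longrightarrow> sphere_inner (\<Sum>i\<in>I. f i) h = (\<Sum>i\<in>I. sphere_inner (f i) h)"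
  unfolding sphere_inner_def by (subst sphere_integral_sum[symmetric]) (auto simp: fun_sum_apply sum_distrib_right intro!: continuous_intros)

lemma sphere_inner_cong: "(\<And>x. norm x = 1 \<Longrightarrow> f x = f' x) \<Longrightarrow> (\<And>x. norm x = 1 \<Longrightarrow> g x = g' x) \<Longrightarrow> sphere_inner f g = sphere_inner f' g'"
  unfolding sphere_inner_def by (rule sphere_integral_cong) simp

text \<open>By Gram-Schmidt. The functions in \<open>B\<close> live on the whole space and need not be
  independent on the sphere.\<close>

lemma orthogonal_projection:
  assumes "finite B" "B \<subseteq> polys" "sphere_cont F"
  shows "\<exists>p\<in>cfun.span B. \<forall>b\<in>cfun.span B. sphere_inner (\<lambda>x. F x - p x) b = 0"
  using assms
proof (induction B arbitrary: F rule: finite_induct)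
  case empty
  then show ?case by (auto simp: sphere_inner_zero)
next
  case (insert b B)
  have "cfun.subspace polys" by (auto simp: cfun_subspace_iff polys_zero polys_add polys_scale)
  then have spB: "cfun.span B \<subseteq> polys" using insert.prems(1) cfun.span_minimal by blast
  have b: "b \<in> polys" using insert.prems by blast
  obtain q where q: "q \<in> cfun.span B" "\<And>c. c \<in> cfun.span B \<Longrightarrow> sphere_inner (\<lambda>x. b x - q x) c = 0"
    using insert.IH[of b] insert.prems(1) polys_sphere_cont[OF b] by blast
  obtain p where p: "p \<in> cfun.span B" "\<And>c. c \<in> cfun.span B \<Longrightarrow> sphere_inner (\<lambda>x. F x - p x) c = 0"
    using insert.IH[of F] insert.prems by blast
  define r where "r = b - q"
  have r': "r = (\<lambda>x. b x - q x)" by (simp add: r_def fun_eq_iff minus_apply)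
  have rp: "r \<in> polys" unfolding r_def using b q(1) spB polys_diff by blast
  have rB: "r \<in> cfun.span (insert b B)"
    unfolding r_def using q(1) cfun.span_mono[OF subset_insertI[of B b]] cfun.span_base[of b "insert b B"]
    by (blast intro: cfun.span_diff)
  have c: "sphere_cont F" "sphere_cont p" "sphere_cont r" using insert.prems(2) p(1) spB rp polys_sphere_cont by blast+
  \<comment> \<open>If \<open>r\<close> has norm zero then it vanishes on the sphere and the coefficient
    \<open>0\<close> will do.\<close>
  define \<gamma> where "\<gamma> = (if sphere_inner r r = 0 then 0 else sphere_inner (\<lambda>x. F x - p x) r / sphere_inner r r)"
  have rr: "sphere_inner (\<lambda>x. F x - p x) r = \<gamma> * sphere_inner r r"
  proof (cases "sphere_inner r r = 0")
    case True
    then have "r x = 0" if "norm x = 1" for x using sphere_integral_pos[OF c(3) _ that] unfolding sphere_inner_def by blast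
    then have "sphere_inner (\<lambda>x. F x - p x) r = sphere_inner (\<lambda>x. F x - p x) 0" by (intro sphere_inner_cong) (auto simp: zero_fun_apply)
    then show ?thesis using True by (simp add: sphere_inner_zero)
  qed (simp add: \<gamma>_def)
  have cp: "sphere_cont (\<lambda>x. F x - p x)" "sphere_cont (\<lambda>x. \<gamma> * r x)" by (intro continuous_intros c)+
  let ?p = "p + (\<lambda>x. \<gamma> * r x)"
  have e: "(\<lambda>x. F x - ?p x) = (\<lambda>x. (F x - p x) - \<gamma> * r x)" by (simp add: plus_fun_apply fun_eq_iff)
  have "?p \<in> cfun.span (insert b B)"
    using p(1) cfun.span_mono[OF subset_insertI[of B b]] cfun.span_scale[OF rB] by (blast intro: cfun.span_add)
  moreover have "sphere_inner (\<lambda>x. F x - ?p x) y = 0" if y: "y \<in> cfun.span (insert b B)" for y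
  proof -
    obtain k where k: "y - (\<lambda>x. k * b x) \<in> cfun.span B" using y cfun.span_breakdown_eq by blast
    define w where "w = (y - (\<lambda>x. k * b x)) + (\<lambda>x. k * q x)"
    have w: "w \<in> cfun.span B" unfolding w_def using k q(1) by (intro cfun.span_add cfun.span_scale)
    have yw: "y = w + (\<lambda>x. k * r x)" unfolding w_def r' by (simp add: pointwise algebra_simps)
    have cw: "sphere_cont w" using w spB polys_sphere_cont by blast
    have ck: "sphere_cont (\<lambda>x. k * r x)" by (intro continuous_intros c)
    have "sphere_inner (\<lambda>x. F x - ?p x) y = sphere_inner (\<lambda>x. F x - p x) y - sphere_inner (\<lambda>x. \<gamma> * r x) y"
      unfolding e by (rule sphere_inner_diff_left[OF cp]) (use polys_sphere_cont spB w rp yw polys_add polys_scale in blast)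
    also have "sphere_inner (\<lambda>x. F x - p x) y = cnj k * (\<gamma> * sphere_inner r r)"
      unfolding yw sphere_inner_add_right[OF cp(1) cw ck] sphere_inner_scale_right rr p(2)[OF w] by simp
    also have "sphere_inner (\<lambda>x. \<gamma> * r x) y = \<gamma> * (cnj k * sphere_inner r r)"
      unfolding yw sphere_inner_scale_left sphere_inner_add_right[OF c(3) cw ck] sphere_inner_scale_right q(2)[OF w, folded r'] by simp
    finally show ?thesis by simp
  qed
  ultimately show ?case by blast
qed

text \<open>Eigenfunctions of a symmetric operator with different eigenvalues.\<close>

lemma sphere_op_orth:
  fixes F G :: "'n::finite cvec \<Rightarrow> complex"
  assumes F: "Ck_on 2 (- {0}) F" and G: "Ck_on 2 UNIV G"
    and eF: "\<And>x. norm x = 1 \<Longrightarrow> sphere_op p q qunit F x = \<mu> * F x"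
    and eG: "\<And>x. norm x = 1 \<Longrightarrow> sphere_op p q qunit G x = of_real \<eta> * G x"
    and ne: "\<mu> \<noteq> of_real \<eta>"
  shows "sphere_inner F G = 0"
proof -
  have G': "Ck_on 2 (- {0}) (\<lambda>x. cnj (G x))"
    by (rule Ck_on_bounded_linear[OF bounded_linear_cnj]) (use Ck_on_subset[OF G] in auto)
  have "\<mu> * sphere_inner F G = sphere_integral (\<lambda>x. sphere_op p q qunit F x * cnj (G x))"
    unfolding sphere_inner_def sphere_integral_scale[symmetric] by (rule sphere_integral_cong) (simp add: eF)
  also have "\<dots> = sphere_integral (\<lambda>x. F x * sphere_op p q qunit (\<lambda>x. cnj (G x)) x)"
    by (rule quat.sphere_op_sym[OF F G'])
  also have "\<dots> = of_real \<eta> * sphere_inner F G"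
    unfolding sphere_inner_def sphere_integral_scale[symmetric] sphere_op_cnj[OF G quat.J_linear]
    by (rule sphere_integral_cong) (simp add: eG)
  finally show ?thesis using ne by simp
qed

lemma bihom_scaleR: "bihom p q f \<Longrightarrow> f (r *\<^sub>R x) = of_real r ^ (p + q) * f x"
  by (induction rule: bihom.induct) (simp_all add: pointwise zc_def wc_def scaleR_conv_of_real[where 'a=complex] algebra_simps)

text \<open>By homogeneity along the rays.\<close>

lemma bihom_sphere_zero:
  fixes f :: "('n::finite) cvec \<Rightarrow> complex"
  assumes f: "bihom p q f" and z: "\<And>x. norm x = 1 \<Longrightarrow> f x = 0"
  shows "f = 0"
proof
  fix x :: "'n cvec"
  obtain u :: "'n cvec" where u: "norm u = 1" "x = norm x *\<^sub>R u"
  proof (cases "x = 0")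
    case True
    then show ?thesis using that[of "base undefined"] by simp
  next
    case False
    then show ?thesis using that[of "x /\<^sub>R norm x"] by simp
  qed
  have "f x = of_real (norm x) ^ (p + q) * f u" using bihom_scaleR[OF f, of "norm x" u] u(2) by simp
  then show "f x = 0 x" using z[OF u(1)] by (simp add: zero_fun_apply)
qed

text \<open>A single index \<open>((z1, z2), j)\<close>, in order to form sums over the weight spaces of all
  pairs.\<close>

definition component :: "(nat \<times> nat) \<times> nat \<Rightarrow> ('n::finite cvec \<Rightarrow> complex) set" where
  "component i = weight_space (fst (fst i)) (snd (fst i)) (snd i)"

definition component_indices :: "((nat \<times> nat) \<times> nat) set" where
  "component_indices = {i. snd (fst i) \<le> fst (fst i) \<and> snd i \<le> fst (fst i) - snd (fst i)}"

lemma component_bihom: "i \<in> component_indices \<Longrightarrow> f \<in> component i \<Longrightarrow> bihom (snd (fst i) + snd i) (fst (fst i) - snd i) f"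
  unfolding component_def component_indices_def by (auto intro: weight_space_bihom)

lemma component_polys: "i \<in> component_indices \<Longrightarrow> f \<in> component i \<Longrightarrow> f \<in> polys"
  using component_bihom bihom_polys by blast

lemma component_sphere_cont: "i \<in> component_indices \<Longrightarrow> f \<in> component i \<Longrightarrow> sphere_cont f"
  using component_polys polys_sphere_cont by blast

lemma component_eigen:
  fixes f :: "'n::finite cvec \<Rightarrow> complex"
  shows "i \<in> component_indices \<Longrightarrow> f \<in> component i \<Longrightarrow> norm x = 1 \<Longrightarrow>
    sphere_op P Q qunit f x = of_real (eigval P Q CARD('n) (fst (fst i)) (snd (fst i))) * f x"
  unfolding component_def component_indices_def by (auto intro: weight_space_eigen)

lemma component_dim: "i \<in> component_indices \<Longrightarrow> has_complex_dim (component i :: ('n::finite cvec \<Rightarrow> complex) set) (hw_dim CARD('n + 'n) (snd (fst i)) (fst (fst i)))"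
  unfolding component_def component_indices_def by (rule dim_weight_space) auto

text \<open>The field \<open>qunit 0\<close> is skew and acts by the imaginary number given by the weight.\<close>

lemma component_orth_weight:
  assumes i: "i \<in> component_indices" "f \<in> component i" and i': "i' \<in> component_indices" "f' \<in> component i'" and ne: "fst i = fst i'" "i \<noteq> i'"
  shows "sphere_inner f f' = 0"
proof -
  obtain z1 z2 j j' where I: "i = ((z1, z2), j)" "i' = ((z1, z2), j')" using ne(1) by (metis prod.collapse)
  have v: "z2 \<le> z1" "j \<le> z1 - z2" "j' \<le> z1 - z2" using i(1) i'(1) I by (auto simp: component_indices_def)
  have jj: "j \<noteq> j'" using ne I by auto
  have b: "bihom (z2 + j) (z1 - j) f" "bihom (z2 + j') (z1 - j') f'" using component_bihom[OF i] component_bihom[OF i'] I by auto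
  define w :: complex where "w = of_nat (z2 + j) - of_nat (z1 - j)"
  define w' :: complex where "w' = of_nat (z2 + j') - of_nat (z1 - j')"
  have "w - w' = 2 * (of_nat j - of_nat j')" using v by (simp add: w_def w'_def of_nat_diff)
  then have ww: "w \<noteq> w'" using jj by auto
  have lf: "lie (qunit 0) f = (\<lambda>x. (\<i> * w) * f x)"
    unfolding lie_qunit0[OF bihom_polys[OF b(1)]] using bihom_Nz[OF b(1)] by (simp add: w_def pointwise algebra_simps)
  have lf': "lie (qunit 0) f' = (\<lambda>x. (\<i> * w') * f' x)"
    unfolding lie_qunit0[OF bihom_polys[OF b(2)]] using bihom_Nz[OF b(2)] by (simp add: w'_def pointwise algebra_simps)
  have cw: "cnj w' = w'" by (simp add: w'_def)
  have p: "f \<in> polys" "f' \<in> polys" using bihom_polys b by blast+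
  have d: "f' differentiable (at x)" for x using Ck_polys[OF p(2), of "Suc 0"] by simp
  have lc: "lie (qunit 0) (\<lambda>x. cnj (f' x)) = (\<lambda>x. - (\<i> * w') * cnj (f' x))"
    unfolding lie_cnj[OF d] lf' by (simp add: cw pointwise)
  have C: "Ck_on 1 (- {0}) f" "Ck_on 1 (- {0}) (\<lambda>x. cnj (f' x))"
    using Ck_on_subset[OF Ck_polys] p bihom_polys[OF bihom_cnj[OF b(2)]] by blast+
  have skew: "qunit 0 x \<bullet> x = 0" for x :: "'a cvec" using quat.J_skew[of 0 x x] by (simp add: inner_commute)
  have "(\<i> * w) * sphere_inner f f' = sphere_integral (\<lambda>x. lie (qunit 0) f x * cnj (f' x))"
    unfolding lf sphere_inner_def sphere_integral_scale[symmetric] mult.assoc ..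
  also have "\<dots> = - sphere_integral (\<lambda>x. f x * lie (qunit 0) (\<lambda>x. cnj (f' x)) x)"
    by (rule sphere_integral_by_parts[OF C quat.J_linear skew])
  also have "sphere_integral (\<lambda>x. f x * lie (qunit 0) (\<lambda>x. cnj (f' x)) x) = (- (\<i> * w')) * sphere_inner f f'"
    unfolding lc sphere_inner_def sphere_integral_scale[symmetric] mult.left_commute[of "f _"] ..
  finally have "(\<i> * w) * sphere_inner f f' = (\<i> * w') * sphere_inner f f'" by (simp add: uminus_apply)
  then show ?thesis using ww by simp
qed

text \<open>Different pairs are separated by the two operators \<open>sphere_op 1 1\<close> and
  \<open>sphere_op 0 1\<close>: the eigenvalue of the first determines \<open>z1 + z2\<close>, that
  of the second \<open>z1 - z2\<close>. Different weights are separated by \<open>qunit 0\<close>.\<close>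

lemma component_orth:
  fixes f f' :: "'n::finite cvec \<Rightarrow> complex"
  assumes i: "i \<in> component_indices" "f \<in> component i" and i': "i' \<in> component_indices" "f' \<in> component i'" and ne: "i \<noteq> i'"
  shows "sphere_inner f f' = 0"
proof (cases "fst i = fst i'")
  case True
  then show ?thesis using component_orth_weight i i' ne by blast
next
  case False
  let ?e = "\<lambda>p q i. eigval p q CARD('n) (fst (fst i)) (snd (fst i))"
  have C: "Ck_on 2 (- {0}) f" "Ck_on 2 UNIV f'"
    using Ck_on_subset[OF Ck_polys[OF component_polys[OF i]]] Ck_polys[OF component_polys[OF i']] by blast+
  have o: "?thesis" if "?e p q i \<noteq> ?e p q i'" for p q
    by (rule sphere_op_orth[OF C component_eigen[OF i, where P=p and Q=q] component_eigen[OF i']]) (use that in auto)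
  have inj: "x = y" if "x * (x + c) = y * (y + c)" "x \<ge> 0" "y \<ge> 0" "c > 0" for x y c :: real
  proof -
    have "(x - y) * (x + y + c) = 0" using that(1) by (simp add: algebra_simps)
    then show ?thesis using that by auto
  qed
  obtain a b j a' b' j' where I: "i = ((a, b), j)" "i' = ((a', b'), j')" by (metis prod.collapse)
  have v: "b \<le> a" "b' \<le> a'" using i(1) i'(1) I by (auto simp: component_indices_def)
  have "\<not> (?e 1 1 i = ?e 1 1 i' \<and> ?e 0 1 i = ?e 0 1 i')"
  proof
    assume e: "?e 1 1 i = ?e 1 1 i' \<and> ?e 0 1 i = ?e 0 1 i'"
    have "real CARD('n) \<ge> 1" by (simp add: Suc_le_eq)
    then have n: "4 * real CARD('n) - 2 > 0" by linarith
    have "real (a + b) = real (a' + b')" by (rule inj[of _ "4 * real CARD('n) - 2"]) (use e n in \<open>auto simp: eigval_def I add_diff_eq\<close>)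
    moreover have "real (a - b) = real (a' - b')" by (rule inj[of _ 2]) (use e in \<open>auto simp: eigval_def I\<close>)
    ultimately have "a + b = a' + b'" "a - b = a' - b'" by linarith+
    then have "a = a' \<and> b = b'" using v by linarith
    then show False using False I by simp
  qed
  then show ?thesis using o by blast
qed

lemma component_independent:
  fixes f :: "(nat \<times> nat) \<times> nat \<Rightarrow> 'n::finite cvec \<Rightarrow> complex"
  assumes I: "finite I" "I \<subseteq> component_indices" and f: "\<And>i. i \<in> I \<Longrightarrow> f i \<in> component i"
    and z: "\<And>x. norm x = 1 \<Longrightarrow> sum f I x = 0" and i: "i \<in> I"
  shows "f i = 0"
proof -
  have c: "sphere_cont (f i)" if "i \<in> I" for i using component_sphere_cont f I that by blast
  have "0 = sphere_inner (sum f I) (f i)"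
    unfolding sphere_inner_def using sphere_integral_scale[of 0 "\<lambda>_. 0"] by (subst sphere_integral_cong[where g="\<lambda>_. 0"]) (simp_all add: z zero_fun_apply)
  also have "\<dots> = (\<Sum>k\<in>I. sphere_inner (f k) (f i))" using sphere_inner_sum_left[of I f "f i"] c i by simp
  also have "\<dots> = (\<Sum>k\<in>I. if k = i then sphere_inner (f i) (f i) else 0)"
    proof (rule sum.cong[OF refl])
    fix k assume k: "k \<in> I"
    show "sphere_inner (f k) (f i) = (if k = i then sphere_inner (f i) (f i) else 0)"
      using component_orth[OF _ f[OF k] _ f[OF i]] k i I(2) by auto
  qed
  also have "\<dots> = sphere_inner (f i) (f i)" using I i by simp
  finally have "sphere_integral (\<lambda>x. f i x * cnj (f i x)) = 0" by (simp add: sphere_inner_def)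
  then have "f i x = 0" if "norm x = 1" for x using sphere_integral_pos[OF c[OF i] _ that] by blast
  then show ?thesis using bihom_sphere_zero component_bihom f I i by blast
qed

lemma component_sum_dim:
  assumes I: "finite I" "I \<subseteq> component_indices"
  shows "has_complex_dim {sum g I |g. \<forall>i\<in>I. g i \<in> (component i :: ('n::finite cvec \<Rightarrow> complex) set)}
    (\<Sum>i\<in>I. hw_dim CARD('n + 'n) (snd (fst i)) (fst (fst i)))"
proof (rule has_complex_dim_sum[OF I(1)])
  show "has_complex_dim (component i :: ('n cvec \<Rightarrow> complex) set) (hw_dim CARD('n + 'n) (snd (fst i)) (fst (fst i)))" if "i \<in> I" for i
    using component_dim that I(2) by blast
  show "f i = 0" if "\<And>i. i \<in> I \<Longrightarrow> f i \<in> component i" "sum f I = 0" "i \<in> I"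
    for f :: "(nat \<times> nat) \<times> nat \<Rightarrow> 'n cvec \<Rightarrow> complex" and i
    using component_independent[OF I that(1) _ that(3)] that(2) by (simp add: zero_fun_apply)
qed

lemma component_parity:
  assumes "i \<in> component_indices" "f \<in> component i"
  shows "f (- x) = (if even (fst (fst i) + snd (fst i)) then f x else - f x)"
proof -
  have "snd (fst i) + snd i + (fst (fst i) - snd i) = fst (fst i) + snd (fst i)" using assms(1) by (auto simp: component_indices_def)
  then show ?thesis using bihom_uminus[OF component_bihom[OF assms], of x] by (simp add: uminus_apply)
qed

lemma even_component_sum:
  assumes "I \<subseteq> component_indices" "\<And>i. i \<in> I \<Longrightarrow> g i \<in> component i" "\<And>i. i \<in> I \<Longrightarrow> even (fst (fst i) + snd (fst i))"
  shows "sum g I (- x) = sum g I x"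
proof -
  have "g i (- x) = g i x" if "i \<in> I" for i
    using component_parity[OF subsetD[OF assms(1) that] assms(2)[OF that], of x] assms(3)[OF that] by simp
  then show ?thesis by (simp add: fun_sum_apply)
qed

text \<open>Different pairs \<open>(z1, z2)\<close> may have the same eigenvalue, so all of them have to be
  collected.\<close>

definition eigen_indices :: "real \<Rightarrow> real \<Rightarrow> nat \<Rightarrow> complex \<Rightarrow> ((nat \<times> nat) \<times> nat) set" where
  "eigen_indices P Q n \<mu> = {i \<in> component_indices. of_real (eigval P Q n (fst (fst i)) (snd (fst i))) = \<mu>}"

text \<open>With \<open>k = z1 + z2 \<ge> d = z1 - z2\<close> the coefficient
  \<open>k * (k + 4 * n - 2) - d * (d + 2)\<close> of \<open>P\<close> is at least \<open>k\<close>,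
  hence the eigenvalues are bounded below by \<open>P * k\<close>.\<close>

lemma finite_eigval:
  assumes "P > 0" "Q > 0" "n \<ge> 2"
  shows "finite {z. snd z \<le> fst z \<and> complex_of_real (eigval P Q n (fst z) (snd z)) = \<mu>}"
proof -
  obtain N :: nat where N: "Re \<mu> / P \<le> real N" using real_arch_simple by blast
  have "fst z + snd z \<le> N" if z: "snd z \<le> fst z" "complex_of_real (eigval P Q n (fst z) (snd z)) = \<mu>" for z
  proof -
    define k where "k = real (fst z + snd z)"
    define d where "d = real (fst z - snd z)"
    have kd: "0 \<le> d" "d \<le> k" by (auto simp: k_def d_def)
    have n: "real n \<ge> 2" using assms(3) by simp
    have e: "Re \<mu> = P * (k * (k + 4 * real n - 2)) + (Q - P) * (d * (d + 2))"
      using z(2) by (auto simp: eigval_def k_def d_def)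
    have "d * (d + 2) \<le> k * (k + 2)" using kd by (intro mult_mono) auto
    moreover have "k * (k + 2) + k \<le> k * (k + 4 * real n - 2)"
    proof -
      have "k * (k + 2) + k = k * (k + 3)" by (simp add: algebra_simps)
      also have "\<dots> \<le> k * (k + 4 * real n - 2)" using kd n by (intro mult_left_mono) auto
      finally show ?thesis .
    qed
    ultimately have "P * k \<le> P * (k * (k + 4 * real n - 2) - d * (d + 2))" using assms(1) by (intro mult_left_mono) auto
    also have "\<dots> \<le> Re \<mu>" unfolding e using kd assms(2) by (simp add: algebra_simps)
    finally have "k \<le> Re \<mu> / P" using assms(1) by (simp add: field_simps)
    then have "k \<le> real N" using N by linarith
    then show ?thesis by (simp add: k_def)
  qed
  then have "{z. snd z \<le> fst z \<and> complex_of_real (eigval P Q n (fst z) (snd z)) = \<mu>} \<subseteq> {..N} \<times> {..N}"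
    by fastforce
  then show ?thesis using finite_subset by blast
qed

lemma eigen_indices_eq:
  "eigen_indices P Q n \<mu> = (SIGMA z:{z. snd z \<le> fst z \<and> complex_of_real (eigval P Q n (fst z) (snd z)) = \<mu>}. {..fst z - snd z})"
  by (auto simp: eigen_indices_def component_indices_def)

lemma finite_eigen_indices: "P > 0 \<Longrightarrow> Q > 0 \<Longrightarrow> n \<ge> 2 \<Longrightarrow> finite (eigen_indices P Q n \<mu>)"
  unfolding eigen_indices_eq using finite_eigval by (intro finite_SigmaI) auto

text \<open>The difference of \<open>F\<close> and its projection onto the components with eigenvalue
  \<open>\<mu>\<close> is orthogonal to these components by construction and to the others because
  the eigenvalues differ. By \<open>poly_sphere_induct\<close> it is orthogonal to all polynomials.\<close>

lemma eigen_expansion: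
  fixes F :: "'n::finite cvec \<Rightarrow> complex"
  assumes PQ: "P > 0" "Q > 0" "CARD('n) \<ge> 2" and F: "Ck_on 2 (- {0}) F"
    and eF: "\<And>x. norm x = 1 \<Longrightarrow> sphere_op P Q qunit F x = \<mu> * F x"
  shows "\<exists>g. (\<forall>i\<in>eigen_indices P Q CARD('n) \<mu>. g i \<in> component i) \<and> (\<forall>x. norm x = 1 \<longrightarrow> F x = sum g (eigen_indices P Q CARD('n) \<mu>) x)"
proof -
  let ?I = "eigen_indices P Q CARD('n) \<mu>"
  have I: "finite ?I" "?I \<subseteq> component_indices" using finite_eigen_indices[OF PQ] by (auto simp: eigen_indices_def)
  let ?S = "{sum g ?I |g. \<forall>i\<in>?I. g i \<in> (component i :: ('n cvec \<Rightarrow> complex) set)}"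
  obtain B where B: "finite B" "cfun.span B = ?S" using component_sum_dim[OF I] by (auto simp: has_complex_dim_def)
  have "sum g ?I \<in> polys" if "\<forall>i\<in>?I. g i \<in> (component i :: ('n cvec \<Rightarrow> complex) set)" for g
    by (rule polys_sum) (use that component_polys I(2) in blast)
  then have Sp: "?S \<subseteq> polys" by blast
  have Bp: "B \<subseteq> polys" using B(2) Sp cfun.span_superset by blast
  have cF: "sphere_cont F" by (rule Ck_on_sphere_cont[OF F])
  obtain p where p: "p \<in> ?S" "\<And>b. b \<in> ?S \<Longrightarrow> sphere_inner (\<lambda>x. F x - p x) b = 0"
    using orthogonal_projection[OF B(1) Bp cF] unfolding B(2) by blast
  then obtain g where g: "\<And>i. i \<in> ?I \<Longrightarrow> g i \<in> component i" "p = sum g ?I" by blast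
  have cp: "sphere_cont p" using p(1) Sp polys_sphere_cont by blast
  have cd: "sphere_cont (\<lambda>x. F x - p x)" by (intro continuous_intros cF cp)
  have comp: "sphere_inner (\<lambda>x. F x - p x) f = 0" if i: "i \<in> component_indices" "f \<in> component i" for i f
  proof (cases "i \<in> ?I")
    case True
    have sub: "cfun.subspace (component k :: ('n cvec \<Rightarrow> complex) set)" if "k \<in> ?I" for k
      using has_complex_dim_subspace[OF component_dim] I(2) that by blast
    have "f = sum (\<lambda>k. if k = i then f else 0) ?I" using True I(1) by simp
    moreover have "\<forall>k\<in>?I. (if k = i then f else 0) \<in> component k" using i(2) sub by (auto simp: cfun_subspace_iff)
    ultimately have "f \<in> ?S" by blast
    then show ?thesis by (rule p(2))
  next
    case False
    then have ne: "\<mu> \<noteq> of_real (eigval P Q CARD('n) (fst (fst i)) (snd (fst i)))" using i(1) by (auto simp: eigen_indices_def)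
    have "sphere_inner F f = 0" by (rule sphere_op_orth[OF F Ck_polys[OF component_polys[OF i]] eF component_eigen[OF i] ne])
    moreover have "sphere_inner p f = (\<Sum>k\<in>?I. sphere_inner (g k) f)"
      unfolding g(2) by (rule sphere_inner_sum_left) (use component_sphere_cont g(1) I(2) i in blast)+
    moreover have "\<dots> = 0" using component_orth[OF _ _ i] g(1) I(2) False by (intro sum.neutral) blast
    ultimately show ?thesis using sphere_inner_diff_left[OF cF cp component_sphere_cont[OF i]] by simp
  qed
  have "F x - p x = 0" if "norm x = 1" for x
  proof (rule orthogonal_polys_zero[OF cd _ that])
    fix h :: "'n cvec \<Rightarrow> complex" assume h: "h \<in> polys"
    have "sphere_inner (\<lambda>x. F x - p x) h = 0"
    proof (rule poly_sphere_induct[where P="\<lambda>h. sphere_inner (\<lambda>x. F x - p x) h = 0", OF _ _ _ _ h])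
      fix z1 z2 j :: nat and f :: "'n cvec \<Rightarrow> complex"
      assume "z2 \<le> z1" "j \<le> z1 - z2" "f \<in> weight_space z1 z2 j"
      then show "sphere_inner (\<lambda>x. F x - p x) f = 0" using comp[of "((z1, z2), j)" f] by (simp add: component_indices_def component_def)
    next
      show "sphere_inner (\<lambda>x. F x - p x) 0 = 0" by (rule sphere_inner_zero)
    next
      fix f g :: "'n cvec \<Rightarrow> complex"
      assume "f \<in> polys" "g \<in> polys" "sphere_inner (\<lambda>x. F x - p x) f = 0" "sphere_inner (\<lambda>x. F x - p x) g = 0"
      then show "sphere_inner (\<lambda>x. F x - p x) (f + g) = 0" using sphere_inner_add_right[OF cd polys_sphere_cont polys_sphere_cont] by simp
    next
      fix f g :: "'n cvec \<Rightarrow> complex"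
      assume "\<And>x. norm x = 1 \<Longrightarrow> f x = g x" "sphere_inner (\<lambda>x. F x - p x) f = 0"
      then show "sphere_inner (\<lambda>x. F x - p x) g = 0" using sphere_inner_cong[of "\<lambda>x. F x - p x" "\<lambda>x. F x - p x" f g] by simp
    qed
    then show "sphere_integral (\<lambda>x. (F x - p x) * cnj (h x)) = 0" by (simp add: sphere_inner_def)
  qed
  then show ?thesis using g by (intro exI[of _ g]) auto
qed

lemma lie_add:
  assumes "\<And>x. f differentiable (at x)" "\<And>x. g differentiable (at x)"
  shows "lie A (f + g) = lie A f + lie A g"
proof
  fix x
  have "((\<lambda>x. f x + g x) has_derivative (\<lambda>v. frechet_derivative f (at x) v + frechet_derivative g (at x) v)) (at x)"
    using assms frechet_derivative_works by (intro has_derivative_add) blast+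
  from frechet_derivative_at[OF this, symmetric] show "lie A (f + g) x = (lie A f + lie A g) x"
    by (simp add: lie_def plus_fun_apply plus_fun_def)
qed

lemma sphere_op_add:
  fixes f g :: "'a::euclidean_space \<Rightarrow> complex"
  assumes f: "Ck_on 2 UNIV f" and g: "Ck_on 2 UNIV g" and J: "\<And>s. linear (J s)"
  shows "sphere_op p q J (f + g) x = sphere_op p q J f x + sphere_op p q J g x"
proof -
  have C: "Ck_on (Suc (Suc 0)) UNIV f" "Ck_on (Suc (Suc 0)) UNIV g" using f g by (simp_all add: numeral_2_eq_2)
  have "lie A (lie A (f + g)) = lie A (lie A f) + lie A (lie A g)" if A: "linear A" for A
  proof -
    have "lie A f differentiable (at x)" "lie A g differentiable (at x)" for x
      using Ck_on_lie[OF open_UNIV C(1) A] Ck_on_lie[OF open_UNIV C(2) A] by auto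
    moreover have "f differentiable (at x)" "g differentiable (at x)" for x using C by auto
    ultimately show ?thesis by (simp add: lie_add)
  qed
  then show ?thesis
    unfolding sphere_op_def by (simp add: linear_plane_rot J plus_fun_apply sum.distrib scaleR_add_right)
qed

lemma sphere_op_zero:
  assumes "\<And>s. linear (J s)" shows "sphere_op p q J 0 x = 0"
proof -
  have "lie A 0 = 0" for A :: "'a::euclidean_space \<Rightarrow> 'a" by (simp add: fun_eq_iff lie_def zero_fun_def)
  then show ?thesis by (simp add: sphere_op_def zero_fun_apply)
qed

lemma sphere_op_component_sum:
  fixes g :: "(nat \<times> nat) \<times> nat \<Rightarrow> 'n::finite cvec \<Rightarrow> complex"
  assumes I: "finite I" "I \<subseteq> eigen_indices P Q CARD('n) \<mu>" and g: "\<And>i. i \<in> I \<Longrightarrow> g i \<in> component i" and x: "norm x = 1"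
  shows "sphere_op P Q qunit (sum g I) x = \<mu> * sum g I x"
  using I g
proof (induction I rule: finite_induct)
  case empty
  show ?case using sphere_op_zero[OF quat.J_linear, where p=P and q=Q and x=x] by (simp add: zero_fun_def)
next
  case (insert i I)
  have v: "k \<in> component_indices" if "k \<in> insert i I" for k using insert.prems(1) that by (auto simp: eigen_indices_def)
  have p: "g k \<in> polys" if "k \<in> insert i I" for k using component_polys[OF v[OF that] insert.prems(2)[OF that]] .
  have e: "of_real (eigval P Q CARD('n) (fst (fst i)) (snd (fst i))) = \<mu>" using insert.prems(1) by (auto simp: eigen_indices_def)
  have "sphere_op P Q qunit (g i) x = \<mu> * g i x" using component_eigen[OF v insert.prems(2) x, of i] e by simp
  moreover have "sphere_op P Q qunit (sum g I) x = \<mu> * sum g I x" using insert by blast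
  moreover have "sphere_op P Q qunit (g i + sum g I) x = sphere_op P Q qunit (g i) x + sphere_op P Q qunit (sum g I) x"
    by (rule sphere_op_add[OF Ck_polys[OF p] Ck_polys[OF polys_sum] quat.J_linear]) (auto intro: p)
  ultimately show ?case unfolding sum.insert[OF insert.hyps] by (simp add: plus_fun_apply[of _ _ x] distrib_left)
qed

section \<open>The spectrum\<close>

text \<open>The function on the homogeneous space corresponding to a function on the sphere, in the opposite
  direction to \<open>sphere_ext\<close>.\<close>

definition transport :: "'n::finite \<Rightarrow> 'n cmat set \<Rightarrow> ('n cvec \<Rightarrow> complex) \<Rightarrow> 'n cmat set \<Rightarrow> complex" where
  "transport e K q p = (if p \<in> homog_space K then q ((SOME A. A \<in> Sp_on UNIV \<and> lcoset K A = p) *v base e) else 0)"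

lemma transport_lcoset:
  assumes G: "G = {1} \<or> G = {1, -1}" and even: "G = {1, -1} \<Longrightarrow> (\<And>x. q (- x) = q x)" and A: "A \<in> Sp_on UNIV"
  shows "transport e (isotropy G e) q (lcoset (isotropy G e) A) = q (A *v base e)"
proof -
  let ?K = "isotropy G e"
  let ?B = "SOME B. B \<in> Sp_on UNIV \<and> lcoset ?K B = lcoset ?K A"
  have B: "?B \<in> Sp_on UNIV \<and> lcoset ?K ?B = lcoset ?K A" by (rule someI[of _ A]) (use A in simp)
  then obtain c where c: "c \<in> G" "?B *v base e = c *s (A *v base e)" using lcoset_eq_iff[OF G _ A] by blast
  have "- 1 *s (A *v base e) = - (A *v base e)" by (simp add: vec_eq_iff)
  then have "q (?B *v base e) = q (A *v base e)" using c G even by auto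
  then show ?thesis using A by (simp add: transport_def homog_space_def)
qed

lemma eigval_eq_sasaki_eta:
  assumes "z2 \<le> z1"
  shows "eigval (\<alpha> * \<delta>) (\<delta>\<^sup>2) n z1 z2 = sasaki_eta n \<alpha> \<delta> z1 z2"
  using assms by (simp add: eigval_def sasaki_eta_def of_nat_diff algebra_simps power2_eq_square minus_apply plus_fun_apply uminus_apply)

lemma sasaki_mult_pos:
  assumes "z2 \<le> z1" "n \<ge> 2"
  shows "sasaki_mult n z1 z2 > 0"
proof -
  have "real n \<ge> 2" "real z1 \<ge> real z2" using assms by simp_all
  moreover have "(z1 + 2 * n - 2) choose (2 * n - 3) > 0" "(z2 + 2 * n - 3) choose (2 * n - 3) > 0"
    using assms(2) by (simp_all add: zero_less_binomial_iff)
  ultimately show ?thesis unfolding sasaki_mult_def by (intro mult_pos_pos divide_pos_pos) (auto simp: zero_less_power)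
qed

lemma has_complex_dim_nontrivial:
  assumes "has_complex_dim V d"
  shows "(\<exists>f\<in>V. f \<noteq> 0) \<longleftrightarrow> d > 0"
proof -
  obtain B where B: "finite B" "card B = d" "cfun.independent B" "cfun.span B = V" using assms by (auto simp: has_complex_dim_def)
  show ?thesis
  proof
    assume "\<exists>f\<in>V. f \<noteq> 0"
    then have "B \<noteq> {}" using B(4) by (auto simp: cfun.span_empty)
    then show "d > 0" unfolding B(2)[symmetric] card_gt_0_iff using B(1) by blast
  next
    assume "d > 0"
    then obtain b where b: "b \<in> B" using B(2) by fastforce
    then have "b \<noteq> 0" using B(3) cfun.dependent_zero by blast
    then show "\<exists>f\<in>V. f \<noteq> 0" using cfun.span_base[OF b] B(4) by blast
  qed
qed

text \<open>The functions on the homogeneous space are those on the sphere if \<open>G = {1}\<close> and the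
  even ones if \<open>G = {1, -1}\<close>. In the second case the expansion of an even function is
  averaged over the antipodal map, which removes the components of odd degree.\<close>

lemma lb_eigenspace_eq:
  fixes e :: "'n::finite" and \<mu> :: complex
  assumes n: "CARD('n) \<ge> 2" and dim: "CARD('d::finite) + 1 = 4 * CARD('n)" and t: "t0 > 0" "t1 > 0"
    and G: "G = {1} \<or> G = {1, -1}"
  defines "I \<equiv> {i \<in> eigen_indices (1 / (2 * t0)) (1 / t1) CARD('n) \<mu>. G = {1} \<or> even (fst (fst i) + snd (fst i))}"
  shows "lb_eigenspace TYPE('d) e (isotropy G e) t0 t1 \<mu> =
    transport e (isotropy G e) ` {sum g I |g. \<forall>i\<in>I. g i \<in> component i}"
proof (intro equalityI subsetI)
  let ?K = "isotropy G e" and ?P = "1 / (2 * t0)" and ?Q = "1 / t1"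
  let ?C = "eigen_indices ?P ?Q CARD('n) \<mu>"
  have PQ: "?P > 0" "?Q > 0" using t by auto
  have C: "finite ?C" "?C \<subseteq> component_indices" using finite_eigen_indices[OF PQ n] by (auto simp: eigen_indices_def)
  then have I: "finite I" "I \<subseteq> component_indices" "I \<subseteq> ?C" by (auto simp: I_def)
  have G12: "({1, - 1} :: complex set) \<noteq> {1}" by auto
  have Ieven: "sum g I (- x) = sum g I x" if "G = {1, -1}" "\<forall>i\<in>I. g i \<in> component i" for x and g :: "(nat \<times> nat) \<times> nat \<Rightarrow> 'n cvec \<Rightarrow> complex"
    by (rule even_component_sum[OF I(2)]) (use that G12 in \<open>auto simp: I_def\<close>)
  {
    fix f assume f: "f \<in> lb_eigenspace TYPE('d) e ?K t0 t1 \<mu>"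
    let ?F = "sphere_ext G e f"
    have sm: "f \<in> smooth_functions TYPE('d) e ?K" using f by (simp add: lb_eigenspace_def)
    have F: "Ck_on 2 (- {0}) ?F" by (rule Ck_sphere_ext[OF G dim sm])
    have Fu: "?F (- y) = ?F y" if "G = {1, -1}" for y using sphere_ext_uminus[OF that] .
    have eF: "sphere_op ?P ?Q qunit ?F x = \<mu> * ?F x" if x: "norm x = 1" for x
    proof -
      obtain A where A: "A \<in> Sp_on UNIV" "A *v base e = x" using Sp_transitive[OF x] by blast
      have "lcoset ?K A \<in> homog_space ?K" using A(1) by (simp add: homog_space_def)
      then have "laplace_beltrami TYPE('d) e ?K t0 t1 f (lcoset ?K A) = \<mu> * f (lcoset ?K A)" using f by (simp add: lb_eigenspace_def)
      moreover have "laplace_beltrami TYPE('d) e ?K t0 t1 f (lcoset ?K A) = sphere_op ?P ?Q qunit ?F (A *v base e)"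
        by (rule laplace_beltrami_eq_sphere_op[OF G dim t F Fu sphere_ext_base[OF G, symmetric] A(1)])
      ultimately show ?thesis using sphere_ext_base[OF G A(1), of e f] A(2) by simp
    qed
    obtain g where g: "\<forall>i\<in>?C. g i \<in> component i" "\<And>x. norm x = 1 \<Longrightarrow> ?F x = sum g ?C x"
      using eigen_expansion[OF PQ n F eF] by blast
    have FI: "?F x = sum g I x" if x: "norm x = 1" for x
    proof (cases "G = {1}")
      case True
      then show ?thesis using g(2)[OF x] by (simp add: I_def)
    next
      case False
      then have G2: "G = {1, -1}" using G by blast
      have x': "norm (- x) = 1" using x by simp
      have "2 * ?F x = sum g ?C x + sum g ?C (- x)" using g(2)[OF x] g(2)[OF x'] Fu[OF G2, of x] by simp
      also have "\<dots> = (\<Sum>i\<in>?C. g i x + g i (- x))" by (simp add: fun_sum_apply sum.distrib)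
      also have "\<dots> = (\<Sum>i\<in>?C. if i \<in> I then 2 * g i x else 0)"
      proof (rule sum.cong[OF refl])
        fix i assume i: "i \<in> ?C"
        have "i \<in> I \<longleftrightarrow> even (fst (fst i) + snd (fst i))" using i False by (auto simp: I_def)
        then show "g i x + g i (- x) = (if i \<in> I then 2 * g i x else 0)"
          using component_parity[of i "g i" x] i C(2) g(1) by auto
      qed
      also have "\<dots> = 2 * sum g I x" using C(1) I(3) by (simp add: sum.If_cases Int_absorb1 fun_sum_apply sum_distrib_left)
      finally show ?thesis by simp
    qed
    have gI: "\<forall>i\<in>I. g i \<in> component i" using g(1) I(3) by blast
    have "f = transport e ?K (sum g I)"
    proof
      fix p
      show "f p = transport e ?K (sum g I) p"
      proof (cases "p \<in> homog_space ?K")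
        case True
        then obtain A where A: "A \<in> Sp_on UNIV" "p = lcoset ?K A" by (auto simp: homog_space_def)
        have "f p = sum g I (A *v base e)"
          using FI[of "A *v base e"] sphere_ext_base[OF G A(1), of e f] A by (simp add: Sp_norm)
        also have "\<dots> = transport e ?K (sum g I) p"
          unfolding A(2) by (rule transport_lcoset[OF G _ A(1), symmetric]) (use Ieven gI in blast)
        finally show ?thesis .
      next
        case False
        then show ?thesis using sm by (simp add: smooth_functions_def transport_def)
      qed
    qed
    then show "f \<in> transport e ?K ` {sum g I |g. \<forall>i\<in>I. g i \<in> component i}" using gI by blast
  }
  {
    fix f assume "f \<in> transport e ?K ` {sum g I |g. \<forall>i\<in>I. g i \<in> component i}"
    then obtain g where fg: "f = transport e ?K (sum g I)" and g: "\<forall>i\<in>I. g i \<in> component i" by blast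
    let ?q = "sum g I"
    have q: "?q \<in> polys" by (rule polys_sum) (use component_polys g I(2) in blast)
    have qe: "?q (- x) = ?q x" if "G = {1, -1}" for x using Ieven that g by blast
    have fA: "f (lcoset ?K A) = ?q (A *v base e)" if "A \<in> Sp_on UNIV" for A
      unfolding fg by (rule transport_lcoset[where q="?q", OF G qe that])
    have "smooth_map_on U (\<lambda>u. f (lcoset ?K (\<sigma> u)))" if lp: "local_param e ?K U \<sigma>" for U and \<sigma> :: "real^'d \<Rightarrow> 'n cmat"
      unfolding smooth_map_on_def
    proof
      fix k
      have U: "open U" and s: "Ck_on k U \<sigma>" and Sp: "\<And>u. u \<in> U \<Longrightarrow> \<sigma> u \<in> Sp_on UNIV"
        using lp smooth_map_on_Ck by (auto simp: local_param_def)
      have bl: "bounded_linear (\<lambda>A :: 'n cmat. A *v base e)"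
        by (rule linear_conv_bounded_linear[THEN iffD1], rule linearI)
          (auto simp: vec_eq_iff mult_base)
      have "Ck_on k U (\<lambda>u. ?q (\<sigma> u *v base e))"
        by (rule Ck_on_compose[OF U open_UNIV subset_UNIV Ck_polys[OF q] Ck_on_bounded_linear[OF bl U s]])
      then show "Ck_on k U (\<lambda>u. f (lcoset ?K (\<sigma> u)))"
        using Ck_on_cong[OF U, of "\<lambda>u. f (lcoset ?K (\<sigma> u))" "\<lambda>u. ?q (\<sigma> u *v base e)" k] fA Sp by simp
    qed
    then have "f \<in> smooth_functions TYPE('d) e ?K" by (simp add: smooth_functions_def fg transport_def)
    moreover have "laplace_beltrami TYPE('d) e ?K t0 t1 f p = \<mu> * f p" if p: "p \<in> homog_space ?K" for p
    proof -
      obtain A where A: "A \<in> Sp_on UNIV" "p = lcoset ?K A" using p by (auto simp: homog_space_def)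
      have C2: "Ck_on 2 (- {0}) ?q" using Ck_on_subset[OF Ck_polys[OF q]] by blast
      have "laplace_beltrami TYPE('d) e ?K t0 t1 f p = sphere_op ?P ?Q qunit ?q (A *v base e)"
        unfolding A(2) by (rule laplace_beltrami_eq_sphere_op[OF G dim t C2 qe fA A(1)])
      also have "\<dots> = \<mu> * ?q (A *v base e)"
        by (rule sphere_op_component_sum[OF I(1) I(3)]) (use g Sp_norm[OF A(1)] in auto)
      finally show ?thesis using fA[OF A(1)] A(2) by simp
    qed
    ultimately show "f \<in> lb_eigenspace TYPE('d) e ?K t0 t1 \<mu>" by (simp add: lb_eigenspace_def)
  }
qed

text \<open>The transport is injective on the sums of components, because such a sum is determined by its values
  on the sphere.\<close>

lemma lb_eigenspace_dim:
  fixes e :: "'n::finite" and \<mu> :: complex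
  assumes n: "CARD('n) \<ge> 2" and dim: "CARD('d::finite) + 1 = 4 * CARD('n)" and t: "t0 > 0" "t1 > 0"
    and G: "G = {1} \<or> G = {1, -1}"
  defines "I \<equiv> {i \<in> eigen_indices (1 / (2 * t0)) (1 / t1) CARD('n) \<mu>. G = {1} \<or> even (fst (fst i) + snd (fst i))}"
  shows "has_complex_dim (lb_eigenspace TYPE('d) e (isotropy G e) t0 t1 \<mu>) (\<Sum>i\<in>I. hw_dim CARD('n + 'n) (snd (fst i)) (fst (fst i)))"
proof -
  let ?S = "{sum g I |g. \<forall>i\<in>I. g i \<in> (component i :: ('n cvec \<Rightarrow> complex) set)}"
  have PQ: "1 / (2 * t0) > 0" "1 / t1 > 0" using t by auto
  have I: "finite I" "I \<subseteq> component_indices" using finite_subset[OF _ finite_eigen_indices[OF PQ n, of \<mu>], of I] by (auto simp: I_def eigen_indices_def)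
  note S = component_sum_dim[OF I, where 'n='n]
  show ?thesis
    unfolding lb_eigenspace_eq[OF n dim t G] I_def[symmetric]
  proof (rule has_complex_dim_image[where \<phi>="\<lambda>c. c", OF S])
    fix q :: "'n cvec \<Rightarrow> complex" assume q: "q \<in> ?S" and 0: "transport e (isotropy G e) q = 0"
    then obtain g where g: "q = sum g I" "\<forall>i\<in>I. g i \<in> component i" by blast
    have G12: "{1, - 1} \<noteq> {1 :: complex}" by auto
    have even: "q (- x) = q x" if G2: "G = {1, -1}" for x
      unfolding g(1) by (rule even_component_sum[OF I(2)]) (use g(2) G2 G12 in \<open>auto simp: I_def\<close>)
    have "q x = 0" if x: "norm x = 1" for x
    proof -
      obtain A where A: "A \<in> Sp_on UNIV" "A *v base e = x" using Sp_transitive[OF x] by blast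
      show ?thesis using transport_lcoset[where q=q and e=e, OF G even A(1)] 0 A(2) by (simp add: zero_fun_apply)
    qed
    then have "g i = 0" if "i \<in> I" for i using component_independent[OF I _ _ that] g by blast
    then show "q = 0" unfolding g(1) by simp
  qed (auto simp: transport_def fun_eq_iff plus_fun_apply)
qed

lemma spectrum_isotropy:
  fixes n :: nat and e :: "'n::finite"
  assumes n: "n \<ge> 2" "CARD('n) = n" and d: "CARD('d::finite) = 4 * n - 1" and \<alpha>\<delta>: "\<alpha> * \<delta> > 0"
    and G: "G = {1} \<or> G = {1, -1}"
  shows "spectrum_given_by (lb_eigenspace TYPE('d) e (isotropy G e) (1 / (2 * \<alpha> * \<delta>)) (1 / \<delta>^2))
       {(z1, z2). z1 \<ge> z2 \<and> (G = {1} \<or> even (z1 + z2))}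
       (\<lambda>(z1, z2). sasaki_eta n \<alpha> \<delta> z1 z2)
       (\<lambda>(z1, z2). sasaki_mult n z1 z2)"
proof -
  let ?t0 = "1 / (2 * \<alpha> * \<delta>)" and ?t1 = "1 / \<delta>^2"
  let ?E = "lb_eigenspace TYPE('d) e (isotropy G e) ?t0 ?t1"
  let ?Z = "{(z1, z2). z1 \<ge> z2 \<and> (G = {1} \<or> even (z1 + z2))}"
  let ?\<eta> = "\<lambda>(z1, z2). sasaki_eta n \<alpha> \<delta> z1 z2" and ?m = "\<lambda>(z1, z2). sasaki_mult n z1 z2"
  have n2: "CARD('n) \<ge> 2" and dim: "CARD('d) + 1 = 4 * CARD('n)" using n d by auto
  have \<delta>0: "\<delta> \<noteq> 0" using \<alpha>\<delta> by auto
  have t: "?t0 > 0" "?t1 > 0" using \<alpha>\<delta> \<delta>0 by (simp_all add: mult.assoc)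
  have PQ: "1 / (2 * ?t0) = \<alpha> * \<delta>" "1 / ?t1 = \<delta>\<^sup>2" by simp_all
  define Z where "Z \<mu> = {z \<in> ?Z. complex_of_real (?\<eta> z) = \<mu>}" for \<mu>
  have Zeq: "Z \<mu> = {z. (snd z \<le> fst z \<and> complex_of_real (eigval (\<alpha> * \<delta>) (\<delta>\<^sup>2) n (fst z) (snd z)) = \<mu>) \<and> (G = {1} \<or> even (fst z + snd z))}" for \<mu>
    unfolding Z_def using eigval_eq_sasaki_eta[of _ _ \<alpha> \<delta> n] by auto
  have finZ: "finite (Z \<mu>)" for \<mu>
    by (rule finite_subset[OF _ finite_eigval[of "\<alpha> * \<delta>" "\<delta>\<^sup>2" n \<mu>]]) (use \<alpha>\<delta> \<delta>0 n in \<open>auto simp: Zeq\<close>)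
  have dimE: "\<exists>d. has_complex_dim (?E \<mu>) d \<and> real d = sum ?m (Z \<mu>)" for \<mu>
  proof -
    let ?I = "{i \<in> eigen_indices (\<alpha> * \<delta>) (\<delta>\<^sup>2) CARD('n) \<mu>. G = {1} \<or> even (fst (fst i) + snd (fst i))}"
    have I: "?I = (SIGMA z:Z \<mu>. {..fst z - snd z})" unfolding eigen_indices_eq Zeq n(2) by auto
    have "(\<Sum>i\<in>?I. hw_dim CARD('n + 'n) (snd (fst i)) (fst (fst i))) = (\<Sum>z\<in>Z \<mu>. \<Sum>j\<le>fst z - snd z. hw_dim CARD('n + 'n) (snd z) (fst z))"
      unfolding I by (subst sum.Sigma) (use finZ in \<open>auto simp: case_prod_beta\<close>)
    also have "real \<dots> = sum ?m (Z \<mu>)"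
    proof -
      have "real (\<Sum>j\<le>fst z - snd z. hw_dim CARD('n + 'n) (snd z) (fst z)) = ?m z" if "z \<in> Z \<mu>" for z
      proof -
        have z: "snd z \<le> fst z" using that by (auto simp: Z_def)
        have "real (\<Sum>j\<le>fst z - snd z. hw_dim CARD('n + 'n) (snd z) (fst z)) = real (hw_dim CARD('n + 'n) (snd z) (fst z)) * (real (fst z) - real (snd z) + 1)"
        proof -
          have "real (fst z - snd z) = real (fst z) - real (snd z)" using z by simp
          then show ?thesis unfolding sum_constant card_atMost of_nat_mult of_nat_Suc by simp
        qed
        also have "\<dots> = sasaki_mult n (fst z) (snd z)" by (rule real_hw_dim[OF z n(2) n(1)])
        finally show ?thesis by (simp add: case_prod_beta)
      qed
      then show ?thesis unfolding of_nat_sum[of _ "Z \<mu>"] by (rule sum.cong[OF refl])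
    qed
    finally show ?thesis using lb_eigenspace_dim[OF n2 dim t G, of e \<mu>] unfolding PQ by blast
  qed
  have mpos: "?m z > 0" if "z \<in> Z \<mu>" for z \<mu>
    using that sasaki_mult_pos[OF _ n(1)] by (auto simp: Z_def)
  have "(\<exists>f\<in>?E \<mu>. f \<noteq> 0) \<longleftrightarrow> Z \<mu> \<noteq> {}" for \<mu>
  proof -
    obtain d where d: "has_complex_dim (?E \<mu>) d" "real d = sum ?m (Z \<mu>)" using dimE by blast
    have "0 < real d \<longleftrightarrow> Z \<mu> \<noteq> {}"
      unfolding d(2) using sum_pos[OF finZ, of \<mu> ?m] mpos by (cases "Z \<mu> = {}") auto
    then show ?thesis using has_complex_dim_nontrivial[OF d(1)] by simp
  qed
  then have "{\<mu>. \<exists>f\<in>?E \<mu>. f \<noteq> 0} = {\<mu>. Z \<mu> \<noteq> {}}" by simp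
  also have "\<dots> = (\<lambda>z. complex_of_real (?\<eta> z)) ` ?Z" unfolding Z_def by blast
  finally have "{\<mu>. \<exists>f\<in>?E \<mu>. f \<noteq> 0} = (\<lambda>z. complex_of_real (?\<eta> z)) ` ?Z" .
  then show ?thesis unfolding spectrum_given_by_def using finZ[unfolded Z_def] dimE[unfolded Z_def] by (intro conjI allI)
qed

theorem theorem4p13:
  fixes n :: nat and \<alpha> \<delta> :: real and e :: "'n::finite"
  assumes "n \<ge> 2"
    and "CARD('n) = n"
    and "CARD('d::finite) = 4 * n - 1"
    and "\<alpha> * \<delta> > 0"
  shows
    "spectrum_given_by
       (lb_eigenspace TYPE('d) e (isotropy_sphere e) (1 / (2 * \<alpha> * \<delta>)) (1 / \<delta>^2))
       {(z1, z2). z1 \<ge> z2}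
       (\<lambda>(z1, z2). sasaki_eta n \<alpha> \<delta> z1 z2)
       (\<lambda>(z1, z2). sasaki_mult n z1 z2) \<and>
     spectrum_given_by
       (lb_eigenspace TYPE('d) e (isotropy_projective e) (1 / (2 * \<alpha> * \<delta>)) (1 / \<delta>^2))
       {(z1, z2). z1 \<ge> z2 \<and> z1 mod 2 = z2 mod 2}
       (\<lambda>(z1, z2). sasaki_eta n \<alpha> \<delta> z1 z2)
       (\<lambda>(z1, z2). sasaki_mult n z1 z2)"
proof
  show "spectrum_given_by
       (lb_eigenspace TYPE('d) e (isotropy_sphere e) (1 / (2 * \<alpha> * \<delta>)) (1 / \<delta>^2))
       {(z1, z2). z1 \<ge> z2}
       (\<lambda>(z1, z2). sasaki_eta n \<alpha> \<delta> z1 z2)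
       (\<lambda>(z1, z2). sasaki_mult n z1 z2)"
    using spectrum_isotropy[OF assms, of "{1}" e] unfolding isotropy_sphere_eq by simp
  have "z1 mod 2 = z2 mod 2 \<longleftrightarrow> even (z1 + z2)" for z1 z2 :: nat by presburger
  moreover have "({1, - 1} :: complex set) \<noteq> {1}" by auto
  ultimately show "spectrum_given_by
       (lb_eigenspace TYPE('d) e (isotropy_projective e) (1 / (2 * \<alpha> * \<delta>)) (1 / \<delta>^2))
       {(z1, z2). z1 \<ge> z2 \<and> z1 mod 2 = z2 mod 2}
       (\<lambda>(z1, z2). sasaki_eta n \<alpha> \<delta> z1 z2)
       (\<lambda>(z1, z2). sasaki_mult n z1 z2)"
    using spectrum_isotropy[OF assms, of "{1, - 1}" e] unfolding isotropy_projective_eq by simp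
qed

end
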